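(* Let $M$ be a (possibly disconnected) nice dodecahedral or nice octahedral hyperbolic three-manifold. Then $M$ embeds geodesically in some connected complete finite-volume orientable hyperbolic four-manifold $W$; that is, there is a connected complete finite-volume orientable hyperbolic four-manifold $W$ that contains $M$ as a geodesic hypersurface.
   Context: A hyperbolic $n$-manifold $M$ embeds geodesically in a hyperbolic $(n+1)$-manifold $W$ if $W$ contains $M$ as an (embedded, totally) geodesic hypersurface, i.e. there is an embedded totally geodesic hypersurface of $W$ isometric to $M$. A complete, possibly disconnected, possibly non-orientable, finite-volume hyperbolic 3-manifold is called dodecahedral (respectively octahedral) if it may be tessellated into right-angled regular hyperbolic dodecahedra, which are compact (respectively right-angled regular ideal hyperbolic octahedra), i.e. it is obtained from (finitely many) such polyhedra by isometrically pairing their 2-dimensional faces. A dodecahedral manifold is nice if it can be decomposed into embedded right-angled dodecahedra; equivalently, if it has such a decomposition in which every vertex is adjacent to 8 distinct dodecahedra. An octahedral manifold is nice if it has a decomposition into right-angled ideal octahedra such that every ideal triangle of the decomposition is adjacent to two distinct ideal octahedra (the four octahedra incident at an edge are not required to be distinct, so the octahedra need not be embedded). *)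

theory Defs
  imports "HOL-Analysis.Analysis"
begin

section \<open>Hyperbolic space\<close>

text \<open>
  Hyperbolic \<open>n\<close>-space is the upper sheet of the hyperboloid in Minkowski space of dimension
  \<open>n + 1\<close>, where \<open>n = CARD('n)\<close>. Vectors of Minkowski space are indexed by \<^typ>\<open>'n option\<close>:
  the index \<^term>\<open>None\<close> is the time coordinate, the indices \<^term>\<open>Some i\<close> are the space coordinates.
\<close>

type_synonym 'n mink = "(real, 'n option) vec"

definition mvec :: "real \<Rightarrow> real ^ 'n \<Rightarrow> 'n::finite mink" where
  "mvec t u = (\<chi> k. case k of None \<Rightarrow> t | Some i \<Rightarrow> u $ i)"

definition lorentz :: "'n::finite mink \<Rightarrow> 'n mink \<Rightarrow> real" where
  "lorentz x y = (\<Sum>i\<in>UNIV. x $ Some i * y $ Some i) - x $ None * y $ None"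

definition hyp :: "'n::finite mink set" where
  "hyp = {x. lorentz x x = -1 \<and> x $ None > 0}"

definition hdist :: "'n::finite mink \<Rightarrow> 'n mink \<Rightarrow> real" where
  "hdist x y = arcosh (- lorentz x y)"

definition hball :: "'n::finite mink \<Rightarrow> real \<Rightarrow> 'n mink set" where
  "hball c r = {x \<in> hyp. hdist c x < r}"

definition hyp_isometry :: "('n::finite mink \<Rightarrow> 'n mink) \<Rightarrow> bool" where
  "hyp_isometry g \<longleftrightarrow>
     bij_betw g hyp hyp \<and> (\<forall>x\<in>hyp. \<forall>y\<in>hyp. hdist (g x) (g y) = hdist x y)"

text \<open>Every isometry is the restriction of a unique linear map, whose determinant is \<open>1\<close> or \<open>- 1\<close>.\<close>

definition hyp_orient_isometry :: "('n::finite mink \<Rightarrow> 'n mink) \<Rightarrow> bool" where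
  "hyp_orient_isometry g \<longleftrightarrow>
     hyp_isometry g \<and> (\<exists>Q. det Q > 0 \<and> (\<forall>x\<in>hyp. g x = Q *v x))"

definition hyp_hyperplane :: "'n::finite mink set \<Rightarrow> bool" where
  "hyp_hyperplane H \<longleftrightarrow> (\<exists>v. lorentz v v > 0 \<and> H = {x \<in> hyp. lorentz v x = 0})"

text \<open>
  The Riemannian volume. In the global coordinates given by the space components \<open>u\<close>, the metric tensor
  of the hyperboloid is \<open>|du|\<^sup>2 - (u \<bullet> du)\<^sup>2 / (1 + u \<bullet> u)\<close>, with determinant \<open>1 / (1 + u \<bullet> u)\<close>.
\<close>

definition hyp_volume :: "'n::finite mink measure" where
  "hyp_volume =
     distr (density lborel (\<lambda>u :: real ^ 'n. ennreal (1 / sqrt (1 + u \<bullet> u)))) borel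
       (\<lambda>u. mvec (sqrt (1 + u \<bullet> u)) u)"


section \<open>Hyperbolic manifolds\<close>

text \<open>
  A hyperbolic manifold is a topological manifold with an atlas of charts into hyperbolic space whose
  transition maps are locally restrictions of isometries. It need not be connected or orientable, and
  the atlas need not be maximal. A chart is given by its domain and its map.
\<close>

type_synonym ('p, 'n) hchart = "'p set \<times> ('p \<Rightarrow> 'n mink)"

definition hyp_chart :: "'p topology \<Rightarrow> ('p, 'n::finite) hchart \<Rightarrow> bool" where
  "hyp_chart X c \<longleftrightarrow> (case c of (U, \<phi>) \<Rightarrow>
     openin X U \<and> openin (top_of_set hyp) (\<phi> ` U) \<and>
     homeomorphic_map (subtopology X U) (top_of_set (\<phi> ` U)) \<phi>)"

definition compatible_via ::
    "('n mink \<Rightarrow> 'n mink) set \<Rightarrow> 'p topology \<Rightarrow> ('p, 'n::finite) hchart \<Rightarrow> ('p, 'n) hchart \<Rightarrow> bool" where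
  "compatible_via G X c c' \<longleftrightarrow> (case c of (U, \<phi>) \<Rightarrow> case c' of (V, \<psi>) \<Rightarrow>
     \<forall>p \<in> U \<inter> V. \<exists>g\<in>G. \<exists>N. openin X N \<and> p \<in> N \<and> N \<subseteq> U \<inter> V \<and> (\<forall>q\<in>N. \<psi> q = g (\<phi> q)))"

definition hyp_atlas :: "'p topology \<Rightarrow> ('p, 'n::finite) hchart set \<Rightarrow> bool" where
  "hyp_atlas X A \<longleftrightarrow>
     (\<forall>c\<in>A. hyp_chart X c) \<and> (\<Union>c\<in>A. fst c) = topspace X \<and>
     (\<forall>c\<in>A. \<forall>c'\<in>A. compatible_via {g. hyp_isometry g} X c c')"

definition hyp_manifold :: "'p topology \<Rightarrow> ('p, 'n::finite) hchart set \<Rightarrow> bool" where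
  "hyp_manifold X A \<longleftrightarrow> Hausdorff_space X \<and> second_countable X \<and> hyp_atlas X A"

definition hyp_orientable :: "'p topology \<Rightarrow> ('p, 'n::finite) hchart set \<Rightarrow> bool" where
  "hyp_orientable X A \<longleftrightarrow>
     (\<exists>B. hyp_atlas X B \<and> hyp_atlas X (A \<union> B) \<and>
        (\<forall>c\<in>B. \<forall>c'\<in>B. compatible_via {g. hyp_orient_isometry g} X c c'))"

text \<open>
  \<open>broken_geodesic X A p q l\<close>: there is a path of length \<open>l\<close> from \<open>p\<close> to \<open>q\<close> that is a
  concatenation of finitely many geodesic segments, each of which is seen by some chart inside a
  metric ball contained in the image of that chart. (Balls are convex, so the segment joining two
  points of the ball stays in the ball; the image of a chart itself need not be convex.)
  The Riemannian distance is the infimum of the lengths of such paths; it is infinite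
  between different components.
\<close>

inductive broken_geodesic ::
    "'p topology \<Rightarrow> ('p, 'n::finite) hchart set \<Rightarrow> 'p \<Rightarrow> 'p \<Rightarrow> real \<Rightarrow> bool"
  for X :: "'p topology" and A :: "('p, 'n) hchart set" where
  refl: "p \<in> topspace X \<Longrightarrow> broken_geodesic X A p p 0"
| step: "\<lbrakk>broken_geodesic X A p q l; (U, \<phi>) \<in> A; q \<in> U; r \<in> U;
      c \<in> hyp; hball c \<rho> \<subseteq> \<phi> ` U; \<phi> q \<in> hball c \<rho>; \<phi> r \<in> hball c \<rho>\<rbrakk>
    \<Longrightarrow> broken_geodesic X A p r (l + hdist (\<phi> q) (\<phi> r))"

definition mfd_dist :: "'p topology \<Rightarrow> ('p, 'n::finite) hchart set \<Rightarrow> 'p \<Rightarrow> 'p \<Rightarrow> ennreal" where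
  "mfd_dist X A p q = (INF l \<in> {l. broken_geodesic X A p q l}. ennreal l)"

definition hyp_complete :: "'p topology \<Rightarrow> ('p, 'n::finite) hchart set \<Rightarrow> bool" where
  "hyp_complete X A \<longleftrightarrow>
     (\<forall>s :: nat \<Rightarrow> 'p. range s \<subseteq> topspace X \<longrightarrow>
        (\<forall>e>0. \<exists>n. \<forall>i\<ge>n. \<forall>j\<ge>n. mfd_dist X A (s i) (s j) < e) \<longrightarrow>
        (\<exists>p. limitin X s p sequentially))"

text \<open>
  A Borel measure that is the hyperbolic volume in every chart. It exists and is unique,
  because countably many chart domains cover the manifold.
\<close>

definition is_volume ::
    "'p topology \<Rightarrow> ('p, 'n::finite) hchart set \<Rightarrow> 'p measure \<Rightarrow> bool" where
  "is_volume X A \<mu> \<longleftrightarrow>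
     space \<mu> = topspace X \<and> sets \<mu> = sigma_sets (topspace X) {U. openin X U} \<and>
     (\<forall>(U, \<phi>) \<in> A. \<forall>S \<in> sets \<mu>. S \<subseteq> U \<longrightarrow> emeasure \<mu> S = emeasure hyp_volume (\<phi> ` S))"

definition hyp_finite_volume :: "'p topology \<Rightarrow> ('p, 'n::finite) hchart set \<Rightarrow> bool" where
  "hyp_finite_volume X A \<longleftrightarrow> (\<exists>\<mu>. is_volume X A \<mu> \<and> emeasure \<mu> (topspace X) < \<infinity>)"

text \<open>
  \<open>f\<close> identifies the manifold \<open>(X, A)\<close> isometrically with an embedded totally geodesic hypersurface of the
  manifold \<open>(Y, B)\<close> of one dimension more: in charts, \<open>f\<close> is an isometry onto a piece of a hyperplane.
\<close>

definition geodesic_hypersurface_embedding ::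
    "'p topology \<Rightarrow> ('p, 'm::finite) hchart set \<Rightarrow> 'q topology \<Rightarrow> ('q, 'n::finite) hchart set
      \<Rightarrow> ('p \<Rightarrow> 'q) \<Rightarrow> bool" where
  "geodesic_hypersurface_embedding X A Y B f \<longleftrightarrow>
     CARD('n) = CARD('m) + 1 \<and> embedding_map X Y f \<and>
     (\<forall>p \<in> topspace X. \<exists>(U, \<phi>) \<in> A. \<exists>(V, \<psi>) \<in> B. \<exists>N H.
        openin X N \<and> p \<in> N \<and> N \<subseteq> U \<and> f ` N \<subseteq> V \<and>
        hyp_hyperplane H \<and> \<psi> ` f ` N \<subseteq> H \<and>
        (\<forall>x\<in>N. \<forall>y\<in>N. hdist (\<psi> (f x)) (\<psi> (f y)) = hdist (\<phi> x) (\<phi> y)))"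


section \<open>Right-angled polyhedra\<close>

text \<open>A polyhedron is given by the outward normal vectors of its faces.\<close>

definition hpoly :: "'n::finite mink set \<Rightarrow> 'n mink set" where
  "hpoly \<N> = {x \<in> hyp. \<forall>v\<in>\<N>. lorentz v x \<le> 0}"

definition hface :: "'n::finite mink set \<Rightarrow> 'n mink \<Rightarrow> 'n mink set" where
  "hface \<N> v = {x \<in> hpoly \<N>. lorentz v x = 0}"

definition golden :: real where
  "golden = (1 + sqrt 5) / 2"

text \<open>
  The face normals of a regular dodecahedron centred at \<open>mvec 1 0\<close> point in the directions of the
  vertices of a regular icosahedron, and those of a regular octahedron in the directions of the vertices
  of a cube. The time component governs the size, and it is chosen so that adjacent faces
  are orthogonal (see the two lemmas below). The vertices of the octahedron
  are the ideal points spanned by the light-like vectors \<open>mvec 1 (\<plusminus> axis i 1)\<close>.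
\<close>

definition dodecahedron_normals :: "3 mink set" where
  "dodecahedron_normals =
     (\<Union>a\<in>{-1, 1}. \<Union>b\<in>{-1, 1}.
        {mvec (sqrt golden) (vector [0, a, b * golden]),
         mvec (sqrt golden) (vector [a, b * golden, 0]),
         mvec (sqrt golden) (vector [b * golden, 0, a])})"

definition octahedron_normals :: "3 mink set" where
  "octahedron_normals =
     (\<Union>a\<in>{-1, 1}. \<Union>b\<in>{-1, 1}. \<Union>c\<in>{-1, 1}. {mvec 1 (vector [a, b, c])})"

lemma lorentz_mvec: "lorentz (mvec s u) (mvec t w) = u \<bullet> w - s * t"
  by (simp add: lorentz_def mvec_def inner_vec_def)

lemma golden_sq: "golden * golden = golden + 1"
  by (simp add: golden_def field_simps)

lemma golden_gt_1: "golden > 1"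
  by (simp add: golden_def)

text \<open>
  All normals have the same Lorentz norm \<open>2\<close>; two such hyperplanes are orthogonal if the product of the
  normals is \<open>0\<close>, and do not meet in hyperbolic space if the product is at most \<open>- 2\<close>.
\<close>

lemma dodecahedron_right_angled:
  assumes "v \<in> dodecahedron_normals" "w \<in> dodecahedron_normals"
  shows "lorentz v v = 2" and "v \<noteq> w \<Longrightarrow> lorentz v w = 0 \<or> lorentz v w < -2"
  using assms golden_gt_1
  by (auto simp: dodecahedron_normals_def lorentz_mvec inner_vec_def sum_3 golden_sq
      real_sqrt_mult[symmetric])

lemma octahedron_right_angled:
  assumes "v \<in> octahedron_normals" "w \<in> octahedron_normals"
  shows "lorentz v v = 2" and "v \<noteq> w \<Longrightarrow> lorentz v w = 0 \<or> lorentz v w \<le> -2"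
  using assms by (auto simp: octahedron_normals_def lorentz_mvec inner_vec_def sum_3)


section \<open>Tessellated manifolds\<close>

text \<open>
  We take \<open>k\<close> copies of the polyhedron \<open>hpoly \<N>\<close>. The pair \<open>(i, v)\<close> denotes the face with normal
  \<open>v\<close> of the \<open>i\<close>-th copy; it is glued to the face \<open>\<tau> (i, v)\<close> by the isometry \<open>g (i, v)\<close>.
\<close>

definition face_pairing ::
    "'n::finite mink set \<Rightarrow> nat \<Rightarrow> (nat \<times> 'n mink \<Rightarrow> nat \<times> 'n mink)
      \<Rightarrow> (nat \<times> 'n mink \<Rightarrow> 'n mink \<Rightarrow> 'n mink) \<Rightarrow> bool" where
  "face_pairing \<N> k \<tau> g \<longleftrightarrow>
     (\<forall>c \<in> {..<k} \<times> \<N>.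
        \<tau> c \<in> {..<k} \<times> \<N> \<and> \<tau> c \<noteq> c \<and> \<tau> (\<tau> c) = c \<and>
        bij_betw (g c) (hface \<N> (snd c)) (hface \<N> (snd (\<tau> c))) \<and>
        (\<forall>x \<in> hface \<N> (snd c). \<forall>y \<in> hface \<N> (snd c). hdist (g c x) (g c y) = hdist x y) \<and>
        (\<forall>x \<in> hface \<N> (snd c). g (\<tau> c) (g c x) = x))"

definition face_glue ::
    "'n::finite mink set \<Rightarrow> nat \<Rightarrow> (nat \<times> 'n mink \<Rightarrow> nat \<times> 'n mink)
      \<Rightarrow> (nat \<times> 'n mink \<Rightarrow> 'n mink \<Rightarrow> 'n mink) \<Rightarrow> ((nat \<times> 'n mink) \<times> (nat \<times> 'n mink)) set" where
  "face_glue \<N> k \<tau> g =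
     {((i, x), (j, y)) | i x j y.
        i < k \<and> (\<exists>v\<in>\<N>. x \<in> hface \<N> v \<and> j = fst (\<tau> (i, v)) \<and> y = g (i, v) x)}"

text \<open>
  The manifold \<open>(X, A)\<close> is, through the map \<open>h\<close>, the quotient of the disjoint union of the copies by the
  equivalence relation generated by the face pairing, and \<open>h\<close> is a local isometry on each copy.
  The relation \<^const>\<open>face_glue\<close> is symmetric, so \<open>rtrancl\<close> makes it an equivalence.
\<close>

definition tessellation ::
    "'n::finite mink set \<Rightarrow> 'p topology \<Rightarrow> ('p, 'n) hchart set \<Rightarrow> nat
      \<Rightarrow> (nat \<times> 'n mink \<Rightarrow> nat \<times> 'n mink) \<Rightarrow> (nat \<times> 'n mink \<Rightarrow> 'n mink \<Rightarrow> 'n mink)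
      \<Rightarrow> (nat \<times> 'n mink \<Rightarrow> 'p) \<Rightarrow> bool" where
  "tessellation \<N> X A k \<tau> g h \<longleftrightarrow>
     face_pairing \<N> k \<tau> g \<and>
     quotient_map (prod_topology (discrete_topology {..<k}) (top_of_set (hpoly \<N>))) X h \<and>
     (\<forall>a \<in> {..<k} \<times> hpoly \<N>. \<forall>b \<in> {..<k} \<times> hpoly \<N>.
        h a = h b \<longleftrightarrow> (a, b) \<in> (face_glue \<N> k \<tau> g)\<^sup>*) \<and>
     (\<forall>i<k. \<forall>x \<in> hpoly \<N>. \<exists>(U, \<phi>) \<in> A. \<exists>G N.
        hyp_isometry G \<and> openin (top_of_set (hpoly \<N>)) N \<and> x \<in> N \<and>
        (\<forall>y\<in>N. h (i, y) \<in> U \<and> \<phi> (h (i, y)) = G y))"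

definition nice_dodecahedral :: "'p topology \<Rightarrow> ('p, 3) hchart set \<Rightarrow> bool" where
  "nice_dodecahedral X A \<longleftrightarrow>
     hyp_manifold X A \<and> hyp_complete X A \<and> hyp_finite_volume X A \<and>
     (\<exists>k \<tau> g h. tessellation dodecahedron_normals X A k \<tau> g h \<and>
        (\<forall>i<k. inj_on (\<lambda>x. h (i, x)) (hpoly dodecahedron_normals)))"

text \<open>In an octahedral manifold only the two octahedra meeting at a common face have to be distinct.\<close>

definition nice_octahedral :: "'p topology \<Rightarrow> ('p, 3) hchart set \<Rightarrow> bool" where
  "nice_octahedral X A \<longleftrightarrow>
     hyp_manifold X A \<and> hyp_complete X A \<and> hyp_finite_volume X A \<and>
     (\<exists>k \<tau> g h. tessellation octahedron_normals X A k \<tau> g h \<and>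
        (\<forall>i<k. \<forall>v \<in> octahedron_normals. fst (\<tau> (i, v)) \<noteq> i))"

text \<open>
  HOL cannot quantify existentially over types, so the points of the four-manifold have to be taken from a
  fixed type: sets of points of countably many copies of hyperbolic four-space. This is no restriction: it
  contains the orbit spaces of groups of isometries as well as all gluings of countably many polyhedra.
\<close>

type_synonym mfd4_point = "(nat \<times> 4 mink) set"

end

theory Submission
  imports Defs "HOL-Library.Option_ord"
begin

text \<open>
  The polyhedron of the tessellation is a facet of the right-angled 24-cell, respectively 120-cell, and every
  symmetry of the polyhedron extends to the cell. Take a cell on either side of each polyhedron of \<open>M\<close>. The cells are
  glued along the facets adjacent to \<open>M\<close> as \<open>M\<close> prescribes; each remaining facet is closed up by gluing
  it identically to the same facet of a second copy. The copies are labelled by sets of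
  colours, and crossing a facet toggles its colour, so that crossings of different facets commute. The colour must not
  change under the gluings of \<open>M\<close>, and different facets of one cell must have different colours; niceness
  makes this possible. The facets opposite to \<open>M\<close> join the pieces belonging to different
  polyhedra, which makes the result connected.

  The four-manifold is the quotient of hyperbolic space by the group of those gluing isometries that lead from one
  cell to itself. A right-angled cell tiles hyperbolic space no matter how its facets are glued, as long as the gluings
  at orthogonal facets commute. Hence this group is discrete, and it has finite covolume; it acts freely as soon as no
  element other than the identity fixes a point of the closed cell, which only involves crossing facets through
  one point.
\<close>

text \<open>Passing to a group action avoids verifying a glued four-manifold chart by chart: charts,
  completeness and connectedness of the quotient come from \<open>hyp\<close>, and what remains is
  the combinatorics of tiles. Even a disconnected M only raises a question of paths: whether one
  tile reaches the tiles over all polyhedra. A single pairing of polyhedra along the opposite facets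
  links at most two of them, so a flag, toggled at the facets in \<open>Z4\<close>, switches between
  two pairings that together link all. The obstacle is the commutation of crossings at orthogonal
  facets. It forces colours to be constant along the relation \<open>cstep\<close> and to be
  permuted at the opposite facet. In the 24-cell a coloured facet is orthogonal to at most one wall
  of the octahedron, so distinct octahedra at each triangle suffice; in the 120-cell it can be
  orthogonal to the three walls at a vertex of the dodecahedron, and embeddedness is what separates
  the colours there. That M is a manifold enters through its charts: they show that the crossings in
  M commute and that no chain of crossings has a nontrivial fixed point.\<close>

abbreviation e0 :: "'n::finite mink" where "e0 \<equiv> mvec 1 0"

section \<open>Minkowski space and the hyperboloid\<close>

definition sp :: "'n::finite mink \<Rightarrow> real ^ 'n" where
  "sp x = (\<chi> i. x $ Some i)"

lemma sum_option: "(\<Sum>k\<in>(UNIV::'n::finite option set). f k) = f None + (\<Sum>i\<in>UNIV. f (Some i))"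
  for f :: "'n::finite option \<Rightarrow> real"
  by (simp add: UNIV_option_conv sum.reindex)

lemma lorentz_sp: "lorentz x y = sp x \<bullet> sp y - x $ None * y $ None"
  by (simp add: lorentz_def sp_def inner_vec_def)

lemma inner_sp: "x \<bullet> y = sp x \<bullet> sp y + x $ None * y $ None" for x y :: "'n::finite mink"
  by (simp add: sp_def inner_vec_def sum_option)

lemma mvec_None [simp]: "mvec t u $ None = t" and sp_mvec [simp]: "sp (mvec t u) = u"
  by (simp_all add: mvec_def sp_def vec_eq_iff)

lemma mvec_sp [simp]: "mvec (x $ None) (sp x) = x"
  by (simp add: mvec_def sp_def vec_eq_iff split: option.split)

lemma mink_eqI: "x $ None = y $ None \<Longrightarrow> sp x = sp y \<Longrightarrow> x = y" for x y :: "'n::finite mink"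
  by (metis mvec_sp)

lemma sp_linear [simp]: "sp (x + y) = sp x + sp y" "sp (x - y) = sp x - sp y" "sp (c *\<^sub>R x) = c *\<^sub>R sp x"
  "sp 0 = 0" "sp (- x) = - sp x"
  by (simp_all add: sp_def vec_eq_iff)

lemma mvec_add: "mvec s u + mvec t w = mvec (s + t) (u + w)"
  and mvec_scale: "c *\<^sub>R mvec s u = mvec (c * s) (c *\<^sub>R u)"
  and mvec_diff: "mvec s u - mvec t w = mvec (s - t) (u - w)"
  by (auto intro!: mink_eqI)

lemma lorentz_self: "lorentz x x = (norm (sp x))\<^sup>2 - (x $ None)\<^sup>2"
  unfolding power2_norm_eq_inner by (simp add: lorentz_sp power2_eq_square)

lemma lorentz_sym: "lorentz x y = lorentz y x"
  by (simp add: lorentz_sp inner_commute)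

lemma lorentz_simps [simp]:
  "lorentz (x + y) z = lorentz x z + lorentz y z" "lorentz x (y + z) = lorentz x y + lorentz x z"
  "lorentz (x - y) z = lorentz x z - lorentz y z" "lorentz x (y - z) = lorentz x y - lorentz x z"
  "lorentz (c *\<^sub>R x) z = c * lorentz x z" "lorentz x (c *\<^sub>R z) = c * lorentz x z"
  "lorentz 0 x = 0" "lorentz x 0 = 0" "lorentz (- x) y = - lorentz x y" "lorentz x (- y) = - lorentz x y"
  by (simp_all add: lorentz_sp algebra_simps inner_simps)

lemma lorentz_sum: "lorentz x (sum f S) = (\<Sum>i\<in>S. lorentz x (f i))"
  by (induction S rule: infinite_finite_induct) auto

lemma lorentz_sum_left: "lorentz (sum f S) x = (\<Sum>i\<in>S. lorentz (f i) x)"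
  by (induction S rule: infinite_finite_induct) auto

lemma bounded_bilinear_lorentz: "bounded_bilinear (lorentz :: 'n::finite mink \<Rightarrow> _)"
  unfolding bilinear_conv_bounded_bilinear[symmetric] bilinear_def
  by (auto intro!: linearI)

lemmas tendsto_lorentz [tendsto_intros] = bounded_bilinear.tendsto[OF bounded_bilinear_lorentz]
lemmas continuous_on_lorentz [continuous_intros] = bounded_bilinear.continuous_on[OF bounded_bilinear_lorentz]

lemma lorentz_e0 [simp]: "lorentz e0 x = - x $ None" "lorentz x e0 = - x $ None"
  by (simp_all add: lorentz_sp)

lemma lorentz_nondeg:
  fixes x :: "'n::finite mink"
  assumes "\<And>y. lorentz x y = 0" shows "x = 0"
proof -
  have "lorentz x (mvec (- x $ None) (sp x)) = x \<bullet> x" by (simp add: lorentz_sp inner_sp)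
  then show ?thesis using assms by simp
qed

lemma hyp_iff: "x \<in> hyp \<longleftrightarrow> x $ None > 0 \<and> (x $ None)\<^sup>2 = 1 + sp x \<bullet> sp x"
  by (auto simp: hyp_def lorentz_sp power2_eq_square)

lemma hyp_self: "x \<in> hyp \<Longrightarrow> lorentz x x = -1" and hyp_pos: "x \<in> hyp \<Longrightarrow> x $ None > 0"
  by (simp_all add: hyp_def)

lemma hyp_ge1: "x \<in> hyp \<Longrightarrow> x $ None \<ge> 1"
proof -
  assume "x \<in> hyp"
  then have "(1::real)\<^sup>2 \<le> (x $ None)\<^sup>2" "x $ None > 0" by (auto simp: hyp_iff)
  then show ?thesis using power2_le_imp_le[of 1 "x $ None"] by simp
qed

lemma e0_hyp [simp]: "e0 \<in> hyp"
  by (simp add: hyp_iff)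

lemma norm_hyp: "x \<in> hyp \<Longrightarrow> (norm x)\<^sup>2 = 2 * (x $ None)\<^sup>2 - 1" for x :: "'n::finite mink"
  unfolding power2_norm_eq_inner by (simp add: inner_sp hyp_iff power2_eq_square)

lemma hyp_norm_sp: "x \<in> hyp \<Longrightarrow> norm (sp x) < x $ None"
  by (rule power2_less_imp_less) (auto simp: hyp_iff power2_norm_eq_inner)

text \<open>Reversed Cauchy-Schwarz: the spatial norm of \<open>c\<close> is at most its time
  component, and for a point of \<open>hyp\<close> it is strictly smaller. Applied to the sum of two
  normals, this excludes that both walls are violated at one point.\<close>

lemma causal_neg:
  assumes "lorentz c c \<le> 0" "c $ None > 0" "x \<in> hyp"
  shows "lorentz c x < 0"
proof -
  have "norm (sp c) \<le> c $ None"
    by (rule power2_le_imp_le) (use assms in \<open>auto simp: lorentz_self\<close>)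
  then have "norm (sp c) * norm (sp x) \<le> c $ None * norm (sp x)" by (simp add: mult_right_mono)
  also have "\<dots> < c $ None * x $ None" using hyp_norm_sp[OF assms(3)] assms(2) by simp
  finally show ?thesis using Cauchy_Schwarz_ineq2[of "sp c" "sp x"] by (simp add: lorentz_sp)
qed

lemma hyp_lorentz_le: assumes "x \<in> hyp" "y \<in> hyp" shows "lorentz x y \<le> -1"
proof -
  define a b where "a = norm (sp x)" and "b = norm (sp y)"
  have *: "(x $ None)\<^sup>2 = 1 + a\<^sup>2" "(y $ None)\<^sup>2 = 1 + b\<^sup>2" "a \<ge> 0" "b \<ge> 0" "x $ None > 0" "y $ None > 0"
    using assms by (auto simp: hyp_iff a_def b_def power2_norm_eq_inner)
  have "(1 + a * b)\<^sup>2 \<le> (1 + a\<^sup>2) * (1 + b\<^sup>2)"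
    using sum_squares_ge_zero[of "a - b" 0] by (simp add: power2_eq_square algebra_simps)
  also have "\<dots> = (x $ None * y $ None)\<^sup>2" using * by (simp add: power_mult_distrib)
  finally have "1 + a * b \<le> x $ None * y $ None" by (rule power2_le_imp_le) (use * in auto)
  then show ?thesis using Cauchy_Schwarz_ineq2[of "sp x" "sp y"] by (simp add: lorentz_sp a_def b_def)
qed

text \<open>The tangent space of \<open>hyp\<close> is positive definite: orthogonality turns
  \<open>x $ None * d $ None\<close> into a Euclidean inner product, to which Cauchy-Schwarz
  applies. The equality case shows that product -1 means equal points.\<close>

lemma hyp_perp:
  assumes "x \<in> hyp" "lorentz x d = 0"
  shows "lorentz d d \<ge> 0" and "lorentz d d = 0 \<Longrightarrow> d = 0"
proof -
  have 1: "x $ None * d $ None = sp x \<bullet> sp d" using assms by (simp add: lorentz_sp)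
  have 2: "(x $ None)\<^sup>2 * (d $ None)\<^sup>2 \<le> ((x $ None)\<^sup>2 - 1) * (norm (sp d))\<^sup>2"
    using Cauchy_Schwarz_ineq[of "sp x" "sp d"] assms(1)
    by (simp add: 1[symmetric] power_mult_distrib hyp_iff power2_norm_eq_inner)
  have 3: "lorentz d d = (norm (sp d))\<^sup>2 - (d $ None)\<^sup>2"
    by (rule lorentz_self)
  have 4: "(x $ None)\<^sup>2 > 0" using hyp_pos[OF assms(1)] by simp
  have 5: "(x $ None)\<^sup>2 * lorentz d d \<ge> (norm (sp d))\<^sup>2" using 2 by (simp add: 3 algebra_simps)
  then have "(x $ None)\<^sup>2 * lorentz d d \<ge> 0" using zero_le_power2 order_trans by blast
  then show "lorentz d d \<ge> 0" using 4 by (simp add: zero_le_mult_iff)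
  show "d = 0" if "lorentz d d = 0"
  proof -
    have "(norm (sp d))\<^sup>2 \<le> 0" using 5 that by simp
    then have "sp d = 0" by simp
    moreover then have "d $ None = 0" using that 3 by simp
    ultimately show ?thesis by (intro mink_eqI) auto
  qed
qed

lemma hyp_eq_iff: assumes "x \<in> hyp" "y \<in> hyp" shows "lorentz x y = -1 \<longleftrightarrow> x = y"
proof
  assume *: "lorentz x y = -1"
  have "x - y = 0"
    by (rule hyp_perp(2)[OF assms(1)]) (use * assms in \<open>auto simp: hyp_self lorentz_sym[of y x]\<close>)
  then show "x = y" by simp
qed (use assms hyp_self in auto)

lemma hyp_sheet: assumes "x \<in> hyp" "lorentz y y = -1" "lorentz x y < 0" shows "y \<in> hyp"
proof -
  consider "y $ None > 0" | "y $ None = 0" | "y $ None < 0" by linarith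
  then show ?thesis
  proof cases
    case 1 then show ?thesis using assms by (simp add: hyp_def)
  next
    case 2 then show ?thesis using assms(2) inner_ge_zero[of "sp y"] by (simp add: lorentz_sp)
  next
    case 3
    then have "- y \<in> hyp" using assms(2) by (simp add: hyp_def)
    from hyp_lorentz_le[OF assms(1) this] assms(3) show ?thesis by simp
  qed
qed

definition nrm :: "'n::finite mink \<Rightarrow> 'n mink" where
  "nrm x = (1 / sqrt (- lorentz x x)) *\<^sub>R x"

lemma nrm_hyp: assumes "lorentz x x < 0" "x $ None > 0" shows "nrm x \<in> hyp"
proof -
  have "lorentz (nrm x) (nrm x) = - ((1 / sqrt (- lorentz x x))\<^sup>2 * (- lorentz x x))"
    by (simp add: nrm_def power2_eq_square)
  also have "\<dots> = -1" using assms by (simp add: power_divide)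
  finally show ?thesis using assms by (simp add: hyp_def nrm_def)
qed

lemma lorentz_nrm: "lorentz v (nrm x) = lorentz v x / sqrt (- lorentz x x)"
  by (simp add: nrm_def)

lemma nrm_id: "x \<in> hyp \<Longrightarrow> nrm x = x"
  by (simp add: nrm_def hyp_self)

section \<open>Lorentz transformations and reflections\<close>

definition lor :: "('n::finite mink \<Rightarrow> 'n mink) \<Rightarrow> bool" where
  "lor A \<longleftrightarrow> linear A \<and> (\<forall>x y. lorentz (A x) (A y) = lorentz x y) \<and> A ` hyp \<subseteq> hyp"

text \<open>The sheet needs testing at one point only: the product with that point is negative on
  the sheet, and \<open>hyp_sheet\<close> recognises the sheet by this sign.\<close>

lemma lorI: "linear A \<Longrightarrow> (\<And>x y. lorentz (A x) (A y) = lorentz x y) \<Longrightarrow> x \<in> hyp \<Longrightarrow> A x \<in> hyp \<Longrightarrow> lor A"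
  for x :: "'n::finite mink"
  unfolding lor_def
proof (intro conjI allI image_subsetI)
  fix y :: "'n mink" assume *: "linear A" "\<And>x y. lorentz (A x) (A y) = lorentz x y" "x \<in> hyp" "A x \<in> hyp" "y \<in> hyp"
  have "lorentz x y < 0" using hyp_lorentz_le[of x y] * by simp
  then show "A y \<in> hyp" by (intro hyp_sheet[OF *(4)]) (use * in \<open>auto simp: hyp_self\<close>)
qed auto

lemma lor_linear: "lor A \<Longrightarrow> linear A" and lor_lorentz: "lor A \<Longrightarrow> lorentz (A x) (A y) = lorentz x y"
  and lor_hyp: "lor A \<Longrightarrow> x \<in> hyp \<Longrightarrow> A x \<in> hyp"
  by (auto simp: lor_def)

lemmas lor_simps = linear_add[OF lor_linear] linear_diff[OF lor_linear] linear_cmul[OF lor_linear]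
  linear_0[OF lor_linear] linear_neg[OF lor_linear]

lemma lor_id: "lor id" "lor (\<lambda>x. x)"
  by (auto simp: lor_def intro: linearI)

lemma lor_comp: "lor A \<Longrightarrow> lor B \<Longrightarrow> lor (A \<circ> B)"
  by (auto simp: lor_def intro!: linear_compose) blast

lemma lor_inj: assumes "lor A" shows "inj A"
proof (rule linear_injective_0[THEN iffD2, OF lor_linear[OF assms], rule_format])
  fix x assume "A x = 0"
  then have "lorentz x y = 0" for y using lor_lorentz[OF assms, of x y] by simp
  then show "x = 0" by (rule lorentz_nondeg)
qed

lemma lor_bij: "lor A \<Longrightarrow> bij A"
  using lor_inj lor_linear linear_injective_imp_surjective by (metis bijI)

lemma lor_inv: assumes "lor A" shows "lor (inv A)"
proof (rule lorI[of _ e0])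
  have b: "bij A" by (rule lor_bij[OF assms])
  show "linear (inv A)"
  proof -
    have s: "A (inv A x) = x" and i: "inv A (A x) = x" for x
      using b by (simp_all add: bij_is_surj surj_f_inv_f bij_is_inj)
    show ?thesis
    proof (rule linearI)
      show "inv A (x + y) = inv A x + inv A y" for x y
        using i[of "inv A x + inv A y"] by (simp add: s linear_add[OF lor_linear[OF assms]])
      show "inv A (c *\<^sub>R x) = c *\<^sub>R inv A x" for c x
        using i[of "c *\<^sub>R inv A x"] by (simp add: s linear_cmul[OF lor_linear[OF assms]])
    qed
  qed
  show pres: "lorentz (inv A x) (inv A y) = lorentz x y" for x y
    using lor_lorentz[OF assms, of "inv A x" "inv A y"] b by (simp add: bij_is_surj surj_f_inv_f)
  show "inv A (e0 :: 'a mink) \<in> hyp"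
  proof (rule ccontr)
    assume n: "inv A e0 \<notin> hyp"
    have 1: "lorentz (inv A e0) (inv A e0) = -1" using pres[of e0 e0] by simp
    then have "inv A e0 $ None \<noteq> 0" using inner_ge_zero[of "sp (inv A e0)"] by (auto simp: lorentz_sp simp del: inner_ge_zero)
    then have "- inv A e0 \<in> hyp" using n 1 by (simp add: hyp_def)
    then have "A (- inv A e0) \<in> hyp" using assms by (simp add: lor_hyp)
    then show False using b assms by (simp add: lor_simps bij_is_surj surj_f_inv_f hyp_def)
  qed
qed (rule e0_hyp)

lemma lor_inv_simps: assumes "lor A" shows "A (inv A x) = x" "inv A (A x) = x"
  using lor_bij[OF assms] by (simp_all add: bij_is_surj surj_f_inv_f bij_is_inj)

lemma lor_image_hyp: assumes "lor A" shows "A ` hyp = hyp"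
proof
  show "hyp \<subseteq> A ` hyp"
    using lor_hyp[OF lor_inv[OF assms]] lor_inv_simps[OF assms] by (metis image_iff subsetI)
qed (use assms in \<open>auto simp: lor_def\<close>)

lemma lor_continuous: "lor A \<Longrightarrow> continuous_on S A"
  by (simp add: lor_linear linear_continuous_on linear_conv_bounded_linear[symmetric])

text \<open>All face normals are scaled to Lorentz norm 2, so the reflection needs no
  division.\<close>

definition lrefl :: "'n::finite mink \<Rightarrow> 'n mink \<Rightarrow> 'n mink" where
  "lrefl v x = x - lorentz v x *\<^sub>R v"

lemma refl_linear: "linear (lrefl v)"
  by (rule linearI) (auto simp: lrefl_def algebra_simps)

lemma refl_refl: "lorentz v v = 2 \<Longrightarrow> lrefl v (lrefl v x) = x"
  by (simp add: lrefl_def algebra_simps scaleR_2)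

lemma refl_lorentz: "lorentz v v = 2 \<Longrightarrow> lorentz (lrefl v x) (lrefl v y) = lorentz x y"
  by (simp add: lrefl_def lorentz_sym[of x v] algebra_simps)

lemma refl_lor: assumes "lorentz v v = 2" shows "lor (lrefl v)"
proof (rule lorI[of _ e0])
  have "lorentz e0 (lrefl v e0) < 0" by (simp add: lrefl_def) (smt (verit) zero_le_square)
  then show "lrefl v e0 \<in> hyp"
    by (intro hyp_sheet[OF e0_hyp]) (use refl_lorentz[OF assms, of e0 e0] in auto)
qed (use refl_linear refl_lorentz[OF assms] in auto)

lemma refl_fix: "lorentz v x = 0 \<Longrightarrow> lrefl v x = x"
  by (simp add: lrefl_def)

lemma refl_commute: "lorentz v w = 0 \<Longrightarrow> lrefl v (lrefl w x) = lrefl w (lrefl v x)"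
  by (simp add: lrefl_def lorentz_sym[of w v] algebra_simps)

lemma lor_refl: "lor A \<Longrightarrow> A (lrefl v x) = lrefl (A v) (A x)"
  by (simp add: lrefl_def lor_simps lor_lorentz)

text \<open>Reflection in the bisector of \<open>e0\<close> and \<open>x\<close>, with a multiple of
  \<open>x - e0\<close> as normal. Being an involution, it transports statements between the two
  points in both directions.\<close>

lemma hyp_homog: assumes "x \<in> hyp" obtains A where "lor A" "A e0 = x" "A x = e0" "\<And>z. A (A z) = z"
proof (cases "x = e0")
  case True then show ?thesis using that[of id] lor_id by auto
next
  case False
  define d where "d = x - e0"
  define v where "v = sqrt (2 / lorentz d d) *\<^sub>R d"
  have "x $ None > 1" using hyp_eq_iff[OF assms e0_hyp] False hyp_ge1[OF assms] by auto
  then have p: "lorentz d d > 0" "lorentz d d = 2 * x $ None - 2"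
    using assms by (simp_all add: d_def hyp_self)
  have s: "sqrt (2 / lorentz d d) * sqrt (2 / lorentz d d) = 2 / lorentz d d" using p(1) by simp
  have v2: "lorentz v v = 2" using p(1) by (simp add: v_def s mult.assoc[symmetric])
  have r: "lrefl v z = z - (2 * lorentz d z / lorentz d d) *\<^sub>R d" for z
  proof -
    have "lrefl v z = z - (sqrt (2 / lorentz d d) * sqrt (2 / lorentz d d) * lorentz d z) *\<^sub>R d"
      by (simp add: lrefl_def v_def mult_ac del: real_sqrt_mult_self)
    then show ?thesis unfolding s by simp
  qed
  have "2 * lorentz d e0 = - lorentz d d" "2 * lorentz d x = lorentz d d"
    unfolding p(2) by (simp_all add: d_def hyp_self[OF assms])
  then have k: "2 * lorentz d e0 / lorentz d d = -1" "2 * lorentz d x / lorentz d d = 1"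
    using p(1) by simp_all
  have "lrefl v e0 = x" "lrefl v x = e0" unfolding r k by (simp_all add: d_def)
  then show ?thesis using that[of "lrefl v"] refl_lor[OF v2] refl_refl[OF v2] by auto
qed

text \<open>A Witt-type extension. \<open>A\<close> is defined on a basis inside \<open>S\<close>;
  at any other vector of \<open>S\<close> the difference \<open>A x - f x\<close> is orthogonal to
  the range of \<open>A\<close>, which is the whole space, so it vanishes.\<close>

lemma lor_extend:
  fixes f :: "'n::finite mink \<Rightarrow> 'n mink"
  assumes "span S = UNIV" and f: "\<And>x y. x \<in> S \<Longrightarrow> y \<in> S \<Longrightarrow> lorentz (f x) (f y) = lorentz x y"
  obtains A where "linear A" "\<And>x y. lorentz (A x) (A y) = lorentz x y" "\<And>x. x \<in> S \<Longrightarrow> A x = f x"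
proof -
  obtain B where B: "B \<subseteq> S" "independent B" "S \<subseteq> span B"
    by (rule maximal_independent_subset)
  have sB: "span B = UNIV" using B(3) assms(1) by (metis span_mono span_span top.extremum_uniqueI)
  obtain A where A: "linear A" "\<And>x. x \<in> B \<Longrightarrow> A x = f x"
    using linear_independent_extend[OF B(2)] by metis
  have P1: "lorentz (A x) (A y) = lorentz x y" if "y \<in> B" for x y
  proof -
    have "x \<in> span B" using sB by simp
    then show ?thesis
    proof (induction rule: span_induct_alt)
      case base then show ?case using A by (simp add: linear_0)
    next
      case (step c x z)
      then show ?case using that B f A by (simp add: linear_add linear_cmul subset_iff)
    qed
  qed
  have pres: "lorentz (A x) (A y) = lorentz x y" for x y
  proof -
    have "y \<in> span B" using sB by simp
    then show ?thesis
    proof (induction rule: span_induct_alt)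
      case base then show ?case using A by (simp add: linear_0)
    next
      case (step c y z)
      then show ?case using P1 A by (simp add: linear_add linear_cmul subset_iff)
    qed
  qed
  have "inj A"
  proof (rule linear_injective_0[THEN iffD2, OF A(1), rule_format])
    fix x assume "A x = 0"
    then have "lorentz x y = 0" for y using pres[of x y] by simp
    then show "x = 0" by (rule lorentz_nondeg)
  qed
  then have surj: "surj A" using A(1) linear_injective_imp_surjective by blast
  have "A x = f x" if x: "x \<in> S" for x
  proof -
    have "lorentz (A x - f x) (A y) = 0" for y
    proof -
      have "y \<in> span B" using sB by simp
      then show ?thesis
      proof (induction rule: span_induct_alt)
        case base then show ?case using A by (simp add: linear_0)
      next
        case (step c y z)
        have "lorentz (f x) (A y) = lorentz x y" "lorentz (A x) (A y) = lorentz x y"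
          using step(1) A B x f by auto (metis A(2) pres)
        then show ?case using A step by (simp add: linear_add linear_cmul)
      qed
    qed
    then have "lorentz (A x - f x) z = 0" for z using surj by (metis surjD)
    then show ?thesis using lorentz_nondeg by fastforce
  qed
  then show ?thesis using that A pres by blast
qed

section \<open>The hyperbolic distance\<close>

lemma cosh_hdist: "x \<in> hyp \<Longrightarrow> y \<in> hyp \<Longrightarrow> cosh (hdist x y) = - lorentz x y"
  using hyp_lorentz_le[of x y] by (simp add: hdist_def)

lemma hdist_nonneg: "x \<in> hyp \<Longrightarrow> y \<in> hyp \<Longrightarrow> hdist x y \<ge> 0"
  using hyp_lorentz_le[of x y] by (simp add: hdist_def)

lemma hdist_sym: "hdist x y = hdist y x"
  by (simp add: hdist_def lorentz_sym)

lemma hdist_self [simp]: "x \<in> hyp \<Longrightarrow> hdist x x = 0"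
  by (simp add: hdist_def hyp_self)

lemma hdist_lor: "lor A \<Longrightarrow> hdist (A x) (A y) = hdist x y"
  by (simp add: hdist_def lor_lorentz)

lemma hdist_less_iff: "x \<in> hyp \<Longrightarrow> y \<in> hyp \<Longrightarrow> r \<ge> 0 \<Longrightarrow> hdist x y < r \<longleftrightarrow> - lorentz x y < cosh r"
  using cosh_real_nonneg_less_iff[of "hdist x y" r] by (simp add: cosh_hdist hdist_nonneg)

lemma hdist_le_iff: "x \<in> hyp \<Longrightarrow> y \<in> hyp \<Longrightarrow> r \<ge> 0 \<Longrightarrow> hdist x y \<le> r \<longleftrightarrow> - lorentz x y \<le> cosh r"
  using cosh_real_nonneg_le_iff[of "hdist x y" r] by (simp add: cosh_hdist hdist_nonneg)

lemma hdist_eq_iff: "x \<in> hyp \<Longrightarrow> y \<in> hyp \<Longrightarrow> x' \<in> hyp \<Longrightarrow> y' \<in> hyp \<Longrightarrow>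
    hdist x y = hdist x' y' \<longleftrightarrow> lorentz x y = lorentz x' y'"
  by (metis cosh_hdist hdist_def neg_equal_iff_equal)

text \<open>Homogeneity moves the middle point to \<open>e0\<close>. There cosh and sinh of the
  distance are the time component and the norm of the space component, and the addition theorem for
  cosh reduces the claim to Cauchy-Schwarz.\<close>

lemma hdist_triangle:
  assumes "x \<in> hyp" "y \<in> hyp" "z \<in> hyp" shows "hdist x z \<le> hdist x y + hdist y z"
proof -
  obtain A where A: "lor A" "A y = e0" using hyp_homog[OF assms(2)] by metis
  have main: "hdist x z \<le> hdist x e0 + hdist e0 z" if "x \<in> hyp" "z \<in> hyp" for x z :: "'a mink"
  proof -
    have c: "cosh (hdist x e0) = x $ None" "cosh (hdist e0 z) = z $ None" using that by (simp_all add: cosh_hdist)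
    have "sinh (hdist x e0) = norm (sp x)"
      by (rule power2_eq_imp_eq) (use that hdist_nonneg[of x e0] in \<open>auto simp: c hyp_iff power2_norm_eq_inner sinh_square_eq\<close>)
    moreover have "sinh (hdist e0 z) = norm (sp z)"
      by (rule power2_eq_imp_eq) (use that hdist_nonneg[of e0 z] in \<open>auto simp: c hyp_iff power2_norm_eq_inner sinh_square_eq\<close>)
    ultimately have "cosh (hdist x e0 + hdist e0 z) = x $ None * z $ None + norm (sp x) * norm (sp z)"
      by (simp add: cosh_add c)
    moreover have "- lorentz x z \<le> x $ None * z $ None + norm (sp x) * norm (sp z)"
      using Cauchy_Schwarz_ineq2[of "sp x" "sp z"] by (simp add: lorentz_sp)
    ultimately show ?thesis using that by (simp add: hdist_le_iff hdist_nonneg)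
  qed
  show ?thesis using main[of "A x" "A z"] assms A hdist_lor[OF A(1)] by (metis lor_hyp)
qed

lemma hball_iff: "c \<in> hyp \<Longrightarrow> r > 0 \<Longrightarrow> x \<in> hball c r \<longleftrightarrow> x \<in> hyp \<and> - lorentz c x < cosh r"
  by (auto simp: hball_def hdist_less_iff)

lemma hball_open: "c \<in> hyp \<Longrightarrow> openin (top_of_set hyp) (hball c r)"
proof (cases "r > 0")
  case True
  assume c: "c \<in> hyp"
  have "hball c r = hyp \<inter> {x. - lorentz c x < cosh r}" using c True by (auto simp: hball_iff)
  moreover have "open {x. - lorentz c x < cosh r}"
    by (intro open_Collect_less continuous_intros)
  ultimately show ?thesis by (simp add: openin_open_Int)
next
  case False
  assume c: "c \<in> hyp"
  have "hball c r = {}" using False c hdist_nonneg by (fastforce simp: hball_def)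
  then show ?thesis by simp
qed

lemma hball_lor: assumes "lor A" shows "A ` hball c r = hball (A c) r"
proof (intro equalityI subsetI)
  fix y assume "y \<in> hball (A c) r"
  then have "inv A y \<in> hball c r"
    using hdist_lor[OF assms, of c "inv A y"] lor_hyp[OF lor_inv[OF assms]] by (auto simp: hball_def lor_inv_simps[OF assms])
  then show "y \<in> A ` hball c r" using lor_inv_simps[OF assms] by (metis image_eqI)
qed (use assms in \<open>auto simp: hball_def lor_hyp hdist_lor\<close>)

lemma lor_openin: assumes "lor A" "openin (top_of_set hyp) U" shows "openin (top_of_set hyp) (A ` U)"
proof -
  have "A ` U = hyp \<inter> inv A -` U"
  proof (intro equalityI subsetI)
    fix x assume "x \<in> hyp \<inter> inv A -` U"
    then show "x \<in> A ` U" using lor_inv_simps(1)[OF assms(1), of x] by (intro image_eqI[of _ _ "inv A x"]) auto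
  qed (use openin_imp_subset[OF assms(2)] lor_hyp[OF assms(1)] lor_inv_simps(2)[OF assms(1)] in auto)
  also have "openin (top_of_set hyp) \<dots>"
    by (rule continuous_openin_preimage[OF lor_continuous[OF lor_inv[OF assms(1)]] _ assms(2)])
      (use lor_hyp[OF lor_inv[OF assms(1)]] in blast)
  finally show ?thesis .
qed

lemma hball_subset_open:
  fixes x :: "'n::finite mink"
  assumes "openin (top_of_set hyp) U" "x \<in> U"
  obtains e where "e > 0" "hball x e \<subseteq> U"
proof -
  have main: "\<exists>e>0. hball e0 e \<subseteq> U" if o: "openin (top_of_set hyp) U" and e: "e0 \<in> U" for U :: "'n mink set"
  proof -
    obtain W where W: "open W" "U = hyp \<inter> W" using o unfolding openin_open by (elim exE conjE) (rule that)
    obtain d where d: "d > 0" "ball e0 d \<subseteq> W" using W e by (meson IntD2 open_contains_ball)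
    \<comment> \<open>Points of the ball have time component below 1 + m, so their squared Euclidean
      distance to \<open>e0\<close> is at most 4 m and hence below d^2; the cap at 1 bounds the
      factor \<open>y $ None\<close> by 2.\<close>
    define m where "m = min 1 (d\<^sup>2 / 8)"
    have m: "m > 0" "m \<le> 1" "m \<le> d\<^sup>2 / 8" using d by (auto simp: m_def)
    have "hball e0 (arcosh (1 + m)) \<subseteq> U"
    proof
      fix y :: "'n mink" assume y: "y \<in> hball e0 (arcosh (1 + m))"
      have "arcosh (1 + m) > 0" using m by simp
      then have yh: "y \<in> hyp" "y $ None < 1 + m" using y m by (simp_all add: hball_iff)
      have "(norm (y - e0))\<^sup>2 = 2 * y $ None * (y $ None - 1)"
        using yh(1) unfolding power2_norm_eq_inner by (simp add: inner_sp hyp_iff power2_eq_square algebra_simps)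
      also have "\<dots> \<le> 4 * m" using yh(2) m hyp_ge1[OF yh(1)]
        by (intro mult_mono) auto
      also have "\<dots> < d\<^sup>2" using m d by (simp add: field_simps)
      finally have "norm (y - e0) < d" by (rule power2_less_imp_less) (use d in auto)
      then show "y \<in> U" using d W yh by (auto simp: subset_iff dist_norm norm_minus_commute)
    qed
    moreover have "arcosh (1 + m) > 0" using m by simp
    ultimately show ?thesis by blast
  qed
  have xh: "x \<in> hyp" using assms openin_imp_subset by blast
  then obtain A where A: "lor A" "A e0 = x" "A x = e0" "\<And>z. A (A z) = z" using hyp_homog by metis
  have "openin (top_of_set hyp) (A ` U)" "e0 \<in> A ` U" using lor_openin[OF A(1) assms(1)] imageI[OF assms(2), of A] by (simp_all add: A)
  then obtain e where "e > 0" "hball e0 e \<subseteq> A ` U" using main by blast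
  then have "A ` hball e0 e \<subseteq> U" using A(4) by force
  then show ?thesis using that[of e] \<open>e > 0\<close> by (simp add: hball_lor[OF A(1)] A)
qed

lemma hcball_compact: fixes c :: "'n::finite mink" assumes "c \<in> hyp" shows "compact {x \<in> hyp. - lorentz c x \<le> r}"
proof -
  have clh: "closed (hyp :: 'n mink set)"
  proof -
    have eq: "(hyp :: 'n mink set) = {x. lorentz x x = -1} \<inter> {x. x $ None \<ge> 0}"
    proof (intro equalityI subsetI)
      fix x :: "'n mink" assume x: "x \<in> {x. lorentz x x = -1} \<inter> {x. x $ None \<ge> 0}"
      then have "x $ None \<noteq> 0" using inner_ge_zero[of "sp x"] by (auto simp: lorentz_sp simp del: inner_ge_zero)
      then show "x \<in> hyp" using x by (simp add: hyp_def)
    qed (auto simp: hyp_def)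
    have 1: "closed {x::'n mink. lorentz x x = -1}" by (intro closed_Collect_eq continuous_intros)
    have 2: "closed {x::'n mink. x $ None \<ge> 0}" by (intro closed_Collect_le continuous_intros)
    show ?thesis unfolding eq by (rule closed_Int[OF 1 2])
  qed
  have 0: "compact {x \<in> (hyp :: 'n mink set). - lorentz e0 x \<le> r}" for r
  proof (rule compact_eq_bounded_closed[THEN iffD2], intro conjI)
    have eq: "{x \<in> hyp. - lorentz e0 x \<le> r} = (hyp :: 'n mink set) \<inter> {x. - lorentz e0 x \<le> r}" by auto
    have 2: "closed {x::'n mink. - lorentz e0 x \<le> r}" by (intro closed_Collect_le continuous_intros)
    show "closed {x \<in> (hyp :: 'n mink set). - lorentz e0 x \<le> r}" unfolding eq by (rule closed_Int[OF clh 2])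
    show "bounded {x \<in> (hyp :: 'n mink set). - lorentz e0 x \<le> r}"
    proof (rule boundedI)
      fix x :: "'n mink" assume x: "x \<in> {x \<in> hyp. - lorentz e0 x \<le> r}"
      then have "x $ None \<le> r" "x $ None > 0" by (auto simp: hyp_pos)
      then have "(x $ None)\<^sup>2 \<le> r\<^sup>2" by (intro power_mono) auto
      then have "2 * (x $ None)\<^sup>2 - 1 \<le> 4 * r\<^sup>2" using zero_le_power2[of r] by linarith
      then have "(norm x)\<^sup>2 \<le> (2 * r)\<^sup>2" using x by (simp add: norm_hyp power_mult_distrib)
      then show "norm x \<le> 2 * r" by (rule power2_le_imp_le) (use \<open>x $ None \<le> r\<close> \<open>x $ None > 0\<close> in auto)
    qed
  qed
  obtain A where A: "lor A" "A e0 = c" "A c = e0" "\<And>z. A (A z) = z" using hyp_homog[OF assms] by metis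
  have eq: "{x \<in> hyp. - lorentz c x \<le> r} = A ` {x \<in> hyp. - lorentz e0 x \<le> r}"
  proof (intro equalityI subsetI)
    fix x assume x: "x \<in> {x \<in> hyp. - lorentz c x \<le> r}"
    then have "A x \<in> {x \<in> hyp. - lorentz e0 x \<le> r}"
      using lor_lorentz[OF A(1), of c x] lor_hyp[OF A(1)] A by simp
    then show "x \<in> A ` {x \<in> hyp. - lorentz e0 x \<le> r}" using A(4) by (metis (lifting) imageI)
  next
    fix x assume "x \<in> A ` {x \<in> hyp. - lorentz e0 x \<le> r}"
    then obtain y where y: "x = A y" "y \<in> hyp" "- lorentz e0 y \<le> r" by auto
    then show "x \<in> {x \<in> hyp. - lorentz c x \<le> r}"
      using lor_lorentz[OF A(1), of e0 y] lor_hyp[OF A(1)] by (simp add: A(2))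
  qed
  show ?thesis unfolding eq by (rule compact_continuous_image[OF lor_continuous[OF A(1)] 0])
qed

section \<open>Determinants\<close>

definition ldet :: "('n::finite mink \<Rightarrow> 'n mink) \<Rightarrow> real" where
  "ldet A = det (matrix A)"

lemma ldet_comp: "lor A \<Longrightarrow> lor B \<Longrightarrow> ldet (A \<circ> B) = ldet A * ldet B"
  by (simp add: ldet_def matrix_compose lor_linear det_mul)

lemma ldet_id [simp]: "ldet id = 1"
  by (simp add: ldet_def matrix_id)

text \<open>Determinants of both sides of A^T J A = J, where J is the matrix of the Lorentz
  form.\<close>

lemma ldet_sq: assumes "lor A" shows "ldet A * ldet A = 1"
proof -
  define J :: "'a mink \<Rightarrow> 'a mink" where "J x = mvec (- x $ None) (sp x)" for x
  have linJ: "linear J" by (rule linearI) (auto simp: J_def intro!: mink_eqI)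
  have lJ: "lorentz x y = x \<bullet> J y" for x y by (simp add: lorentz_sp inner_sp J_def)
  have JJ: "J \<circ> J = id" by (auto simp: J_def intro!: mink_eqI)
  have dJ: "det (matrix J) * det (matrix J) = 1"
    by (metis JJ det_I det_mul linJ matrix_compose matrix_id)
  have l: "linear A" using assms by (rule lor_linear)
  have "(transpose (matrix A) ** matrix J ** matrix A) *v y = matrix J *v y" for y
  proof (rule vector_eq_rdot[THEN iffD1, rule_format])
    fix x
    have "x \<bullet> ((transpose (matrix A) ** matrix J ** matrix A) *v y) = (matrix A *v x) \<bullet> (matrix J *v (matrix A *v y))"
      by (metis dot_lmul_matrix matrix_vector_mul_assoc vector_transpose_matrix transpose_transpose)
    also have "\<dots> = lorentz (A x) (A y)" using l linJ by (simp add: lJ matrix_works)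
    also have "\<dots> = x \<bullet> (matrix J *v y)" using linJ assms by (simp add: lJ[symmetric] matrix_works lor_lorentz)
    finally show "((transpose (matrix A) ** matrix J ** matrix A) *v y) \<bullet> x = (matrix J *v y) \<bullet> x" by (simp add: inner_commute)
  qed
  then have "transpose (matrix A) ** matrix J ** matrix A = matrix J" by (simp add: matrix_eq)
  then have "det (transpose (matrix A) ** matrix J ** matrix A) = det (matrix J)" by simp
  then have "det (matrix A) * det (matrix J) * det (matrix A) = det (matrix J)" by (simp add: det_mul)
  moreover have "det (matrix J) \<noteq> 0" using dJ by auto
  ultimately show ?thesis by (simp add: ldet_def)
qed

lemma ldet_cases: "lor A \<Longrightarrow> ldet A = 1 \<or> ldet A = -1"
  using ldet_sq square_eq_1_iff by blast

text \<open>For a purely spatial normal the Lorentz reflection is a Euclidean one. An orthogonal map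
  takes the normal to a coordinate axis, where the matrix becomes diagonal; the index
  \<open>None\<close> merely names such an axis.\<close>

lemma ldet_lrefl_aux:
  fixes v :: "'n::finite mink"
  assumes "v \<bullet> v = 2" "v $ None = 0" shows "ldet (lrefl v) = -1"
proof -
  define k :: "'n option" where "k = None"
  define a :: "'n mink" where "a = axis k (sqrt 2)"
  define D :: "'n mink \<Rightarrow> 'n mink" where "D x = x - (a \<bullet> x) *\<^sub>R a" for x
  have lD: "linear D" by (rule linearI) (auto simp: D_def algebra_simps inner_simps)
  have "norm v = norm a" using assms(1) by (simp add: a_def inner_axis norm_eq_sqrt_inner)
  then obtain B where B: "orthogonal_transformation B" "B v = a" by (rule orthogonal_transformation_exists)
  have lB: "linear B" using B by (simp add: orthogonal_transformation_def)
  have r: "lrefl v x = x - (v \<bullet> x) *\<^sub>R v" for x using assms(2) by (simp add: lrefl_def lorentz_sp inner_sp)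
  have "B \<circ> lrefl v = D \<circ> B"
  proof
    fix x
    have "a \<bullet> B x = v \<bullet> x" using B unfolding orthogonal_transformation_def by metis
    then show "(B \<circ> lrefl v) x = (D \<circ> B) x" by (simp add: r D_def linear_diff[OF lB] linear_cmul[OF lB] B(2))
  qed
  then have "matrix B ** matrix (lrefl v) = matrix D ** matrix B"
    by (metis lB lD refl_linear matrix_compose)
  then have 1: "det (matrix B) * det (matrix (lrefl v)) = det (matrix D) * det (matrix B)" by (metis det_mul)
  have "orthogonal_matrix (matrix B)" using B orthogonal_transformation_matrix by blast
  then have "det (matrix B) \<noteq> 0" using det_orthogonal_matrix[of "matrix B"] by force
  moreover have "det (matrix D) = -1"
  proof -
    have ia: "a \<bullet> axis j 1 = (if j = k then sqrt 2 else 0)" for j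
      unfolding inner_axis by (simp add: a_def axis_def)
    have e: "matrix D $ i $ j = (if i = j then (if i = k then -1 else 1) else 0)" for i j
      by (auto simp: matrix_def D_def ia) (auto simp: a_def axis_def)
    have "det (matrix D) = (\<Prod>i\<in>UNIV. matrix D $ i $ i)" by (rule det_diagonal) (simp add: e)
    also have "\<dots> = (\<Prod>i\<in>UNIV. if i = k then -1 else 1)" by (simp add: e)
    also have "\<dots> = -1" by (simp add: prod.delta)
    finally show ?thesis .
  qed
  ultimately have "det (matrix B) * (det (matrix (lrefl v)) + 1) = 0" using 1 by (simp add: algebra_simps)
  then show ?thesis using \<open>det (matrix B) \<noteq> 0\<close> by (simp add: ldet_def)
qed

lemma ldet_lrefl: assumes "lorentz v v = 2" shows "ldet (lrefl v) = -1"
proof -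
  \<comment> \<open>The orthogonal projection of \<open>e0\<close> to the hyperplane of
    \<open>v\<close>. Moving its normalisation to \<open>e0\<close> makes the normal purely
    spatial.\<close>
  define z where "z = e0 + (v $ None / 2) *\<^sub>R v"
  have z0: "z $ None > 0" using zero_le_square[of "v $ None"] by (simp add: z_def add_pos_nonneg)
  have "lorentz z z = -1 - (v $ None)\<^sup>2 / 2" by (simp add: z_def assms power2_eq_square field_simps)
  then have zz: "lorentz z z < 0" using zero_le_power2[of "v $ None"] by linarith
  have vz: "lorentz v z = 0" by (simp add: z_def assms)
  obtain A where A: "lor A" "A (nrm z) = e0" using hyp_homog[OF nrm_hyp[OF zz z0]] by metis
  have "lorentz (A v) e0 = 0" using lor_lorentz[OF A(1), of v "nrm z"] by (simp add: A lorentz_nrm vz)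
  then have 0: "A v $ None = 0" by simp
  have "lorentz (A v) (A v) = 2" using assms A by (simp add: lor_lorentz)
  then have "A v \<bullet> A v = 2" using 0 by (simp add: lorentz_sp inner_sp)
  from ldet_lrefl_aux[OF this 0] have *: "ldet (lrefl (A v)) = -1" .
  have "A \<circ> lrefl v = lrefl (A v) \<circ> A" using lor_refl[OF A(1)] by auto
  then have "ldet A * ldet (lrefl v) = ldet (lrefl (A v)) * ldet A"
    by (metis A(1) assms ldet_comp lor_lorentz refl_lor)
  then have "ldet A * (ldet (lrefl v) + 1) = 0" using * by (simp add: algebra_simps)
  then show ?thesis using ldet_sq[OF A(1)] by auto
qed

lemma ldet_pos_matrix: "lor A \<Longrightarrow> ldet A = 1 \<Longrightarrow> det (matrix A) > 0 \<and> A x = matrix A *v x"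
  by (simp add: ldet_def matrix_works lor_linear)

section \<open>Invariance of the volume\<close>

text \<open>The part of the cone over \<open>S\<close> up to Lorentz length 1. Its Lebesgue measure
  is a constant multiple of the hyperbolic volume of \<open>S\<close>, so the invariance of the
  volume reduces to determinants being 1 or -1.\<close>

definition lcone :: "'n::finite mink set \<Rightarrow> 'n mink set" where
  "lcone S = {y. lorentz y y < 0 \<and> y $ None > 0 \<and> - lorentz y y \<le> 1 \<and> nrm y \<in> S}"

lemma borel_lorentz [measurable]: "f \<in> borel_measurable M \<Longrightarrow> g \<in> borel_measurable M \<Longrightarrow>
    (\<lambda>x. lorentz (f x) (g x)) \<in> borel_measurable M"
  by (rule borel_measurable_continuous_Pair[where H=lorentz]) (auto intro!: continuous_intros simp: case_prod_beta)

lemma nrm_measurable [measurable]: "nrm \<in> borel \<rightarrow>\<^sub>M borel"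
  unfolding nrm_def by measurable

lemma borel_None [measurable]: "(\<lambda>y::'n::finite mink. y $ None) \<in> borel_measurable borel"
  by (intro borel_measurable_continuous_onI continuous_intros)

lemma cone_measurable [measurable]: assumes [measurable]: "S \<in> sets borel" shows "lcone S \<in> sets borel"
  unfolding lcone_def by measurable

lemma continuous_mvec: "continuous_on UNIV (\<lambda>p. mvec (fst p) (snd p))"
  unfolding mvec_def
proof (intro continuous_on_vec_lambda)
  fix i :: "'a option"
  show "continuous_on UNIV (\<lambda>x. case i of None \<Rightarrow> fst x | Some j \<Rightarrow> snd x $ j)"
    by (cases i) (auto intro!: continuous_intros)
qed

lemma mvec_measurable: "(\<lambda>p. mvec (fst p) (snd p)) \<in> borel \<rightarrow>\<^sub>M borel"
  by (rule borel_measurable_continuous_onI[OF continuous_mvec])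

lemma mvec_measurable' [measurable (raw)]:
  "f \<in> M \<rightarrow>\<^sub>M borel \<Longrightarrow> g \<in> M \<rightarrow>\<^sub>M borel \<Longrightarrow> (\<lambda>x. mvec (f x) (g x)) \<in> M \<rightarrow>\<^sub>M borel"
  for f :: "'a \<Rightarrow> real" and g :: "'a \<Rightarrow> real ^ 'n::finite"
  using measurable_compose[OF borel_measurable_Pair[of f M g] mvec_measurable] by simp

lemma prod_Basis_vec: "(\<Prod>b\<in>Basis. f b) = (\<Prod>i\<in>UNIV. f (axis i (1::real)))" for f :: "real ^ 'n::finite \<Rightarrow> 'b::comm_monoid_mult"
proof -
  have "Basis = range (\<lambda>i::'n. axis i (1::real))" by (auto simp: Basis_vec_def)
  moreover have "inj (\<lambda>i::'n. axis i (1::real))" by (auto simp: inj_on_def axis_eq_axis)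
  ultimately show ?thesis by (simp add: prod.reindex_cong)
qed

lemma prod_option: "(\<Prod>k\<in>(UNIV::'n::finite option set). f k) = f None * (\<Prod>i\<in>UNIV. f (Some i))"
  for f :: "'n::finite option \<Rightarrow> real"
  by (simp add: UNIV_option_conv prod.reindex)

lemma lborel_mink: "(lborel :: 'n::finite mink measure) = distr (lborel \<Otimes>\<^sub>M lborel) borel (\<lambda>p. mvec (fst p) (snd p))"
proof (rule lborel_eqI)
  fix l u :: "'n mink" assume le: "\<And>b. b \<in> Basis \<Longrightarrow> l \<bullet> b \<le> u \<bullet> b"
  have le': "l $ k \<le> u $ k" for k using le[of "axis k 1"] by (simp add: inner_axis)
  have le2: "sp l \<bullet> b \<le> sp u \<bullet> b" if "b \<in> Basis" for b :: "real ^ 'n"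
    using that le' by (auto simp: Basis_vec_def inner_axis sp_def)
  have "(\<lambda>p. mvec (fst p) (snd p)) -` box l u = box (l $ None) (u $ None) \<times> box (sp l) (sp u)"
    by (auto simp: mem_box_cart mvec_def sp_def split: option.splits)
  then have "emeasure (distr (lborel \<Otimes>\<^sub>M lborel) borel (\<lambda>p. mvec (fst p) (snd p))) (box l u)
      = emeasure (lborel \<Otimes>\<^sub>M lborel) (box (l $ None) (u $ None) \<times> box (sp l) (sp u))"
    by (subst emeasure_distr) (auto simp: lborel_prod space_pair_measure intro!: mvec_measurable)
  also have "\<dots> = emeasure lborel (box (l $ None) (u $ None)) * emeasure lborel (box (sp l) (sp u))"
    by (rule lborel.emeasure_pair_measure_Times) auto
  also have "\<dots> = ennreal (u $ None - l $ None) * ennreal (\<Prod>b\<in>Basis. (sp u - sp l) \<bullet> b)"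
    using le' le2 by (simp add: emeasure_lborel_box_eq)
  also have "\<dots> = ennreal ((u $ None - l $ None) * (\<Prod>b\<in>Basis. (sp u - sp l) \<bullet> b))"
    using le' le2 by (intro ennreal_mult[symmetric]) (auto intro!: prod_nonneg simp: inner_simps)
  also have "(u $ None - l $ None) * (\<Prod>b\<in>Basis. (sp u - sp l) \<bullet> b) = (\<Prod>b\<in>Basis. (u - l) \<bullet> b)"
    by (simp add: prod_Basis_vec prod_option inner_axis sp_def)
  finally show "emeasure (distr (lborel \<Otimes>\<^sub>M lborel) borel (\<lambda>p. mvec (fst p) (snd p))) (box l u) = ennreal (\<Prod>b\<in>Basis. (u - l) \<bullet> b)" .
qed simp

lemma nn_integral_scale:
  fixes f :: "'a::euclidean_space \<Rightarrow> ennreal"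
  assumes [measurable]: "f \<in> borel_measurable borel" and "t > 0"
  shows "(\<integral>\<^sup>+w. f w \<partial>lborel) = ennreal (t ^ DIM('a)) * (\<integral>\<^sup>+u. f (t *\<^sub>R u) \<partial>lborel)"
proof -
  have "(\<integral>\<^sup>+w. f w \<partial>lborel) = (\<integral>\<^sup>+w. f w \<partial>(density (distr lborel borel (\<lambda>x. 0 + t *\<^sub>R x)) (\<lambda>_. \<bar>t\<bar>^DIM('a))))"
    using lborel_affine[of t "0::'a"] assms(2) by simp
  also have "\<dots> = (\<integral>\<^sup>+u. ennreal (t ^ DIM('a)) * f (t *\<^sub>R u) \<partial>lborel)"
    using assms(2) by (simp add: nn_integral_density nn_integral_distr)
  also have "\<dots> = ennreal (t ^ DIM('a)) * (\<integral>\<^sup>+u. f (t *\<^sub>R u) \<partial>lborel)"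
    by (rule nn_integral_cmult) measurable
  finally show ?thesis .
qed

text \<open>The change from the time coordinate \<open>a\<close> to the Lorentz length t = sqrt(a^2
  - c^2); the number \<open>c\<close> will be the norm of the space component.\<close>

lemma inner_substitution:
  fixes f :: "real \<Rightarrow> ennreal"
  assumes [measurable]: "f \<in> borel_measurable borel" and "c > 0"
  shows "(\<integral>\<^sup>+a. f a * indicator {c..sqrt (1 + c\<^sup>2)} a \<partial>lborel) =
    (\<integral>\<^sup>+t. f (sqrt (t\<^sup>2 + c\<^sup>2)) * ennreal (t / sqrt (t\<^sup>2 + c\<^sup>2)) * indicator {0..1} t \<partial>lborel)"
proof -
  have pos: "t\<^sup>2 + c\<^sup>2 > 0" for t :: real using assms(2) by (simp add: add_nonneg_pos)
  have 1: "((\<lambda>t. sqrt (t\<^sup>2 + c\<^sup>2)) has_real_derivative t / sqrt (t\<^sup>2 + c\<^sup>2)) (at t)" for t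
    using pos[of t] by (auto intro!: derivative_eq_intros simp: field_simps)
  have 2: "continuous_on {0..1} (\<lambda>t. t / sqrt (t\<^sup>2 + c\<^sup>2))"
    using pos by (intro continuous_intros) (auto simp: less_imp_neq[OF pos, symmetric])
  have "(\<integral>\<^sup>+a. f a * indicator {sqrt (0\<^sup>2 + c\<^sup>2)..sqrt (1\<^sup>2 + c\<^sup>2)} a \<partial>lborel) =
    (\<integral>\<^sup>+t. f (sqrt (t\<^sup>2 + c\<^sup>2)) * ennreal (t / sqrt (t\<^sup>2 + c\<^sup>2)) * indicator {0..1} t \<partial>lborel)"
    by (rule nn_integral_substitution_aux) (use 1 2 assms pos in \<open>auto intro!: divide_nonneg_nonneg\<close>)
  then show ?thesis using assms(2) by simp
qed

lemma cone_indicator: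
  fixes w :: "real ^ 'n::finite"
  assumes "S \<subseteq> hyp" "w \<noteq> 0"
  shows "indicator (lcone S) (mvec a w) =
    (indicator S (nrm (mvec a w)) * indicator {norm w..sqrt (1 + (norm w)\<^sup>2)} a :: ennreal)"
proof -
  have l: "lorentz (mvec a w) (mvec a w) = (norm w)\<^sup>2 - a\<^sup>2" by (simp add: lorentz_self)
  have w: "norm w > 0" using assms by simp
  show ?thesis
  proof (cases "a = norm w")
    case True
    \<comment> \<open>On the light cone \<open>nrm\<close> divides by 0 and returns 0, which is not
      in \<open>hyp\<close>.\<close>
    then have "nrm (mvec a w) = 0" unfolding nrm_def l by simp
    then have "nrm (mvec a w) \<notin> S" using assms by (auto simp: hyp_def)
    then show ?thesis by (simp add: lcone_def)
  next
    case False
    have "(norm w)\<^sup>2 - a\<^sup>2 < 0 \<and> a > 0 \<longleftrightarrow> norm w < a"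
      using w by (smt (verit) norm_ge_zero power2_less_imp_less power_strict_mono zero_less_numeral)
    moreover have "a > 0 \<Longrightarrow> - ((norm w)\<^sup>2 - a\<^sup>2) \<le> 1 \<longleftrightarrow> a \<le> sqrt (1 + (norm w)\<^sup>2)"
      by (auto simp: real_le_rsqrt intro: real_le_rsqrt)
        (smt (verit) real_le_lsqrt real_sqrt_le_iff real_sqrt_pow2 real_sqrt_unique zero_le_power2 power_mono)
    ultimately have "mvec a w \<in> lcone S \<longleftrightarrow> nrm (mvec a w) \<in> S \<and> a \<in> {norm w..sqrt (1 + (norm w)\<^sup>2)}"
      using False w by (auto simp: lcone_def l)
    then show ?thesis by (auto simp: indicator_def)
  qed
qed

lemma hyp_volume_eq:
  assumes [measurable]: "S \<in> sets borel"
  shows "emeasure hyp_volume S =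
    (\<integral>\<^sup>+u. indicator S (mvec (sqrt (1 + u \<bullet> u)) u) * ennreal (1 / sqrt (1 + u \<bullet> u)) \<partial>lborel)"
proof -
  have m: "(\<lambda>u. mvec (sqrt (1 + u \<bullet> u)) u) \<in> borel \<rightarrow>\<^sub>M (borel :: 'a mink measure)" by measurable
  then have pre: "(\<lambda>u. mvec (sqrt (1 + u \<bullet> u)) u) -` S \<in> sets borel"
    using measurable_sets[OF m assms] by simp
  have "emeasure hyp_volume S = emeasure (density lborel (\<lambda>u. ennreal (1 / sqrt (1 + u \<bullet> u)))) ((\<lambda>u. mvec (sqrt (1 + u \<bullet> u)) u) -` S)"
    unfolding hyp_volume_def by (subst emeasure_distr) (use m in auto)
  also have "\<dots> = (\<integral>\<^sup>+u. ennreal (1 / sqrt (1 + u \<bullet> u)) * indicator ((\<lambda>u. mvec (sqrt (1 + u \<bullet> u)) u) -` S) u \<partial>lborel)"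
    by (subst emeasure_density) (use pre in auto)
  also have "\<dots> = (\<integral>\<^sup>+u. indicator S (mvec (sqrt (1 + u \<bullet> u)) u) * ennreal (1 / sqrt (1 + u \<bullet> u)) \<partial>lborel)"
    by (intro nn_integral_cong) (auto simp: indicator_def)
  finally show ?thesis .
qed

text \<open>Polar coordinates (t, u) -> t (sqrt(1 + |u|^2), u) with Jacobian t^n / sqrt(1 + |u|^2),
  in two stages: for fixed space component w the time coordinate is replaced by t, then for fixed t
  the component w is rescaled to t u.\<close>

lemma cone_volume:
  fixes S :: "'n::finite mink set"
  assumes [measurable]: "S \<in> sets borel" and S: "S \<subseteq> hyp"
  shows "emeasure lborel (lcone S) =
    (\<integral>\<^sup>+t. ennreal (t ^ CARD('n)) * indicator {0..1} t \<partial>lborel) * emeasure hyp_volume S"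
proof -
  define G :: "real \<Rightarrow> real ^ 'n \<Rightarrow> ennreal" where
    "G t w = indicator S (nrm (mvec (sqrt (t\<^sup>2 + (norm w)\<^sup>2)) w)) * ennreal (t / sqrt (t\<^sup>2 + (norm w)\<^sup>2)) * indicator {0..1} t" for t w
  have [measurable]: "(\<lambda>p. G (fst p) (snd p)) \<in> borel_measurable (lborel \<Otimes>\<^sub>M lborel)"
    unfolding G_def by measurable
  have [measurable]: "(\<lambda>w. G t w) \<in> borel_measurable borel" for t
    unfolding G_def by measurable
  have [measurable]: "(\<lambda>p. indicator (lcone S) (mvec (fst p) (snd p)) :: ennreal) \<in> borel_measurable (lborel \<Otimes>\<^sub>M lborel)"
    by measurable
  have "emeasure lborel (lcone S) = (\<integral>\<^sup>+y. indicator (lcone S) y \<partial>(lborel :: 'n mink measure))"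
    by simp
  also have "\<dots> = (\<integral>\<^sup>+p. indicator (lcone S) (mvec (fst p) (snd p)) \<partial>(lborel \<Otimes>\<^sub>M lborel))"
    by (subst lborel_mink, subst nn_integral_distr) auto
  also have "\<dots> = (\<integral>\<^sup>+w. (\<integral>\<^sup>+a. indicator (lcone S) (mvec a w) \<partial>lborel) \<partial>lborel)"
    by (subst lborel_pair.nn_integral_snd[symmetric]) auto
  also have "\<dots> = (\<integral>\<^sup>+w. (\<integral>\<^sup>+t. G t w \<partial>lborel) \<partial>lborel)"
  proof (rule nn_integral_cong_AE)
    have "AE w in (lborel :: (real ^ 'n) measure). w \<noteq> 0" by (rule AE_lborel_singleton)
    then show "AE w in lborel. (\<integral>\<^sup>+a. indicator (lcone S) (mvec a w) \<partial>lborel) = (\<integral>\<^sup>+t. G t w \<partial>lborel)"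
    proof eventually_elim
      fix w :: "real ^ 'n" assume "w \<noteq> 0"
      then show "(\<integral>\<^sup>+a. indicator (lcone S) (mvec a w) \<partial>lborel) = (\<integral>\<^sup>+t. G t w \<partial>lborel)"
        unfolding G_def by (subst inner_substitution[symmetric]) (auto simp: cone_indicator[OF S])
    qed
  qed
  also have "\<dots> = (\<integral>\<^sup>+t. (\<integral>\<^sup>+w. G t w \<partial>lborel) \<partial>lborel)"
    by (subst lborel_pair.Fubini') auto
  also have "\<dots> = (\<integral>\<^sup>+t. (ennreal (t ^ CARD('n)) * indicator {0..1} t) * emeasure hyp_volume S \<partial>lborel)"
  proof (rule nn_integral_cong)
    fix t :: real
    consider "t < 0" | "t = 0" | "t > 0" by linarith
    then show "(\<integral>\<^sup>+w. G t w \<partial>lborel) = (ennreal (t ^ CARD('n)) * indicator {0..1} t) * emeasure hyp_volume S"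
    proof cases
      case 3
      have "G t (t *\<^sub>R u) = indicator {0..1} t * (indicator S (mvec (sqrt (1 + u \<bullet> u)) u) * ennreal (1 / sqrt (1 + u \<bullet> u)))" for u
      proof -
        have p: "1 + u \<bullet> u > 0" by (simp add: add_pos_nonneg)
        have "t\<^sup>2 + (norm (t *\<^sub>R u))\<^sup>2 = t\<^sup>2 * (1 + u \<bullet> u)" by (simp add: power_mult_distrib power2_norm_eq_inner algebra_simps)
        then have s: "sqrt (t\<^sup>2 + (norm (t *\<^sub>R u))\<^sup>2) = t * sqrt (1 + u \<bullet> u)" using 3 by (simp add: real_sqrt_mult)
        have "lorentz (mvec (t * sqrt (1 + u \<bullet> u)) (t *\<^sub>R u)) (mvec (t * sqrt (1 + u \<bullet> u)) (t *\<^sub>R u)) = - (t\<^sup>2)"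
          using p by (simp add: lorentz_sp power2_eq_square algebra_simps)
        then have "nrm (mvec (t * sqrt (1 + u \<bullet> u)) (t *\<^sub>R u)) = mvec (sqrt (1 + u \<bullet> u)) u"
          using 3 by (simp add: nrm_def mvec_scale)
        then show ?thesis using 3 unfolding G_def s by (simp add: mult_ac)
      qed
      then show ?thesis using 3
        by (subst nn_integral_scale[of "G t" t]) (auto simp: nn_integral_cmult hyp_volume_eq mult_ac)
    qed (auto simp: G_def)
  qed
  also have "\<dots> = (\<integral>\<^sup>+t. ennreal (t ^ CARD('n)) * indicator {0..1} t \<partial>lborel) * emeasure hyp_volume S"
    by (rule nn_integral_multc) measurable
  finally show ?thesis .
qed

lemma cone_constant:
  fixes n :: nat
  defines "c \<equiv> \<integral>\<^sup>+t. ennreal (t ^ n) * indicator {0..1::real} t \<partial>lborel"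
  shows "c \<noteq> 0" "c \<noteq> \<infinity>"
proof -
  have "c \<le> (\<integral>\<^sup>+t. indicator {0..1::real} t \<partial>lborel)" unfolding c_def
    by (rule nn_integral_mono) (auto simp: indicator_def power_le_one)
  also have "\<dots> = 1" by simp
  finally show "c \<noteq> \<infinity>" by (auto simp: top_unique)
  have "ennreal ((1/2) ^ n) * ennreal (1/2) = (\<integral>\<^sup>+t. ennreal ((1/2) ^ n) * indicator {1/2..1::real} t \<partial>lborel)"
    by (subst nn_integral_cmult_indicator) auto
  also have "\<dots> \<le> c" unfolding c_def
    by (rule nn_integral_mono) (auto simp: indicator_def intro!: ennreal_leI power_mono)
  finally show "c \<noteq> 0" by auto
qed

lemma lborel_lor:
  fixes A :: "'n::{finite,wellorder} mink \<Rightarrow> 'n mink"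
  assumes "lor A" shows "distr lborel borel A = lborel"
proof (rule lborel_eqI[symmetric])
  fix l u :: "'n mink" assume le: "\<And>b. b \<in> Basis \<Longrightarrow> l \<bullet> b \<le> u \<bullet> b"
  have i: "lor (inv A)" by (rule lor_inv[OF assms])
  have mA: "A \<in> borel \<rightarrow>\<^sub>M borel" using lor_continuous[OF assms] by (rule borel_measurable_continuous_onI)
  have pre: "A -` box l u = inv A ` box l u"
    using bij_vimage_eq_inv_image[OF lor_bij[OF assms]] by simp
  have b: "box l u \<in> lmeasurable" by simp
  have sb: "inv A ` box l u \<in> sets borel" using measurable_sets[OF mA, of "box l u"] by (simp add: pre)
  have lm: "inv A ` box l u \<in> lmeasurable" by (rule measurable_linear_image[OF lor_linear[OF i] b])
  have "\<bar>det (matrix (inv A))\<bar> = 1" using ldet_cases[OF i] by (auto simp: ldet_def)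
  then have m: "measure lebesgue (inv A ` box l u) = measure lebesgue (box l u)"
    using measure_linear_image[OF lor_linear[OF i] b] by simp
  have "emeasure (distr lborel borel A) (box l u) = emeasure lborel (inv A ` box l u)"
    by (subst emeasure_distr) (auto simp: mA pre)
  also have "\<dots> = emeasure lebesgue (inv A ` box l u)" using sb by simp
  also have "\<dots> = ennreal (measure lebesgue (box l u))"
    using lm by (simp add: emeasure_eq_measure2 m)
  also have "measure lebesgue (box l u) = (\<Prod>b\<in>Basis. (u - l) \<bullet> b)"
    using le by (simp add: measure_lborel_box_eq)
  finally show "emeasure (distr lborel borel A) (box l u) = ennreal (\<Prod>b\<in>Basis. (u - l) \<bullet> b)" .
qed simp

lemma lor_image_borel: assumes "lor A" "S \<in> sets borel" shows "A ` S \<in> sets borel"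
proof -
  have "inv A \<in> borel \<rightarrow>\<^sub>M borel"
    using lor_continuous[OF lor_inv[OF assms(1)]] by (rule borel_measurable_continuous_onI)
  from measurable_sets[OF this assms(2)] have "inv A -` S \<in> sets borel" by simp
  moreover have "inv A -` S = A ` S"
    using bij_vimage_eq_inv_image[OF lor_bij[OF lor_inv[OF assms(1)]]] inv_inv_eq[OF lor_bij[OF assms(1)]] by simp
  ultimately show ?thesis by simp
qed

lemma cone_lor: assumes "lor A" shows "lcone (A ` S) = A ` lcone S"
proof -
  have n: "nrm (A y) = A (nrm y)" for y using assms by (simp add: nrm_def lor_lorentz lor_simps)
  have t: "lorentz y y < 0 \<Longrightarrow> A y $ None > 0 \<longleftrightarrow> y $ None > 0" for y
  proof -
    assume y: "lorentz y y < 0"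
    have *: "A y $ None > 0" if "lorentz y y < 0" "y $ None > 0" "lor A" for A and y :: "'a mink"
    proof -
      have "nrm y \<in> hyp" using that nrm_hyp by blast
      then have "A (nrm y) $ None > 0" using that(3) by (simp add: lor_hyp hyp_pos)
      then show ?thesis using that by (simp add: nrm_def lor_simps zero_less_mult_iff zero_less_divide_iff)
    qed
    have "lorentz (A y) (A y) < 0" using y assms by (simp add: lor_lorentz)
    then show ?thesis using *[of y A] *[of "A y" "inv A"] lor_inv[OF assms] lor_inv_simps[OF assms] assms y by metis
  qed
  show ?thesis
  proof (intro equalityI subsetI)
    fix y assume y: "y \<in> lcone (A ` S)"
    define z where "z = inv A y"
    have yz: "y = A z" using lor_inv_simps(1)[OF assms] by (simp add: z_def)
    have "nrm z \<in> S" using y inj_image_mem_iff[OF lor_inj[OF assms]] by (simp add: yz lcone_def n)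
    then have "z \<in> lcone S" using y t[of z] assms by (simp add: yz lcone_def lor_lorentz)
    then show "y \<in> A ` lcone S" using yz by blast
  qed (use t assms in \<open>auto simp: lcone_def n lor_lorentz\<close>)
qed

text \<open>\<open>lcone\<close> commutes with \<open>A\<close>, Lebesgue measure is invariant under
  \<open>A\<close>, and the positive finite constant of \<open>cone_volume\<close> cancels.\<close>

lemma hyp_volume_lor:
  fixes A :: "'n::{finite,wellorder} mink \<Rightarrow> 'n mink"
  assumes "lor A" "S \<in> sets borel" "S \<subseteq> hyp"
  shows "emeasure hyp_volume (A ` S) = emeasure hyp_volume S"
proof -
  let ?c = "\<integral>\<^sup>+t. ennreal (t ^ CARD('n)) * indicator {0..1::real} t \<partial>lborel"
  have mA: "A \<in> borel \<rightarrow>\<^sub>M borel" using lor_continuous[OF assms(1)] by (rule borel_measurable_continuous_onI)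
  have "?c * emeasure hyp_volume (A ` S) = emeasure lborel (lcone (A ` S))"
    using assms by (intro cone_volume[symmetric] lor_image_borel) (auto simp: lor_hyp)
  also have "\<dots> = emeasure (distr lborel borel A) (A ` lcone S)"
    by (simp add: cone_lor[OF assms(1)] lborel_lor[OF assms(1)])
  also have "\<dots> = emeasure lborel (A -` (A ` lcone S))"
    using mA assms by (subst emeasure_distr) (auto intro!: lor_image_borel cone_measurable)
  also have "A -` (A ` lcone S) = lcone S" using lor_inj[OF assms(1)] by (simp add: inj_vimage_image_eq)
  also have "emeasure lborel (lcone S) = ?c * emeasure hyp_volume S"
    using assms by (intro cone_volume)
  finally show ?thesis using cone_constant[of "CARD('n)"] by (simp add: ennreal_mult_cancel_left)
qed

section \<open>Quotients of hyperbolic space\<close>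

lemma hyp_closed: "closed (hyp :: 'n::finite mink set)"
proof -
  have eq: "(hyp :: 'n mink set) = {x. lorentz x x = -1} \<inter> {x. x $ None \<ge> 0}"
  proof (intro equalityI subsetI)
    fix x :: "'n mink" assume x: "x \<in> {x. lorentz x x = -1} \<inter> {x. x $ None \<ge> 0}"
    then have "x $ None \<noteq> 0" using inner_ge_zero[of "sp x"] by (auto simp: lorentz_sp simp del: inner_ge_zero)
    then show "x \<in> hyp" using x by (simp add: hyp_def)
  qed (auto simp: hyp_def)
  have 1: "closed {x::'n mink. lorentz x x = -1}" by (intro closed_Collect_eq continuous_intros)
  have 2: "closed {x::'n mink. x $ None \<ge> 0}" by (intro closed_Collect_le continuous_intros)
  show ?thesis unfolding eq by (rule closed_Int[OF 1 2])
qed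

lemma hyp_borel: "hyp \<in> sets borel"
  by (rule borel_closed[OF hyp_closed])

lemma openin_hyp_borel: "openin (top_of_set hyp) U \<Longrightarrow> U \<in> sets borel"
  unfolding openin_open using hyp_borel by auto

lemma hyp_connected: "connected (hyp :: 'n::finite mink set)"
proof -
  have "hyp = range (\<lambda>u :: real ^ 'n. mvec (sqrt (1 + u \<bullet> u)) u)"
  proof (intro equalityI subsetI)
    fix x :: "'n mink" assume x: "x \<in> hyp"
    then have "sqrt (1 + sp x \<bullet> sp x) = x $ None" by (intro real_sqrt_unique) (auto simp: hyp_iff)
    then have "x = mvec (sqrt (1 + sp x \<bullet> sp x)) (sp x)" by simp
    then show "x \<in> range (\<lambda>u :: real ^ 'n. mvec (sqrt (1 + u \<bullet> u)) u)" by blast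
  next
    fix x :: "'n mink" assume "x \<in> range (\<lambda>u :: real ^ 'n. mvec (sqrt (1 + u \<bullet> u)) u)"
    then show "x \<in> hyp" by (auto simp: hyp_iff add_pos_nonneg)
  qed
  moreover have "continuous_on UNIV (\<lambda>u :: real ^ 'n. mvec (sqrt (1 + u \<bullet> u)) u)"
    using continuous_on_compose2[OF continuous_mvec, of UNIV "\<lambda>u. (sqrt (1 + u \<bullet> u), u)"]
    by (simp add: continuous_intros)
  ultimately show ?thesis using connected_continuous_image[OF _ connected_UNIV] by fastforce
qed

text \<open>Discreteness is stated at the base point only; \<open>disc2\<close> spreads it to all
  points by the triangle inequality. Together with \<open>free\<close> it makes the projection
  \<open>q\<close> injective on small balls.\<close>

locale disc_group =
  fixes G :: "('n::{finite,wellorder} mink \<Rightarrow> 'n mink) set"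
  assumes lorG: "A \<in> G \<Longrightarrow> lor A"
    and id_G: "id \<in> G"
    and comp_G: "A \<in> G \<Longrightarrow> B \<in> G \<Longrightarrow> A \<circ> B \<in> G"
    and inv_G: "A \<in> G \<Longrightarrow> inv A \<in> G"
    and disc: "finite {A \<in> G. - lorentz e0 (A e0) \<le> C}"
    and free: "A \<in> G \<Longrightarrow> x \<in> hyp \<Longrightarrow> A x = x \<Longrightarrow> A = id"
begin

text \<open>Orbits carry the tag 0 so that in dimension four they have the type
  \<open>mfd4_point\<close>.\<close>

definition q :: "'n mink \<Rightarrow> (nat \<times> 'n mink) set" where
  "q x = {(0, A x) | A. A \<in> G}"

definition Y :: "(nat \<times> 'n mink) set topology" where
  "Y = topology (\<lambda>U. U \<subseteq> q ` hyp \<and> openin (top_of_set hyp) (hyp \<inter> q -` U))"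

definition charts :: "((nat \<times> 'n mink) set, 'n) hchart set" where
  "charts = {(q ` hball c r, inv_into (hball c r) q) | c r. c \<in> hyp \<and> r > 0 \<and> inj_on q (hball c r)}"

lemma q_eq: "q x = q y \<longleftrightarrow> (\<exists>A\<in>G. y = A x)"
proof
  assume "q x = q y"
  moreover have "(0, y) \<in> q y" unfolding q_def using id_G by (auto intro!: exI[of _ id])
  ultimately have "(0, y) \<in> q x" by simp
  then show "\<exists>A\<in>G. y = A x" by (auto simp: q_def)
next
  assume "\<exists>A\<in>G. y = A x"
  then obtain A where A: "A \<in> G" "y = A x" by blast
  show "q x = q y"
  proof (intro equalityI subsetI)
    fix p assume "p \<in> q x"
    then obtain B where B: "B \<in> G" "p = (0, B x)" by (auto simp: q_def)
    have "B x = (B \<circ> inv A) y" using A lor_inv_simps(2)[OF lorG] by simp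
    then show "p \<in> q y" unfolding q_def using B A comp_G inv_G by blast
  next
    fix p assume "p \<in> q y"
    then obtain B where B: "B \<in> G" "p = (0, B y)" by (auto simp: q_def)
    then have "p = (0, (B \<circ> A) x)" using A by simp
    then show "p \<in> q x" unfolding q_def using B A comp_G by blast
  qed
qed

lemma openin_Y: "openin Y U \<longleftrightarrow> U \<subseteq> q ` hyp \<and> openin (top_of_set hyp) (hyp \<inter> q -` U)"
proof -
  have "istopology (\<lambda>U. U \<subseteq> q ` hyp \<and> openin (top_of_set hyp) (hyp \<inter> q -` U))"
    unfolding istopology_def
  proof (intro conjI allI impI)
    fix S T assume a: "S \<subseteq> q ` hyp \<and> openin (top_of_set hyp) (hyp \<inter> q -` S)"
      "T \<subseteq> q ` hyp \<and> openin (top_of_set hyp) (hyp \<inter> q -` T)"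
    have "hyp \<inter> q -` (S \<inter> T) = (hyp \<inter> q -` S) \<inter> (hyp \<inter> q -` T)" by auto
    then show "openin (top_of_set hyp) (hyp \<inter> q -` (S \<inter> T))" using a by (simp add: openin_Int)
    show "S \<inter> T \<subseteq> q ` hyp" using a by blast
  next
    fix K assume a: "\<forall>S\<in>K. S \<subseteq> q ` hyp \<and> openin (top_of_set hyp) (hyp \<inter> q -` S)"
    have "hyp \<inter> q -` (\<Union>K) = \<Union>((\<lambda>S. hyp \<inter> q -` S) ` K)" by auto
    show "openin (top_of_set hyp) (hyp \<inter> q -` (\<Union>K))"
      unfolding \<open>hyp \<inter> q -` (\<Union>K) = _\<close> by (rule openin_Union) (use a in blast)
    show "\<Union>K \<subseteq> q ` hyp" using a by blast
  qed
  then show ?thesis unfolding Y_def by (simp add: topology_inverse')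
qed

lemma topspace_Y [simp]: "topspace Y = q ` hyp"
proof -
  have "openin Y (q ` hyp)"
  proof -
    have "hyp \<inter> q -` q ` hyp = hyp" by auto
    then show ?thesis unfolding openin_Y by simp
  qed
  then show ?thesis unfolding topspace_def using openin_Y by blast
qed

lemma q_cont: "continuous_map (top_of_set hyp) Y q"
  unfolding continuous_map_def
proof (intro conjI allI impI)
  fix U assume "openin Y U"
  then have "openin (top_of_set hyp) (hyp \<inter> q -` U)" by (simp add: openin_Y)
  moreover have "{x \<in> topspace (top_of_set hyp). q x \<in> U} = hyp \<inter> q -` U" by auto
  ultimately show "openin (top_of_set hyp) {x \<in> topspace (top_of_set hyp). q x \<in> U}" by simp
qed auto

lemma q_open: "openin (top_of_set hyp) U \<Longrightarrow> openin Y (q ` U)"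
proof -
  assume U: "openin (top_of_set hyp) U"
  have s: "U \<subseteq> hyp" using openin_imp_subset[OF U] .
  have "hyp \<inter> q -` (q ` U) = (\<Union>A\<in>G. A ` U)"
  proof (intro equalityI subsetI)
    fix x assume "x \<in> hyp \<inter> q -` (q ` U)"
    then obtain u where u: "u \<in> U" "q u = q x" by auto
    then obtain A where "A \<in> G" "x = A u" using q_eq by metis
    then show "x \<in> (\<Union>A\<in>G. A ` U)" using u by blast
  next
    fix x assume "x \<in> (\<Union>A\<in>G. A ` U)"
    then obtain A u where u: "A \<in> G" "u \<in> U" "x = A u" by auto
    then have "q u = q x" using q_eq by blast
    moreover have "x \<in> hyp" using u s lor_hyp[OF lorG] by blast
    ultimately show "x \<in> hyp \<inter> q -` (q ` U)" using u by (metis IntI image_eqI vimageI)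
  qed
  moreover have "openin (top_of_set hyp) (\<Union>A\<in>G. A ` U)"
    using lor_openin[OF lorG U] by (intro openin_Union) auto
  ultimately show ?thesis unfolding openin_Y using s by auto
qed

lemma disc2:
  assumes "x \<in> hyp" "y \<in> hyp"
  shows "finite {A \<in> G. hdist x (A y) \<le> C}"
proof (cases "C \<ge> 0")
  case True
  define D where "D = hdist e0 x + C + hdist y e0"
  have D: "D \<ge> 0" using True assms by (simp add: D_def hdist_nonneg)
  have "{A \<in> G. hdist x (A y) \<le> C} \<subseteq> {A \<in> G. - lorentz e0 (A e0) \<le> cosh D}"
  proof (intro subsetI CollectI conjI; elim CollectE conjE)
    fix A assume A: "A \<in> G" "hdist x (A y) \<le> C"
    have h: "A y \<in> hyp" "A e0 \<in> hyp" using lor_hyp[OF lorG[OF A(1)]] assms by auto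
    have "hdist e0 (A e0) \<le> hdist e0 x + (hdist x (A y) + hdist (A y) (A e0))"
      using hdist_triangle[of e0 x "A e0"] hdist_triangle[of x "A y" "A e0"] h assms by auto
    also have "\<dots> \<le> D" using A(2) by (simp add: D_def hdist_lor[OF lorG[OF A(1)]])
    finally show "- lorentz e0 (A e0) \<le> cosh D" using hdist_le_iff[OF e0_hyp h(2) D] by simp
  qed
  then show ?thesis using finite_subset[OF _ disc[of "cosh D"]] by blast
next
  case False
  have "{A \<in> G. hdist x (A y) \<le> C} = {}"
    using False hdist_nonneg[OF assms(1) lor_hyp[OF lorG assms(2)]] by force
  then show ?thesis by (metis finite.emptyI)
qed

lemma inj_ball: assumes x: "x \<in> hyp" obtains r where "r > 0" "inj_on q (hball x r)"
proof -
  define F where "F = {A \<in> G. hdist x (A x) \<le> 1} - {id}"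
  \<comment> \<open>The value 1 covers an empty \<open>F\<close> as well as the nontrivial elements
    outside \<open>F\<close>, which move \<open>x\<close> by more than 1.\<close>
  define e where "e = Min (insert 1 ((\<lambda>A. hdist x (A x)) ` F))"
  have fin: "finite F" using disc2[OF x x] by (simp add: F_def)
  have pos: "hdist x (A x) > 0" if "A \<in> F" for A
  proof -
    have A: "A \<in> G" "A \<noteq> id" using that by (auto simp: F_def)
    have "A x \<noteq> x" using free[OF A(1) x] A by blast
    moreover have "A x \<in> hyp" using lor_hyp[OF lorG[OF A(1)] x] .
    ultimately have "lorentz x (A x) \<noteq> -1" using hyp_eq_iff x by metis
    then have "hdist x (A x) \<noteq> hdist x x" using hdist_eq_iff[of x "A x" x x] x \<open>A x \<in> hyp\<close> by (simp add: hyp_self)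
    then show ?thesis using hdist_nonneg[OF x \<open>A x \<in> hyp\<close>] x by simp
  qed
  have e: "e > 0" unfolding e_def using fin pos by (subst Min_gr_iff) auto
  have "inj_on q (hball x (e/2))"
  proof (rule inj_onI)
    fix y z assume yz: "y \<in> hball x (e/2)" "z \<in> hball x (e/2)" "q y = q z"
    then obtain A where A: "A \<in> G" "z = A y" using q_eq by blast
    have h: "y \<in> hyp" "z \<in> hyp" "A x \<in> hyp" using yz lor_hyp[OF lorG[OF A(1)] x] by (auto simp: hball_def)
    have "hdist x (A x) \<le> hdist x z + hdist z (A x)" using hdist_triangle[OF x h(2,3)] .
    also have "hdist z (A x) = hdist x y" using A hdist_lor[OF lorG[OF A(1)], of y x] by (simp add: hdist_sym)
    also have "hdist x z + hdist x y < e" using yz by (auto simp: hball_def)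
    finally have l: "hdist x (A x) < e" .
    have "A = id"
    proof (rule ccontr)
      assume "A \<noteq> id"
      have "e \<le> 1" unfolding e_def using fin by (intro Min_le) auto
      then have "A \<in> F" using A l \<open>A \<noteq> id\<close> by (auto simp: F_def)
      then have "e \<le> hdist x (A x)" unfolding e_def using fin by (intro Min_le) auto
      then show False using l by simp
    qed
    then show "y = z" using A by simp
  qed
  then show ?thesis using that[of "e/2"] e by simp
qed

lemma chartE:
  assumes "(U, \<phi>) \<in> charts"
  obtains c r where "c \<in> hyp" "r > 0" "inj_on q (hball c r)" "U = q ` hball c r" "\<phi> = inv_into (hball c r) q"
    "\<And>x. x \<in> hball c r \<Longrightarrow> \<phi> (q x) = x" "\<phi> ` U = hball c r"
  using assms unfolding charts_def by (force simp: inv_into_image_cancel)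

lemma charts_chart: assumes "ch \<in> charts" shows "hyp_chart Y ch"
proof -
  obtain U \<phi> where ch: "ch = (U, \<phi>)" by (cases ch)
  obtain c r where c: "c \<in> hyp" "r > 0" "inj_on q (hball c r)" "U = q ` hball c r"
    "\<And>x. x \<in> hball c r \<Longrightarrow> \<phi> (q x) = x" "\<phi> ` U = hball c r"
    using chartE[of U \<phi>] assms ch by metis
  have bo: "openin (top_of_set hyp) (hball c r)" by (rule hball_open[OF c(1)])
  have bs: "hball c r \<subseteq> hyp" by (auto simp: hball_def)
  have Uo: "openin Y U" unfolding c(4) by (rule q_open[OF bo])
  have "homeomorphic_maps (subtopology Y U) (top_of_set (hball c r)) \<phi> q"
    unfolding homeomorphic_maps_def
  proof (intro conjI ballI)
    show "continuous_map (subtopology Y U) (top_of_set (hball c r)) \<phi>"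
      unfolding continuous_map_def
    proof (intro conjI allI impI)
      show "\<phi> \<in> topspace (subtopology Y U) \<rightarrow> topspace (top_of_set (hball c r))"
        using c by auto
      fix W assume W: "openin (top_of_set (hball c r)) W"
      have Ws: "W \<subseteq> hball c r" using openin_imp_subset[OF W] .
      have "{p \<in> topspace (subtopology Y U). \<phi> p \<in> W} = q ` W"
        using c(4,5) Ws bs by auto
      moreover have "openin Y (q ` W)" by (rule q_open[OF openin_trans[OF W bo]])
      moreover have "q ` W \<subseteq> U" using Ws c by blast
      ultimately show "openin (subtopology Y U) {p \<in> topspace (subtopology Y U). \<phi> p \<in> W}"
        unfolding openin_subtopology by blast
    qed
    show "continuous_map (top_of_set (hball c r)) (subtopology Y U) q"
      using continuous_map_from_subtopology[OF q_cont, of "hball c r"] bs c(4)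
      by (auto simp: continuous_map_in_subtopology subtopology_subtopology Int_absorb1)
    show "q (\<phi> y) = y" if "y \<in> topspace (subtopology Y U)" for y using that c by auto
    show "\<phi> (q y) = y" if "y \<in> topspace (top_of_set (hball c r))" for y using that c by auto
  qed
  then show ?thesis unfolding hyp_chart_def ch using Uo bo c(6) homeomorphic_maps_imp_map by fastforce
qed

text \<open>The set \<open>P\<close> of admissible transition maps is a parameter because the lemma
  serves both the atlas and the orientation.\<close>

lemma charts_compat:
  assumes "ch \<in> charts" "ch' \<in> charts" "\<And>A. A \<in> G \<Longrightarrow> A \<in> P"
  shows "compatible_via P Y ch ch'"
proof -
  obtain U \<phi> where ch: "ch = (U, \<phi>)" by (cases ch)
  obtain V \<psi> where ch': "ch' = (V, \<psi>)" by (cases ch')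
  obtain c r where c: "c \<in> hyp" "U = q ` hball c r"
    "\<And>x. x \<in> hball c r \<Longrightarrow> \<phi> (q x) = x" "\<phi> ` U = hball c r"
    using chartE[of U \<phi>] assms ch by metis
  obtain c' r' where c': "c' \<in> hyp" "V = q ` hball c' r'"
    "\<And>x. x \<in> hball c' r' \<Longrightarrow> \<psi> (q x) = x" "\<psi> ` V = hball c' r'"
    using chartE[of V \<psi>] assms ch' by metis
  have "\<exists>g\<in>P. \<exists>N. openin Y N \<and> p \<in> N \<and> N \<subseteq> U \<inter> V \<and> (\<forall>y\<in>N. \<psi> y = g (\<phi> y))" if p: "p \<in> U \<inter> V" for p
  proof -
    obtain x where x: "x \<in> hball c r" "p = q x" using p c by auto
    obtain y where y: "y \<in> hball c' r'" "p = q y" using p c' by auto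
    obtain A where A: "A \<in> G" "y = A x" using x y q_eq by metis
    define W where "W = hball c r \<inter> inv A ` hball c' r'"
    have W: "z \<in> hball c r \<and> A z \<in> hball c' r'" if "z \<in> W" for z
      using that lor_inv_simps[OF lorG[OF A(1)]] by (auto simp: W_def)
    have Wo: "openin (top_of_set hyp) W" unfolding W_def
      by (intro openin_Int hball_open lor_openin c c' lorG inv_G A)
    have xW: "x \<in> W" unfolding W_def using x y A lor_inv_simps(2)[OF lorG[OF A(1)]] by (metis IntI image_eqI)
    have qA: "q z = q (A z)" for z using q_eq A by blast
    have "\<psi> s = A (\<phi> s)" if "s \<in> q ` W" for s
    proof -
      obtain z where z: "z \<in> W" "s = q z" using \<open>s \<in> q ` W\<close> by blast
      then show ?thesis using c(3)[of z] c'(3)[of "A z"] W[OF z(1)] qA[of z] by simp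
    qed
    moreover have "q ` W \<subseteq> U \<inter> V"
    proof
      fix s assume "s \<in> q ` W"
      then obtain z where z: "z \<in> W" "s = q z" by blast
      have "q z \<in> U" "q (A z) \<in> V" using W[OF z(1)] c(2) c'(2) by blast+
      then show "s \<in> U \<inter> V" using z qA[of z] by simp
    qed
    moreover have "openin Y (q ` W)" by (rule q_open[OF Wo])
    moreover have "p \<in> q ` W" using x xW by blast
    ultimately show ?thesis using assms(3)[OF A(1)] by blast
  qed
  then show ?thesis unfolding compatible_via_def ch ch' by auto
qed

lemma lor_isometry: "lor A \<Longrightarrow> hyp_isometry A"
  unfolding hyp_isometry_def bij_betw_def
  using lor_image_hyp lor_inj hdist_lor by (metis inj_on_subset subset_UNIV)

lemma charts_atlas: "hyp_atlas Y charts"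
  unfolding hyp_atlas_def
proof (intro conjI ballI)
  show "(\<Union>c\<in>charts. fst c) = topspace Y"
  proof (intro equalityI subsetI)
    fix p assume "p \<in> topspace Y"
    then obtain x where x: "x \<in> hyp" "p = q x" by auto
    obtain r where r: "r > 0" "inj_on q (hball x r)" using inj_ball[OF x(1)] .
    then have "(q ` hball x r, inv_into (hball x r) q) \<in> charts" using x by (auto simp: charts_def)
    moreover have "p \<in> q ` hball x r" using x r by (auto simp: hball_def)
    ultimately show "p \<in> (\<Union>c\<in>charts. fst c)" by force
  qed (auto simp: charts_def hball_def)
  show "compatible_via {g. hyp_isometry g} Y c c'" if "c \<in> charts" "c' \<in> charts" for c c'
    using that by (rule charts_compat) (use lor_isometry lorG in blast)
qed (rule charts_chart)

lemma Hausdorff_Y: "Hausdorff_space Y"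
  unfolding Hausdorff_space_def
proof (intro allI impI; elim conjE)
  fix p p' assume p: "p \<in> topspace Y" "p' \<in> topspace Y" "p \<noteq> p'"
  obtain x where x: "x \<in> hyp" "p = q x" using p by auto
  obtain y where y: "y \<in> hyp" "p' = q y" using p by auto
  define F where "F = {A \<in> G. hdist x (A y) \<le> 1}"
  define e where "e = Min (insert 1 ((\<lambda>A. hdist x (A y)) ` F))"
  have fin: "finite F" using disc2[OF x(1) y(1)] by (simp add: F_def)
  have pos: "hdist x (A y) > 0" if "A \<in> G" for A
  proof -
    have "A y \<in> hyp" using lor_hyp[OF lorG[OF that] y(1)] .
    moreover have "A y \<noteq> x" using q_eq[of y x] that x y p by auto
    ultimately have "lorentz x (A y) \<noteq> -1" using hyp_eq_iff x by metis
    then have "hdist x (A y) \<noteq> hdist x x" using hdist_eq_iff[of x "A y" x x] x \<open>A y \<in> hyp\<close> by (simp add: hyp_self)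
    then show ?thesis using hdist_nonneg[OF x(1) \<open>A y \<in> hyp\<close>] x by simp
  qed
  have e: "e > 0" unfolding e_def using fin pos by (subst Min_gr_iff) (auto simp: F_def)
  have e2: "e \<le> hdist x (A y)" if "A \<in> G" for A
  proof (cases "A \<in> F")
    case True then show ?thesis unfolding e_def using fin by (intro Min_le) auto
  next
    case False
    have "e \<le> 1" unfolding e_def using fin by (intro Min_le) auto
    then show ?thesis using False that by (simp add: F_def)
  qed
  have "disjnt (q ` hball x (e/2)) (q ` hball y (e/2))"
    unfolding disjnt_iff
  proof (intro allI notI; elim conjE)
    fix s assume s: "s \<in> q ` hball x (e/2)" "s \<in> q ` hball y (e/2)"
    obtain z where z: "z \<in> hball x (e/2)" "s = q z" using s by auto
    obtain w where w: "w \<in> hball y (e/2)" "s = q w" using s by auto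
    obtain A where A: "A \<in> G" "z = A w" using q_eq z w by metis
    have h: "z \<in> hyp" "A y \<in> hyp" using z lor_hyp[OF lorG[OF A(1)] y(1)] by (auto simp: hball_def)
    have "hdist x (A y) \<le> hdist x z + hdist z (A y)" using hdist_triangle[OF x(1) h] .
    also have "hdist z (A y) = hdist y w" using A hdist_lor[OF lorG[OF A(1)], of w y] by (simp add: hdist_sym)
    also have "hdist x z + hdist y w < e" using z w by (auto simp: hball_def)
    finally show False using e2[OF A(1)] by simp
  qed
  moreover have "openin Y (q ` hball x (e/2))" "openin Y (q ` hball y (e/2))"
    using q_open hball_open x y by auto
  moreover have "p \<in> q ` hball x (e/2)" "p' \<in> q ` hball y (e/2)" using x y e by (auto simp: hball_def)
  ultimately show "\<exists>U V. openin Y U \<and> openin Y V \<and> p \<in> U \<and> p' \<in> V \<and> disjnt U V" by blast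
qed

lemma second_countable_Y: "second_countable Y"
proof (rule second_countable_open_map_image[OF q_cont])
  show "open_map (top_of_set hyp) Y q" unfolding open_map_def using q_open by blast
  show "second_countable (top_of_set (hyp :: 'n mink set))"
  proof -
    obtain B where B: "countable B" "\<And>C. C \<in> B \<Longrightarrow> openin (top_of_set (hyp :: 'n mink set)) C"
      "\<And>T. openin (top_of_set (hyp :: 'n mink set)) T \<Longrightarrow> \<exists>\<U>. \<U> \<subseteq> B \<and> T = \<Union>\<U>"
      using subset_second_countable[of hyp] by metis
    then show ?thesis unfolding second_countable_def by (intro exI[of _ B]) blast
  qed
qed auto

lemma manifold_Y: "hyp_manifold Y charts"
  unfolding hyp_manifold_def using Hausdorff_Y second_countable_Y charts_atlas by blast

lemma connected_Y: "connected_space Y"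
proof -
  have "connectedin (top_of_set hyp) (hyp :: 'n mink set)"
    using hyp_connected by (simp add: connectedin_subtopology)
  from connectedin_continuous_map_image[OF q_cont this] show ?thesis
    using connectedin_topspace[of Y] by simp
qed

lemma orientable_Y: assumes "\<And>A. A \<in> G \<Longrightarrow> ldet A = 1" shows "hyp_orientable Y charts"
proof -
  have "hyp_orient_isometry A" if "A \<in> G" for A
    unfolding hyp_orient_isometry_def
    using lor_isometry[OF lorG[OF that]] ldet_pos_matrix[OF lorG[OF that] assms[OF that]] by blast
  then have "\<forall>c\<in>charts. \<forall>c'\<in>charts. compatible_via {g. hyp_orient_isometry g} Y c c'"
    using charts_compat by auto
  then show ?thesis unfolding hyp_orientable_def using charts_atlas by (intro exI[of _ charts]) auto
qed

text \<open>A segment lies in a ball on which \<open>q\<close> is injective, and an element of the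
  group moves its lift to the endpoint already reached. Hence close points of the quotient have
  close lifts, which is what completeness uses.\<close>

lemma broken_geodesic_lift:
  assumes "broken_geodesic Y charts p p' l"
  shows "\<forall>x\<in>hyp. q x = p \<longrightarrow> (\<exists>y\<in>hyp. q y = p' \<and> hdist x y \<le> l)"
  using assms
proof (induction rule: broken_geodesic.induct)
  case (refl p)
  then show ?case by fastforce
next
  case (step p p' l U \<phi> p'' c \<rho>)
  show ?case
  proof (intro ballI impI)
    fix x assume x: "x \<in> hyp" "q x = p"
    then obtain y where y: "y \<in> hyp" "q y = p'" "hdist x y \<le> l" using step by blast
    obtain b r where b: "b \<in> hyp" "U = q ` hball b r" "\<And>x. x \<in> hball b r \<Longrightarrow> \<phi> (q x) = x"
      using chartE[OF step(2)] by metis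
    obtain z z' where z: "z \<in> hball b r" "p' = q z" "z' \<in> hball b r" "p'' = q z'" using step b by auto
    obtain A where A: "A \<in> G" "y = A z" using y z q_eq by metis
    have h: "z' \<in> hyp" "A z' \<in> hyp" using z lor_hyp[OF lorG[OF A(1)]] by (auto simp: hball_def)
    have "q (A z') = p''" using q_eq A z by metis
    moreover have "hdist x (A z') \<le> hdist x y + hdist y (A z')" using hdist_triangle x y h by blast
    moreover have "hdist y (A z') = hdist (\<phi> p') (\<phi> p'')" using A z b hdist_lor[OF lorG[OF A(1)]] by simp
    ultimately show "\<exists>y\<in>hyp. q y = p'' \<and> hdist x y \<le> l + hdist (\<phi> p') (\<phi> p'')" using h y by force
  qed
qed

lemma mfd_dist_lift:
  assumes "mfd_dist Y charts (q x) p < ennreal e" "x \<in> hyp"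
  obtains y where "y \<in> hyp" "q y = p" "hdist x y < e"
proof -
  obtain l where l: "broken_geodesic Y charts (q x) p l" "ennreal l < ennreal e"
    using assms(1) unfolding mfd_dist_def INF_less_iff by auto
  obtain y where y: "y \<in> hyp" "q y = p" "hdist x y \<le> l" using broken_geodesic_lift[OF l(1)] assms by blast
  then have "0 \<le> l" using hdist_nonneg[OF assms(2) y(1)] by simp
  then have "l < e" using l(2) by (simp add: ennreal_less_iff)
  then show ?thesis using that y by simp
qed

lemma complete_Y: "hyp_complete Y charts"
  unfolding hyp_complete_def
proof (intro allI impI)
  fix s :: "nat \<Rightarrow> (nat \<times> 'n mink) set"
  assume rs: "range s \<subseteq> topspace Y" and C: "\<forall>e>0. \<exists>n. \<forall>i\<ge>n. \<forall>j\<ge>n. mfd_dist Y charts (s i) (s j) < e"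
  \<comment> \<open>From this index on all points are within distance 1 of \<open>s N\<close>, so
    they lift to one compact ball; a convergent subsequence of the lifts supplies the limit.\<close>
  obtain N where N: "\<And>i j. i \<ge> N \<Longrightarrow> j \<ge> N \<Longrightarrow> mfd_dist Y charts (s i) (s j) < ennreal 1"
    using C[rule_format, of "ennreal 1"] by auto
  obtain x0 where x0: "x0 \<in> hyp" "s N = q x0" using subsetD[OF rs, of "s N"] by auto
  have "\<exists>y. y \<in> hyp \<and> q y = s (N + i) \<and> hdist x0 y < 1" for i
    using mfd_dist_lift[of x0 "s (N + i)" 1] N[of N "N + i"] x0 by (metis le_add1 order_refl)
  then obtain y where y: "\<And>i. y i \<in> hyp" "\<And>i. q (y i) = s (N + i)" "\<And>i. hdist x0 (y i) < 1" by metis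
  have yK: "\<forall>i. y i \<in> {z \<in> hyp. - lorentz x0 z \<le> cosh 1}"
    using y x0 hdist_le_iff[OF x0(1), of "y _" 1] by (simp add: less_imp_le)
  obtain l r where l: "l \<in> {z \<in> hyp. - lorentz x0 z \<le> cosh 1}" "strict_mono (r :: nat \<Rightarrow> nat)" "(y \<circ> r) \<longlonglongrightarrow> l"
    using seq_compactE[OF compact_imp_seq_compact[OF hcball_compact[OF x0(1), of "cosh 1"]] yK] by blast
  have lh: "l \<in> hyp" using l by simp
  have ev: "\<forall>\<^sub>F j in sequentially. y (r j) \<in> hball l e" if e: "e > 0" for e
  proof -
    obtain W where W: "open W" "hball l e = hyp \<inter> W" using hball_open[OF lh, of e] unfolding openin_open by blast
    have "l \<in> W" using W lh e by (force simp: hball_def)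
    then have "\<forall>\<^sub>F j in sequentially. (y \<circ> r) j \<in> W" using topological_tendstoD[OF l(3) W(1)] by blast
    then show ?thesis by (rule eventually_mono) (use W y in auto)
  qed
  have "limitin Y s (q l) sequentially"
    unfolding limitin_def
  proof (intro conjI allI impI; (elim conjE)?)
    show "q l \<in> topspace Y" using lh by simp
    fix U assume U: "openin Y U" "q l \<in> U"
    have "openin (top_of_set hyp) (hyp \<inter> q -` U)" "l \<in> hyp \<inter> q -` U" using U lh openin_Y by auto
    then obtain e where e: "e > 0" "hball l e \<subseteq> hyp \<inter> q -` U" by (rule hball_subset_open)
    obtain M where M: "\<And>i j. i \<ge> M \<Longrightarrow> j \<ge> M \<Longrightarrow> mfd_dist Y charts (s i) (s j) < ennreal (e/2)"
      using C[rule_format, of "ennreal (e/2)"] e by auto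
    have "\<forall>\<^sub>F j in sequentially. y (r j) \<in> hball l (e/2) \<and> j \<ge> M"
      using ev[of "e/2"] e by (intro eventually_conj eventually_ge_at_top) auto
    then obtain j where j: "y (r j) \<in> hball l (e/2)" "j \<ge> M" using eventually_happens by force
    have "N + r j \<ge> M" using j(2) seq_suble[OF l(2), of j] by linarith
    have "s i \<in> U" if "i \<ge> M" for i
    proof -
      have "mfd_dist Y charts (q (y (r j))) (s i) < ennreal (e/2)" using M[OF \<open>N + r j \<ge> M\<close> that] y(2) by simp
      then obtain z where z: "z \<in> hyp" "q z = s i" "hdist (y (r j)) z < e/2" using mfd_dist_lift y(1) by metis
      have "hdist l z < e" using hdist_triangle[OF lh y(1)[of "r j"] z(1)] j(1) z(3) by (simp add: hball_def)
      then show ?thesis using e z by (force simp: hball_def)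
    qed
    then show "\<forall>\<^sub>F i in sequentially. s i \<in> U" by (auto simp: eventually_sequentially)
  qed
  then show "\<exists>p. limitin Y s p sequentially" by blast
qed

end

section \<open>Finite volume of the quotient\<close>

context disc_group
begin

lemma countable_G: "countable G"
proof -
  have "G = (\<Union>n::nat. {A \<in> G. - lorentz e0 (A e0) \<le> real n})"
    using real_arch_simple by blast
  moreover have "countable (\<Union>n::nat. {A \<in> G. - lorentz e0 (A e0) \<le> real n})"
    by (rule countable_UN) (use countable_finite[OF disc] in blast)+
  ultimately show ?thesis by simp
qed

lemma sat_eq: assumes "B \<subseteq> hyp" shows "{x \<in> hyp. q x \<in> q ` B} = (\<Union>A\<in>G. A ` B)"
proof (intro equalityI subsetI)
  fix x assume "x \<in> {x \<in> hyp. q x \<in> q ` B}"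
  then obtain u where u: "u \<in> B" "q u = q x" by auto
  then obtain A where "A \<in> G" "x = A u" using q_eq by metis
  then show "x \<in> (\<Union>A\<in>G. A ` B)" using u by blast
next
  fix x assume "x \<in> (\<Union>A\<in>G. A ` B)"
  then obtain A u where u: "A \<in> G" "u \<in> B" "x = A u" by auto
  then have "q u = q x" using q_eq by blast
  moreover have "x \<in> hyp" using u assms lor_hyp[OF lorG] by blast
  ultimately show "x \<in> {x \<in> hyp. q x \<in> q ` B}" using u by (metis (mono_tags, lifting) image_eqI mem_Collect_eq)
qed

lemma sat_borel: assumes "B \<subseteq> hyp" "B \<in> sets borel" shows "{x \<in> hyp. q x \<in> q ` B} \<in> sets borel"
  unfolding sat_eq[OF assms(1)]
  by (rule sets.countable_UN'[OF countable_G]) (use lor_image_borel lorG assms in blast)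

lemma qpre:
  assumes "S \<in> sigma_sets (topspace Y) {U. openin Y U}"
  shows "S \<subseteq> topspace Y \<and> {x \<in> hyp. q x \<in> S} \<in> sets borel"
  using assms
proof (induction rule: sigma_sets.induct)
  case (Basic a)
  then have "openin (top_of_set hyp) (hyp \<inter> q -` a)" "a \<subseteq> topspace Y" using openin_Y by auto
  moreover have "{x \<in> hyp. q x \<in> a} = hyp \<inter> q -` a" by auto
  ultimately show ?case using openin_hyp_borel by metis
next
  case (Compl a)
  have "{x \<in> hyp. q x \<in> topspace Y - a} = hyp - {x \<in> hyp. q x \<in> a}" by auto
  moreover have "hyp - {x \<in> hyp. q x \<in> a} \<in> sets borel" by (rule sets.Diff) (use hyp_borel Compl in auto)
  ultimately show ?case by auto
next
  case (Union a)
  have "{x \<in> hyp. q x \<in> \<Union>(range a)} = (\<Union>i. {x \<in> hyp. q x \<in> a i})" by auto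
  moreover have "(\<Union>i. {x \<in> hyp. q x \<in> a i}) \<in> sets borel" by (rule sets.countable_UN) (use Union in auto)
  ultimately show ?case using Union by (simp add: UN_least)
qed auto

text \<open>\<open>Q\<close> meets every orbit, possibly several times. A Borel set \<open>D\<close>
  with one representative per orbit is extracted from it, and the measure of the quotient is the
  image of the volume on \<open>D\<close>; it agrees with the charts because
  \<open>hyp_volume\<close> is invariant under the group.\<close>

lemma finite_volume_Y:
  assumes Q: "Q \<in> sets borel" "Q \<subseteq> hyp" "\<And>x. x \<in> hyp \<Longrightarrow> \<exists>A\<in>G. A x \<in> Q"
    and fin: "emeasure hyp_volume Q < \<infinity>"
  shows "hyp_finite_volume Y charts"
proof -
  define F where "F = {hball c r | c r. c \<in> hyp \<and> r > 0 \<and> inj_on q (hball c r)}"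
  have Fo: "openin (top_of_set hyp) S" "inj_on q S" if "S \<in> F" for S
    using that hball_open by (auto simp: F_def)
  obtain F' where F': "F' \<subseteq> F" "countable F'" "\<Union>F' = \<Union>F"
    using Lindelof_openin[of F hyp] Fo(1) by metis
  have "hyp \<subseteq> \<Union>F"
  proof
    fix x :: "'n mink" assume x: "x \<in> hyp"
    obtain r where "r > 0" "inj_on q (hball x r)" using inj_ball[OF x] .
    then have "hball x r \<in> F" "x \<in> hball x r" using x by (auto simp: F_def hball_def)
    then show "x \<in> \<Union>F" by blast
  qed
  then have cov: "hyp \<subseteq> \<Union>F'" using F' by simp
  moreover have "(e0 :: 'n mink) \<in> hyp" by simp
  ultimately have "F' \<noteq> {}" by blast
  define b where "b = from_nat_into F'"
  have rb: "range b = F'" unfolding b_def by (rule range_from_nat_into[OF \<open>F' \<noteq> {}\<close> F'(2)])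
  have b: "openin (top_of_set hyp) (b n)" "inj_on q (b n)" for n using Fo rb F'(1) by blast+
  have bb: "b n \<in> sets borel" "b n \<subseteq> hyp" for n using openin_hyp_borel[OF b(1)] openin_imp_subset[OF b(1)] by auto
  have bcov: "\<exists>n. x \<in> b n" if "x \<in> hyp" for x using cov that rb by blast
  define sat where "sat B = {x \<in> hyp. q x \<in> q ` B}" for B
  \<comment> \<open>The representative of an orbit is taken from the first ball \<open>b n\<close>
    whose part in \<open>Q\<close> meets the orbit; as \<open>q\<close> is injective on the ball,
    there is only one.\<close>
  define D where "D = (\<Union>n. (b n \<inter> Q) - (\<Union>m<n. sat (b m \<inter> Q)))"
  have Db: "D \<in> sets borel" unfolding D_def sat_def
    using bb Q(1,2) by (intro sets.countable_UN' sets.Diff sets.finite_UN sat_borel sets.Int image_subsetI) auto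
  have DQ: "D \<subseteq> Q" by (auto simp: D_def)
  have Dh: "D \<subseteq> hyp" using DQ Q by blast
  have D1: "\<exists>A\<in>G. A x \<in> D" if x: "x \<in> hyp" for x
  proof -
    define P where "P n \<longleftrightarrow> q x \<in> q ` (b n \<inter> Q)" for n
    obtain A where A: "A \<in> G" "A x \<in> Q" using Q(3)[OF x] by blast
    have "A x \<in> hyp" using A Q by blast
    then obtain n0 where "A x \<in> b n0" using bcov by blast
    moreover have "q x = q (A x)" using q_eq A by blast
    ultimately have "P n0" using A unfolding P_def by blast
    define n where "n = (LEAST n. P n)"
    have n: "P n" "\<And>m. m < n \<Longrightarrow> \<not> P m" unfolding n_def using LeastI[of P, OF \<open>P n0\<close>] not_less_Least by auto
    then obtain y where y: "y \<in> b n \<inter> Q" "q x = q y" by (auto simp: P_def)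
    then obtain B where B: "B \<in> G" "y = B x" using q_eq by blast
    have "y \<in> (b n \<inter> Q) - (\<Union>m<n. sat (b m \<inter> Q))" using y n(2) by (auto simp: P_def sat_def)
    then have "y \<in> D" unfolding D_def by blast
    then show ?thesis using B by blast
  qed
  have D2: "A = id" if AG: "A \<in> G" and xD: "x \<in> D" and AxD: "A x \<in> D" for A x
  proof -
    note that = AG xD AxD
    have qx: "q x = q (A x)" using q_eq AG by blast
    obtain n where n: "x \<in> b n \<inter> Q" "\<And>m. m < n \<Longrightarrow> x \<notin> sat (b m \<inter> Q)" using xD by (auto simp: D_def)
    obtain n' where n': "A x \<in> b n' \<inter> Q" "\<And>m. m < n' \<Longrightarrow> A x \<notin> sat (b m \<inter> Q)" using AxD by (auto simp: D_def)
    have h: "x \<in> hyp" "A x \<in> hyp" using that Dh by auto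
    have "A x \<in> sat (b n \<inter> Q)" unfolding sat_def using n(1) qx h by (metis (mono_tags, lifting) image_eqI mem_Collect_eq)
    moreover have "x \<in> sat (b n' \<inter> Q)" unfolding sat_def using n'(1) qx h by (metis (mono_tags, lifting) image_eqI mem_Collect_eq)
    ultimately have "n = n'" using n(2) n'(2) by (metis linorder_neqE_nat)
    then have "A x = x" using b(2)[of n] n(1) n'(1) qx unfolding inj_on_def by auto
    then show ?thesis using free that(1) h by blast
  qed
  have iA: "inv A \<in> G" "lor A" "lor (inv A)" "\<And>x. A (inv A x) = x" "\<And>x. inv A (A x) = x" if "A \<in> G" for A
    using that inv_G lorG lor_inv_simps[OF lorG[OF that]] lor_inv by auto
  \<comment> \<open>Both sides are cut into countably many pieces indexed by the group:
    \<open>A\<close> carries the piece of \<open>S\<close> in the translate of \<open>D\<close> by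
    \<open>inv A\<close> onto a piece of \<open>D\<close>.\<close>
  have vol: "emeasure hyp_volume S = emeasure hyp_volume {x \<in> D. q x \<in> q ` S}"
    if S: "S \<in> sets borel" "S \<subseteq> hyp" "inj_on q S" for S
  proof -
    have dec: "S = (\<Union>A\<in>G. S \<inter> inv A ` D)"
    proof (intro equalityI subsetI)
      fix x assume x: "x \<in> S"
      then obtain A where A: "A \<in> G" "A x \<in> D" using D1 S by blast
      then have "x \<in> inv A ` D" using iA(5)[of A x] by (metis image_eqI)
      then show "x \<in> (\<Union>A\<in>G. S \<inter> inv A ` D)" using x A by blast
    qed auto
    have dis: "disjoint_family_on (\<lambda>A. S \<inter> inv A ` D) G"
      unfolding disjoint_family_on_def
    proof (intro ballI impI)
      fix A B assume AB: "A \<in> G" "B \<in> G" "A \<noteq> B"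
      show "(S \<inter> inv A ` D) \<inter> (S \<inter> inv B ` D) = {}"
      proof (rule ccontr)
        assume "\<not> ?thesis"
        then obtain d d' where d: "d \<in> D" "d' \<in> D" "inv A d = inv B d'" by blast
        then have "(A \<circ> inv B) d' = d" using iA(4)[of A] AB by (metis comp_apply)
        then have "A \<circ> inv B = id" using D2[of "A \<circ> inv B" d'] d AB comp_G iA(1) by metis
        then have "A (inv B (B x)) = B x" for x by (auto dest: fun_cong[of _ _ "B x"])
        then have "A x = B x" for x using iA(5)[OF AB(2), of x] by metis
        then have "A = B" by blast
        then show False using AB by blast
      qed
    qed
    have dec': "{x \<in> D. q x \<in> q ` S} = (\<Union>A\<in>G. A ` S \<inter> D)"
    proof -
      have "{x \<in> D. q x \<in> q ` S} = {x \<in> hyp. q x \<in> q ` S} \<inter> D" using Dh by auto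
      then show ?thesis unfolding sat_eq[OF S(2)] by simp
    qed
    have dis': "disjoint_family_on (\<lambda>A. A ` S \<inter> D) G"
      unfolding disjoint_family_on_def
    proof (intro ballI impI)
      fix A B assume AB: "A \<in> G" "B \<in> G" "A \<noteq> B"
      show "(A ` S \<inter> D) \<inter> (B ` S \<inter> D) = {}"
      proof (rule ccontr)
        assume "\<not> ?thesis"
        then obtain s s' where s: "s \<in> S" "s' \<in> S" "A s = B s'" by blast
        then have "q s = q s'" using q_eq AB by metis
        then have "s = s'" using S(3) s unfolding inj_on_def by blast
        then have "inv B (A s) = s" using s iA(5)[OF AB(2)] by simp
        then have "inv B \<circ> A = id" using free[of "inv B \<circ> A" s] comp_G iA(1) AB s S by auto
        then have "inv B (A x) = x" for x by (auto dest: fun_cong[of _ _ x])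
        then have "A x = B x" for x using iA(4)[OF AB(2), of "A x"] by metis
        then have "A = B" by blast
        then show False using AB by blast
      qed
    qed
    have eqA: "A ` (S \<inter> inv A ` D) = A ` S \<inter> D" if "A \<in> G" for A
      unfolding image_Int[OF lor_inj[OF iA(2)[OF that]]] image_image iA(4)[OF that] image_ident ..
    have sb: "S \<inter> inv A ` D \<in> sets borel" if "A \<in> G" for A
      by (rule sets.Int[OF S(1) lor_image_borel[OF iA(3)[OF that] Db]])
    have sb': "A ` S \<inter> D \<in> sets borel" if "A \<in> G" for A
      by (rule sets.Int[OF lor_image_borel[OF iA(2)[OF that] S(1)] Db])
    have hs: "sets hyp_volume = sets borel" by (simp add: hyp_volume_def)
    have "emeasure hyp_volume S = (\<integral>\<^sup>+A. emeasure hyp_volume (S \<inter> inv A ` D) \<partial>count_space G)"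
      by (subst dec, rule emeasure_UN_countable) (use sb dis countable_G hs in auto)
    also have "\<dots> = (\<integral>\<^sup>+A. emeasure hyp_volume (A ` S \<inter> D) \<partial>count_space G)"
      by (rule nn_integral_cong) (use hyp_volume_lor[OF iA(2) sb] S(2) eqA in fastforce)
    also have "\<dots> = emeasure hyp_volume {x \<in> D. q x \<in> q ` S}"
      by (subst dec', rule emeasure_UN_countable[symmetric]) (use sb' dis' countable_G hs in auto)
    finally show ?thesis .
  qed
  define M where "M = sigma (topspace Y) {U. openin Y U}"
  have sM: "sets M = sigma_sets (topspace Y) {U. openin Y U}" "space M = topspace Y"
    unfolding M_def using openin_subset[of Y] by (auto intro!: sets_measure_of space_measure_of)
  define \<mu> where "\<mu> = distr (restrict_space hyp_volume D) M q"
  have hv: "sets hyp_volume = sets borel" "space hyp_volume = UNIV" by (simp_all add: hyp_volume_def)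
  have qm: "q \<in> restrict_space hyp_volume D \<rightarrow>\<^sub>M M"
  proof (rule measurableI)
    fix S assume "S \<in> sets M"
    then have "{x \<in> hyp. q x \<in> S} \<in> sets borel" using qpre sM by blast
    moreover have "q -` S \<inter> space (restrict_space hyp_volume D) = {x \<in> hyp. q x \<in> S} \<inter> D"
      using Dh by (auto simp: space_restrict_space hv)
    ultimately show "q -` S \<inter> space (restrict_space hyp_volume D) \<in> sets (restrict_space hyp_volume D)"
      by (auto simp: sets_restrict_space hv)
  qed (use Dh in \<open>auto simp: space_restrict_space sM\<close>)
  have em: "emeasure \<mu> S = emeasure hyp_volume {x \<in> D. q x \<in> S}" if "S \<in> sets M" for S
  proof -
    have "emeasure \<mu> S = emeasure (restrict_space hyp_volume D) (q -` S \<inter> space (restrict_space hyp_volume D))"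
      unfolding \<mu>_def by (rule emeasure_distr[OF qm that])
    also have "q -` S \<inter> space (restrict_space hyp_volume D) = {x \<in> D. q x \<in> S}"
      by (auto simp: space_restrict_space hv)
    also have "emeasure (restrict_space hyp_volume D) {x \<in> D. q x \<in> S} = emeasure hyp_volume {x \<in> D. q x \<in> S}"
      by (rule emeasure_restrict_space) (use Db in \<open>auto simp: hv\<close>)
    finally show ?thesis .
  qed
  have "is_volume Y charts \<mu>"
    unfolding is_volume_def
  proof (intro conjI ballI, simp_all only: case_prod_conv split_paired_all)
    show "space \<mu> = topspace Y" "sets \<mu> = sigma_sets (topspace Y) {U. openin Y U}" by (simp_all add: \<mu>_def sM)
    fix U \<phi> assume "(U, \<phi>) \<in> charts"
    then obtain c r where c: "c \<in> hyp" "inj_on q (hball c r)" "U = q ` hball c r"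
      "\<And>x. x \<in> hball c r \<Longrightarrow> \<phi> (q x) = x" using chartE by metis
    show "\<forall>S\<in>sets \<mu>. S \<subseteq> U \<longrightarrow> emeasure \<mu> S = emeasure hyp_volume (\<phi> ` S)"
    proof (intro ballI impI)
      fix S assume S: "S \<in> sets \<mu>" "S \<subseteq> U"
      have S': "S \<in> sets M" using S by (simp add: \<mu>_def)
      define S1 where "S1 = {x \<in> hyp. q x \<in> S} \<inter> hball c r"
      have b1: "S1 \<in> sets borel" unfolding S1_def
        using qpre S' sM openin_hyp_borel[OF hball_open[OF c(1)]] by (intro sets.Int) blast+
      have q1: "q ` S1 = S" unfolding S1_def using S(2) c(3) by (force simp: hball_def)
      have p1: "\<phi> ` S = S1" unfolding q1[symmetric] using c(4) by (force simp: S1_def)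
      have "emeasure \<mu> S = emeasure hyp_volume {x \<in> D. q x \<in> q ` S1}" using em[OF S'] q1 by simp
      also have "\<dots> = emeasure hyp_volume S1"
      proof (rule vol[OF b1, symmetric])
        show "S1 \<subseteq> hyp" "inj_on q S1" by (auto simp: S1_def intro: inj_on_subset[OF c(2)])
      qed
      finally show "emeasure \<mu> S = emeasure hyp_volume (\<phi> ` S)" using p1 by simp
    qed
  qed
  moreover have "emeasure \<mu> (topspace Y) < \<infinity>"
  proof -
    have "topspace Y \<in> sets M" using sM sets.top[of M] by simp
    then have "emeasure \<mu> (topspace Y) = emeasure hyp_volume {x \<in> D. q x \<in> topspace Y}" by (rule em)
    also have "\<dots> \<le> emeasure hyp_volume Q" using DQ Q by (intro emeasure_mono) (auto simp: hv)
    finally show ?thesis using fin by (rule order.strict_trans1)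
  qed
  ultimately show ?thesis unfolding hyp_finite_volume_def by blast
qed

end

section \<open>Right-angled polytopes and their mirrors\<close>

text \<open>The common time component \<open>s\<close> puts all walls at the same distance from
  \<open>e0\<close>. Because of it, reflection in a violated wall lowers the time component of a
  point, which is the measure of progress used below.\<close>

definition right_angled :: "'n::finite mink set \<Rightarrow> real \<Rightarrow> bool" where
  "right_angled \<N> s \<longleftrightarrow> finite \<N> \<and> s > 0 \<and> (\<forall>v\<in>\<N>. lorentz v v = 2 \<and> v $ None = s) \<and>
     (\<forall>v\<in>\<N>. \<forall>w\<in>\<N>. v \<noteq> w \<longrightarrow> lorentz v w = 0 \<or> lorentz v w \<le> -2)"

lemma right_angledD:
  assumes "right_angled \<N> s"
  shows "finite \<N>" "s > 0" "v \<in> \<N> \<Longrightarrow> lorentz v v = 2" "v \<in> \<N> \<Longrightarrow> v $ None = s"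
    "v \<in> \<N> \<Longrightarrow> w \<in> \<N> \<Longrightarrow> v \<noteq> w \<Longrightarrow> lorentz v w = 0 \<or> lorentz v w \<le> -2"
  using assms unfolding right_angled_def by blast+

text \<open>If the product of the normals is at most -2, their sum is a future causal vector and
  therefore negative on \<open>hyp\<close>.\<close>

lemma right_angled_orth:
  assumes "right_angled \<N> s" "v \<in> \<N>" "w \<in> \<N>" "v \<noteq> w" "x \<in> hyp" "lorentz v x \<ge> 0" "lorentz w x \<ge> 0"
  shows "lorentz v w = 0"
proof (rule ccontr)
  assume "lorentz v w \<noteq> 0"
  then have "lorentz v w \<le> -2" using right_angledD(5)[OF assms(1-4)] by blast
  then have "lorentz (v + w) (v + w) \<le> 0"
    using right_angledD(3)[OF assms(1)] assms(2,3) by (simp add: lorentz_sym[of w v])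
  moreover have "(v + w) $ None > 0" using right_angledD(2,4)[OF assms(1)] assms(2,3) by simp
  ultimately have "lorentz (v + w) x < 0" using causal_neg assms(5) by blast
  then show False using assms(6,7) by simp
qed

text \<open>Cauchy-Schwarz for the space components. The bound exceeds 1 and separates the centres
  of different tiles.\<close>

lemma right_angled_far:
  assumes "right_angled \<N> s" "v \<in> \<N>" "x \<in> hyp" "lorentz v x \<ge> 0"
  shows "x $ None \<ge> sqrt (1 + s\<^sup>2 / 2)"
proof -
  have v: "lorentz v v = 2" "v $ None = s" "s > 0" using right_angledD[OF assms(1)] assms(2) by auto
  have nv: "(norm (sp v))\<^sup>2 = 2 + s\<^sup>2" using v lorentz_self[of v] by simp
  have nx: "(norm (sp x))\<^sup>2 = (x $ None)\<^sup>2 - 1" using hyp_self[OF assms(3)] lorentz_self[of x] by simp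
  have "s * x $ None \<le> norm (sp v) * norm (sp x)"
    using assms(4) Cauchy_Schwarz_ineq2[of "sp v" "sp x"] v by (simp add: lorentz_sp)
  moreover have "0 \<le> s * x $ None" using v hyp_pos[OF assms(3)] by simp
  ultimately have "(s * x $ None)\<^sup>2 \<le> (norm (sp v) * norm (sp x))\<^sup>2" by (rule power_mono)
  then have "s\<^sup>2 * (x $ None)\<^sup>2 \<le> (2 + s\<^sup>2) * ((x $ None)\<^sup>2 - 1)" by (simp add: power_mult_distrib nv nx)
  then have "1 + s\<^sup>2 / 2 \<le> (x $ None)\<^sup>2" by (simp add: algebra_simps)
  then show ?thesis using hyp_pos[OF assms(3)] by (simp add: real_le_lsqrt)
qed

text \<open>Compactness in place of a volume count: along a convergent subsequence
  \<open>- lorentz\<close> of consecutive terms would tend to 1.\<close>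

lemma packing:
  fixes f :: "nat \<Rightarrow> 'n::finite mink"
  assumes "x \<in> hyp" "\<And>n. f n \<in> hyp" "\<And>n. - lorentz x (f n) \<le> C" "\<kappa> > 1"
    and sep: "\<And>m n. m < n \<Longrightarrow> - lorentz (f m) (f n) \<ge> \<kappa>"
  shows False
proof -
  have fK: "\<forall>n. f n \<in> {y \<in> hyp. - lorentz x y \<le> C}" using assms by auto
  obtain l r where l: "l \<in> {y \<in> hyp. - lorentz x y \<le> C}" "strict_mono (r :: nat \<Rightarrow> nat)" "(f \<circ> r) \<longlonglongrightarrow> l"
    using seq_compactE[OF compact_imp_seq_compact[OF hcball_compact[OF assms(1), of C]] fK] by blast
  have a: "(\<lambda>n. f (r n)) \<longlonglongrightarrow> l" using l(3) by (simp add: o_def)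
  then have b: "(\<lambda>n. f (r (Suc n))) \<longlonglongrightarrow> l" by (rule LIMSEQ_Suc)
  have "(\<lambda>n. - lorentz (f (r n)) (f (r (Suc n)))) \<longlonglongrightarrow> - lorentz l l"
    using a b by (intro tendsto_intros)
  moreover have "- lorentz (f (r n)) (f (r (Suc n))) \<ge> \<kappa>" for n
    using sep l(2) by (simp add: strict_mono_Suc_iff)
  ultimately have "- lorentz l l \<ge> \<kappa>" by (intro LIMSEQ_le_const) auto
  then show False using l(1) assms(4) by (simp add: hyp_self)
qed

text \<open>
  A tile \<open>t\<close> is a copy of the polytope. Behind its wall \<open>v\<close> lies the tile \<open>nb t v\<close>, glued by the symmetry \<open>sy t v\<close>
  of the polytope. In \<open>reach t0 t A\<close>, the isometry \<open>A\<close> carries a tile of the universal cover, namely one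
  that a path of crossings starting in \<open>t0\<close> leads to, to the standard polytope of \<open>t\<close>; \<open>zreach\<close> only crosses walls
  through the point \<open>x\<close>.
\<close>

locale mirror =
  fixes \<N> :: "'n::{finite,wellorder} mink set" and s :: real and T :: "'t set"
    and nb :: "'t \<Rightarrow> 'n mink \<Rightarrow> 't" and sy :: "'t \<Rightarrow> 'n mink \<Rightarrow> 'n mink \<Rightarrow> 'n mink"
  assumes ra: "right_angled \<N> s"
    and nbT: "t \<in> T \<Longrightarrow> v \<in> \<N> \<Longrightarrow> nb t v \<in> T"
    and sylor: "t \<in> T \<Longrightarrow> v \<in> \<N> \<Longrightarrow> lor (sy t v)"
    and syN: "t \<in> T \<Longrightarrow> v \<in> \<N> \<Longrightarrow> w \<in> \<N> \<Longrightarrow> sy t v w \<in> \<N>"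
    and sye0: "t \<in> T \<Longrightarrow> v \<in> \<N> \<Longrightarrow> sy t v e0 = e0"
    and nbinv: "t \<in> T \<Longrightarrow> v \<in> \<N> \<Longrightarrow> nb (nb t v) (sy t v v) = t"
    and syinv: "t \<in> T \<Longrightarrow> v \<in> \<N> \<Longrightarrow> sy (nb t v) (sy t v v) (sy t v x) = x"
    and nbcomm: "t \<in> T \<Longrightarrow> v \<in> \<N> \<Longrightarrow> w \<in> \<N> \<Longrightarrow> lorentz v w = 0 \<Longrightarrow>
      nb (nb t v) (sy t v w) = nb (nb t w) (sy t w v)"
    and sycomm: "t \<in> T \<Longrightarrow> v \<in> \<N> \<Longrightarrow> w \<in> \<N> \<Longrightarrow> lorentz v w = 0 \<Longrightarrow>
      sy (nb t v) (sy t v w) (sy t v x) = sy (nb t w) (sy t w v) (sy t w x)"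
begin

inductive reach :: "'t \<Rightarrow> 't \<Rightarrow> ('n mink \<Rightarrow> 'n mink) \<Rightarrow> bool" for t0 where
  start: "t0 \<in> T \<Longrightarrow> reach t0 t0 id"
| cross: "reach t0 t A \<Longrightarrow> v \<in> \<N> \<Longrightarrow> reach t0 (nb t v) (sy t v \<circ> lrefl v \<circ> A)"

inductive zreach :: "'t \<Rightarrow> 'n mink \<Rightarrow> 't \<Rightarrow> ('n mink \<Rightarrow> 'n mink) \<Rightarrow> bool" for t0 x where
  start: "t0 \<in> T \<Longrightarrow> zreach t0 x t0 id"
| cross: "zreach t0 x t A \<Longrightarrow> v \<in> \<N> \<Longrightarrow> lorentz v (A x) = 0 \<Longrightarrow>
    zreach t0 x (nb t v) (sy t v \<circ> lrefl v \<circ> A)"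

text \<open>
  Every reachable state can be folded towards \<open>x\<close>, by crossing walls that separate it from \<open>x\<close>, into a state that is
  reachable through walls containing \<open>x\<close> only. Since violated walls at one point are orthogonal, this invariant
  survives the crossing of an arbitrary wall (the diamond below), and no termination argument is needed.
\<close>

inductive folds :: "'t \<Rightarrow> 'n mink \<Rightarrow> 't \<Rightarrow> ('n mink \<Rightarrow> 'n mink) \<Rightarrow> bool" for t0 x where
  zero: "zreach t0 x t A \<Longrightarrow> folds t0 x t A"
| fold: "t \<in> T \<Longrightarrow> lor A \<Longrightarrow> v \<in> \<N> \<Longrightarrow> lorentz v (A x) > 0 \<Longrightarrow>
    folds t0 x (nb t v) (sy t v \<circ> lrefl v \<circ> A) \<Longrightarrow> folds t0 x t A"

lemma lrefl_lor: "v \<in> \<N> \<Longrightarrow> lor (lrefl v)"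
  using refl_lor right_angledD(3)[OF ra] by blast

lemma step_lor: "t \<in> T \<Longrightarrow> v \<in> \<N> \<Longrightarrow> lor A \<Longrightarrow> lor (sy t v \<circ> lrefl v \<circ> A)"
  by (intro lor_comp sylor lrefl_lor)

lemma reach_props: "reach t0 t A \<Longrightarrow> t \<in> T \<and> lor A \<and> t0 \<in> T"
proof (induction rule: reach.induct)
  case (cross t A v)
  then show ?case using nbT step_lor by blast
qed (simp add: lor_id)

lemma zreach_reach: "zreach t0 x t A \<Longrightarrow> reach t0 t A"
proof (induction rule: zreach.induct)
  case start then show ?case by (rule reach.start)
next
  case (cross t A v) then show ?case by (blast intro: reach.cross)
qed

lemma folds_props: "folds t0 x t A \<Longrightarrow> t \<in> T \<and> lor A"
  by (induction rule: folds.induct) (use zreach_reach reach_props in blast)+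

lemma sy_onto: assumes "t \<in> T" "v \<in> \<N>" "w \<in> \<N>" obtains w' where "w' \<in> \<N>" "w = sy t v w'"
proof -
  have "sy t v ` \<N> \<subseteq> \<N>" using syN assms by blast
  moreover have "inj_on (sy t v) \<N>" using lor_inj[OF sylor[OF assms(1,2)]] inj_on_subset by blast
  ultimately have "sy t v ` \<N> = \<N>" using endo_inj_surj right_angledD(1)[OF ra] by blast
  then show ?thesis using assms(3) that by blast
qed

lemma sy_hpoly: assumes "t \<in> T" "v \<in> \<N>" "x \<in> hpoly \<N>" shows "sy t v x \<in> hpoly \<N>"
  unfolding hpoly_def
proof (intro CollectI conjI ballI)
  show "sy t v x \<in> hyp" using assms lor_hyp[OF sylor] by (auto simp: hpoly_def)
  fix w assume "w \<in> \<N>"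
  then obtain w' where "w' \<in> \<N>" "w = sy t v w'" using sy_onto assms by metis
  then show "lorentz w (sy t v x) \<le> 0" using assms lor_lorentz[OF sylor] by (auto simp: hpoly_def)
qed

lemma zreach_hpoly: "zreach t0 x t A \<Longrightarrow> x \<in> hpoly \<N> \<Longrightarrow> A x \<in> hpoly \<N>"
proof (induction rule: zreach.induct)
  case (cross t A v)
  then have "t \<in> T" using zreach_reach reach_props by blast
  then show ?case using cross sy_hpoly by (simp add: refl_fix)
qed simp

lemma pos_step: "t \<in> T \<Longrightarrow> v \<in> \<N> \<Longrightarrow> lorentz v w = 0 \<Longrightarrow>
    lorentz (sy t v w) ((sy t v \<circ> lrefl v \<circ> A) x) = lorentz w (A x)"
  by (simp add: lor_lorentz[OF sylor] lrefl_def lorentz_sym[of w v])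

text \<open>Moving the second reflection through the first symmetry leaves on either side two
  symmetries after the reflections in \<open>v\<close> and \<open>w\<close>. The reflections commute
  by orthogonality, the symmetries by \<open>sycomm\<close>.\<close>

lemma step_comm:
  assumes "t \<in> T" "v \<in> \<N>" "w \<in> \<N>" "lorentz v w = 0"
  shows "sy (nb t v) (sy t v w) \<circ> lrefl (sy t v w) \<circ> (sy t v \<circ> lrefl v \<circ> A) =
    sy (nb t w) (sy t w v) \<circ> lrefl (sy t w v) \<circ> (sy t w \<circ> lrefl w \<circ> A)"
proof
  fix x
  have "lorentz w v = 0" using assms(4) by (simp add: lorentz_sym)
  then show "(sy (nb t v) (sy t v w) \<circ> lrefl (sy t v w) \<circ> (sy t v \<circ> lrefl v \<circ> A)) x =
    (sy (nb t w) (sy t w v) \<circ> lrefl (sy t w v) \<circ> (sy t w \<circ> lrefl w \<circ> A)) x"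
    by (simp add: lor_refl[OF sylor, symmetric] assms sycomm[OF assms] refl_commute[OF assms(4)])
qed

lemma step_back:
  assumes "t \<in> T" "v \<in> \<N>"
  shows "sy (nb t v) (sy t v v) \<circ> lrefl (sy t v v) \<circ> (sy t v \<circ> lrefl v \<circ> A) = A"
  by (simp add: fun_eq_iff lor_refl[OF sylor, symmetric] assms syinv refl_refl right_angledD(3)[OF ra])

text \<open>Crossing \<open>v\<close> keeps the orthogonal wall \<open>w\<close> violated, now under
  the name \<open>sy t v w\<close>. Folding there arrives where folding \<open>w\<close> first and
  crossing \<open>v\<close> afterwards arrives.\<close>

lemma diamond:
  assumes "t \<in> T" "lor A" "v \<in> \<N>" "w \<in> \<N>" "lorentz v w = 0" "lorentz w (A x) > 0"
    and "folds t0 x (nb (nb t w) (sy t w v)) (sy (nb t w) (sy t w v) \<circ> lrefl (sy t w v) \<circ> (sy t w \<circ> lrefl w \<circ> A))"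
  shows "folds t0 x (nb t v) (sy t v \<circ> lrefl v \<circ> A)"
proof (rule folds.fold[where v = "sy t v w"])
  show "folds t0 x (nb (nb t v) (sy t v w)) (sy (nb t v) (sy t v w) \<circ> lrefl (sy t v w) \<circ> (sy t v \<circ> lrefl v \<circ> A))"
    using assms nbcomm[OF assms(1,3,4,5)] step_comm[OF assms(1,3,4,5)] by metis
  show "0 < lorentz (sy t v w) ((sy t v \<circ> lrefl v \<circ> A) x)"
    using assms by (simp only: pos_step)
qed (use assms nbT syN step_lor in auto)

lemma folds_zero:
  assumes "folds t0 x t A" "x \<in> hpoly \<N>" "v \<in> \<N>" "lorentz v (A x) = 0"
  shows "folds t0 x (nb t v) (sy t v \<circ> lrefl v \<circ> A)"
  using assms
proof (induction arbitrary: v rule: folds.induct)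
  case (zero t A)
  then show ?case by (intro folds.zero zreach.cross)
next
  case (fold t A w)
  have "A x \<in> hyp" using fold lor_hyp by (auto simp: hpoly_def)
  then have vw: "lorentz v w = 0"
    using right_angled_orth[OF ra, of v w "A x"] fold by fastforce
  show ?case
  proof (rule diamond[of t A v w])
    have wv: "lorentz w v = 0" using vw by (simp add: lorentz_sym)
    show "folds t0 x (nb (nb t w) (sy t w v)) (sy (nb t w) (sy t w v) \<circ> lrefl (sy t w v) \<circ> (sy t w \<circ> lrefl w \<circ> A))"
    proof (rule fold.IH)
      show "lorentz (sy t w v) ((sy t w \<circ> lrefl w \<circ> A) x) = 0"
        unfolding pos_step[OF fold(1,3) wv] by (rule fold.prems)
    qed (use fold syN in auto)
  qed (use fold vw in auto)
qed

text \<open>Any violated wall may be folded first. A state of \<open>zreach\<close> has none;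
  otherwise a violated wall different from the one already chosen is orthogonal to it, and
  \<open>diamond\<close> exchanges the two.\<close>

lemma folds_pos:
  assumes "folds t0 x t A" "x \<in> hpoly \<N>" "v \<in> \<N>" "lorentz v (A x) > 0"
  shows "folds t0 x (nb t v) (sy t v \<circ> lrefl v \<circ> A)"
  using assms
proof (induction arbitrary: v rule: folds.induct)
  case (zero t A)
  then show ?case using zreach_hpoly[of t0 x t A] by (force simp: hpoly_def)
next
  case (fold t A w)
  show ?case
  proof (cases "v = w")
    case False
    have "A x \<in> hyp" using fold lor_hyp by (auto simp: hpoly_def)
    then have vw: "lorentz v w = 0"
      using right_angled_orth[OF ra, of v w "A x"] fold False by fastforce
    show ?thesis
    proof (rule diamond[of t A v w])
      have wv: "lorentz w v = 0" using vw by (simp add: lorentz_sym)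
      show "folds t0 x (nb (nb t w) (sy t w v)) (sy (nb t w) (sy t w v) \<circ> lrefl (sy t w v) \<circ> (sy t w \<circ> lrefl w \<circ> A))"
      proof (rule fold.IH)
        show "0 < lorentz (sy t w v) ((sy t w \<circ> lrefl w \<circ> A) x)"
          unfolding pos_step[OF fold(1,3) wv] by (rule fold.prems)
      qed (use fold syN in auto)
    qed (use fold vw in auto)
  next
    case True
    show ?thesis unfolding True by (rule fold.hyps(5))
  qed
qed

text \<open>Such a crossing creates a violated wall, and folding it undoes the crossing.\<close>

lemma folds_neg:
  assumes "folds t0 x t A" "v \<in> \<N>" "lorentz v (A x) < 0"
  shows "folds t0 x (nb t v) (sy t v \<circ> lrefl v \<circ> A)"
proof (rule folds.fold[where v = "sy t v v"])
  have t: "t \<in> T" "lor A" using folds_props assms by auto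
  show "folds t0 x (nb (nb t v) (sy t v v)) (sy (nb t v) (sy t v v) \<circ> lrefl (sy t v v) \<circ> (sy t v \<circ> lrefl v \<circ> A))"
    using assms t by (simp only: step_back nbinv)
  show "0 < lorentz (sy t v v) ((sy t v \<circ> lrefl v \<circ> A) x)"
    using assms t right_angledD(3)[OF ra assms(2)] by (simp add: lor_lorentz[OF sylor] lrefl_def)
qed (use assms folds_props[OF assms(1)] nbT syN step_lor in auto)

lemma reach_folds: "reach t0 t A \<Longrightarrow> x \<in> hpoly \<N> \<Longrightarrow> folds t0 x t A"
proof (induction rule: reach.induct)
  case start then show ?case by (intro folds.zero zreach.start)
next
  case (cross t A v)
  then show ?case using folds_zero folds_pos folds_neg by (metis linorder_neqE_linordered_idom)
qed

text \<open>The passage from global to local: an image inside the polytope violates no wall, so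
  there is nothing left to fold. Fixed points and coincidences in the quotient are thus decided by
  crossings through a single point.\<close>

lemma reach_zreach:
  assumes "reach t0 t A" "x \<in> hpoly \<N>" "A x \<in> hpoly \<N>" shows "zreach t0 x t A"
  using reach_folds[OF assms(1,2)]
proof cases
  case (fold v)
  then show ?thesis using assms(3) by (force simp: hpoly_def)
qed

lemma e0_hpoly: "e0 \<in> hpoly \<N>"
  using right_angledD(2,4)[OF ra] by (auto simp: hpoly_def)

definition \<kappa> :: real where "\<kappa> = sqrt (1 + s\<^sup>2 / 2)"

lemma kappa: "\<kappa> > 1"
  using right_angledD(2)[OF ra] by (simp add: \<kappa>_def)

text \<open>No wall contains \<open>e0\<close>, so \<open>zreach\<close> cannot leave the first
  tile; in every other state some wall is violated by the image of \<open>e0\<close>, and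
  \<open>right_angled_far\<close> applies.\<close>

lemma reach_sep: assumes "reach t0 t A" shows "(t = t0 \<and> A = id) \<or> - lorentz e0 (A e0) \<ge> \<kappa>"
proof -
  have z: "t = t0 \<and> A = id" if "zreach t0 e0 t A" for t A
    using that
  proof (induction rule: zreach.induct)
    case (cross t A v)
    then show ?case using right_angledD(2,4)[OF ra] by auto
  qed simp
  show ?thesis using reach_folds[OF assms e0_hpoly]
  proof cases
    case zero then show ?thesis using z by blast
  next
    case (fold v)
    have "A e0 \<in> hyp" by (rule lor_hyp[OF fold(2) e0_hyp])
    then show ?thesis using right_angled_far[OF ra fold(3), of "A e0"] fold by (simp add: \<kappa>_def)
  qed
qed

lemma reach_trans: "reach t1 t2 B \<Longrightarrow> reach t0 t1 A \<Longrightarrow> reach t0 t2 (B \<circ> A)"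
proof (induction rule: reach.induct)
  case (cross t B v)
  then show ?case using reach.cross[of t0 t "B \<circ> A" v] by (metis comp_assoc)
qed simp

lemma reach_inv: "reach t0 t A \<Longrightarrow> reach t t0 (inv A)"
proof (induction rule: reach.induct)
  case start then show ?case unfolding inv_id by (rule reach.start)
next
  case (cross t A v)
  have t: "t \<in> T" "lor A" using reach_props cross by auto
  let ?M = "sy t v \<circ> lrefl v" and ?N = "sy (nb t v) (sy t v v) \<circ> lrefl (sy t v v)"
  have "reach (nb t v) (nb (nb t v) (sy t v v)) (?N \<circ> id)"
    using t cross nbT syN by (intro reach.intros) auto
  then have "reach (nb t v) t ?N" using nbinv t cross by simp
  from reach_trans[OF cross(3) this] have r: "reach (nb t v) t0 (inv A \<circ> ?N)" .
  have l: "lor (?M \<circ> A)" using step_lor t cross by (simp add: comp_assoc)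
  have 1: "(inv A \<circ> ?N) ((?M \<circ> A) x) = x" for x
    using step_back[of t v A] t cross lor_inv_simps(2)[OF t(2)] by (metis comp_apply comp_assoc)
  have "(inv A \<circ> ?N) y = inv (?M \<circ> A) y" for y
    using 1[of "inv (?M \<circ> A) y"] lor_inv_simps(1)[OF l] by simp
  then have "inv A \<circ> ?N = inv (?M \<circ> A)" by blast
  with r show ?case by (simp only:)
qed

text \<open>Distinct elements move \<open>e0\<close> to points that are uniformly apart, by
  \<open>reach_sep\<close> for the quotient of two elements; \<open>packing\<close> leaves room for
  finitely many.\<close>

lemma reach_finite: "finite {A. reach t0 t0 A \<and> - lorentz e0 (A e0) \<le> C}"
proof (rule ccontr)
  assume "infinite {A. reach t0 t0 A \<and> - lorentz e0 (A e0) \<le> C}"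
  then obtain f :: "nat \<Rightarrow> 'n mink \<Rightarrow> 'n mink" where
    f: "inj f" "range f \<subseteq> {A. reach t0 t0 A \<and> - lorentz e0 (A e0) \<le> C}"
    using infinite_countable_subset by blast
  have r: "reach t0 t0 (f n)" "- lorentz e0 (f n e0) \<le> C" "lor (f n)" for n
    using f(2) reach_props by blast+
  show False
  proof (rule packing[of e0 "\<lambda>n. f n e0" C \<kappa>])
    fix m n :: nat assume "m < n"
    have "reach t0 t0 (inv (f m) \<circ> f n)" using reach_trans reach_inv r by blast
    moreover have "inv (f m) \<circ> f n \<noteq> id"
    proof
      assume "inv (f m) \<circ> f n = id"
      then have "f m = f n" using lor_inv_simps(1)[OF r(3)[of m]] by (metis comp_apply eq_id_iff ext)
      then show False using f(1) \<open>m < n\<close> by (auto dest: injD)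
    qed
    ultimately have "- lorentz e0 (inv (f m) (f n e0)) \<ge> \<kappa>" using reach_sep by fastforce
    moreover have "lorentz (f m e0) (f n e0) = lorentz e0 (inv (f m) (f n e0))"
      using lor_lorentz[OF r(3)[of m], of e0 "inv (f m) (f n e0)"] lor_inv_simps(1)[OF r(3)[of m]] by simp
    ultimately show "\<kappa> \<le> - lorentz (f m e0) (f n e0)" by simp
  qed (use r kappa lor_hyp[OF r(3) e0_hyp] in auto)
qed

text \<open>Greedy folding terminates: each step lowers the time component of the image of
  \<open>x\<close>, so an infinite run would produce infinitely many separated tile centres within
  bounded distance of \<open>x\<close>.\<close>

lemma reach_hpoly:
  assumes "t0 \<in> T" "x \<in> hyp" obtains t A where "reach t0 t A" "A x \<in> hpoly \<N>"
proof (rule ccontr)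
  assume n: "\<not> thesis"
  define Q where "Q p p' \<longleftrightarrow> (\<exists>v\<in>\<N>. lorentz v (snd p x) > 0 \<and> p' = (nb (fst p) v, sy (fst p) v \<circ> lrefl v \<circ> snd p))"
    for p p' :: "'t \<times> ('n mink \<Rightarrow> 'n mink)"
  have "\<exists>f. \<forall>n. reach t0 (fst (f n)) (snd (f n)) \<and> Q (f n) (f (Suc n))"
  proof (rule dependent_nat_choice)
    show "\<exists>p. reach t0 (fst p) (snd p)" using reach.start[OF assms(1)] by force
    fix p :: "'t \<times> ('n mink \<Rightarrow> 'n mink)" assume p: "reach t0 (fst p) (snd p)"
    have "snd p x \<in> hyp" using p reach_props lor_hyp assms by blast
    moreover have "snd p x \<notin> hpoly \<N>" using n that p by blast
    ultimately obtain v where "v \<in> \<N>" "lorentz v (snd p x) > 0" by (force simp: hpoly_def)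
    then show "\<exists>p'. reach t0 (fst p') (snd p') \<and> Q p p'"
      unfolding Q_def using reach.cross[OF p] by fastforce
  qed
  then obtain f where f: "\<And>n. reach t0 (fst (f n)) (snd (f n))" "\<And>n. Q (f n) (f (Suc n))" by blast
  define A where "A n = snd (f n)" for n
  have l: "lor (A n)" "fst (f n) \<in> T" for n using reach_props[OF f(1)[of n]] by (simp_all add: A_def)
  have dec1: "A (Suc n) x $ None < A n x $ None" for n
  proof -
    obtain v where v: "v \<in> \<N>" "lorentz v (A n x) > 0" "A (Suc n) = sy (fst (f n)) v \<circ> lrefl v \<circ> A n"
      using f(2)[of n] unfolding Q_def A_def by auto
    have "lorentz e0 (A (Suc n) x) = lorentz (sy (fst (f n)) v e0) (sy (fst (f n)) v (lrefl v (A n x)))"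
      using sye0[OF l(2) v(1)] v(3) by simp
    also have "\<dots> = lorentz e0 (lrefl v (A n x))" by (rule lor_lorentz[OF sylor[OF l(2) v(1)]])
    also have "\<dots> = - (A n x $ None - lorentz v (A n x) * s)"
      using right_angledD(4)[OF ra v(1)] by (simp add: lrefl_def)
    finally show ?thesis using mult_pos_pos[OF v(2) right_angledD(2)[OF ra]] by simp
  qed
  have dec: "A n x $ None < A m x $ None" if "m < n" for m n
    using that dec1 by (rule lift_Suc_mono_less[where f="\<lambda>n. - (A n x $ None)", simplified, rotated])
  show False
  proof (rule packing[of x "\<lambda>n. inv (A n) e0" "A 0 x $ None" \<kappa>])
    show "inv (A n) e0 \<in> hyp" for n by (rule lor_hyp[OF lor_inv[OF l(1)] e0_hyp])
    show "- lorentz x (inv (A n) e0) \<le> A 0 x $ None" for n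
    proof -
      have "- lorentz x (inv (A n) e0) = A n x $ None"
        using lor_lorentz[OF l(1)[of n], of x "inv (A n) e0"] lor_inv_simps(1)[OF l(1)[of n]] by simp
      also have "A n x $ None \<le> A 0 x $ None" using dec[of 0 n] by (cases n) auto
      finally show ?thesis .
    qed
    fix m n :: nat assume mn: "m < n"
    have "reach (fst (f n)) (fst (f m)) (A m \<circ> inv (A n))"
      using reach_trans reach_inv f(1) unfolding A_def by blast
    moreover have "A m \<circ> inv (A n) \<noteq> id"
    proof
      assume "A m \<circ> inv (A n) = id"
      then have "A m = A n" using lor_inv_simps(2)[OF l(1)[of n]] by (metis comp_apply eq_id_iff ext)
      then show False using dec[OF mn] by simp
    qed
    ultimately have "- lorentz e0 ((A m \<circ> inv (A n)) e0) \<ge> \<kappa>" using reach_sep by blast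
    moreover have "lorentz (inv (A m) e0) (inv (A n) e0) = lorentz e0 (A m (inv (A n) e0))"
      using lor_lorentz[OF l(1)[of m], of "inv (A m) e0" "inv (A n) e0"] lor_inv_simps(1)[OF l(1)[of m]] by simp
    ultimately show "\<kappa> \<le> - lorentz (inv (A m) e0) (inv (A n) e0)" by simp
  qed (use assms kappa in auto)
qed

end

section \<open>Orientation, free action and the quotient of a mirror system\<close>

lemma hpoly_closed: "closed (hpoly \<N>)" for \<N> :: "'n::finite mink set"
proof -
  have "hpoly \<N> = hyp \<inter> (\<Inter>v\<in>\<N>. {x. lorentz v x \<le> 0})" by (auto simp: hpoly_def)
  moreover have "closed (\<Inter>v\<in>\<N>. {x :: 'n mink. lorentz v x \<le> 0})"
    by (intro closed_INT ballI closed_Collect_le continuous_intros)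
  ultimately show ?thesis using hyp_closed by auto
qed

text \<open>\<open>sg\<close> orients the tiles. A crossing contributes the factor -1 of the
  reflection and the determinant of the symmetry, so a closed path has determinant 1.\<close>

locale oriented_mirror = mirror +
  fixes sg :: "'b \<Rightarrow> real"
  assumes sg_step: "t \<in> T \<Longrightarrow> v \<in> \<N> \<Longrightarrow> sg (nb t v) = - sg t * ldet (sy t v)"
    and sg_nz: "t \<in> T \<Longrightarrow> sg t \<noteq> 0"
begin

lemma reach_ldet: "reach t0 t A \<Longrightarrow> sg t = sg t0 * ldet A"
proof (induction rule: reach.induct)
  case (cross t A v)
  have t: "t \<in> T" "lor A" using reach_props cross by auto
  have 1: "ldet (sy t v \<circ> lrefl v \<circ> A) = ldet (sy t v) * ldet (lrefl v) * ldet A"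
    using ldet_comp[OF lor_comp[OF sylor[OF t(1) cross(2)] lrefl_lor[OF cross(2)]] t(2)]
      ldet_comp[OF sylor[OF t(1) cross(2)] lrefl_lor[OF cross(2)]] by metis
  have 2: "ldet (lrefl v) = -1" using ldet_lrefl right_angledD(3)[OF ra cross(2)] by blast
  show ?case unfolding 1 2 sg_step[OF t(1) cross(2)] cross(3) by simp
next
  case start show ?case unfolding ldet_id by simp
qed

lemma reach_self_ldet: "reach t0 t0 A \<Longrightarrow> ldet A = 1"
  using reach_ldet[of t0 t0 A] sg_nz reach_props by fastforce

end

locale free_mirror = oriented_mirror +
  assumes fre: "t \<in> T \<Longrightarrow> x \<in> hpoly \<N> \<Longrightarrow> zreach t x t A \<Longrightarrow> A x = x \<Longrightarrow> A = id"
begin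

definition \<Gamma> :: "'b \<Rightarrow> ('a mink \<Rightarrow> 'a mink) set" where
  "\<Gamma> t0 = {A. reach t0 t0 A}"

lemma gamma_disc: assumes t0: "t0 \<in> T" shows "disc_group (\<Gamma> t0)"
proof
  show "A \<in> \<Gamma> t0 \<Longrightarrow> lor A" for A using reach_props by (auto simp: \<Gamma>_def)
  show "id \<in> \<Gamma> t0" using reach.start[OF t0] by (simp add: \<Gamma>_def)
  show "A \<in> \<Gamma> t0 \<Longrightarrow> B \<in> \<Gamma> t0 \<Longrightarrow> A \<circ> B \<in> \<Gamma> t0" for A B
    using reach_trans by (auto simp: \<Gamma>_def)
  show "A \<in> \<Gamma> t0 \<Longrightarrow> inv A \<in> \<Gamma> t0" for A using reach_inv by (auto simp: \<Gamma>_def)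
  show "finite {A \<in> \<Gamma> t0. - lorentz e0 (A e0) \<le> C}" for C using reach_finite by (simp add: \<Gamma>_def)
  fix A x assume A: "A \<in> \<Gamma> t0" and x: "x \<in> hyp" "A x = x"
  obtain t B where B: "reach t0 t B" "B x \<in> hpoly \<N>" using reach_hpoly[OF t0 x(1)] .
  have lB: "lor B" "lor A" "t \<in> T" using reach_props B A by (auto simp: \<Gamma>_def)
  \<comment> \<open>Conjugation by a path that brings \<open>x\<close> into the polytope turns the
    fixed point into one of the closed cell of the tile \<open>t\<close>, where \<open>fre\<close>
    applies.\<close>
  define C where "C = B \<circ> A \<circ> inv B"
  have C: "reach t t C" unfolding C_def using reach_trans reach_inv B A by (auto simp: \<Gamma>_def comp_assoc)
  have Cx: "C (B x) = B x" using x lor_inv_simps[OF lB(1)] by (simp add: C_def)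
  have "zreach t (B x) t C" using reach_zreach[OF C B(2)] Cx B(2) by simp
  then have "C = id" using fre[OF lB(3) B(2)] Cx by blast
  then have "B (A y) = B y" for y using lor_inv_simps(2)[OF lB(1), of y] by (metis C_def comp_apply id_apply)
  then have "A y = y" for y using lor_inj[OF lB(1)] by (simp add: inj_eq)
  then show "A = id" by (simp add: fun_eq_iff)
qed

text \<open>One copy of the polytope for each of the finitely many reachable tiles, carried back to
  \<open>t0\<close>, meets every orbit.\<close>

lemma gamma_cover:
  assumes t0: "t0 \<in> T" and fin: "finite T" "emeasure hyp_volume (hpoly \<N>) < \<infinity>"
  obtains Q where "Q \<in> sets borel" "Q \<subseteq> hyp" "\<And>x. x \<in> hyp \<Longrightarrow> \<exists>A\<in>\<Gamma> t0. A x \<in> Q"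
    "emeasure hyp_volume Q < \<infinity>"
proof
  define C where "C t = (SOME C. reach t t0 C)" for t
  define R where "R = {t. \<exists>A. reach t0 t A}"
  have C: "reach t t0 (C t)" if "t \<in> R" for t
  proof -
    obtain A where "reach t0 t A" using \<open>t \<in> R\<close> by (auto simp: R_def)
    then have "\<exists>C. reach t t0 C" using reach_inv by blast
    then show ?thesis unfolding C_def by (rule someI_ex)
  qed
  have fR: "finite R" using fin(1) reach_props by (auto simp: R_def intro: finite_subset)
  have lC: "lor (C t)" if "t \<in> R" for t using C[OF that] reach_props by blast
  define Q where "Q = (\<Union>t\<in>R. C t ` hpoly \<N>)"
  have Pb: "hpoly \<N> \<in> sets borel" using hpoly_closed by (rule borel_closed)
  have Ph: "hpoly \<N> \<subseteq> hyp" by (auto simp: hpoly_def)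
  have Cb: "C t ` hpoly \<N> \<in> sets borel" if "t \<in> R" for t using lor_image_borel[OF lC[OF that] Pb] .
  show "Q \<in> sets borel" unfolding Q_def using fR Cb by (rule sets.finite_UN)
  show "Q \<subseteq> hyp" unfolding Q_def using lC lor_hyp Ph by blast
  show "\<exists>A\<in>\<Gamma> t0. A x \<in> Q" if x: "x \<in> hyp" for x
  proof -
    obtain t B where B: "reach t0 t B" "B x \<in> hpoly \<N>" using reach_hpoly[OF t0 x] .
    then have t: "t \<in> R" by (auto simp: R_def)
    have "C t \<circ> B \<in> \<Gamma> t0" using reach_trans[OF C[OF t] B(1)] by (simp add: \<Gamma>_def)
    moreover have "(C t \<circ> B) x \<in> Q" unfolding Q_def using t B by auto
    ultimately show ?thesis by blast
  qed
  have hs: "sets hyp_volume = sets borel" by (simp add: hyp_volume_def)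
  have "emeasure hyp_volume Q \<le> (\<Sum>t\<in>R. emeasure hyp_volume (C t ` hpoly \<N>))"
    unfolding Q_def by (rule emeasure_subadditive_finite) (use fR Cb hs in auto)
  also have "\<dots> = (\<Sum>t\<in>R. emeasure hyp_volume (hpoly \<N>))"
    by (rule sum.cong) (use hyp_volume_lor[OF lC Pb Ph] in auto)
  also have "\<dots> < \<infinity>" using fin(2) by (simp add: ennreal_mult_less_top of_nat_less_top)
  finally show "emeasure hyp_volume Q < \<infinity>" .
qed

theorem quotient_manifold:
  assumes t0: "t0 \<in> T" and fin: "finite T" "emeasure hyp_volume (hpoly \<N>) < \<infinity>"
  defines "W \<equiv> disc_group.Y (\<Gamma> t0)" and "B \<equiv> disc_group.charts (\<Gamma> t0)"
  shows "hyp_manifold W B" "connected_space W" "hyp_complete W B" "hyp_finite_volume W B" "hyp_orientable W B"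
proof -
  interpret dg: disc_group "\<Gamma> t0" by (rule gamma_disc[OF t0])
  obtain Q where "Q \<in> sets borel" "Q \<subseteq> hyp" "\<And>x. x \<in> hyp \<Longrightarrow> \<exists>A\<in>\<Gamma> t0. A x \<in> Q" "emeasure hyp_volume Q < \<infinity>"
    using gamma_cover[OF assms(1-3)] by metis
  then show "hyp_finite_volume W B" unfolding W_def B_def by (rule dg.finite_volume_Y)
  show "hyp_manifold W B" "connected_space W" "hyp_complete W B"
    unfolding W_def B_def using dg.manifold_Y dg.connected_Y dg.complete_Y by auto
  show "hyp_orientable W B" unfolding W_def B_def
    by (rule dg.orientable_Y) (use reach_self_ldet in \<open>auto simp: \<Gamma>_def\<close>)
qed

end

section \<open>The right-angled 24-cell and 120-cell\<close>

text \<open>The pair \<open>(a, b)\<close> stands for \<open>a + b \<phi>\<close>. This turns the incidences of the cells into computations with lists.\<close>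

type_synonym zphi = "int \<times> int"

definition zval :: "zphi \<Rightarrow> real" where "zval p = real_of_int (fst p) + real_of_int (snd p) * golden"

fun zadd :: "zphi \<Rightarrow> zphi \<Rightarrow> zphi" where "zadd (a, b) (c, d) = (a + c, b + d)"

fun zmul :: "zphi \<Rightarrow> zphi \<Rightarrow> zphi" where "zmul (a, b) (c, d) = (a * c + b * d, a * d + b * c + b * d)"

fun zneg :: "zphi \<Rightarrow> zphi" where "zneg (a, b) = (- a, - b)"

fun zdot :: "zphi list \<Rightarrow> zphi list \<Rightarrow> zphi" where
  "zdot (x # xs) (y # ys) = zadd (zmul x y) (zdot xs ys)"
| "zdot _ _ = (0, 0)"

fun zsum :: "zphi list list \<Rightarrow> zphi list" where
  "zsum [] = [(0, 0), (0, 0), (0, 0)]"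
| "zsum (X # XS) = map2 zadd X (zsum XS)"

text \<open>The ordered n-cliques of the graph on \<open>A\<close> whose edges are the pairs with
  inner product \<open>d\<close>. For the dodecahedron with its value \<open>dtup\<close> they are
  single faces, pairs of faces at an edge and triples of faces at a vertex.\<close>

fun tuples :: "zphi list list \<Rightarrow> zphi \<Rightarrow> nat \<Rightarrow> zphi list list list" where
  "tuples A d 0 = [[]]"
| "tuples A d (Suc n) =
     concat (map (\<lambda>X. map (\<lambda>a. a # X) (filter (\<lambda>a. list_all (\<lambda>b. zdot a b = d) X) A)) (tuples A d n))"

definition comb :: "zphi \<Rightarrow> zphi \<Rightarrow> zphi list list \<Rightarrow> zphi list" where
  "comb c \<alpha> X = c # map (zmul \<alpha>) (zsum X)"

definition gens :: "zphi list list \<Rightarrow> zphi \<Rightarrow> (zphi \<times> zphi \<times> nat) list \<Rightarrow> zphi list list" where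
  "gens A d forms = remdups (concat (map (\<lambda>(c, \<alpha>, n). map (comb c \<alpha>) (tuples A d n)) forms))"

lemma zval_simps [simp]: "zval (zadd p q) = zval p + zval q" "zval (zmul p q) = zval p * zval q"
  "zval (zneg p) = - zval p" "zval (0, 0) = 0"
proof -
  have g: "golden * (golden * x) = golden * x + x" for x by (simp add: mult.assoc[symmetric] golden_sq algebra_simps)
  show "zval (zadd p q) = zval p + zval q" "zval (zmul p q) = zval p * zval q" "zval (zneg p) = - zval p" "zval (0, 0) = 0"
    by (cases p; cases q; simp add: zval_def algebra_simps g golden_sq)+
qed

definition vec3 :: "zphi list \<Rightarrow> real ^ 3" where
  "vec3 a = vector [zval (a ! 0), zval (a ! 1), zval (a ! 2)]"

definition vec4 :: "zphi list \<Rightarrow> real ^ 4" where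
  "vec4 a = (\<chi> i. if i = 1 then zval (a ! 0) else if i = 2 then zval (a ! 1) else if i = 3 then zval (a ! 2) else zval (a ! 3))"

definition pr3 :: "real ^ 4 \<Rightarrow> real ^ 3" where
  "pr3 u = vector [u $ 2, u $ 3, u $ 4]"

definition em4 :: "real \<Rightarrow> real ^ 3 \<Rightarrow> real ^ 4" where
  "em4 x u = (\<chi> i. if i = 1 then x else if i = 2 then u $ 1 else if i = 3 then u $ 2 else u $ 3)"

lemma em4_comp: "em4 x u $ 1 = x" "em4 x u $ 2 = u $ 1" "em4 x u $ 3 = u $ 2" "em4 x u $ 4 = u $ 3"
  by (simp_all add: em4_def)

lemma inner_em4: "em4 x u \<bullet> em4 y w = x * y + u \<bullet> w"
  by (simp add: inner_vec_def sum_4 sum_3 em4_comp)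

lemma inner_em4_0: "em4 x 0 \<bullet> u = x * u $ 1"
  by (simp add: inner_vec_def sum_4 em4_comp)

lemma em4_add: "em4 x u + em4 y w = em4 (x + y) (u + w)" and em4_scale: "c *\<^sub>R em4 x u = em4 (c * x) (c *\<^sub>R u)"
  by (simp_all add: vec_eq_iff forall_4 em4_comp)

lemma em4_pr3: "em4 (u $ 1) (pr3 u) = u" and pr3_em4: "pr3 (em4 x w) = w"
  by (simp_all add: vec_eq_iff forall_4 forall_3 em4_comp pr3_def)

lemma vec4_Cons: "length a = 3 \<Longrightarrow> vec4 (c # a) = em4 (zval c) (vec3 a)"
  by (simp add: vec_eq_iff forall_4 em4_comp vec4_def vec3_def)

lemma length_3: "length a = 3 \<Longrightarrow> \<exists>x y z. a = [x, y, z]"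
  and length_4: "length a = 4 \<Longrightarrow> \<exists>w x y z. a = [w, x, y, z]" for a :: "'a list"
  by (auto simp: eval_nat_numeral length_Suc_conv)

lemma inner_vec3: assumes "length a = 3" "length b = 3" shows "vec3 a \<bullet> vec3 b = zval (zdot a b)"
proof -
  obtain x y z x' y' z' where "a = [x, y, z]" "b = [x', y', z']" using length_3 assms by metis
  then show ?thesis by (simp add: inner_vec_def sum_3 vec3_def)
qed

lemma inner_vec4: assumes "length a = 4" "length b = 4" shows "vec4 a \<bullet> vec4 b = zval (zdot a b)"
proof -
  obtain w x y z w' x' y' z' where "a = [w, x, y, z]" "b = [w', x', y', z']" using length_4 assms by metis
  then show ?thesis by (simp add: inner_vec_def sum_4 vec4_def)
qed

lemma length_zsum: "list_all (\<lambda>a. length a = 3) X \<Longrightarrow> length (zsum X) = 3"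
  by (induction X) auto

lemma vec3_zsum: "list_all (\<lambda>a. length a = 3) X \<Longrightarrow> vec3 (zsum X) = (\<Sum>a\<leftarrow>X. vec3 a)"
proof (induction X)
  case Nil then show ?case by (simp add: vec3_def vec_eq_iff forall_3)
next
  case (Cons a X)
  then have "length (zsum X) = 3" "length a = 3" using length_zsum by auto
  then have "vec3 (map2 zadd a (zsum X)) = vec3 a + vec3 (zsum X)"
    by (simp add: vec3_def vec_eq_iff forall_3)
  then show ?case using Cons by simp
qed

lemma vec3_map: "length a = 3 \<Longrightarrow> vec3 (map (zmul c) a) = zval c *\<^sub>R vec3 a"
  by (simp add: vec3_def vec_eq_iff forall_3)

text \<open>
  The normals are \<open>mvec s (\<kappa> u)\<close> for \<open>u\<close> in the list \<open>U\<close> of vectors of length 2. The facet \<open>f0\<close> is given by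
  \<open>u = (2, 0, 0, 0)\<close>, and its neighbours by \<open>a0 # a\<close> for \<open>a\<close> in \<open>A\<close>. Facets are orthogonal iff the inner product
  of their vectors is \<open>dadj\<close>. The isometry onto the hyperplane of \<open>f0\<close> is a boost with \<open>cosh = C\<close> and \<open>sinh = S\<close>.
  The list \<open>forms\<close> expresses each vector of \<open>U\<close> by sums of vectors in \<open>A\<close> with pairwise inner products \<open>dtup\<close>, which
  shows that symmetries of the facet preserve \<open>U\<close>. The facets in \<open>Z\<close> are glued by a flag instead of a colour.
\<close>

locale cell_data =
  fixes \<kappa> s C S :: real and A U Z :: "zphi list list" and a0 dadj dtup :: zphi
    and forms :: "(zphi \<times> zphi \<times> nat) list" and lows offs :: "zphi list"
  assumes pos: "\<kappa> > 0" "s > 0" "C > 0" "S > 0"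
    and par: "4 * \<kappa>\<^sup>2 - s\<^sup>2 = 2" "C\<^sup>2 - S\<^sup>2 = 1" "2 * \<kappa> * S = s * C" "s\<^sup>2 = \<kappa>\<^sup>2 * zval dadj" "S * s = \<kappa> * zval a0 * C"
    and low: "d \<in> set lows \<Longrightarrow> \<kappa>\<^sup>2 * (zval d - zval dadj) \<le> -2"
    and A3: "list_all (\<lambda>a. length a = 3) A"
    and U4: "list_all (\<lambda>u. length u = 4 \<and> zdot u u = (4, 0)) U"
    and UU: "list_all (\<lambda>u. list_all (\<lambda>w. u = w \<or> zdot u w = dadj \<or> zdot u w \<in> set lows) U) U"
    and F0: "[(2, 0), (0, 0), (0, 0), (0, 0)] \<in> set U" "[(-2, 0), (0, 0), (0, 0), (0, 0)] \<in> set U"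
    and walls: "list_all (\<lambda>u. zdot [(2, 0), (0, 0), (0, 0), (0, 0)] u = dadj \<longleftrightarrow> u \<in> set (map ((#) a0) A)) U"
    and AU: "list_all (\<lambda>a. (a0 # a) \<in> set U) A"
    and opp: "list_all (\<lambda>a. zdot [(-2, 0), (0, 0), (0, 0), (0, 0)] (a0 # a) \<noteq> dadj) A"
    and negA: "list_all (\<lambda>a. map zneg a \<in> set A) A"
    and AA: "list_all (\<lambda>a. list_all (\<lambda>b. b = a \<or> zdot (a0 # b) (a0 # a) = dadj \<or> map zneg b = a \<or>
       zdot (a0 # map zneg b) (a0 # a) = dadj) A) A"
    and forms: "set (gens A dtup forms) = set U"
    and off: "d \<in> set offs \<Longrightarrow> zval d \<noteq> zval dtup"
    and dtup: "list_all (\<lambda>a. list_all (\<lambda>b. zdot a b = dtup \<or> zdot a b \<in> set offs) A) A"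
    and ZU: "list_all (\<lambda>z. z \<in> set U \<and> z \<noteq> [(2, 0), (0, 0), (0, 0), (0, 0)] \<and> z \<noteq> [(-2, 0), (0, 0), (0, 0), (0, 0)] \<and>
       zdot z [(2, 0), (0, 0), (0, 0), (0, 0)] \<noteq> dadj \<and> zdot z [(-2, 0), (0, 0), (0, 0), (0, 0)] \<noteq> dadj) Z" "Z \<noteq> []"
    and ZZ: "list_all (\<lambda>z. list_all (\<lambda>w. zdot z w \<noteq> dadj) Z) Z"
    and nbU: "list_all (\<lambda>u. u \<in> set Z \<or> u = [(-2, 0), (0, 0), (0, 0), (0, 0)] \<or> u = [(2, 0), (0, 0), (0, 0), (0, 0)] \<or>
       u \<in> set (map ((#) a0) A) \<or>
       (let n = filter (\<lambda>a. zdot (a0 # a) u = dadj) A in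
         list_all (\<lambda>a. list_all (\<lambda>b. a = b \<or> zdot (a0 # a) (a0 # b) = dadj) n) n \<and>
         (n = [] \<or> list_all (\<lambda>w. u = w \<or> w \<in> set Z \<or> filter (\<lambda>a. zdot (a0 # a) w = dadj) A \<noteq> n) U))) U"
begin

definition f0 :: "4 mink" where "f0 = mvec s (em4 (2 * \<kappa>) 0)"
definition opp0 :: "4 mink" where "opp0 = mvec s (em4 (- 2 * \<kappa>) 0)"
definition n3 :: "zphi list \<Rightarrow> 3 mink" where "n3 a = mvec (s / C) (\<kappa> *\<^sub>R vec3 a)"
definition n4 :: "zphi list \<Rightarrow> 4 mink" where "n4 u = mvec s (\<kappa> *\<^sub>R vec4 u)"
definition N3 :: "3 mink set" where "N3 = n3 ` set A"
definition N4 :: "4 mink set" where "N4 = n4 ` set U"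
definition Z4 :: "4 mink set" where "Z4 = n4 ` set Z"
definition \<iota> :: "3 mink \<Rightarrow> 4 mink" where "\<iota> x = mvec (C * x $ None) (em4 (S * x $ None) (sp x))"
definition \<rho> :: "4 mink \<Rightarrow> 3 mink" where "\<rho> y = mvec (C * y $ None - S * sp y $ 1) (pr3 (sp y))"
text \<open>Fixing the normal \<open>f0\<close> makes the extension preserve the two sides of the
  hyperplane that carries the facet.\<close>

definition ext :: "(3 mink \<Rightarrow> 3 mink) \<Rightarrow> 4 mink \<Rightarrow> 4 mink" where
  "ext L y = \<iota> (L (\<rho> y)) + (lorentz f0 y / 2) *\<^sub>R f0"

lemma iota_linear: "linear \<iota>"
  by (rule linearI) (simp_all add: \<iota>_def mvec_add mvec_scale em4_add em4_scale algebra_simps)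

lemma iota_lorentz: "lorentz (\<iota> x) (\<iota> y) = lorentz x y"
proof -
  have "lorentz (\<iota> x) (\<iota> y) = sp x \<bullet> sp y + (S * S - C * C) * (x $ None * y $ None)"
    by (simp add: \<iota>_def lorentz_sp inner_em4 algebra_simps)
  moreover have "S * S - C * C = -1" using par(2) by (simp add: power2_eq_square)
  ultimately show ?thesis by (simp add: lorentz_sp)
qed

lemma f0_iota: "lorentz f0 (\<iota> x) = 0"
  using par(3) by (simp add: f0_def \<iota>_def lorentz_sp inner_em4 mult.assoc[symmetric])

lemma f0_f0: "lorentz f0 f0 = 2"
  using par(1) by (simp add: f0_def lorentz_sp inner_em4 power2_eq_square)

lemma rho_iota: "\<rho> (\<iota> x) = x"
proof -
  have "C * C = 1 + S * S" using par(2) by (simp add: power2_eq_square)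
  then have "C * (C * z) = z + S * (S * z)" for z by (simp add: mult.assoc[symmetric] distrib_right)
  then show ?thesis by (simp add: \<rho>_def \<iota>_def em4_comp pr3_em4)
qed

lemma rho_f0: "\<rho> f0 = 0"
  using par(3) by (intro mink_eqI) (simp_all add: \<rho>_def f0_def em4_comp pr3_em4 mult_ac)

lemma rho_linear: "linear \<rho>"
proof (rule linearI)
  have p: "pr3 (u + w) = pr3 u + pr3 w" "pr3 (c *\<^sub>R u) = c *\<^sub>R pr3 u" for u w c
    by (simp_all add: pr3_def vec_eq_iff forall_3)
  show "\<rho> (x + y) = \<rho> x + \<rho> y" for x y by (intro mink_eqI) (simp_all add: \<rho>_def p algebra_simps)
  show "\<rho> (c *\<^sub>R x) = c *\<^sub>R \<rho> x" for x c by (intro mink_eqI) (simp_all add: \<rho>_def p algebra_simps)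
qed

lemma decomp: "y = \<iota> (\<rho> y) + (lorentz f0 y / 2) *\<^sub>R f0"
proof (rule mink_eqI)
  define a b where "a = y $ None" and "b = sp y $ 1"
  have l: "lorentz f0 y = 2 * \<kappa> * b - s * a"
    by (simp add: f0_def lorentz_sp b_def a_def inner_em4_0)
  have h: "s * s = 4 * (\<kappa> * \<kappa>) - 2" "C * C = 1 + S * S" "2 * \<kappa> * S = s * C"
    using par by (simp_all add: power2_eq_square)
  \<comment> \<open>The relations among the parameters, here
    \<open>C * C = 2 * (\<kappa> * \<kappa>)\<close> and next \<open>s * s = 2 * (S * S)\<close> and
    \<open>\<kappa> * s = S * C\<close>, all follow from \<open>par\<close>.\<close>
  have k: "2 * (\<kappa> * \<kappa>) = C * C"
  proof -
    have "s * s * (C * C) = (s * C) * (s * C)" by simp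
    also have "\<dots> = 4 * (\<kappa> * \<kappa>) * (S * S)" unfolding h(3)[symmetric] by simp
    finally have "s * s * (C * C) = 4 * (\<kappa> * \<kappa>) * (S * S)" .
    then have "(4 * (\<kappa> * \<kappa>) - 2) * (C * C) = 4 * (\<kappa> * \<kappa>) * (C * C - 1)" using h by simp
    then show ?thesis by (simp add: algebra_simps)
  qed
  have ss: "s * s = 2 * (S * S)" using h k by simp
  have ks: "\<kappa> * s = S * C"
  proof -
    have "2 * \<kappa> * S * \<kappa> = s * C * \<kappa>" using h(3) by simp
    then have "C * (S * C) = C * (\<kappa> * s)" using k by (metis mult.assoc mult.commute)
    then show ?thesis using pos by simp
  qed
  have "a = C * (C * a - S * b) + (2 * \<kappa> * b - s * a) / 2 * s"
  proof -
    have "C * (C * a - S * b) + (2 * \<kappa> * b - s * a) / 2 * s = C * C * a - S * C * b + \<kappa> * s * b - s * s * a / 2"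
      by (simp add: field_simps)
    also have "\<dots> = a" by (simp add: ks ss h(2) algebra_simps)
    finally show ?thesis by simp
  qed
  then show "y $ None = (\<iota> (\<rho> y) + (lorentz f0 y / 2) *\<^sub>R f0) $ None"
    unfolding l by (simp add: \<iota>_def \<rho>_def f0_def a_def b_def)
  have "b = S * (C * a - S * b) + (2 * \<kappa> * b - s * a) / 2 * (2 * \<kappa>)"
  proof -
    have "S * (C * a - S * b) + (2 * \<kappa> * b - s * a) / 2 * (2 * \<kappa>) = S * C * a - S * S * b + 2 * (\<kappa> * \<kappa>) * b - \<kappa> * s * a"
      by (simp add: field_simps)
    also have "\<dots> = b" unfolding ks k h(2) by (simp add: algebra_simps)
    finally show ?thesis by simp
  qed
  then show "sp y = sp (\<iota> (\<rho> y) + (lorentz f0 y / 2) *\<^sub>R f0)"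
    unfolding l by (subst em4_pr3[symmetric]) (simp add: \<iota>_def \<rho>_def f0_def a_def[symmetric] b_def[symmetric] em4_add em4_scale)
qed

lemma iota_hyp: "x \<in> hyp \<Longrightarrow> \<iota> x \<in> hyp"
  using pos iota_lorentz[of x x] by (simp add: hyp_def) (simp add: \<iota>_def)

lemma lenU: "u \<in> set U \<Longrightarrow> length u = 4" and lenA: "a \<in> set A \<Longrightarrow> length a = 3"
  using U4 A3 by (auto simp: list_all_iff)

lemma n4_lorentz: "length u = 4 \<Longrightarrow> length w = 4 \<Longrightarrow> lorentz (n4 u) (n4 w) = \<kappa>\<^sup>2 * (zval (zdot u w) - zval dadj)"
  using par(4) by (simp add: n4_def lorentz_sp inner_vec4 power2_eq_square algebra_simps)

lemma iota_n3: "a \<in> set A \<Longrightarrow> \<iota> (n3 a) = n4 (a0 # a)"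
  using par(5) pos lenA by (simp add: \<iota>_def n3_def n4_def vec4_Cons em4_scale field_simps)

lemma f0_n4: "f0 = n4 [(2, 0), (0, 0), (0, 0), (0, 0)]" and opp0_n4: "opp0 = n4 [(-2, 0), (0, 0), (0, 0), (0, 0)]"
  by (simp_all add: f0_def opp0_def n4_def vec4_def vec_eq_iff forall_4 em4_comp zval_def mvec_def split: option.splits)

text \<open>The integer pairs decide orthogonality exactly: a value in \<open>lows\<close> gives a
  product of at most -2 and equal vectors give 2, so only \<open>dadj\<close> gives 0.\<close>

lemma n4_cases: assumes "u \<in> set U" "w \<in> set U"
  shows "lorentz (n4 u) (n4 u) = 2" "u \<noteq> w \<Longrightarrow> lorentz (n4 u) (n4 w) = 0 \<or> lorentz (n4 u) (n4 w) \<le> -2"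
    "lorentz (n4 u) (n4 w) = 0 \<longleftrightarrow> zdot u w = dadj"
proof -
  have uu: "zdot u u = (4, 0)" using U4 assms by (auto simp: list_all_iff)
  then show 2: "lorentz (n4 u) (n4 u) = 2"
    using n4_lorentz[of u u] lenU assms par by (simp add: zval_def algebra_simps)
  have c: "u = w \<or> zdot u w = dadj \<or> zdot u w \<in> set lows" using UU assms by (auto simp: list_all_iff)
  have l: "lorentz (n4 u) (n4 w) = \<kappa>\<^sup>2 * (zval (zdot u w) - zval dadj)"
    by (rule n4_lorentz[OF lenU[OF assms(1)] lenU[OF assms(2)]])
  show 3: "u \<noteq> w \<Longrightarrow> lorentz (n4 u) (n4 w) = 0 \<or> lorentz (n4 u) (n4 w) \<le> -2"
    using c low[of "zdot u w"] unfolding l by (elim disjE) simp_all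
  show "lorentz (n4 u) (n4 w) = 0 \<longleftrightarrow> zdot u w = dadj"
  proof
    assume 0: "lorentz (n4 u) (n4 w) = 0"
    show "zdot u w = dadj"
    proof (rule ccontr)
      assume n: "zdot u w \<noteq> dadj"
      then consider "u = w" | "zdot u w \<in> set lows" using c by blast
      then show False
      proof cases
        case 1 then show ?thesis using 0 2 by simp
      next
        case 2 show ?thesis using 0 low[OF 2] l by linarith
      qed
    qed
  qed (simp add: l)
qed

lemma n4_inj: "u \<in> set U \<Longrightarrow> w \<in> set U \<Longrightarrow> n4 u = n4 w \<Longrightarrow> u = w"
  using n4_cases(1,2)[of u w] by force

lemma ra4: "right_angled N4 s"
  unfolding right_angled_def
proof (intro conjI ballI impI)
  show "finite N4" "s > 0" using pos by (simp_all add: N4_def)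
  fix v assume v: "v \<in> N4"
  then show "lorentz v v = 2" "v $ None = s" using n4_cases(1) by (auto simp: N4_def n4_def)
  fix w assume "w \<in> N4" "v \<noteq> w"
  then show "lorentz v w = 0 \<or> lorentz v w \<le> -2" using v n4_cases(2) by (auto simp: N4_def)
qed

lemma AU': "a \<in> set A \<Longrightarrow> a0 # a \<in> set U"
  using AU by (auto simp: list_all_iff)

lemma walls4: "{v \<in> N4. lorentz f0 v = 0} = \<iota> ` N3"
proof -
  have "lorentz f0 (n4 u) = 0 \<longleftrightarrow> u \<in> set (map ((#) a0) A)" if "u \<in> set U" for u
    unfolding f0_n4 using n4_cases(3)[OF F0(1) that] walls that by (simp add: list_all_iff)
  then show ?thesis
    using iota_n3 AU' by (force simp: N4_def N3_def image_iff)
qed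

lemma iota_inj: "\<iota> x = \<iota> y \<Longrightarrow> x = y"
  using rho_iota by metis

lemma ra3: "right_angled N3 (s / C)"
  unfolding right_angled_def
proof (intro conjI ballI impI)
  show "finite N3" "s / C > 0" using pos by (simp_all add: N3_def)
  fix v assume v: "v \<in> N3"
  then have v4: "\<iota> v \<in> N4" using walls4 by blast
  then show "lorentz v v = 2" using right_angledD(3)[OF ra4 v4] by (simp add: iota_lorentz)
  show "v $ None = s / C" using v by (auto simp: N3_def n3_def)
  fix w assume w: "w \<in> N3" "v \<noteq> w"
  then have "\<iota> w \<in> N4" "\<iota> v \<noteq> \<iota> w" using walls4 iota_inj by blast+
  from right_angledD(5)[OF ra4 v4 this] show "lorentz v w = 0 \<or> lorentz v w \<le> -2" by (simp add: iota_lorentz)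
qed

lemma n3_neg: "length a = 3 \<Longrightarrow> n3 (map zneg a) = (2 * s / C) *\<^sub>R e0 - n3 a"
  by (auto simp: n3_def mvec_scale mvec_diff vec3_def vec_eq_iff forall_3 mvec_def split: option.splits)

lemma antipode3: "v \<in> N3 \<Longrightarrow> (2 * s / C) *\<^sub>R e0 - v \<in> N3"
  using negA lenA n3_neg by (force simp: N3_def list_all_iff)

lemma n3_orth: "a \<in> set A \<Longrightarrow> b \<in> set A \<Longrightarrow> lorentz (n3 a) (n3 b) = 0 \<longleftrightarrow> zdot (a0 # a) (a0 # b) = dadj"
  using n4_cases(3)[OF AU' AU'] iota_lorentz[of "n3 a" "n3 b"] iota_n3 by metis

text \<open>Up to the central symmetry, \<open>v\<close> and its neighbours are all the walls. In
  \<open>L_N\<close> this extends what is known near one wall to the whole polyhedron.\<close>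

lemma antipodal_cover:
  assumes "v \<in> N3" "w \<in> N3"
  shows "w = v \<or> lorentz w v = 0 \<or> (2 * s / C) *\<^sub>R e0 - w = v \<or> lorentz ((2 * s / C) *\<^sub>R e0 - w) v = 0"
proof -
  obtain a b where ab: "a \<in> set A" "b \<in> set A" "v = n3 a" "w = n3 b" using assms by (auto simp: N3_def)
  have nb: "map zneg b \<in> set A" using negA ab by (auto simp: list_all_iff)
  have "b = a \<or> zdot (a0 # b) (a0 # a) = dadj \<or> map zneg b = a \<or> zdot (a0 # map zneg b) (a0 # a) = dadj"
    using AA ab by (simp add: list_all_iff)
  then show ?thesis using ab n3_neg[OF lenA[OF ab(2)]] n3_orth nb by metis
qed

lemma opp_facts: "opp0 \<in> N4" "opp0 \<noteq> f0" "v \<in> N3 \<Longrightarrow> lorentz opp0 (\<iota> v) \<noteq> 0" "lorentz opp0 f0 \<noteq> 0"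
proof -
  show "opp0 \<in> N4" using F0 by (simp add: opp0_n4 N4_def)
  show "opp0 \<noteq> f0" using n4_inj[OF F0(2,1)] by (auto simp: opp0_n4 f0_n4)
  show "lorentz opp0 (\<iota> v) \<noteq> 0" if "v \<in> N3"
    using \<open>v \<in> N3\<close> opp n4_cases(3)[OF F0(2) AU'] by (auto simp: N3_def iota_n3 list_all_iff opp0_n4)
  show "lorentz opp0 f0 \<noteq> 0"
    using par pos by (simp add: opp0_def f0_def lorentz_sp inner_em4 power2_eq_square)
      (smt (verit) mult_pos_pos)
qed

lemma f0_N4: "f0 \<in> N4" using F0 by (simp add: f0_n4 N4_def)

lemma Z_facts:
  assumes "z \<in> Z4"
  shows "z \<in> N4" "z \<noteq> f0" "z \<noteq> opp0" "lorentz z f0 \<noteq> 0" "lorentz z opp0 \<noteq> 0" "w \<in> Z4 \<Longrightarrow> lorentz z w \<noteq> 0"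
proof -
  obtain u where u: "z = n4 u" "u \<in> set Z" using assms by (auto simp: Z4_def)
  have uU: "u \<in> set U" and f: "u \<noteq> [(2, 0), (0, 0), (0, 0), (0, 0)]" "u \<noteq> [(-2, 0), (0, 0), (0, 0), (0, 0)]"
    "zdot u [(2, 0), (0, 0), (0, 0), (0, 0)] \<noteq> dadj" "zdot u [(-2, 0), (0, 0), (0, 0), (0, 0)] \<noteq> dadj"
    using ZU(1) u by (auto simp: list_all_iff)
  show "z \<in> N4" using uU u by (simp add: N4_def)
  show "z \<noteq> f0" "z \<noteq> opp0" using f n4_inj[OF uU] F0 by (auto simp: u f0_n4 opp0_n4)
  show "lorentz z f0 \<noteq> 0" "lorentz z opp0 \<noteq> 0" using f n4_cases(3)[OF uU] F0 by (auto simp: u f0_n4 opp0_n4)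
  show "lorentz z w \<noteq> 0" if w: "w \<in> Z4"
  proof -
    obtain u' where u': "w = n4 u'" "u' \<in> set Z" using w by (auto simp: Z4_def)
    then have "u' \<in> set U" "zdot u u' \<noteq> dadj" using ZU(1) ZZ u by (auto simp: list_all_iff)
    then show ?thesis using n4_cases(3)[OF uU] u u' by auto
  qed
qed

lemma Z_nonempty: "Z4 \<noteq> {}" using ZU(2) by (simp add: Z4_def)

text \<open>The walls adjacent to \<open>F\<close>; they are the crossings after which
  \<open>F\<close> continues as a facet of the neighbouring tile.\<close>

definition nbs :: "4 mink \<Rightarrow> 3 mink set" where "nbs F = {v \<in> N3. lorentz (\<iota> v) F = 0}"

definition rest :: "4 mink set" where "rest = N4 - {f0, opp0} - \<iota> ` N3 - Z4"

text \<open>Both claims translate the finite check \<open>nbU\<close> to real vectors. By the second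
  one a coloured facet that has adjacent walls is determined by them, so it can be recognised by a
  point of the polyhedron.\<close>

lemma nbs_facts:
  assumes "F \<in> rest"
  shows "v \<in> nbs F \<Longrightarrow> w \<in> nbs F \<Longrightarrow> v \<noteq> w \<Longrightarrow> lorentz v w = 0"
    and "F' \<in> rest \<Longrightarrow> nbs F = nbs F' \<Longrightarrow> nbs F \<noteq> {} \<Longrightarrow> F = F'"
proof -
  define n where "n u = filter (\<lambda>a. zdot (a0 # a) u = dadj) A" for u
  have nbs: "nbs (n4 u) = n3 ` set (n u)" if "u \<in> set U" for u
    using n4_cases(3)[OF AU' that] iota_n3 by (auto simp: nbs_def n_def N3_def)
  have n3_inj: "a \<in> set A \<Longrightarrow> b \<in> set A \<Longrightarrow> n3 a = n3 b \<Longrightarrow> a = b" for a b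
    using n4_inj[OF AU' AU'] iota_n3 by (metis list.inject)
  have r: "\<exists>u. F = n4 u \<and> u \<in> set U \<and> u \<notin> set Z \<and>
      list_all (\<lambda>a. list_all (\<lambda>b. a = b \<or> zdot (a0 # a) (a0 # b) = dadj) (n u)) (n u) \<and>
      (n u = [] \<or> list_all (\<lambda>w. u = w \<or> w \<in> set Z \<or> n w \<noteq> n u) U)" if F: "F \<in> rest" for F
  proof -
    note that = F
    obtain u where u: "F = n4 u" "u \<in> set U" using F by (auto simp: rest_def N4_def)
    have "u \<notin> set Z" "u \<noteq> [(-2, 0), (0, 0), (0, 0), (0, 0)]" "u \<noteq> [(2, 0), (0, 0), (0, 0), (0, 0)]"
      using that u by (auto simp: rest_def Z4_def f0_n4 opp0_n4)
    moreover have "u \<notin> set (map ((#) a0) A)"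
    proof
      assume "u \<in> set (map ((#) a0) A)"
      then obtain a where a: "a \<in> set A" "u = a0 # a" by auto
      then have "F = \<iota> (n3 a)" using u iota_n3 by simp
      then show False using F a by (simp add: rest_def N3_def)
    qed
    ultimately show ?thesis using nbU u unfolding list_all_iff Let_def n_def by blast
  qed
  obtain u where u: "F = n4 u" "u \<in> set U" "u \<notin> set Z"
    "list_all (\<lambda>a. list_all (\<lambda>b. a = b \<or> zdot (a0 # a) (a0 # b) = dadj) (n u)) (n u)"
    "n u = [] \<or> list_all (\<lambda>w. u = w \<or> w \<in> set Z \<or> n w \<noteq> n u) U"
    using r[OF assms] by blast
  show "lorentz v w = 0" if vw: "v \<in> nbs F" "w \<in> nbs F" "v \<noteq> w"
  proof -
    obtain a b where ab: "a \<in> set (n u)" "b \<in> set (n u)" "v = n3 a" "w = n3 b" using vw u nbs by auto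
    then have "zdot (a0 # a) (a0 # b) = dadj" using u(4) vw by (auto simp: list_all_iff)
    then show ?thesis using ab n3_orth by (auto simp: n_def)
  qed
  show "F = F'" if F': "F' \<in> rest" "nbs F = nbs F'" "nbs F \<noteq> {}"
  proof -
    obtain w where w: "F' = n4 w" "w \<in> set U" "w \<notin> set Z" using r[OF F'(1)] by blast
    have "n3 ` set (n u) = n3 ` set (n w)" using F' u w nbs by simp
    then have "set (n u) = set (n w)"
      using inj_on_image_eq_iff[of n3 "set A" "set (n u)" "set (n w)"] n3_inj by (auto simp: inj_on_def n_def)
    then have "n u = n w" unfolding n_def by (auto intro!: filter_cong)
    moreover have "n u \<noteq> []" using F'(3) nbs u by auto
    ultimately have "u = w" using u(5) w by (auto simp: list_all_iff)
    then show ?thesis using u w by simp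
  qed
qed

section \<open>Extending symmetries of the facet\<close>

lemma ext_lor: assumes "lor L" shows "lor (ext L)"
proof (rule lorI)
  have lL: "linear L" using assms by (rule lor_linear)
  show "linear (ext L)"
    by (rule linearI) (simp_all add: ext_def linear_add[OF rho_linear] linear_cmul[OF rho_linear] linear_add[OF lL]
        linear_cmul[OF lL] linear_add[OF iota_linear] linear_cmul[OF iota_linear] algebra_simps add_divide_distrib)
  have f: "lorentz (\<iota> x) f0 = 0" for x using f0_iota lorentz_sym by metis
  have g: "lorentz (\<iota> x + a *\<^sub>R f0) (\<iota> y + b *\<^sub>R f0) = lorentz x y + 2 * a * b" for x y a b
    by (simp add: f f0_iota f0_f0 iota_lorentz)
  show "lorentz (ext L x) (ext L y) = lorentz x y" for x y
    unfolding ext_def g by (subst (3) decomp[of x], subst (3) decomp[of y]) (simp only: g lor_lorentz[OF assms])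
  show "\<iota> e0 \<in> hyp" by (rule iota_hyp) simp
  show "ext L (\<iota> e0) \<in> hyp" using assms by (simp add: ext_def rho_iota f0_iota iota_hyp lor_hyp)
qed

lemma ext_iota: "linear L \<Longrightarrow> ext L (\<iota> x) = \<iota> (L x)" by (simp add: ext_def rho_iota f0_iota)

lemma ext_f0: "linear L \<Longrightarrow> ext L f0 = f0"
  by (simp add: ext_def rho_f0 f0_f0 linear_0 linear_0[OF iota_linear])

lemma ext_comp: "linear L \<Longrightarrow> linear M \<Longrightarrow> ext L (ext M y) = ext (L \<circ> M) y"
proof -
  assume l: "linear L" "linear M"
  have "lorentz f0 (ext M y) = lorentz f0 y" by (simp add: ext_def f0_iota f0_f0)
  moreover have "\<rho> (ext M y) = M (\<rho> y)"
    by (simp add: ext_def linear_add[OF rho_linear] linear_cmul[OF rho_linear] rho_iota rho_f0)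
  ultimately show ?thesis by (simp add: ext_def)
qed

lemma ext_id: "ext (\<lambda>x. x) y = y" "ext id y = y" using decomp[of y] by (simp_all add: ext_def)

lemma ext_axis: assumes "lor L" "L e0 = e0" shows "ext L (mvec t (em4 x 0)) = mvec t (em4 x 0)"
proof -
  have "\<rho> (mvec t (em4 x 0)) = (C * t - S * x) *\<^sub>R e0"
    by (intro mink_eqI) (simp_all add: \<rho>_def em4_comp pr3_em4)
  then have "L (\<rho> (mvec t (em4 x 0))) = \<rho> (mvec t (em4 x 0))" using assms by (simp add: lor_simps)
  then show ?thesis using decomp[of "mvec t (em4 x 0)"] by (simp add: ext_def)
qed

lemma ext_e0: "lor L \<Longrightarrow> L e0 = e0 \<Longrightarrow> ext L e0 = e0"
proof -
  have "em4 0 0 = 0" by (simp add: em4_def vec_eq_iff)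
  then show "lor L \<Longrightarrow> L e0 = e0 \<Longrightarrow> ext L e0 = e0" using ext_axis[of L 1 0] by simp
qed

lemma tuples_set: "X \<in> set (tuples A d n) \<Longrightarrow> set X \<subseteq> set A \<and> length X = n"
  by (induction n arbitrary: X) fastforce+

text \<open>The symmetry group is never listed. Every vector of \<open>U\<close> is given by a first
  coordinate and a multiple of a sum over a clique of walls. \<open>ext L\<close> fixes the axis,
  permutes the walls and keeps inner products, so it sends cliques to cliques and each formula to a
  formula of the same kind.\<close>

lemma ext_N4:
  assumes L: "lor L" "L e0 = e0" "\<And>v. v \<in> N3 \<Longrightarrow> L v \<in> N3" and v: "v \<in> N4"
  shows "ext L v \<in> N4"
proof -
  \<comment> \<open>The part of a wall normal perpendicular to the plane spanned by
    \<open>e0\<close> and \<open>f0\<close>.\<close>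
  define w where "w a = mvec 0 (em4 0 (\<kappa> *\<^sub>R vec3 a))" for a
  have lin: "linear (ext L)" using ext_lor[OF L(1)] by (rule lor_linear)
  have "\<exists>a'. a' \<in> set A \<and> L (n3 a) = n3 a'" if "a \<in> set A" for a
    using L(3)[of "n3 a"] that by (auto simp: N3_def)
  then obtain m where m: "\<And>a. a \<in> set A \<Longrightarrow> m a \<in> set A" "\<And>a. a \<in> set A \<Longrightarrow> L (n3 a) = n3 (m a)" by metis
  have wn: "w a = \<iota> (n3 a) - mvec s (em4 (\<kappa> * zval a0) 0)" if "a \<in> set A" for a
    unfolding iota_n3[OF that] by (simp add: w_def n4_def vec4_Cons lenA that mvec_diff em4_scale)
      (simp add: vec_eq_iff forall_4 em4_comp mvec_def split: option.splits)
  have ew: "ext L (w a) = w (m a)" if "a \<in> set A" for a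
    using wn[OF that] wn[OF m(1)[OF that]] m(2)[OF that]
    by (simp add: linear_diff[OF lin] ext_axis[OF L(1,2)] ext_iota[OF lor_linear[OF L(1)]])
  have lz: "lorentz (n3 a) (n3 b) = \<kappa>\<^sup>2 * zval (zdot a b) - (s / C)\<^sup>2" if "a \<in> set A" "b \<in> set A" for a b
    using that lenA by (simp add: n3_def lorentz_sp inner_vec3 power2_eq_square)
  \<comment> \<open>\<open>L\<close> preserves the real inner products; \<open>off\<close> turns the
    equality of real values into an equality of pairs.\<close>
  have md: "zdot (m a) (m b) = dtup" if "a \<in> set A" "b \<in> set A" "zdot a b = dtup" for a b
  proof -
    have "lorentz (n3 (m a)) (n3 (m b)) = lorentz (n3 a) (n3 b)" using m that lor_lorentz[OF L(1)] by metis
    then have "zval (zdot (m a) (m b)) = zval dtup" using lz m that pos by simp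
    moreover have "zdot (m a) (m b) = dtup \<or> zdot (m a) (m b) \<in> set offs"
      using dtup m(1)[OF that(1)] m(1)[OF that(2)] unfolding list_all_iff by blast
    ultimately show ?thesis using off by metis
  qed
  have mt: "map m X \<in> set (tuples A dtup n)" if "X \<in> set (tuples A dtup n)" for X n
    using that
  proof (induction n arbitrary: X)
    case (Suc n)
    then obtain a Y where X: "X = a # Y" "Y \<in> set (tuples A dtup n)" "a \<in> set A" "list_all (\<lambda>b. zdot a b = dtup) Y" by auto
    have "set Y \<subseteq> set A" using tuples_set X by blast
    then have "list_all (\<lambda>b. zdot (m a) b = dtup) (map m Y)" using X md by (auto simp: list_all_iff)
    then show ?case using Suc(1)[OF X(2)] X m by auto
  qed simp
  have len: "list_all (\<lambda>a. length a = 3) X" if "set X \<subseteq> set A" for X using that lenA by (auto simp: list_all_iff)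
  have cw: "n4 (comb c \<alpha> X) = mvec s (em4 (\<kappa> * zval c) 0) + zval \<alpha> *\<^sub>R (\<Sum>a\<leftarrow>X. w a)" if "set X \<subseteq> set A" for c \<alpha> X
  proof -
    have sw: "(\<Sum>a\<leftarrow>Y. w a) = mvec 0 (em4 0 (\<kappa> *\<^sub>R (\<Sum>a\<leftarrow>Y. vec3 a)))" for Y
    proof (induction Y)
      case Nil then show ?case by (simp add: mvec_def em4_def vec_eq_iff split: option.splits)
    next
      case (Cons a Y) then show ?case by (simp add: w_def mvec_add em4_add algebra_simps)
    qed
    have "vec4 (comb c \<alpha> X) = em4 (zval c) (zval \<alpha> *\<^sub>R (\<Sum>a\<leftarrow>X. vec3 a))"
      unfolding comb_def using length_zsum[OF len[OF that]] vec3_zsum[OF len[OF that]]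
      by (simp add: vec4_Cons vec3_map)
    then show ?thesis by (simp add: n4_def sw mvec_add mvec_scale em4_add em4_scale mult_ac)
  qed
  obtain u where u: "v = n4 u" "u \<in> set U" using v by (auto simp: N4_def)
  then obtain c \<alpha> n X where f: "(c, \<alpha>, n) \<in> set forms" "X \<in> set (tuples A dtup n)" "u = comb c \<alpha> X"
    unfolding forms[symmetric] gens_def by auto
  have XA: "set X \<subseteq> set A" using tuples_set f(2) by blast
  have mX: "set (map m X) \<subseteq> set A" using XA m(1) by auto
  have "ext L (\<Sum>a\<leftarrow>X. w a) = (\<Sum>a\<leftarrow>map m X. w a)" using XA
    by (induction X) (simp_all add: linear_0[OF lin] linear_add[OF lin] ew)
  then have "ext L v = n4 (comb c \<alpha> (map m X))"
    unfolding u f(3) cw[OF XA] cw[OF mX]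
    by (simp only: linear_add[OF lin] linear_cmul[OF lin] ext_axis[OF L(1,2)])
  moreover have "comb c \<alpha> (map m X) \<in> set U"
    unfolding forms[symmetric] gens_def set_remdups set_concat set_map image_image
    by (rule UN_I[OF f(1)]) (use mt[OF f(2)] in simp)
  ultimately show ?thesis by (simp add: N4_def)
qed

end

section \<open>Points of a right-angled polytope\<close>

locale ra_polytope =
  fixes \<N> :: "'n::{finite,wellorder} mink set" and s :: real
  assumes ra: "right_angled \<N> s"
begin

abbreviation P where "P \<equiv> hpoly \<N>"

definition orthset :: "'n mink set \<Rightarrow> bool" where
  "orthset V \<longleftrightarrow> V \<subseteq> \<N> \<and> (\<forall>v\<in>V. \<forall>w\<in>V. v \<noteq> w \<longrightarrow> lorentz v w = 0)"

text \<open>The orthogonal projection of \<open>e0\<close> to the intersection of the walls in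
  \<open>V\<close>, as each normal has norm 2 and product -s with \<open>e0\<close>.\<close>

definition mid :: "'n mink set \<Rightarrow> 'n mink" where "mid V = e0 + (s / 2) *\<^sub>R \<Sum>V"

definition zeros :: "'n mink \<Rightarrow> 'n mink set" where "zeros x = {v \<in> \<N>. lorentz v x = 0}"

lemma mid_lorentz:
  assumes V: "orthset V" and w: "w \<in> \<N>"
  shows "w \<in> V \<Longrightarrow> lorentz w (mid V) = 0" "w \<notin> V \<Longrightarrow> lorentz w (mid V) < 0"
proof -
  have fin: "finite V" using V right_angledD(1)[OF ra] finite_subset by (auto simp: orthset_def)
  have e: "lorentz w (mid V) = - s + s / 2 * (\<Sum>v\<in>V. lorentz w v)"
    using right_angledD(4)[OF ra w] by (simp add: mid_def lorentz_sum)
  show "lorentz w (mid V) = 0" if wV: "w \<in> V"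
  proof -
    have "(\<Sum>v\<in>V. lorentz w v) = (\<Sum>v\<in>V. if v = w then 2 else 0)"
      by (rule sum.cong) (use V wV right_angledD(3)[OF ra w] in \<open>auto simp: orthset_def\<close>)
    also have "\<dots> = 2" using wV fin by simp
    finally show ?thesis using e by simp
  qed
  show "lorentz w (mid V) < 0" if wV: "w \<notin> V"
  proof -
    have "(\<Sum>v\<in>V. lorentz w v) \<le> 0"
    proof (rule sum_nonpos)
      fix v assume v: "v \<in> V"
      then have "v \<in> \<N>" "w \<noteq> v" using V wV by (auto simp: orthset_def)
      then show "lorentz w v \<le> 0" using right_angledD(5)[OF ra w] by fastforce
    qed
    then have "s / 2 * (\<Sum>v\<in>V. lorentz w v) \<le> 0" using right_angledD(2)[OF ra] by (intro mult_nonneg_nonpos) auto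
    then show ?thesis using e right_angledD(2)[OF ra] by linarith
  qed
qed

lemma mid_timelike: assumes V: "orthset V" shows "lorentz (mid V) (mid V) < 0" "mid V $ None > 0"
proof -
  have VN: "v \<in> \<N>" if "v \<in> V" for v using V that by (auto simp: orthset_def)
  have t: "(\<Sum>V) $ None \<ge> 0"
    unfolding sum_component using right_angledD(2,4)[OF ra] VN by (intro sum_nonneg) (simp add: less_imp_le)
  then have "s / 2 * (\<Sum>V) $ None \<ge> 0" using right_angledD(2)[OF ra] by simp
  then show p: "mid V $ None > 0" by (simp add: mid_def)
  have "lorentz (\<Sum>V) (mid V) = 0"
    unfolding lorentz_sum_left using mid_lorentz(1)[OF V VN] by (intro sum.neutral) blast
  then have "lorentz (mid V) (mid V) = lorentz e0 (mid V)"
    by (subst (1) mid_def) simp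
  then show "lorentz (mid V) (mid V) < 0" using p by simp
qed

definition center :: "'n mink set \<Rightarrow> 'n mink" where "center V = nrm (mid V)"

lemma center_facts:
  assumes V: "orthset V"
  shows "center V \<in> hyp" "w \<in> V \<Longrightarrow> lorentz w (center V) = 0" "w \<in> \<N> \<Longrightarrow> w \<notin> V \<Longrightarrow> lorentz w (center V) < 0"
    "center V \<in> P" "zeros (center V) = V"
proof -
  have t: "sqrt (- lorentz (mid V) (mid V)) > 0" using mid_timelike[OF V] by simp
  show h: "center V \<in> hyp" unfolding center_def using mid_timelike[OF V] by (rule nrm_hyp)
  have VN: "V \<subseteq> \<N>" using V by (simp add: orthset_def)
  show 1: "lorentz w (center V) = 0" if "w \<in> V" for w
    using mid_lorentz(1)[OF V _ that] that VN by (auto simp: center_def lorentz_nrm)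
  show 2: "lorentz w (center V) < 0" if "w \<in> \<N>" "w \<notin> V" for w
    using mid_lorentz(2)[OF V that] t by (simp add: center_def lorentz_nrm divide_neg_pos)
  have "lorentz w (center V) \<le> 0" if "w \<in> \<N>" for w using 1 2 that by (cases "w \<in> V") (auto simp: less_imp_le)
  then show "center V \<in> P" unfolding hpoly_def using h by blast
  show "zeros (center V) = V" unfolding zeros_def using 1 2 VN by force
qed

lemma nrm_tendsto:
  assumes "(f \<longlongrightarrow> x) F" "lorentz x x < 0"
  shows "((\<lambda>t. nrm (f t)) \<longlongrightarrow> nrm x) F"
  unfolding nrm_def using assms by (intro tendsto_intros) auto

text \<open>Two small moves. The first, towards \<open>mid V\<close>, stays in the walls of
  \<open>V\<close> and leaves all others strictly; the second, in the direction \<open>y\<close>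
  tangent to the walls of \<open>V\<close>, keeps these strict inequalities. Up to scaling the two
  points differ by a multiple of \<open>y\<close>.\<close>

lemma nearby:
  assumes O: "open W" and x: "x \<in> P" "x \<in> W" and V: "orthset V" "V \<subseteq> zeros x"
    and y: "\<And>v. v \<in> V \<Longrightarrow> lorentz v y = 0"
  obtains z e where "e > 0" "z \<in> P \<inter> W" "\<And>v. v \<in> V \<Longrightarrow> lorentz v z = 0" "\<And>w. w \<in> \<N> \<Longrightarrow> w \<notin> V \<Longrightarrow> lorentz w z < 0"
    "nrm (z + e *\<^sub>R y) \<in> P \<inter> W" "\<And>v. v \<in> V \<Longrightarrow> lorentz v (nrm (z + e *\<^sub>R y)) = 0"
    "lorentz (z + e *\<^sub>R y) (z + e *\<^sub>R y) < 0"
proof -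
  have xh: "x \<in> hyp" using x by (simp add: hpoly_def)
  let ?m = "mid V"
  have lim1: "((\<lambda>d. x + d *\<^sub>R ?m) \<longlongrightarrow> x) (at_right 0)"
    by (rule tendsto_eq_intros refl | simp)+
  have "((\<lambda>d. nrm (x + d *\<^sub>R ?m)) \<longlongrightarrow> nrm x) (at_right 0)"
    by (rule nrm_tendsto[OF lim1]) (simp add: hyp_self[OF xh])
  then have "\<forall>\<^sub>F d in at_right 0. nrm (x + d *\<^sub>R ?m) \<in> W"
    using O x(2) by (simp add: nrm_id[OF xh] topological_tendstoD)
  moreover have "\<forall>\<^sub>F d in at_right (0::real). d > 0" by (simp add: eventually_at_right_less)
  ultimately have "\<forall>\<^sub>F d in at_right (0::real). nrm (x + d *\<^sub>R ?m) \<in> W \<and> d > 0" by eventually_elim auto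
  then obtain d :: real where d: "nrm (x + d *\<^sub>R ?m) \<in> W" "d > 0"
    using eventually_happens trivial_limit_at_right_real by blast
  define z where "z = nrm (x + d *\<^sub>R ?m)"
  have xm: "lorentz x ?m < 0" using causal_neg[of ?m x] mid_timelike[OF V(1)] xh by (simp add: lorentz_sym[of x])
  have "lorentz (x + d *\<^sub>R ?m) (x + d *\<^sub>R ?m) = -1 + 2 * (d * lorentz x ?m) + d * d * lorentz ?m ?m"
    by (simp add: hyp_self[OF xh] lorentz_sym[of ?m x] algebra_simps)
  moreover have "d * lorentz x ?m < 0" "d * d * lorentz ?m ?m < 0"
    using d xm mid_timelike[OF V(1)] by (simp_all add: mult_pos_neg)
  ultimately have zt: "lorentz (x + d *\<^sub>R ?m) (x + d *\<^sub>R ?m) < 0" by linarith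
  have z0: "(x + d *\<^sub>R ?m) $ None > 0" using hyp_pos[OF xh] d mid_timelike[OF V(1)] by (simp add: add_pos_pos)
  have zh: "z \<in> hyp" unfolding z_def by (rule nrm_hyp[OF zt z0])
  have zV: "lorentz v z = 0" if "v \<in> V" for v
    using that V mid_lorentz(1)[OF V(1), of v] by (auto simp: z_def lorentz_nrm zeros_def)
  have zw: "lorentz w z < 0" if w: "w \<in> \<N>" "w \<notin> V" for w
  proof -
    have "lorentz w x \<le> 0" using x(1) w by (simp add: hpoly_def)
    moreover have "d * lorentz w ?m < 0" using mid_lorentz(2)[OF V(1) w] d by (simp add: mult_pos_neg)
    ultimately have "lorentz w (x + d *\<^sub>R ?m) < 0" by simp
    then show ?thesis using zt by (simp add: z_def lorentz_nrm divide_neg_pos)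
  qed
  have "lorentz w z \<le> 0" if "w \<in> \<N>" for w using zV zw that by (cases "w \<in> V") (auto simp: less_imp_le)
  then have zP: "z \<in> P" unfolding hpoly_def using zh by blast
  have lim2: "((\<lambda>e. z + e *\<^sub>R y) \<longlongrightarrow> z) (at_right 0)"
    by (rule tendsto_eq_intros refl | simp)+
  have "((\<lambda>e. nrm (z + e *\<^sub>R y)) \<longlongrightarrow> nrm z) (at_right 0)"
    by (rule nrm_tendsto[OF lim2]) (simp add: hyp_self[OF zh])
  then have e1: "\<forall>\<^sub>F e in at_right 0. nrm (z + e *\<^sub>R y) \<in> W"
    using O d(1) by (simp add: nrm_id[OF zh] topological_tendstoD z_def[symmetric])
  have "((\<lambda>e. lorentz (z + e *\<^sub>R y) (z + e *\<^sub>R y)) \<longlongrightarrow> lorentz z z) (at_right 0)"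
    by (intro tendsto_lorentz lim2)
  then have e2: "\<forall>\<^sub>F e in at_right 0. lorentz (z + e *\<^sub>R y) (z + e *\<^sub>R y) < 0"
    using hyp_self[OF zh] by (intro order_tendstoD) auto
  have "((\<lambda>e. lorentz e0 (z + e *\<^sub>R y)) \<longlongrightarrow> lorentz e0 z) (at_right 0)"
    by (intro tendsto_lorentz lim2 tendsto_const)
  then have e3: "\<forall>\<^sub>F e in at_right 0. lorentz e0 (z + e *\<^sub>R y) < 0"
    using hyp_pos[OF zh] by (intro order_tendstoD) auto
  have e4: "\<forall>\<^sub>F e in at_right 0. \<forall>w\<in>\<N> - V. lorentz w (z + e *\<^sub>R y) < 0"
  proof (rule eventually_ball_finite)
    show "finite (\<N> - V)" using right_angledD(1)[OF ra] by simp
    show "\<forall>w\<in>\<N> - V. \<forall>\<^sub>F e in at_right 0. lorentz w (z + e *\<^sub>R y) < 0"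
    proof
      fix w assume w: "w \<in> \<N> - V"
      have "((\<lambda>e. lorentz w (z + e *\<^sub>R y)) \<longlongrightarrow> lorentz w z) (at_right 0)"
        by (intro tendsto_lorentz lim2 tendsto_const)
      then show "\<forall>\<^sub>F e in at_right 0. lorentz w (z + e *\<^sub>R y) < 0"
        using zw w by (intro order_tendstoD) auto
    qed
  qed
  have e5: "\<forall>\<^sub>F e in at_right (0::real). e > 0" by (simp add: eventually_at_right_less)
  have "\<forall>\<^sub>F e in at_right 0. nrm (z + e *\<^sub>R y) \<in> W \<and> lorentz (z + e *\<^sub>R y) (z + e *\<^sub>R y) < 0 \<and>
    lorentz e0 (z + e *\<^sub>R y) < 0 \<and> (\<forall>w\<in>\<N> - V. lorentz w (z + e *\<^sub>R y) < 0) \<and> e > 0"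
    using e1 e2 e3 e4 e5 by eventually_elim auto
  then obtain e where e: "nrm (z + e *\<^sub>R y) \<in> W" "lorentz (z + e *\<^sub>R y) (z + e *\<^sub>R y) < 0"
    "lorentz e0 (z + e *\<^sub>R y) < 0" "\<And>w. w \<in> \<N> - V \<Longrightarrow> lorentz w (z + e *\<^sub>R y) < 0" "e > 0"
    using eventually_happens trivial_limit_at_right_real by blast
  have nV: "lorentz v (nrm (z + e *\<^sub>R y)) = 0" if "v \<in> V" for v
    using zV[OF that] y[OF that] by (simp add: lorentz_nrm)
  have nw: "lorentz w (nrm (z + e *\<^sub>R y)) < 0" if "w \<in> \<N>" "w \<notin> V" for w
    using e(4)[of w] that e(2) by (simp add: lorentz_nrm divide_neg_pos)
  have nh: "nrm (z + e *\<^sub>R y) \<in> hyp" using e(2,3) by (intro nrm_hyp) auto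
  have "lorentz w (nrm (z + e *\<^sub>R y)) \<le> 0" if "w \<in> \<N>" for w using nV nw that by (cases "w \<in> V") (auto simp: less_imp_le)
  then have nP: "nrm (z + e *\<^sub>R y) \<in> P" unfolding hpoly_def using nh by blast
  show ?thesis
    by (rule that[of e z]) (use e zP d(1) nP nV zV zw in \<open>auto simp: z_def\<close>)
qed

text \<open>This recovers a linear map from its values on a relatively open piece of a face.\<close>

lemma span_local:
  assumes "openin (top_of_set P) N'" "x \<in> N'" "orthset V" "V \<subseteq> zeros x"
    and y: "\<And>v. v \<in> V \<Longrightarrow> lorentz v y = 0"
  shows "y \<in> span (N' \<inter> {z. \<forall>v\<in>V. lorentz v z = 0})"
proof -
  let ?S = "N' \<inter> {z. \<forall>v\<in>V. lorentz v z = 0}"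
  obtain W where W: "open W" "N' = P \<inter> W" using assms(1) unfolding openin_open by blast
  have x: "x \<in> P" "x \<in> W" using assms(2) W by auto
  obtain z e where ze: "e > 0" "z \<in> P \<inter> W" "\<And>v. v \<in> V \<Longrightarrow> lorentz v z = 0"
    "nrm (z + e *\<^sub>R y) \<in> P \<inter> W" "\<And>v. v \<in> V \<Longrightarrow> lorentz v (nrm (z + e *\<^sub>R y)) = 0"
    "lorentz (z + e *\<^sub>R y) (z + e *\<^sub>R y) < 0"
    using nearby[OF W(1) x assms(3,4) y] by metis
  have "z \<in> span ?S" "nrm (z + e *\<^sub>R y) \<in> span ?S" using ze W by (auto intro!: span_base)
  then have "sqrt (- lorentz (z + e *\<^sub>R y) (z + e *\<^sub>R y)) *\<^sub>R nrm (z + e *\<^sub>R y) - z \<in> span ?S"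
    by (intro span_diff span_mul)
  moreover have "sqrt (- lorentz (z + e *\<^sub>R y) (z + e *\<^sub>R y)) *\<^sub>R nrm (z + e *\<^sub>R y) = z + e *\<^sub>R y"
    using ze(6) by (simp add: nrm_def)
  ultimately have "e *\<^sub>R y \<in> span ?S" by simp
  then have "(1 / e) *\<^sub>R (e *\<^sub>R y) \<in> span ?S" by (rule span_mul)
  then show ?thesis using ze(1) by simp
qed

lemma linear_eq_local:
  assumes "linear A" "linear B" "openin (top_of_set P) N'" "x \<in> N'" "orthset V" "V \<subseteq> zeros x"
    and eq: "\<And>z. z \<in> N' \<Longrightarrow> (\<And>v. v \<in> V \<Longrightarrow> lorentz v z = 0) \<Longrightarrow> A z = B z"
    and y: "\<And>v. v \<in> V \<Longrightarrow> lorentz v y = 0"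
  shows "A y = B y"
  using linear_eq_on[OF assms(1,2) span_local[OF assms(3-6) y]] eq by blast

lemma orthset_empty: "orthset {}" by (simp add: orthset_def)

lemma linear_eq_open:
  assumes "linear A" "linear B" "openin (top_of_set P) N'" "x \<in> N'" and eq: "\<And>z. z \<in> N' \<Longrightarrow> A z = B z"
  shows "A = B"
  using linear_eq_local[OF assms(1-4) orthset_empty] eq by (metis empty_iff empty_subsetI ext)

lemma interior_point:
  assumes "openin (top_of_set P) N'" "x \<in> N'"
  obtains z where "z \<in> N'" "\<And>v. v \<in> \<N> \<Longrightarrow> lorentz v z < 0"
proof -
  obtain W where W: "open W" "N' = P \<inter> W" using assms(1) unfolding openin_open by blast
  have x: "x \<in> P" "x \<in> W" using assms(2) W by auto
  obtain z where "z \<in> P \<inter> W" "\<And>w. w \<in> \<N> \<Longrightarrow> w \<notin> {} \<Longrightarrow> lorentz w z < 0"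
    by (rule nearby[OF W(1) x orthset_empty, of "0"]) auto
  then show ?thesis using that[of z] W by simp
qed

lemma interior_open: "openin (top_of_set P) {z \<in> P. \<forall>v\<in>\<N>. lorentz v z < 0}"
proof -
  have "{z \<in> P. \<forall>v\<in>\<N>. lorentz v z < 0} = P \<inter> (\<Inter>v\<in>\<N>. {z. lorentz v z < 0})" by auto
  moreover have "open (\<Inter>v\<in>\<N>. {z. lorentz v z < 0})"
    using right_angledD(1)[OF ra] by (intro open_INT ballI open_Collect_less continuous_on_lorentz continuous_intros)
  ultimately show ?thesis using openin_open_Int[of _ P] by auto
qed

text \<open>An isometry of a face \<open>v\<close> onto a face \<open>w\<close> extends linearly; the extension takes the walls adjacent to \<open>v\<close>
  to walls adjacent to \<open>w\<close>, because these are the walls that support the face along its edges.\<close>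

lemma face_wall:
  assumes L: "lor L" "L v = w" "L ` hface \<N> v = hface \<N> w" and v: "v \<in> \<N>" "w \<in> \<N>"
    and u: "u \<in> \<N>" "lorentz u v = 0"
  shows "L u \<in> \<N>" "lorentz (L u) w = 0"
proof -
  have uv: "u \<noteq> v" using u right_angledD(3)[OF ra v(1)] by auto
  have V: "orthset {u, v}" using u v by (auto simp: orthset_def lorentz_sym)
  have V1: "orthset {v}" using v by (auto simp: orthset_def)
  define E where "E = {y \<in> P. lorentz u y = 0 \<and> lorentz v y = 0}"
  have Ef: "y \<in> hface \<N> v" if "y \<in> E" for y using that by (auto simp: E_def hface_def)
  \<comment> \<open>The walls other than \<open>w\<close> through the image of a point.\<close>
  define F where "F y = {u' \<in> \<N> - {w}. lorentz u' (L y) = 0}" for y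
  have finF: "finite (F y)" for y using right_angledD(1)[OF ra] by (simp add: F_def)
  have LP: "L y \<in> hpoly \<N>" "lorentz w (L y) = 0" if "y \<in> hface \<N> v" for y
    using L(3) that by (auto simp: hface_def)
  \<comment> \<open>If no further wall passed through \<open>L y\<close>, a short move from it in
    the direction \<open>L u\<close> would stay in the face of \<open>w\<close> and pull back to a
    point of the face of \<open>v\<close> beyond the wall \<open>u\<close>.\<close>
  have ne: "F y \<noteq> {}" if y: "y \<in> E" for y
  proof
    assume "F y = {}"
    then have neg: "lorentz u' (L y) < 0" if "u' \<in> \<N>" "u' \<noteq> w" for u'
      using that LP(1)[OF Ef[OF y]] by (force simp: F_def hpoly_def)
    have zL: "zeros (L y) = {w}" using neg LP(2)[OF Ef[OF y]] v by (force simp: zeros_def)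
    have lw: "lorentz w (L u) = 0" using lor_lorentz[OF L(1), of v u] L(2) u(2) by (simp add: lorentz_sym)
    have V2: "orthset {w}" using v by (auto simp: orthset_def)
    have Lyh: "L y \<in> hyp" using LP(1)[OF Ef[OF y]] by (simp add: hpoly_def)
    have lim: "((\<lambda>e. L y + e *\<^sub>R L u) \<longlongrightarrow> L y) (at_right 0)" by (rule tendsto_eq_intros refl | simp)+
    have e4: "\<forall>\<^sub>F e in at_right 0. \<forall>u'\<in>\<N> - {w}. lorentz u' (L y + e *\<^sub>R L u) < 0"
    proof (rule eventually_ball_finite)
      show "finite (\<N> - {w})" using right_angledD(1)[OF ra] by simp
      show "\<forall>u'\<in>\<N> - {w}. \<forall>\<^sub>F e in at_right 0. lorentz u' (L y + e *\<^sub>R L u) < 0"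
      proof
        fix u' assume u': "u' \<in> \<N> - {w}"
        have "((\<lambda>e. lorentz u' (L y + e *\<^sub>R L u)) \<longlongrightarrow> lorentz u' (L y)) (at_right 0)"
          by (intro tendsto_lorentz lim tendsto_const)
        then show "\<forall>\<^sub>F e in at_right 0. lorentz u' (L y + e *\<^sub>R L u) < 0"
          using neg u' by (intro order_tendstoD) auto
      qed
    qed
    have "((\<lambda>e. lorentz (L y + e *\<^sub>R L u) (L y + e *\<^sub>R L u)) \<longlongrightarrow> lorentz (L y) (L y)) (at_right 0)"
      by (intro tendsto_lorentz lim)
    then have e2: "\<forall>\<^sub>F e in at_right 0. lorentz (L y + e *\<^sub>R L u) (L y + e *\<^sub>R L u) < 0"
      using hyp_self[OF Lyh] by (intro order_tendstoD) auto
    have "((\<lambda>e. lorentz e0 (L y + e *\<^sub>R L u)) \<longlongrightarrow> lorentz e0 (L y)) (at_right 0)"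
      by (intro tendsto_lorentz lim tendsto_const)
    then have e3: "\<forall>\<^sub>F e in at_right 0. lorentz e0 (L y + e *\<^sub>R L u) < 0"
      using hyp_pos[OF Lyh] by (intro order_tendstoD) auto
    have e5: "\<forall>\<^sub>F e in at_right (0::real). e > 0" by (simp add: eventually_at_right_less)
    have "\<forall>\<^sub>F e in at_right 0. (\<forall>u'\<in>\<N> - {w}. lorentz u' (L y + e *\<^sub>R L u) < 0) \<and>
      lorentz (L y + e *\<^sub>R L u) (L y + e *\<^sub>R L u) < 0 \<and> lorentz e0 (L y + e *\<^sub>R L u) < 0 \<and> e > 0"
      using e2 e3 e4 e5 by eventually_elim auto
    then obtain e where e: "\<And>u'. u' \<in> \<N> - {w} \<Longrightarrow> lorentz u' (L y + e *\<^sub>R L u) < 0"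
      "lorentz (L y + e *\<^sub>R L u) (L y + e *\<^sub>R L u) < 0" "lorentz e0 (L y + e *\<^sub>R L u) < 0" "e > 0"
      using eventually_happens trivial_limit_at_right_real by blast
    define p where "p = nrm (L y + e *\<^sub>R L u)"
    have "p \<in> hyp" unfolding p_def using e by (intro nrm_hyp) auto
    moreover have pw: "lorentz w p = 0" unfolding p_def using lw LP(2)[OF Ef[OF y]] by (simp add: lorentz_nrm)
    moreover have "lorentz u' p < 0" if "u' \<in> \<N> - {w}" for u'
      unfolding p_def using e(1)[OF that] e(2) by (simp add: lorentz_nrm divide_neg_pos)
    ultimately have "p \<in> hface \<N> w" using v by (force simp: hface_def hpoly_def)
    then obtain x where x: "x \<in> hface \<N> v" "p = L x" using L(3) by blast
    have "lorentz u x = lorentz (L u) p" using x lor_lorentz[OF L(1)] by simp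
    also have "\<dots> = (lorentz (L u) (L y) + e * lorentz (L u) (L u)) / sqrt (- lorentz (L y + e *\<^sub>R L u) (L y + e *\<^sub>R L u))"
      by (simp add: p_def lorentz_nrm)
    also have "lorentz (L u) (L y) = 0" using y lor_lorentz[OF L(1)] by (simp add: E_def)
    also have "lorentz (L u) (L u) = 2" using right_angledD(3)[OF ra u(1)] lor_lorentz[OF L(1)] by simp
    finally have "lorentz u x > 0" using e by simp
    then show False using x u by (force simp: hface_def hpoly_def)
  qed
  have cE: "center {u, v} \<in> E" using center_facts[OF V] by (simp add: E_def)
  \<comment> \<open>The image of \<open>y\<close> lies on as few walls as possible. The images of
    nearby points of \<open>E\<close> lie on no other walls, so by minimality they lie on the same
    ones.\<close>
  then obtain y where y: "y \<in> E" "\<And>y'. y' \<in> E \<Longrightarrow> card (F y) \<le> card (F y')"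
    using ex_has_least_nat[of "\<lambda>y. y \<in> E" "center {u, v}" "\<lambda>y. card (F y)"] by blast
  obtain u' where u': "u' \<in> F y" using ne[OF y(1)] by blast
  have yP: "y \<in> P" "y \<in> hyp" using y by (auto simp: E_def hpoly_def)
  define W where "W = (\<Inter>b\<in>\<N> - {w} - F y. {z. lorentz b (L z) < 0})"
  have Lc: "continuous_on UNIV L" using lor_continuous[OF L(1)] .
  have "open W" unfolding W_def
    using right_angledD(1)[OF ra] Lc by (intro open_INT ballI open_Collect_less continuous_intros) auto
  then have oW: "openin (top_of_set P) (P \<inter> W)" by (simp add: openin_open_Int)
  have "y \<in> W" unfolding W_def using LP(1)[OF Ef[OF y(1)]] by (force simp: F_def hpoly_def)
  have van: "lorentz u' (L z) = 0" if z: "z \<in> P \<inter> W" "lorentz u z = 0" "lorentz v z = 0" for z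
  proof -
    have "z \<in> E" using z by (auto simp: E_def)
    have "F z \<subseteq> F y" using z by (force simp: F_def W_def)
    then have "F z = F y" using y(2)[OF \<open>z \<in> E\<close>] finF card_seteq by metis
    then show ?thesis using u' by (auto simp: F_def)
  qed
  define b where "b = inv L u'"
  have Lb: "L b = u'" using lor_inv_simps[OF L(1)] by (simp add: b_def)
  have bz: "lorentz b z = 0" if z: "lorentz u z = 0" "lorentz v z = 0" for z
  proof -
    have "z \<in> span ((P \<inter> W) \<inter> {z. \<forall>v'\<in>{u, v}. lorentz v' z = 0})"
      by (rule span_local[OF oW _ V, of y]) (use \<open>y \<in> W\<close> y z u v in \<open>auto simp: E_def zeros_def\<close>)
    then show ?thesis
    proof (induction rule: span_induct_alt)
      case base then show ?case by simp
    next
      case (step c x z)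
      have "lorentz b x = lorentz u' (L x)" using lor_lorentz[OF L(1), of b x] Lb by simp
      also have "\<dots> = 0" using step van by auto
      finally show ?case using step by simp
    qed
  qed
  have norms: "lorentz u u = 2" "lorentz v v = 2" "lorentz v u = 0"
    using u v right_angledD(3)[OF ra] by (auto simp: lorentz_sym)
  have u'N: "u' \<in> \<N>" "u' \<noteq> w" "lorentz u' (L y) = 0" using u' by (auto simp: F_def)
  have u'w: "lorentz u' w = 0"
    using right_angled_orth[OF ra u'N(1) v(2) u'N(2), of "L y"] u'N(3) LP[OF Ef[OF y(1)]] by (simp add: hpoly_def)
  have bv: "lorentz b v = 0" using lor_lorentz[OF L(1), of b v] Lb L(2) u'w by simp
  define a where "a = lorentz b u / 2"
  \<comment> \<open>\<open>b\<close> vanishes on the vectors orthogonal to both \<open>u\<close> and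
    \<open>v\<close>, and it is orthogonal to \<open>v\<close>; hence it is a multiple of
    \<open>u\<close>.\<close>
  have "b - a *\<^sub>R u = 0"
  proof (rule lorentz_nondeg)
    fix z
    define z' where "z' = z - (lorentz u z / 2) *\<^sub>R u - (lorentz v z / 2) *\<^sub>R v"
    have "lorentz b z' = 0" by (rule bz) (simp_all add: z'_def norms u(2))
    then have "lorentz b z = lorentz u z / 2 * lorentz b u" using bv by (simp add: z'_def)
    then show "lorentz (b - a *\<^sub>R u) z = 0" by (simp add: a_def)
  qed
  then have ba: "b = a *\<^sub>R u" by simp
  have "lorentz b b = 2" using lor_lorentz[OF L(1), of b b] Lb right_angledD(3)[OF ra u'N(1)] by simp
  then have aa: "a * a = 1" using ba norms by simp
  \<comment> \<open>The sign of \<open>a\<close> is read off at the centre of the face, which lies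
    strictly inside the wall \<open>u\<close>.\<close>
  have c: "center {v} \<in> hface \<N> v" "lorentz u (center {v}) < 0"
    using center_facts[OF V1] u uv by (auto simp: hface_def)
  have "lorentz u' (L (center {v})) \<le> 0" using LP(1)[OF c(1)] u'N by (simp add: hpoly_def)
  then have "a * lorentz u (center {v}) \<le> 0" using lor_lorentz[OF L(1), of b "center {v}"] Lb ba by simp
  then have "a \<ge> 0" using c(2) by (simp add: mult_le_0_iff)
  then have "a = 1" using aa by (metis abs_of_nonneg abs_mult_self_eq abs_1 mult.right_neutral power2_eq_square power2_eq_1_iff not_one_le_zero zero_le_one neg_0_le_iff_le)
  then have "L u = u'" using ba Lb by simp
  then show "L u \<in> \<N>" "lorentz (L u) w = 0" using u'N u'w by auto
qed

end

section \<open>The combinatorics of a tessellated manifold\<close>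

text \<open>The assumptions on the polyhedron make the linear extension of a face pairing fix
  \<open>e0\<close> (\<open>nondeg\<close>) and permute all walls (\<open>anti\<close>,
  \<open>cover\<close>). \<open>dist\<close> is the part of niceness that the development in charts
  uses: the two sides of a face are different copies.\<close>

locale tess = ra_polytope \<N> s for \<N> :: "'n::{finite,wellorder} mink set" and s +
  fixes X :: "'p topology" and Ac :: "('p, 'n) hchart set" and k :: nat
    and \<tau> :: "nat \<times> 'n mink \<Rightarrow> nat \<times> 'n mink" and g :: "nat \<times> 'n mink \<Rightarrow> 'n mink \<Rightarrow> 'n mink"
    and h :: "nat \<times> 'n mink \<Rightarrow> 'p"
  assumes anti: "v \<in> \<N> \<Longrightarrow> (2 * s) *\<^sub>R e0 - v \<in> \<N>"
    and cover: "v \<in> \<N> \<Longrightarrow> w \<in> \<N> \<Longrightarrow> w = v \<or> lorentz w v = 0 \<or> (2 * s) *\<^sub>R e0 - w = v \<or> lorentz ((2 * s) *\<^sub>R e0 - w) v = 0"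
    and nondeg: "v \<in> \<N> \<Longrightarrow> lorentz x v = 0 \<Longrightarrow> (\<And>u. u \<in> \<N> \<Longrightarrow> lorentz u v = 0 \<Longrightarrow> lorentz x u = 0) \<Longrightarrow> x = 0"
    and mfd: "hyp_manifold X Ac"
    and tes: "tessellation \<N> X Ac k \<tau> g h"
    and dist: "i < k \<Longrightarrow> v \<in> \<N> \<Longrightarrow> fst (\<tau> (i, v)) \<noteq> i"
begin

definition nb3 :: "nat \<Rightarrow> 'n mink \<Rightarrow> nat" where "nb3 i v = fst (\<tau> (i, v))"
definition wl :: "nat \<Rightarrow> 'n mink \<Rightarrow> 'n mink" where "wl i v = snd (\<tau> (i, v))"

lemma tau_eq: "\<tau> (i, v) = (nb3 i v, wl i v)" by (simp add: nb3_def wl_def)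

lemma pairing:
  assumes "i < k" "v \<in> \<N>"
  shows "nb3 i v < k" "wl i v \<in> \<N>" "\<tau> (nb3 i v, wl i v) = (i, v)"
    "bij_betw (g (i, v)) (hface \<N> v) (hface \<N> (wl i v))"
    "x \<in> hface \<N> v \<Longrightarrow> y \<in> hface \<N> v \<Longrightarrow> hdist (g (i, v) x) (g (i, v) y) = hdist x y"
    "x \<in> hface \<N> v \<Longrightarrow> g (nb3 i v, wl i v) (g (i, v) x) = x" "nb3 i v \<noteq> i"
proof -
  have "face_pairing \<N> k \<tau> g" using tes by (simp add: tessellation_def)
  from this[unfolded face_pairing_def, rule_format, of "(i, v)"] assms
  show "nb3 i v < k" "wl i v \<in> \<N>" "\<tau> (nb3 i v, wl i v) = (i, v)"
    "bij_betw (g (i, v)) (hface \<N> v) (hface \<N> (wl i v))"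
    "x \<in> hface \<N> v \<Longrightarrow> y \<in> hface \<N> v \<Longrightarrow> hdist (g (i, v) x) (g (i, v) y) = hdist x y"
    "x \<in> hface \<N> v \<Longrightarrow> g (nb3 i v, wl i v) (g (i, v) x) = x"
    by (simp_all add: tau_eq)
  show "nb3 i v \<noteq> i" using dist[OF assms] by (simp add: nb3_def)
qed

lemma hface_hyp: "x \<in> hface \<N> v \<Longrightarrow> x \<in> hyp \<and> x \<in> P \<and> lorentz v x = 0"
  by (auto simp: hface_def hpoly_def)

lemma span_face: assumes v: "v \<in> \<N>" shows "span (hface \<N> v \<union> {v}) = UNIV"
proof -
  have V: "orthset {v}" using v by (auto simp: orthset_def)
  have "y \<in> span (hface \<N> v \<union> {v})" for y
  proof -
    define y' where "y' = y - (lorentz v y / 2) *\<^sub>R v"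
    have "y' \<in> span (P \<inter> {z. \<forall>v'\<in>{v}. lorentz v' z = 0})"
    proof (rule span_local[OF _ _ V])
      show "center {v} \<in> P" "{v} \<subseteq> zeros (center {v})" using center_facts[OF V] by auto
      show "lorentz v' y' = 0" if "v' \<in> {v}" for v'
        using that right_angledD(3)[OF ra v] by (simp add: y'_def)
    qed auto
    also have "P \<inter> {z. \<forall>v'\<in>{v}. lorentz v' z = 0} = hface \<N> v" by (auto simp: hface_def)
    finally have "y' \<in> span (hface \<N> v \<union> {v})" using span_mono[of "hface \<N> v" "hface \<N> v \<union> {v}"] by blast
    moreover have "(lorentz v y / 2) *\<^sub>R v \<in> span (hface \<N> v \<union> {v})" by (intro span_mul span_base) simp
    ultimately have "y' + (lorentz v y / 2) *\<^sub>R v \<in> span (hface \<N> v \<union> {v})" by (rule span_add)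
    then show ?thesis by (simp add: y'_def)
  qed
  then show ?thesis by blast
qed

lemma face_ext_unique:
  assumes "linear A" "linear B" "v \<in> \<N>" "A v = B v" "\<And>x. x \<in> hface \<N> v \<Longrightarrow> A x = B x"
  shows "A = B"
proof
  fix y
  have "y \<in> span (hface \<N> v \<union> {v})" using span_face[OF assms(3)] by simp
  then show "A y = B y" by (rule linear_eq_on[OF assms(1,2)]) (use assms(4,5) in auto)
qed

text \<open>The outward normal goes to the outward normal of the partner, so \<open>L\<close>
  superimposes neighbouring copies and is a symmetry of the polyhedron. The reflection that lays
  them side by side is composed separately in \<open>reach\<close>.\<close>

definition L :: "nat \<Rightarrow> 'n mink \<Rightarrow> 'n mink \<Rightarrow> 'n mink" where
  "L i v = (SOME A. lor A \<and> A v = wl i v \<and> (\<forall>x\<in>hface \<N> v. A x = g (i, v) x))"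

text \<open>A face together with its normal spans the space, and the pairing with the assignment of
  normals preserves products on this set, so \<open>lor_extend\<close> applies.\<close>

lemma L_props:
  assumes iv: "i < k" "v \<in> \<N>"
  shows "lor (L i v)" "L i v v = wl i v" "x \<in> hface \<N> v \<Longrightarrow> L i v x = g (i, v) x"
    "L i v ` hface \<N> v = hface \<N> (wl i v)"
proof -
  let ?w = "wl i v"
  define f where "f x = (if x = v then ?w else g (i, v) x)" for x
  have vn: "v \<notin> hface \<N> v" using right_angledD(3)[OF ra iv(2)] by (auto simp: hface_def)
  have gf: "g (i, v) x \<in> hface \<N> ?w" if "x \<in> hface \<N> v" for x
    using bij_betwE[OF pairing(4)[OF iv]] that by blast
  have f1: "f x = g (i, v) x" if "x \<in> hface \<N> v" for x using that vn by (auto simp: f_def)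
  have pres: "lorentz (f x) (f y) = lorentz x y" if xy: "x \<in> hface \<N> v \<union> {v}" "y \<in> hface \<N> v \<union> {v}" for x y
  proof -
    have 1: "lorentz (f x) (f y) = lorentz x y" if "x \<in> hface \<N> v" "y \<in> hface \<N> v" for x y
    proof -
      have "x \<in> hyp" "y \<in> hyp" "f x \<in> hyp" "f y \<in> hyp" using gf[OF that(1)] gf[OF that(2)] f1 hface_hyp that by simp_all
      then show ?thesis using pairing(5)[OF iv that] hdist_eq_iff[of "f x" "f y" x y] f1 that by simp
    qed
    have 2: "lorentz ?w (f x) = 0" "lorentz v x = 0" if "x \<in> hface \<N> v" for x
      using f1[OF that] gf[OF that] that by (auto simp: hface_def)
    have 3: "lorentz ?w ?w = lorentz v v" using right_angledD(3)[OF ra] iv pairing(2)[OF iv] by simp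
    have fv: "f v = ?w" by (simp add: f_def)
    consider "x \<in> hface \<N> v" "y \<in> hface \<N> v" | "x = v" "y \<in> hface \<N> v" | "x \<in> hface \<N> v" "y = v" | "x = v" "y = v"
      using xy by blast
    then show ?thesis
    proof cases
      case 3
      then show ?thesis using 2[OF 3(1)] fv lorentz_sym[of "f x" ?w] lorentz_sym[of x v] by simp
    qed (use 1 2 3 fv in simp_all)
  qed
  obtain A where A: "linear A" "\<And>x y. lorentz (A x) (A y) = lorentz x y" "\<And>x. x \<in> hface \<N> v \<union> {v} \<Longrightarrow> A x = f x"
    using lor_extend[OF span_face[OF iv(2)] pres] by metis
  have "orthset {v}" using iv by (auto simp: orthset_def)
  then have c: "center {v} \<in> hface \<N> v" using center_facts[of "{v}"] by (auto simp: hface_def)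
  have "lor A"
    using A(3)[of "center {v}"] c f1[OF c] gf[OF c] hface_hyp by (intro lorI[OF A(1,2), of "center {v}"]) auto
  then have "\<exists>A. lor A \<and> A v = ?w \<and> (\<forall>x\<in>hface \<N> v. A x = g (i, v) x)"
    using A(3) f1 by (intro exI[of _ A]) (simp add: f_def)
  then have *: "lor (L i v) \<and> L i v v = ?w \<and> (\<forall>x\<in>hface \<N> v. L i v x = g (i, v) x)"
    unfolding L_def by (rule someI_ex)
  then show "lor (L i v)" "L i v v = ?w" "x \<in> hface \<N> v \<Longrightarrow> L i v x = g (i, v) x" by auto
  have "L i v ` hface \<N> v = g (i, v) ` hface \<N> v" using * by (intro image_cong) auto
  then show "L i v ` hface \<N> v = hface \<N> ?w" using pairing(4)[OF iv] by (simp add: bij_betw_def)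
qed

lemma L_back:
  assumes iv: "i < k" "v \<in> \<N>"
  shows "nb3 (nb3 i v) (wl i v) = i" "wl (nb3 i v) (wl i v) = v" "L (nb3 i v) (wl i v) (L i v x) = x"
proof -
  note p = pairing[OF iv]
  show n: "nb3 (nb3 i v) (wl i v) = i" "wl (nb3 i v) (wl i v) = v" using p(3) by (simp_all add: nb3_def wl_def)
  have "L (nb3 i v) (wl i v) \<circ> L i v = id"
  proof (rule face_ext_unique)
    show "linear (L (nb3 i v) (wl i v) \<circ> L i v)"
      using L_props(1)[OF iv] L_props(1)[OF p(1,2)] lor_linear linear_compose by blast
    show "linear id" by (rule linear_id)
    show "(L (nb3 i v) (wl i v) \<circ> L i v) v = id v" using L_props(2)[OF iv] L_props(2)[OF p(1,2)] n by simp
    fix x assume x: "x \<in> hface \<N> v"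
    then have "g (i, v) x \<in> hface \<N> (wl i v)" using bij_betwE[OF p(4)] by blast
    then show "(L (nb3 i v) (wl i v) \<circ> L i v) x = id x"
      using L_props(3)[OF iv x] L_props(3)[OF p(1,2)] p(6)[OF x] by simp
  qed (rule iv)
  then show "L (nb3 i v) (wl i v) (L i v x) = x" by (metis comp_apply id_apply)
qed

lemma L_nbrs:
  assumes "i < k" "v \<in> \<N>" "u \<in> \<N>" "lorentz u v = 0"
  shows "L i v u \<in> \<N>" "lorentz (L i v u) (wl i v) = 0"
  using face_wall[OF L_props(1)[OF assms(1,2)] L_props(2)[OF assms(1,2)] L_props(4)[OF assms(1,2)] assms(2)
      pairing(2)[OF assms(1,2)] assms(3,4)] by auto

text \<open>\<open>e0\<close> has product -s with every normal, and by \<open>face_wall\<close> the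
  walls around \<open>wl i v\<close> are images of walls. So \<open>L i v e0 - e0\<close> is
  orthogonal to \<open>wl i v\<close> and to everything around it.\<close>

lemma L_e0: assumes iv: "i < k" "v \<in> \<N>" shows "L i v e0 = e0"
proof -
  note p = pairing[OF iv]
  have "L i v e0 - e0 = 0"
  proof (rule nondeg[OF p(2)])
    have e: "lorentz e0 v = - s" if "v \<in> \<N>" for v using right_angledD(4)[OF ra that] by simp
    have 1: "lorentz (L i v e0) (L i v u) = lorentz e0 u" for u by (rule lor_lorentz[OF L_props(1)[OF iv]])
    show "lorentz (L i v e0 - e0) (wl i v) = 0" using 1[of v] L_props(2)[OF iv] e p(2) iv by simp
    fix u assume u: "u \<in> \<N>" "lorentz u (wl i v) = 0"
    define u' where "u' = L (nb3 i v) (wl i v) u"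
    have u': "u' \<in> \<N>" using L_nbrs(1)[OF p(1,2) u] by (simp add: u'_def)
    have "L i v u' = u" using L_back(3)[OF p(1,2), of u] L_back(1,2)[OF iv] by (simp add: u'_def)
    then show "lorentz (L i v e0 - e0) u = 0" using 1[of u'] e u' u by simp
  qed
  then show ?thesis by simp
qed

text \<open>Neighbours of \<open>v\<close> are settled by \<open>face_wall\<close>. The remaining
  walls are antipodes of walls already treated, and fixing \<open>e0\<close> lets the map respect
  antipodes.\<close>

lemma L_N: assumes iv: "i < k" "v \<in> \<N>" and u: "u \<in> \<N>" shows "L i v u \<in> \<N>"
proof -
  have l: "L i v ((2 * s) *\<^sub>R e0 - x) = (2 * s) *\<^sub>R e0 - L i v x" for x
    using L_e0[OF iv] by (simp add: lor_simps[OF L_props(1)[OF iv]])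
  consider "u = v" | "lorentz u v = 0" | "(2 * s) *\<^sub>R e0 - u = v" | "lorentz ((2 * s) *\<^sub>R e0 - u) v = 0"
    using cover[OF iv(2) u] by blast
  then show ?thesis
  proof cases
    case 1 then show ?thesis using L_props(2)[OF iv] pairing(2)[OF iv] by simp
  next
    case 2 then show ?thesis using L_nbrs(1)[OF iv u] by simp
  next
    case 3
    then have "(2 * s) *\<^sub>R e0 - L i v u = wl i v" using l[of u] L_props(2)[OF iv] by simp
    then have "L i v u = (2 * s) *\<^sub>R e0 - wl i v" by (simp add: algebra_simps)
    then show ?thesis using anti[OF pairing(2)[OF iv]] by simp
  next
    case 4
    have "L i v ((2 * s) *\<^sub>R e0 - u) \<in> \<N>" using L_nbrs(1)[OF iv anti[OF u] 4] .
    from anti[OF this] show ?thesis unfolding l by simp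
  qed
qed

lemma L_P: assumes iv: "i < k" "v \<in> \<N>" and x: "x \<in> P" shows "L i v x \<in> P"
proof -
  note p = pairing[OF iv]
  have "lorentz w (L i v x) \<le> 0" if w: "w \<in> \<N>" for w
  proof -
    define w' where "w' = L (nb3 i v) (wl i v) w"
    have "L i v w' = w" using L_back(3)[OF p(1,2), of w] L_back(1,2)[OF iv] by (simp add: w'_def)
    moreover have "w' \<in> \<N>" using L_N[OF p(1,2) w] by (simp add: w'_def)
    ultimately show ?thesis using x lor_lorentz[OF L_props(1)[OF iv], of w' x] by (auto simp: hpoly_def)
  qed
  then show ?thesis using x lor_hyp[OF L_props(1)[OF iv]] by (auto simp: hpoly_def)
qed

section \<open>Developing a tessellated manifold in a chart\<close>

text \<open>Near \<open>x\<close> the chart shows the copy \<open>j\<close> in the position given by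
  \<open>G\<close>.\<close>

definition dev :: "'p set \<Rightarrow> ('p \<Rightarrow> 'n mink) \<Rightarrow> ('n mink \<Rightarrow> 'n mink) \<Rightarrow> nat \<Rightarrow> 'n mink \<Rightarrow> bool" where
  "dev U \<phi> G j x \<longleftrightarrow> (\<exists>N. openin (top_of_set P) N \<and> x \<in> N \<and> (\<forall>y\<in>N. h (j, y) \<in> U \<and> \<phi> (h (j, y)) = G y))"

lemma glue_iff: "i < k \<Longrightarrow> x \<in> P \<Longrightarrow> j < k \<Longrightarrow> y \<in> P \<Longrightarrow>
    h (i, x) = h (j, y) \<longleftrightarrow> ((i, x), (j, y)) \<in> (face_glue \<N> k \<tau> g)\<^sup>*"
  using tes by (auto simp: tessellation_def)

lemma glue_step: assumes "i < k" "v \<in> \<N>" "x \<in> P" "lorentz v x = 0" shows "h (nb3 i v, L i v x) = h (i, x)"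
proof -
  have xf: "x \<in> hface \<N> v" using assms by (simp add: hface_def)
  have "((i, x), (nb3 i v, L i v x)) \<in> face_glue \<N> k \<tau> g"
    unfolding face_glue_def using assms xf L_props(3)[OF assms(1,2) xf] by (auto simp: nb3_def)
  then show ?thesis using glue_iff[OF assms(1,3) pairing(1)[OF assms(1,2)] L_P[OF assms(1-3)]] by auto
qed

lemma glue_interior:
  assumes "((i, z), b) \<in> (face_glue \<N> k \<tau> g)\<^sup>*" "\<And>v. v \<in> \<N> \<Longrightarrow> lorentz v z < 0" shows "b = (i, z)"
  using assms(1)
proof (induction rule: rtrancl_induct)
  case (step y b)
  then show ?case using assms(2) by (fastforce simp: face_glue_def hface_def)
qed simp

lemma h_cont: assumes "i < k" shows "continuous_map (top_of_set P) X (\<lambda>x. h (i, x))"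
proof -
  have 1: "continuous_map (prod_topology (discrete_topology {..<k}) (top_of_set P)) X h"
    using tes quotient_imp_continuous_map by (auto simp: tessellation_def)
  have 2: "continuous_map (top_of_set P) (prod_topology (discrete_topology {..<k}) (top_of_set P)) (\<lambda>x. (i, x))"
    using assms by (intro continuous_map_pairedI) auto
  show ?thesis using continuous_map_compose[OF 2 1] by (simp add: o_def)
qed

lemma h_open: assumes "i < k" "openin X W" shows "openin (top_of_set P) {y \<in> P. h (i, y) \<in> W}"
  using openin_continuous_map_preimage[OF h_cont[OF assms(1)] assms(2)] by simp

lemma h_topspace: "i < k \<Longrightarrow> x \<in> P \<Longrightarrow> h (i, x) \<in> topspace X"
  using h_cont[of i] by (auto simp: continuous_map_def)

lemma chart_facts:
  assumes "(U, \<phi>) \<in> Ac" shows "openin X U" "inj_on \<phi> U"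
proof -
  have c: "hyp_chart X (U, \<phi>)" using mfd assms by (auto simp: hyp_manifold_def hyp_atlas_def)
  then show o: "openin X U" by (simp add: hyp_chart_def)
  have "topspace (subtopology X U) = U" using openin_subset[OF o] by auto
  moreover have "homeomorphic_map (subtopology X U) (top_of_set (\<phi> ` U)) \<phi>" using c by (simp add: hyp_chart_def)
  ultimately show "inj_on \<phi> U" using homeomorphic_imp_injective_map by metis
qed

text \<open>\<open>hyp\<close> spans the space and equal distances mean equal products, so
  \<open>lor_extend\<close> applies.\<close>

lemma isometry_lor:
  fixes G :: "'n mink \<Rightarrow> 'n mink"
  assumes "hyp_isometry G"
  obtains A where "lor A" "\<And>x. x \<in> hyp \<Longrightarrow> A x = G x"
proof -
  have sp: "span hyp = (UNIV :: 'n mink set)"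
  proof -
    have "y \<in> span hyp" for y :: "'n mink"
    proof -
      have "y \<in> span (P \<inter> {z. \<forall>v\<in>{}. lorentz v z = 0})"
        by (rule span_local[of P "center {}"]) (use center_facts[OF orthset_empty] orthset_empty in auto)
      also have "\<dots> \<subseteq> span hyp" by (rule span_mono) (auto simp: hpoly_def)
      finally show ?thesis .
    qed
    then show ?thesis by blast
  qed
  have Gh: "G x \<in> hyp" if "x \<in> hyp" for x
    using assms that by (auto simp: hyp_isometry_def bij_betw_def)
  have pr: "lorentz (G x) (G y) = lorentz x y" if "x \<in> hyp" "y \<in> hyp" for x y
  proof -
    have "hdist (G x) (G y) = hdist x y" using assms that by (auto simp: hyp_isometry_def)
    then show ?thesis using hdist_eq_iff[of "G x" "G y" x y] that Gh by blast
  qed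
  obtain A where A: "linear A" "\<And>x y. lorentz (A x) (A y) = lorentz x y" "\<And>x. x \<in> hyp \<Longrightarrow> A x = G x"
    using lor_extend[OF sp pr] by metis
  have "lor A" by (rule lorI[OF A(1,2), of e0]) (use A(3)[of e0] Gh[of e0] in auto)
  then show ?thesis using that A(3) by blast
qed

lemma dev_exists:
  assumes "i < k" "x \<in> P" obtains U \<phi> G where "(U, \<phi>) \<in> Ac" "lor G" "dev U \<phi> G i x"
proof -
  have "\<forall>i<k. \<forall>x\<in>P. \<exists>(U, \<phi>)\<in>Ac. \<exists>G N. hyp_isometry G \<and> openin (top_of_set P) N \<and> x \<in> N \<and>
      (\<forall>y\<in>N. h (i, y) \<in> U \<and> \<phi> (h (i, y)) = G y)"
    using tes unfolding tessellation_def by (elim conjE)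
  then obtain c where c: "c \<in> Ac" "case c of (U, \<phi>) \<Rightarrow> \<exists>G N. hyp_isometry G \<and> openin (top_of_set P) N \<and> x \<in> N \<and>
      (\<forall>y\<in>N. h (i, y) \<in> U \<and> \<phi> (h (i, y)) = G y)" using assms by blast
  obtain U \<phi> where Uc: "c = (U, \<phi>)" by (cases c)
  obtain G N where "hyp_isometry G \<and> openin (top_of_set P) N \<and> x \<in> N \<and> (\<forall>y\<in>N. h (i, y) \<in> U \<and> \<phi> (h (i, y)) = G y)"
    using c(2) unfolding Uc prod.case by blast
  then have *: "(U, \<phi>) \<in> Ac" "hyp_isometry G" "openin (top_of_set P) N" "x \<in> N"
    "\<And>y. y \<in> N \<Longrightarrow> h (i, y) \<in> U \<and> \<phi> (h (i, y)) = G y" using c(1) Uc by simp_all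
  obtain A where A: "lor A" "\<And>x. x \<in> hyp \<Longrightarrow> A x = G x" using isometry_lor[OF *(2)] by metis
  have "N \<subseteq> hyp" using openin_imp_subset[OF *(3)] by (auto simp: hpoly_def)
  then have "dev U \<phi> A i x" unfolding dev_def using * A(2) by (intro exI[of _ N]) auto
  then show ?thesis using that *(1) A(1) by blast
qed

lemma dev_change:
  assumes U: "(U, \<phi>) \<in> Ac" and ix: "i < k" "x \<in> P" "h (i, x) \<in> U"
  obtains G where "lor G" "dev U \<phi> G i x"
proof -
  obtain V \<psi> G where V: "(V, \<psi>) \<in> Ac" "lor G" "dev V \<psi> G i x" using dev_exists[OF ix(1,2)] by metis
  obtain N where N: "openin (top_of_set P) N" "x \<in> N" "\<And>y. y \<in> N \<Longrightarrow> h (i, y) \<in> V \<and> \<psi> (h (i, y)) = G y"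
    using V(3) unfolding dev_def by metis
  have "h (i, x) \<in> V \<inter> U" using N ix by blast
  moreover have "compatible_via {g. hyp_isometry g} X (V, \<psi>) (U, \<phi>)"
  proof -
    have "\<forall>c\<in>Ac. \<forall>c'\<in>Ac. compatible_via {g. hyp_isometry g} X c c'"
      using mfd unfolding hyp_manifold_def hyp_atlas_def by simp
    then show ?thesis using U V(1) by simp
  qed
  ultimately have "\<exists>t\<in>{g. hyp_isometry g}. \<exists>M. openin X M \<and> h (i, x) \<in> M \<and> M \<subseteq> V \<inter> U \<and> (\<forall>q\<in>M. \<phi> q = t (\<psi> q))"
    unfolding compatible_via_def prod.case by (elim bspec)
  then obtain t M where t: "hyp_isometry t" "openin X M" "h (i, x) \<in> M" "M \<subseteq> V \<inter> U" "\<And>q. q \<in> M \<Longrightarrow> \<phi> q = t (\<psi> q)"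
    by blast
  obtain A where A: "lor A" "\<And>x. x \<in> hyp \<Longrightarrow> A x = t x" using isometry_lor[OF t(1)] by metis
  let ?N = "N \<inter> {y \<in> P. h (i, y) \<in> M}"
  have "N \<subseteq> hyp" using openin_imp_subset[OF N(1)] by (auto simp: hpoly_def)
  have "dev U \<phi> (A \<circ> G) i x" unfolding dev_def
  proof (intro exI conjI ballI)
    show "openin (top_of_set P) ?N" by (intro openin_Int N(1) h_open ix t)
    show "x \<in> ?N" using N ix t by blast
    fix y assume y: "y \<in> ?N"
    then show "h (i, y) \<in> U" using t by blast
    have "G y \<in> hyp" using y \<open>N \<subseteq> hyp\<close> lor_hyp[OF V(2)] by blast
    then show "\<phi> (h (i, y)) = (A \<circ> G) y" using t(5)[of "h (i, y)"] N(3)[of y] y A(2) by simp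
  qed
  then show ?thesis using that lor_comp[OF A(1) V(2)] by blast
qed

lemma dev_unique:
  assumes "dev U \<phi> G i x" "dev U \<phi> G' i x" "lor G" "lor G'" shows "G = G'"
proof -
  obtain N where N: "openin (top_of_set P) N" "x \<in> N" "\<And>y. y \<in> N \<Longrightarrow> \<phi> (h (i, y)) = G y"
    using assms(1) unfolding dev_def by metis
  obtain N' where N': "openin (top_of_set P) N'" "x \<in> N'" "\<And>y. y \<in> N' \<Longrightarrow> \<phi> (h (i, y)) = G' y"
    using assms(2) unfolding dev_def by metis
  have "openin (top_of_set P) (N \<inter> N')" "x \<in> N \<inter> N'" using N N' by auto
  then show ?thesis
    by (rule linear_eq_open[OF lor_linear[OF assms(3)] lor_linear[OF assms(4)]]) (use N N' in force)
qed

lemma preimage_open: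
  assumes "lor B" "openin (top_of_set P) N" shows "openin (top_of_set P) {y \<in> P. B y \<in> P \<longrightarrow> B y \<in> N}"
    and "(\<And>y. y \<in> P \<Longrightarrow> B y \<in> P) \<Longrightarrow> openin (top_of_set P) {y \<in> P. B y \<in> N}"
proof -
  show *: "openin (top_of_set P) {y \<in> P. B y \<in> N}" if "\<And>y. y \<in> P \<Longrightarrow> B y \<in> P"
  proof -
    have "openin (top_of_set P) (P \<inter> B -` N)"
      by (rule continuous_openin_preimage[OF lor_continuous[OF assms(1)] _ assms(2)]) (use that in auto)
    moreover have "P \<inter> B -` N = {y \<in> P. B y \<in> N}" by auto
    ultimately show ?thesis by simp
  qed
  obtain W where W: "open W" "N = P \<inter> W" using assms(2) unfolding openin_open by blast
  have "{y \<in> P. B y \<in> P \<longrightarrow> B y \<in> N} = P \<inter> B -` (- P \<union> W)" unfolding W(2) by auto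
  moreover have "open (B -` (- P \<union> W))"
    using W(1) hpoly_closed[of \<N>] lor_continuous[OF assms(1), of UNIV] by (intro open_vimage) auto
  ultimately show "openin (top_of_set P) {y \<in> P. B y \<in> P \<longrightarrow> B y \<in> N}" by (metis openin_open_Int)
qed

text \<open>The neighbouring polytope develops to the mirror image: if it were folded onto the first one, the two would
  overlap in the manifold.\<close>

lemma dev_step:
  assumes U: "(U, \<phi>) \<in> Ac" and d: "dev U \<phi> G i x" and G: "lor G"
    and iv: "i < k" "v \<in> \<N>" "x \<in> P" "lorentz v x = 0"
  shows "dev U \<phi> (G \<circ> lrefl v \<circ> inv (L i v)) (nb3 i v) (L i v x)"
proof -
  let ?L = "L i v" and ?j = "nb3 i v"
  have l: "lor ?L" using L_props(1)[OF iv(1,2)] .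
  have j: "?j < k" "?j \<noteq> i" "?L x \<in> P" using pairing[OF iv(1,2)] L_P[OF iv(1-3)] by auto
  obtain N where N: "openin (top_of_set P) N" "x \<in> N" "\<And>y. y \<in> N \<Longrightarrow> h (i, y) \<in> U \<and> \<phi> (h (i, y)) = G y"
    using d unfolding dev_def by metis
  have "h (?j, ?L x) \<in> U" using glue_step[OF iv] N by simp
  then obtain G' where G': "lor G'" "dev U \<phi> G' ?j (?L x)" using dev_change[OF U j(1,3)] by metis
  obtain N' where N': "openin (top_of_set P) N'" "?L x \<in> N'" "\<And>y. y \<in> N' \<Longrightarrow> h (?j, y) \<in> U \<and> \<phi> (h (?j, y)) = G' y"
    using G'(2) unfolding dev_def by metis
  define M where "M = N \<inter> {y \<in> P. ?L y \<in> N'}"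
  have M: "openin (top_of_set P) M" "x \<in> M"
    unfolding M_def using N N' iv preimage_open(2)[OF l N'(1) L_P[OF iv(1,2)]] by auto
  have V: "orthset {v}" "{v} \<subseteq> zeros x" using iv by (auto simp: orthset_def zeros_def)
  have MP: "M \<subseteq> P" using openin_imp_subset[OF M(1)] .
  \<comment> \<open>One chart shows both copies, and \<open>B\<close> compares their positions. It
    fixes the common face, so it is the identity or the reflection in \<open>v\<close>.\<close>
  define B where "B = inv G \<circ> G' \<circ> ?L"
  have lB: "lor B" unfolding B_def by (intro lor_comp lor_inv G G' l)
  have GB: "G (B y) = G' (?L y)" for y using lor_inv_simps(1)[OF G] by (simp add: B_def)
  have Bface: "B y = y" if "lorentz v y = 0" for y
  proof -
    have "G y = (G' \<circ> ?L) y"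
    proof (rule linear_eq_local[OF lor_linear[OF G] _ M V])
      show "linear (G' \<circ> ?L)" using lor_comp[OF G'(1) l] lor_linear by blast
      fix z assume z: "z \<in> M" "\<And>v'. v' \<in> {v} \<Longrightarrow> lorentz v' z = 0"
      have "h (?j, ?L z) = h (i, z)" using glue_step[OF iv(1,2)] z MP by blast
      then show "G z = (G' \<circ> ?L) z" using N(3)[of z] N'(3)[of "?L z"] z by (auto simp: M_def)
    qed (use that in auto)
    then have "G y = G' (?L y)" by simp
    then show ?thesis using lor_inv_simps(2)[OF G, of y] unfolding B_def comp_apply by metis
  qed
  have vv: "lorentz v v = 2" using right_angledD(3)[OF ra iv(2)] .
  define b where "b = lorentz v (B v) / 2"
  have Bv: "B v = b *\<^sub>R v"
  proof -
    have "B v - b *\<^sub>R v = 0"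
    proof (rule lorentz_nondeg)
      fix y
      define y' where "y' = y - (lorentz v y / 2) *\<^sub>R v"
      have y': "lorentz v y' = 0" by (simp add: y'_def vv)
      have "lorentz (B v) (B y') = lorentz v y'" by (rule lor_lorentz[OF lB])
      then have "lorentz (B v) y' = 0" using Bface[OF y'] y' by simp
      then have "lorentz (B v) y = lorentz v y / 2 * lorentz (B v) v" by (simp add: y'_def)
      then show "lorentz (B v - b *\<^sub>R v) y = 0" by (simp add: b_def lorentz_sym[of "B v" v])
    qed
    then show ?thesis by simp
  qed
  have "lorentz (B v) (B v) = 2" using lor_lorentz[OF lB, of v v] vv by simp
  then have "b * b = 1" by (simp add: Bv vv)
  then have b: "b = 1 \<or> b = -1" by (simp add: square_eq_1_iff)
  have Bdec: "B y = y + ((b - 1) * lorentz v y / 2) *\<^sub>R v" for y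
  proof -
    have "B (y - (lorentz v y / 2) *\<^sub>R v) = y - (lorentz v y / 2) *\<^sub>R v" by (rule Bface) (simp add: vv)
    then have "B y - (lorentz v y / 2) *\<^sub>R B v = y - (lorentz v y / 2) *\<^sub>R v" by (simp add: lor_simps[OF lB])
    then show ?thesis by (simp add: Bv algebra_simps diff_divide_distrib)
  qed
  \<comment> \<open>If \<open>B\<close> were the identity, the chart would show interior points of
    two different copies at the same place, so they would coincide in the manifold.\<close>
  have "b \<noteq> 1"
  proof
    assume "b = 1"
    then have "B y = y" for y using Bdec[of y] by simp
    then have eq: "G y = G' (?L y)" for y using GB[of y] by simp
    obtain z where z: "z \<in> M" "\<And>v. v \<in> \<N> \<Longrightarrow> lorentz v z < 0" using interior_point[OF M] by metis
    have zP: "z \<in> P" "?L z \<in> P" using z MP L_P[OF iv(1,2)] by auto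
    have a: "h (i, z) \<in> U" "\<phi> (h (i, z)) = G z" "h (?j, ?L z) \<in> U" "\<phi> (h (?j, ?L z)) = G' (?L z)"
      using z N(3) N'(3) by (auto simp: M_def)
    then have "h (i, z) = h (?j, ?L z)" using chart_facts(2)[OF U] eq unfolding inj_on_def by metis
    then have "((i, z), (?j, ?L z)) \<in> (face_glue \<N> k \<tau> g)\<^sup>*" using glue_iff[OF iv(1) zP(1) j(1) zP(2)] by simp
    then have "(?j, ?L z) = (i, z)" using glue_interior z(2) by blast
    then show False using j by simp
  qed
  then have "b = -1" using b by simp
  then have "B y = lrefl v y" for y using Bdec[of y] by (simp add: lrefl_def)
  then have "G' (?L y) = G (lrefl v y)" for y using GB[of y] by simp
  then have "G' y = (G \<circ> lrefl v \<circ> inv ?L) y" for y using lor_inv_simps(1)[OF l, of y] by (metis comp_apply)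
  then show ?thesis using G'(2) by presburger
qed

text \<open>At a point on both faces the two orders of crossing are developed in one chart, where
  orthogonal reflections commute, so both show the same region. The chart is injective and interior
  points are glued to no others, hence the final copies and the maps into them agree.\<close>

lemma mirror3_comm:
  assumes iv: "i < k" "v \<in> \<N>" "u \<in> \<N>" "lorentz v u = 0"
  shows "nb3 (nb3 i v) (L i v u) = nb3 (nb3 i u) (L i u v)"
    "L (nb3 i v) (L i v u) (L i v x) = L (nb3 i u) (L i u v) (L i u x)"
proof -
  have uv: "lorentz u v = 0" using iv by (simp add: lorentz_sym)
  have V: "orthset {v, u}" using iv uv by (auto simp: orthset_def)
  define p where "p = center {v, u}"
  have p: "p \<in> P" "lorentz v p = 0" "lorentz u p = 0" using center_facts[OF V] by (auto simp: p_def)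
  obtain U \<phi> G where U: "(U, \<phi>) \<in> Ac" "lor G" "dev U \<phi> G i p" using dev_exists[OF iv(1) p(1)] by metis
  have two: "dev U \<phi> (G \<circ> lrefl u \<circ> lrefl v \<circ> inv (L (nb3 i v) (L i v u) \<circ> L i v)) (nb3 (nb3 i v) (L i v u)) (L (nb3 i v) (L i v u) (L i v p))
     \<and> nb3 (nb3 i v) (L i v u) < k \<and> lor (L (nb3 i v) (L i v u) \<circ> L i v) \<and> (\<forall>x\<in>P. L (nb3 i v) (L i v u) (L i v x) \<in> P)"
    if vu: "v \<in> \<N>" "u \<in> \<N>" "lorentz u v = 0" "lorentz v p = 0" "lorentz u p = 0" for u v
  proof -
    let ?j = "nb3 i v" and ?L = "L i v" and ?u = "L i v u"
    note l = L_props(1)[OF iv(1) vu(1)]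
    have vu': "lorentz v u = 0" using vu by (simp add: lorentz_sym)
    have j: "?j < k" "?u \<in> \<N>" "?L p \<in> P" using pairing(1) L_N L_P iv(1) vu p by auto
    have 1: "dev U \<phi> (G \<circ> lrefl v \<circ> inv ?L) ?j (?L p)" by (rule dev_step[OF U(1,3,2) iv(1) vu(1) p(1) vu(4)])
    have vl: "lor (lrefl v)" "lor (lrefl u)" using refl_lor right_angledD(3)[OF ra] vu by auto
    have lG: "lor (G \<circ> lrefl v \<circ> inv ?L)" by (intro lor_comp U vl lor_inv l)
    have z: "lorentz ?u (?L p) = 0" using lor_lorentz[OF l] vu by simp
    have 2: "dev U \<phi> (G \<circ> lrefl v \<circ> inv ?L \<circ> lrefl ?u \<circ> inv (L ?j ?u)) (nb3 ?j ?u) (L ?j ?u (?L p))"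
      by (rule dev_step[OF U(1) 1 lG j z])
    note l2 = L_props(1)[OF j(1,2)]
    have "(G \<circ> lrefl v \<circ> inv ?L \<circ> lrefl ?u \<circ> inv (L ?j ?u)) y = (G \<circ> lrefl u \<circ> lrefl v \<circ> inv (L ?j ?u \<circ> ?L)) y" for y
    proof -
      define y' where "y' = inv ?L (inv (L ?j ?u) y)"
      have y: "inv (L ?j ?u) y = ?L y'" using lor_inv_simps(1)[OF l] by (simp add: y'_def)
      have "inv (L ?j ?u \<circ> ?L) y = y'" using o_inv_distrib[OF lor_bij[OF l2] lor_bij[OF l]] by (simp add: y'_def)
      moreover have "inv ?L (lrefl ?u (?L y')) = lrefl u y'"
        using lor_refl[OF l, of u y'] lor_inv_simps(2)[OF l] by metis
      ultimately show ?thesis using y refl_commute[OF vu'] by simp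
    qed
    then have e: "G \<circ> lrefl v \<circ> inv ?L \<circ> lrefl ?u \<circ> inv (L ?j ?u) = G \<circ> lrefl u \<circ> lrefl v \<circ> inv (L ?j ?u \<circ> ?L)" by blast
    show ?thesis using 2 pairing(1)[OF j(1,2)] lor_comp[OF l2 l] L_P[OF j(1,2)] L_P[OF iv(1) vu(1)] unfolding e by blast
  qed
  define B where "B = L (nb3 i v) (L i v u) \<circ> L i v"
  define B' where "B' = L (nb3 i u) (L i u v) \<circ> L i u"
  define j where "j = nb3 (nb3 i v) (L i v u)"
  define j' where "j' = nb3 (nb3 i u) (L i u v)"
  have d: "dev U \<phi> (G \<circ> lrefl u \<circ> lrefl v \<circ> inv B) j (B p)" "j < k" "lor B" "\<And>x. x \<in> P \<Longrightarrow> B x \<in> P"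
    using two[OF iv(2,3) uv p(2,3)] by (auto simp: B_def j_def)
  have d': "dev U \<phi> (G \<circ> lrefl v \<circ> lrefl u \<circ> inv B') j' (B' p)" "j' < k" "lor B'" "\<And>x. x \<in> P \<Longrightarrow> B' x \<in> P"
    using two[OF iv(3,2,4) p(3,2)] by (auto simp: B'_def j'_def)
  obtain N where N: "openin (top_of_set P) N" "B p \<in> N"
    "\<And>y. y \<in> N \<Longrightarrow> h (j, y) \<in> U \<and> \<phi> (h (j, y)) = (G \<circ> lrefl u \<circ> lrefl v \<circ> inv B) y"
    using d(1) unfolding dev_def by metis
  obtain N' where N': "openin (top_of_set P) N'" "B' p \<in> N'"
    "\<And>y. y \<in> N' \<Longrightarrow> h (j', y) \<in> U \<and> \<phi> (h (j', y)) = (G \<circ> lrefl v \<circ> lrefl u \<circ> inv B') y"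
    using d'(1) unfolding dev_def by metis
  define M where "M = {y \<in> P. B y \<in> N} \<inter> {y \<in> P. B' y \<in> N'}"
  have M: "openin (top_of_set P) M" "p \<in> M"
    unfolding M_def using preimage_open(2)[OF d(3) N(1) d(4)] preimage_open(2)[OF d'(3) N'(1) d'(4)] p N N' by auto
  have eq: "j = j' \<and> B z = B' z" if z: "z \<in> M" "\<And>w. w \<in> \<N> \<Longrightarrow> lorentz w z < 0" for z
  proof -
    have zP: "z \<in> P" "B z \<in> P" "B' z \<in> P" using z d(4) d'(4) by (auto simp: M_def)
    have "\<phi> (h (j, B z)) = \<phi> (h (j', B' z))" "h (j, B z) \<in> U" "h (j', B' z) \<in> U"
      using z N(3)[of "B z"] N'(3)[of "B' z"] lor_inv_simps(2)[OF d(3)] lor_inv_simps(2)[OF d'(3)] refl_commute[OF iv(4)]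
      by (auto simp: M_def)
    then have "h (j, B z) = h (j', B' z)" using chart_facts(2)[OF U(1)] unfolding inj_on_def by blast
    then have "((j, B z), (j', B' z)) \<in> (face_glue \<N> k \<tau> g)\<^sup>*" using glue_iff[OF d(2) zP(2) d'(2) zP(3)] by simp
    moreover have "lorentz w (B z) < 0" if w: "w \<in> \<N>" for w
    proof -
      have i1: "nb3 i v < k" "L i v u \<in> \<N>" using pairing(1) L_N iv by auto
      define w1 where "w1 = L (nb3 (nb3 i v) (L i v u)) (wl (nb3 i v) (L i v u)) w"
      define w2 where "w2 = L (nb3 i v) (wl i v) w1"
      have w1: "w1 \<in> \<N>" unfolding w1_def by (rule L_N[OF pairing(1,2)[OF i1] w])
      have w2: "w2 \<in> \<N>" unfolding w2_def by (rule L_N[OF pairing(1,2)[OF iv(1,2)] w1])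
      have "L (nb3 i v) (L i v u) w1 = w"
        using L_back(3)[OF pairing(1,2)[OF i1], of w] L_back(1,2)[OF i1] by (simp add: w1_def)
      moreover have "L i v w2 = w1"
        using L_back(3)[OF pairing(1,2)[OF iv(1,2)], of w1] L_back(1,2)[OF iv(1,2)] by (simp add: w2_def)
      ultimately have "B w2 = w" by (simp add: B_def)
      then show ?thesis using lor_lorentz[OF d(3), of w2 z] z(2)[OF w2] by simp
    qed
    ultimately have "(j', B' z) = (j, B z)" using glue_interior by blast
    then show ?thesis by simp
  qed
  obtain z where z: "z \<in> M" "\<And>w. w \<in> \<N> \<Longrightarrow> lorentz w z < 0" using interior_point[OF M] by metis
  show "nb3 (nb3 i v) (L i v u) = nb3 (nb3 i u) (L i u v)" using eq[OF z] by (simp add: j_def j'_def)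
  have "B = B'"
  proof (rule linear_eq_open[OF lor_linear[OF d(3)] lor_linear[OF d'(3)]])
    show "openin (top_of_set P) (M \<inter> {z \<in> P. \<forall>v\<in>\<N>. lorentz v z < 0})" by (intro openin_Int M interior_open)
    show "z \<in> M \<inter> {z \<in> P. \<forall>v\<in>\<N>. lorentz v z < 0}" using z by (auto simp: M_def)
  qed (use eq in auto)
  then show "L (nb3 i v) (L i v u) (L i v x) = L (nb3 i u) (L i u v) (L i u x)" by (simp add: B_def B'_def fun_eq_iff)
qed

lemma mirror3: "mirror \<N> s {..<k} nb3 L"
proof
  show "right_angled \<N> s" by (rule ra)
  fix t v w x assume t: "t \<in> {..<k}" and v: "v \<in> \<N>"
  show "nb3 t v \<in> {..<k}" using pairing(1) t v by auto
  show "lor (L t v)" using L_props(1) t v by auto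
  show "L t v e0 = e0" using L_e0 t v by auto
  show "nb3 (nb3 t v) (L t v v) = t" using L_back(1) L_props(2) t v by auto
  show "L (nb3 t v) (L t v v) (L t v x) = x" using L_back(3) L_props(2) t v by auto
  assume w: "w \<in> \<N>"
  show "L t v w \<in> \<N>" using L_N t v w by auto
  assume "lorentz v w = 0"
  then show "nb3 (nb3 t v) (L t v w) = nb3 (nb3 t w) (L t w v)"
    "L (nb3 t v) (L t v w) (L t v x) = L (nb3 t w) (L t w v) (L t w x)"
    using mirror3_comm t v w by auto
qed

sublocale m3: mirror \<N> s "{..<k}" nb3 L by (rule mirror3)

text \<open>Iterates \<open>dev_step\<close>: a chain of crossings through one point can be
  developed in a single chart.\<close>

lemma zreach_dev:
  assumes "m3.zreach i x j C" "x \<in> P" "(U, \<phi>) \<in> Ac" "dev U \<phi> G i x" "lor G"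
  shows "dev U \<phi> (G \<circ> inv C) j (C x) \<and> h (j, C x) = h (i, x)"
  using assms(1)
proof (induction rule: m3.zreach.induct)
  case start
  then show ?case using assms by (simp add: inv_id comp_def)
next
  case (cross j C v)
  have jC: "j < k" "lor C" using m3.reach_props[OF m3.zreach_reach[OF cross(1)]] by auto
  have CP: "C x \<in> P" using m3.zreach_hpoly[OF cross(1) assms(2)] .
  have lG: "lor (G \<circ> inv C)" by (intro lor_comp assms lor_inv jC)
  have d: "dev U \<phi> (G \<circ> inv C \<circ> lrefl v \<circ> inv (L j v)) (nb3 j v) (L j v (C x))"
    by (rule dev_step[OF assms(3) _ lG jC(1) cross(2) CP cross(3)]) (use cross in blast)
  have l: "lor (L j v)" "lor (lrefl v)" using L_props(1)[OF jC(1) cross(2)] refl_lor right_angledD(3)[OF ra cross(2)] by auto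
  have "inv (L j v \<circ> lrefl v \<circ> C) y = (inv C \<circ> lrefl v \<circ> inv (L j v)) y" for y
  proof -
    have "(L j v \<circ> lrefl v \<circ> C) ((inv C \<circ> lrefl v \<circ> inv (L j v)) y) = y"
      using lor_inv_simps(1)[OF jC(2)] lor_inv_simps(1)[OF l(1)] refl_refl[OF right_angledD(3)[OF ra cross(2)]] by simp
    then show ?thesis
      using lor_inv_simps(2)[OF lor_comp[OF lor_comp[OF l] jC(2)]] by metis
  qed
  then have "G \<circ> inv (L j v \<circ> lrefl v \<circ> C) = G \<circ> inv C \<circ> lrefl v \<circ> inv (L j v)" by (simp add: fun_eq_iff)
  moreover have "(L j v \<circ> lrefl v \<circ> C) x = L j v (C x)" using cross by (simp add: refl_fix)
  moreover have "h (nb3 j v, L j v (C x)) = h (j, C x)" by (rule glue_step[OF jC(1) cross(2) CP cross(3)])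
  moreover have "h (j, C x) = h (i, x)" using cross by blast
  ultimately show ?case using d by metis
qed

text \<open>In a chart at \<open>x\<close> the copy \<open>i\<close> has only one position, while
  the chain of crossings would change it by \<open>inv C\<close>.\<close>

lemma zreach_free:
  assumes "m3.zreach i x i C" "x \<in> P" "C x = x" shows "C = id"
proof -
  have i: "i < k" and C: "lor C" using m3.reach_props[OF m3.zreach_reach[OF assms(1)]] by auto
  obtain U \<phi> G where U: "(U, \<phi>) \<in> Ac" "lor G" "dev U \<phi> G i x" using dev_exists[OF i assms(2)] by metis
  have "dev U \<phi> (G \<circ> inv C) i x" using zreach_dev[OF assms(1,2) U(1,3,2)] assms(3) by simp
  then have "G = G \<circ> inv C" using dev_unique[OF U(3) _ U(2)] lor_comp[OF U(2) lor_inv[OF C]] by blast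
  then have "G y = G (inv C y)" for y by (metis comp_apply)
  then have "inv C y = y" for y using lor_inj[OF U(2)] by (metis injD)
  then show "C = id" using lor_inv_simps(1)[OF C] by (metis eq_id_iff)
qed

lemma glue_zreach:
  assumes "((i, x), b) \<in> (face_glue \<N> k \<tau> g)\<^sup>*" "i < k" "x \<in> P"
  shows "\<exists>C. m3.zreach i x (fst b) C \<and> C x = snd b"
  using assms(1)
proof (induction rule: rtrancl_induct)
  case base
  then show ?case using m3.zreach.start[of i x] assms(2) by (metis fst_conv snd_conv id_apply lessThan_iff)
next
  case (step b c)
  obtain j y where b: "b = (j, y)" by (cases b)
  obtain C where C: "m3.zreach i x j C" "C x = y" using step b by auto
  obtain v where v: "v \<in> \<N>" "y \<in> hface \<N> v" "fst c = nb3 j v" "snd c = g (j, v) y" "j < k"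
    using step(2) b by (auto simp: face_glue_def nb3_def)
  have z: "lorentz v (C x) = 0" using v C by (simp add: hface_def)
  have "m3.zreach i x (nb3 j v) (L j v \<circ> lrefl v \<circ> C)" by (rule m3.zreach.cross[OF C(1) v(1) z])
  moreover have "(L j v \<circ> lrefl v \<circ> C) x = snd c" using C v L_props(3)[OF v(5,1,2)] z by (simp add: refl_fix)
  ultimately show ?case using v by metis
qed

end

section \<open>The four-dimensional mirror groupoid\<close>

type_synonym tile = "nat \<times> real \<times> (nat \<times> 4 mink) set set \<times> bool"

text \<open>Invariance of \<open>Z4\<close> is asked only for facets adjacent to a wall. In the
  24-cell the whole set is invariant; the single facet chosen in the 120-cell is adjacent to no
  wall, which makes the condition vacuous there.\<close>

locale tessellated_cell = cell_data +
  fixes X :: "'p topology" and Ac :: "('p, 3) hchart set" and k :: nat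
    and \<tau> :: "nat \<times> 3 mink \<Rightarrow> nat \<times> 3 mink" and g :: "nat \<times> 3 mink \<Rightarrow> 3 mink \<Rightarrow> 3 mink"
    and h :: "nat \<times> 3 mink \<Rightarrow> 'p"
  assumes tess: "tess N3 (s / C) X Ac k \<tau> g h"
    and Zext: "lor M \<Longrightarrow> M e0 = e0 \<Longrightarrow> (\<And>v. v \<in> N3 \<Longrightarrow> M v \<in> N3) \<Longrightarrow> F \<in> Z4 \<Longrightarrow> nbs F \<noteq> {} \<Longrightarrow> ext M F \<in> Z4"
begin

sublocale t: tess N3 "s / C" X Ac k \<tau> g h by (rule tess)

abbreviation E where "E i a \<equiv> ext (t.L i a)"

lemma L_facts:
  assumes "i < k" "a \<in> N3"
  shows "lor (t.L i a)" "linear (t.L i a)" "t.L i a e0 = e0" "v \<in> N3 \<Longrightarrow> t.L i a v \<in> N3" "lor (E i a)"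
    "t.nb3 i a < k" "t.L i a a \<in> N3" "t.nb3 (t.nb3 i a) (t.L i a a) = i" "t.L (t.nb3 i a) (t.L i a a) (t.L i a x) = x"
    "E (t.nb3 i a) (t.L i a a) (E i a y) = y"
proof -
  show l: "lor (t.L i a)" "t.L i a e0 = e0" "v \<in> N3 \<Longrightarrow> t.L i a v \<in> N3" "t.nb3 i a < k"
    using t.L_props(1) t.L_e0 t.L_N t.pairing(1) assms by auto
  show "linear (t.L i a)" "lor (E i a)" using l lor_linear ext_lor by auto
  show "t.L i a a \<in> N3" using t.L_N assms by auto
  show n: "t.nb3 (t.nb3 i a) (t.L i a a) = i" "t.L (t.nb3 i a) (t.L i a a) (t.L i a x) = x" for x
    using t.L_back(1,3)[OF assms] t.L_props(2)[OF assms] by auto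
  have l2: "linear (t.L (t.nb3 i a) (t.L i a a))"
    using t.L_props(1)[OF l(4) \<open>t.L i a a \<in> N3\<close>] lor_linear by blast
  have "t.L (t.nb3 i a) (t.L i a a) \<circ> t.L i a = id" using n(2) by (simp add: fun_eq_iff)
  then show "E (t.nb3 i a) (t.L i a a) (E i a y) = y"
    using ext_comp[OF l2 \<open>linear (t.L i a)\<close>, of y] ext_id(2) by simp
qed

lemma E_N4: "i < k \<Longrightarrow> a \<in> N3 \<Longrightarrow> v \<in> N4 \<Longrightarrow> E i a v \<in> N4"
  using ext_N4[OF L_facts(1,3,4)] by blast

lemma E_f0: "i < k \<Longrightarrow> a \<in> N3 \<Longrightarrow> E i a f0 = f0"
  using ext_f0 L_facts(2) by blast

lemma E_opp0: "i < k \<Longrightarrow> a \<in> N3 \<Longrightarrow> E i a opp0 = opp0"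
  unfolding opp0_def using ext_axis[OF L_facts(1,3)] by blast

lemma E_iota: "i < k \<Longrightarrow> a \<in> N3 \<Longrightarrow> E i a (\<iota> x) = \<iota> (t.L i a x)"
  using ext_iota L_facts(2) by blast

lemma walls_cases:
  assumes "F \<in> N4"
  obtains "F = f0" | a where "a \<in> N3" "F = \<iota> a" | "F \<in> Z4" | "F = opp0" | "F \<in> rest"
  using assms unfolding rest_def by blast

lemma walls_distinct:
  "f0 \<notin> \<iota> ` N3" "opp0 \<notin> \<iota> ` N3" "f0 \<notin> Z4" "opp0 \<notin> Z4" "f0 \<notin> rest" "opp0 \<notin> rest" "opp0 \<noteq> f0"
  "F \<in> Z4 \<Longrightarrow> F \<notin> \<iota> ` N3 \<and> F \<noteq> f0 \<and> F \<noteq> opp0 \<and> F \<notin> rest \<and> F \<in> N4"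
  "F \<in> rest \<Longrightarrow> F \<notin> \<iota> ` N3 \<and> F \<noteq> f0 \<and> F \<noteq> opp0 \<and> F \<notin> Z4 \<and> F \<in> N4"
  "a \<in> N3 \<Longrightarrow> \<iota> a \<noteq> f0 \<and> \<iota> a \<noteq> opp0 \<and> \<iota> a \<notin> Z4 \<and> \<iota> a \<notin> rest \<and> \<iota> a \<in> N4"
proof -
  have w: "\<iota> a \<in> N4" "lorentz f0 (\<iota> a) = 0" if "a \<in> N3" for a using walls4 that by blast+
  have o: "\<iota> a \<noteq> opp0" if "a \<in> N3" for a using w(2)[OF that] opp_facts(4) lorentz_sym[of f0] by metis
  have z: "\<iota> a \<notin> Z4" if "a \<in> N3" for a using w(2)[OF that] Z_facts(4) lorentz_sym[of f0] by metis
  have f: "\<iota> a \<noteq> f0" if "a \<in> N3" for a using w(2)[OF that] f0_f0 by force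
  show "f0 \<notin> \<iota> ` N3" "opp0 \<notin> \<iota> ` N3" using o f by (metis imageE)+
  show "f0 \<notin> Z4" "opp0 \<notin> Z4" using Z_facts by blast+
  show "f0 \<notin> rest" "opp0 \<notin> rest" by (auto simp: rest_def)
  show "opp0 \<noteq> f0" by (rule opp_facts(2))
  show "F \<in> Z4 \<Longrightarrow> F \<notin> \<iota> ` N3 \<and> F \<noteq> f0 \<and> F \<noteq> opp0 \<and> F \<notin> rest \<and> F \<in> N4"
    using z Z_facts by (auto simp: rest_def)
  show "F \<in> rest \<Longrightarrow> F \<notin> \<iota> ` N3 \<and> F \<noteq> f0 \<and> F \<noteq> opp0 \<and> F \<notin> Z4 \<and> F \<in> N4"
    by (auto simp: rest_def)
  show "a \<in> N3 \<Longrightarrow> \<iota> a \<noteq> f0 \<and> \<iota> a \<noteq> opp0 \<and> \<iota> a \<notin> Z4 \<and> \<iota> a \<notin> rest \<and> \<iota> a \<in> N4"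
    using f o z w by (auto simp: rest_def)
qed

lemma orth_f0: "F \<in> N4 \<Longrightarrow> lorentz f0 F = 0 \<Longrightarrow> F \<in> \<iota> ` N3"
  using walls4 by blast

lemma E_Z: assumes "i < k" "a \<in> N3" "F \<in> Z4" "lorentz (\<iota> a) F = 0" shows "E i a F \<in> Z4"
proof -
  have "a \<in> nbs F" using assms by (simp add: nbs_def)
  then show ?thesis using Zext[OF L_facts(1,3,4)[OF assms(1,2)] assms(3)] by blast
qed

lemma E_orth: "i < k \<Longrightarrow> a \<in> N3 \<Longrightarrow> lorentz (\<iota> (t.L i a a)) (E i a F) = lorentz (\<iota> a) F"
  using lor_lorentz[OF L_facts(5), of i a "\<iota> a" F] E_iota by simp

lemma E_rest: assumes ia: "i < k" "a \<in> N3" and F: "F \<in> rest" "lorentz (\<iota> a) F = 0" shows "E i a F \<in> rest"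
proof -
  let ?j = "t.nb3 i a" and ?b = "t.L i a a"
  note f = L_facts[OF ia]
  have FN: "F \<in> N4" "F \<notin> \<iota> ` N3" "F \<noteq> f0" "F \<noteq> opp0" "F \<notin> Z4" using walls_distinct(9)[OF F(1)] by auto
  have b: "E ?j ?b (E i a F) = F" by (rule f(10))
  have "E i a F \<noteq> f0" using b E_f0[OF f(6,7)] FN by auto
  moreover have "E i a F \<noteq> opp0" using b E_opp0[OF f(6,7)] FN by auto
  moreover have "E i a F \<notin> \<iota> ` N3"
  proof
    assume "E i a F \<in> \<iota> ` N3"
    then obtain u where u: "u \<in> N3" "E i a F = \<iota> u" by blast
    then have "F = \<iota> (t.L ?j ?b u)" using b E_iota[OF f(6,7)] by simp
    then show False using FN L_facts(4)[OF f(6,7) u(1)] by blast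
  qed
  moreover have "E i a F \<notin> Z4"
  proof
    assume z: "E i a F \<in> Z4"
    have "lorentz (\<iota> ?b) (E i a F) = 0" using E_orth[OF ia] F(2) by simp
    then have "E ?j ?b (E i a F) \<in> Z4" by (rule E_Z[OF f(6,7) z])
    then show False using b FN by simp
  qed
  ultimately show ?thesis using E_N4[OF ia FN(1)] by (simp add: rest_def)
qed

text \<open>Crossing a wall orthogonal to \<open>F\<close> carries \<open>F\<close> to a facet of
  the neighbouring tile. For the two crossings to commute both facets must have one colour, so the
  classes of this relation serve as colours.\<close>

definition cstep :: "((nat \<times> 4 mink) \<times> (nat \<times> 4 mink)) set" where
  "cstep = {((i, F), (t.nb3 i a, E i a F)) | i F a. i < k \<and> F \<in> rest \<and> a \<in> nbs F}"

definition col :: "nat \<Rightarrow> 4 mink \<Rightarrow> (nat \<times> 4 mink) set" where "col i F = cstep\<^sup>* `` {(i, F)}"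

lemma cstep_sym: "(p, q) \<in> cstep \<Longrightarrow> (q, p) \<in> cstep"
proof -
  assume "(p, q) \<in> cstep"
  then obtain i F a where p: "p = (i, F)" "q = (t.nb3 i a, E i a F)" "i < k" "F \<in> rest" "a \<in> N3" "lorentz (\<iota> a) F = 0"
    by (auto simp: cstep_def nbs_def)
  note f = L_facts[OF p(3,5)]
  have "t.L i a a \<in> nbs (E i a F)" using E_orth[OF p(3,5)] p(6) f(7) by (simp add: nbs_def)
  then have "((t.nb3 i a, E i a F), (t.nb3 (t.nb3 i a) (t.L i a a), E (t.nb3 i a) (t.L i a a) (E i a F))) \<in> cstep"
    unfolding cstep_def using f(6) E_rest[OF p(3,5,4,6)] by blast
  then show ?thesis using p f(8,10) by simp
qed

lemma crel_sym: "(p, q) \<in> cstep\<^sup>* \<Longrightarrow> (q, p) \<in> cstep\<^sup>*"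
  using sym_rtrancl[of cstep] cstep_sym by (meson symD symI)

lemma col_eq_iff: "col i F = col j F' \<longleftrightarrow> ((i, F), (j, F')) \<in> cstep\<^sup>*"
proof
  assume "col i F = col j F'"
  moreover have "(j, F') \<in> col j F'" by (simp add: col_def)
  ultimately have "(j, F') \<in> col i F" by simp
  then show "((i, F), (j, F')) \<in> cstep\<^sup>*" by (simp add: col_def)
next
  assume a: "((i, F), (j, F')) \<in> cstep\<^sup>*"
  have "col j F' \<subseteq> col i F" using rtrancl_trans[OF a] by (auto simp: col_def)
  moreover have "col i F \<subseteq> col j F'" using rtrancl_trans[OF crel_sym[OF a]] by (auto simp: col_def)
  ultimately show "col i F = col j F'" by blast
qed

lemma col_step:
  assumes "i < k" "a \<in> N3" "F \<in> rest" "lorentz (\<iota> a) F = 0" shows "col (t.nb3 i a) (E i a F) = col i F"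
proof -
  have "((i, F), (t.nb3 i a, E i a F)) \<in> cstep" using assms by (auto simp: cstep_def nbs_def)
  then have "((i, F), (t.nb3 i a, E i a F)) \<in> cstep\<^sup>*" by (rule r_into_rtrancl)
  then show ?thesis using col_eq_iff by blast
qed

definition Col :: "(nat \<times> 4 mink) set set" where "Col = {col i F | i F. i < k \<and> F \<in> rest}"

lemma finite_Col: "finite Col"
proof -
  have "finite rest" using right_angledD(1)[OF ra4] by (auto simp: rest_def)
  then have "finite ((\<lambda>(i, F). col i F) ` ({..<k} \<times> rest))" by simp
  moreover have "Col = (\<lambda>(i, F). col i F) ` ({..<k} \<times> rest)" by (auto simp: Col_def)
  ultimately show ?thesis by simp
qed

end

section \<open>Toggled colours and the tiles of the four-manifold\<close>

definition sdiff :: "'a set \<Rightarrow> 'a set \<Rightarrow> 'a set" where "sdiff A B = (A - B) \<union> (B - A)"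

lemma sdiff_props: "sdiff (sdiff A B) B = A" "sdiff (sdiff A B) D = sdiff (sdiff A D) B"
  "sdiff A (sdiff B D) = sdiff (sdiff A B) D" "sdiff A B = A \<longleftrightarrow> B = {}" "sdiff A {} = A"
  by (auto simp: sdiff_def)

lemma sdiff_image: "inj_on f D \<Longrightarrow> A \<subseteq> D \<Longrightarrow> B \<subseteq> D \<Longrightarrow> f ` sdiff A B = sdiff (f ` A) (f ` B)"
  unfolding sdiff_def image_Un using inj_on_image_set_diff[of f D A B] inj_on_image_set_diff[of f D B A] by blast

lemma ext_bij_permutes:
  assumes "finite D" "A \<subseteq> D" "inj_on f A" "f ` A \<subseteq> D"
  shows "\<exists>p. bij_betw p D D \<and> (\<forall>x\<in>A. p x = f x)"
proof -
  have "card (D - A) = card (D - f ` A)"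
    using assms card_image[OF assms(3)] finite_subset[OF assms(2,1)] by (simp add: card_Diff_subset)
  then obtain r where r: "bij_betw r (D - A) (D - f ` A)"
    using finite_same_card_bij[of "D - A" "D - f ` A"] assms(1) by auto
  let ?p = "\<lambda>x. if x \<in> A then f x else r x"
  have "bij_betw ?p A (f ` A)" using assms(3) by (auto simp: bij_betw_def inj_on_def)
  moreover have "bij_betw ?p (D - A) (D - f ` A)" using r by (subst bij_betw_cong[where g = r]) auto
  ultimately have "bij_betw ?p (A \<union> (D - A)) (f ` A \<union> (D - f ` A))" by (rule bij_betw_combine) auto
  moreover have "A \<union> (D - A) = D" "f ` A \<union> (D - f ` A) = D" using assms by auto
  ultimately have "bij_betw ?p D D" by simp
  then show ?thesis by (intro exI[of _ ?p]) auto
qed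

text \<open>Niceness enters through \<open>colinj\<close>: the colours toggled at a tile reveal
  which of its facets were crossed an odd number of times.\<close>

locale coloured_cell = tessellated_cell +
  assumes colinj: "i < k \<Longrightarrow> F \<in> rest \<Longrightarrow> F' \<in> rest \<Longrightarrow> ((i, F), (i, F')) \<in> cstep\<^sup>* \<Longrightarrow> F = F'"
begin

lemma col_inj: "i < k \<Longrightarrow> inj_on (col i) rest"
  using colinj col_eq_iff by (auto simp: inj_on_def)

text \<open>The opposite facet joins copy \<open>i\<close> identically to copy \<open>j\<close>, so
  \<open>F\<close> continues as \<open>F\<close> although its colour in \<open>j\<close> is another
  one. Commutation there needs a permutation of all colours that matches the two.\<close>

definition side :: "nat \<Rightarrow> nat \<Rightarrow> (nat \<times> 4 mink) set \<Rightarrow> (nat \<times> 4 mink) set" where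
  "side i j = (SOME p. bij_betw p Col Col \<and> (\<forall>F\<in>rest. p (col i F) = col j F))"

lemma side_props:
  assumes "i < k" "j < k"
  shows "bij_betw (side i j) Col Col" "F \<in> rest \<Longrightarrow> side i j (col i F) = col j F"
proof -
  let ?f = "\<lambda>x. col j (inv_into rest (col i) x)"
  have 1: "?f (col i F) = col j F" if "F \<in> rest" for F using inv_into_f_f[OF col_inj[OF assms(1)] that] by simp
  have "inj_on ?f (col i ` rest)"
  proof (rule inj_onI)
    fix x y assume "x \<in> col i ` rest" "y \<in> col i ` rest" and xy: "?f x = ?f y"
    then obtain F F' where F: "F \<in> rest" "x = col i F" "F' \<in> rest" "y = col i F'" by blast
    have "col j F = col j F'" using xy 1[OF F(1)] 1[OF F(3)] F by simp
    then show "x = y" using F inj_onD[OF col_inj[OF assms(2)]] by metis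
  qed
  moreover have "?f ` (col i ` rest) \<subseteq> Col"
  proof
    fix x assume "x \<in> ?f ` (col i ` rest)"
    then obtain F where "F \<in> rest" "x = ?f (col i F)" by blast
    then show "x \<in> Col" using 1 assms(2) by (auto simp: Col_def)
  qed
  moreover have "col i ` rest \<subseteq> Col" using assms by (auto simp: Col_def)
  ultimately have "\<exists>p. bij_betw p Col Col \<and> (\<forall>x\<in>col i ` rest. p x = ?f x)"
    by (intro ext_bij_permutes finite_Col)
  then have "\<exists>p. bij_betw p Col Col \<and> (\<forall>F\<in>rest. p (col i F) = col j F)" using 1 by (metis imageI)
  then have "bij_betw (side i j) Col Col \<and> (\<forall>F\<in>rest. side i j (col i F) = col j F)"
    unfolding side_def by (rule someI_ex)
  then show "bij_betw (side i j) Col Col" "F \<in> rest \<Longrightarrow> side i j (col i F) = col j F" by auto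
qed

text \<open>Choosing the matching only for i < j makes \<open>perm j i\<close> inverse to
  \<open>perm i j\<close>.\<close>

definition perm :: "nat \<Rightarrow> nat \<Rightarrow> (nat \<times> 4 mink) set \<Rightarrow> (nat \<times> 4 mink) set" where
  "perm i j = (if i = j then id else if i < j then side i j else inv_into Col (side j i))"

lemma perm_props:
  assumes "i < k" "j < k"
  shows "bij_betw (perm i j) Col Col" "F \<in> rest \<Longrightarrow> perm i j (col i F) = col j F" "x \<in> Col \<Longrightarrow> perm j i (perm i j x) = x"
    "perm i i = id"
proof -
  note s = side_props(1)[OF assms] side_props(1)[OF assms(2,1)]
  show b: "bij_betw (perm i j) Col Col" using s bij_betw_inv_into by (auto simp: perm_def)
  have c: "col i F \<in> Col" if "F \<in> rest" for F using that assms by (auto simp: Col_def)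
  show "perm i j (col i F) = col j F" if F: "F \<in> rest"
  proof (cases "i \<le> j")
    case True
    then show ?thesis using side_props(2)[OF assms F] by (simp add: perm_def)
  next
    case False
    have "inv_into Col (side j i) (side j i (col j F)) = col j F"
      using s(2) F assms by (intro inv_into_f_f) (auto simp: bij_betw_def Col_def)
    then show ?thesis using False side_props(2)[OF assms(2,1) F] by (simp add: perm_def)
  qed
  show "perm j i (perm i j x) = x" if x: "x \<in> Col"
    using x s bij_betw_inv_into_left[OF s(1) x] bij_betw_inv_into_right[OF s(2) x] by (auto simp: perm_def)
  show "perm i i = id" by (simp add: perm_def)
qed

text \<open>Crossing the facet opposite to \<open>f0\<close> exchanges \<open>2 m\<close> with \<open>2 m + 1\<close> or
  \<open>2 m + 1\<close> with \<open>2 m + 2\<close>, depending on the boolean flag, which is what makes the result connected.\<close>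

definition mate :: "bool \<Rightarrow> nat \<Rightarrow> nat" where
  "mate z i = (let j = (if even i \<noteq> z then i + 1 else i - 1) in if j < k then j else i)"

text \<open>Truncated subtraction keeps 0 fixed, and the test against \<open>k\<close> keeps a last
  index without partner fixed; so both pairings are involutions of the indices.\<close>

lemma mate: "i < k \<Longrightarrow> mate z i < k" "i < k \<Longrightarrow> mate z (mate z i) = i"
proof -
  show m: "mate z i < k" if "i < k" for i using that by (simp add: mate_def Let_def)
  show "mate z (mate z i) = i" if i: "i < k"
  proof (cases "mate z i = i")
    case False
    then have j: "mate z i = (if even i \<noteq> z then i + 1 else i - 1)" by (auto simp: mate_def Let_def split: if_splits)
    then have "even (mate z i) \<longleftrightarrow> odd i" using False by auto
    then show ?thesis using j i False by (auto simp: mate_def Let_def)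
  qed simp
qed

text \<open>
  The tile \<open>(i, \<epsilon>, c, z)\<close> is a cell over the polyhedron \<open>i\<close> with orientation \<open>\<epsilon>\<close>, a set \<open>c\<close> of toggled colours, and
  the flag \<open>z\<close>.
\<close>

definition T :: "tile set" where "T = {..<k} \<times> {1, -1} \<times> Pow Col \<times> UNIV"

text \<open>Every crossing is a reflection and changes the sign; where the gluing is not identical,
  the determinant of the symmetry is a further factor.\<close>

definition nb :: "tile \<Rightarrow> 4 mink \<Rightarrow> tile" where
  "nb t F = (case t of (i, \<epsilon>, c, z) \<Rightarrow>
     if F = f0 then (i, - \<epsilon>, c, z)
     else if F \<in> \<iota> ` N3 then (t.nb3 i (\<rho> F), - \<epsilon> * ldet (E i (\<rho> F)), c, z)
     else if F \<in> Z4 then (i, - \<epsilon>, c, \<not> z)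
     else if F = opp0 then (mate z i, - \<epsilon>, perm i (mate z i) ` c, z)
     else (i, - \<epsilon>, sdiff c {col i F}, z))"

definition sy :: "tile \<Rightarrow> 4 mink \<Rightarrow> 4 mink \<Rightarrow> 4 mink" where
  "sy t F = (if F \<in> \<iota> ` N3 then E (fst t) (\<rho> F) else id)"

lemma nb_simps:
  "nb (i, \<epsilon>, c, z) f0 = (i, - \<epsilon>, c, z)"
  "a \<in> N3 \<Longrightarrow> nb (i, \<epsilon>, c, z) (\<iota> a) = (t.nb3 i a, - \<epsilon> * ldet (E i a), c, z)"
  "F \<in> Z4 \<Longrightarrow> nb (i, \<epsilon>, c, z) F = (i, - \<epsilon>, c, \<not> z)"
  "nb (i, \<epsilon>, c, z) opp0 = (mate z i, - \<epsilon>, perm i (mate z i) ` c, z)"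
  "F \<in> rest \<Longrightarrow> nb (i, \<epsilon>, c, z) F = (i, - \<epsilon>, sdiff c {col i F}, z)"
  "sy t f0 = id" "a \<in> N3 \<Longrightarrow> sy t (\<iota> a) = E (fst t) a" "F \<in> Z4 \<Longrightarrow> sy t F = id" "sy t opp0 = id" "F \<in> rest \<Longrightarrow> sy t F = id"
  using walls_distinct by (auto simp: nb_def sy_def rho_iota)

lemma T_cases: assumes "t \<in> T" obtains i \<epsilon> c z where "t = (i, \<epsilon>, c, z)" "i < k" "\<epsilon> = 1 \<or> \<epsilon> = -1" "c \<subseteq> Col"
  using assms by (auto simp: T_def)

lemma TI: "i < k \<Longrightarrow> \<epsilon> = 1 \<or> \<epsilon> = -1 \<Longrightarrow> c \<subseteq> Col \<Longrightarrow> (i, \<epsilon>, c, z) \<in> T"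
  by (auto simp: T_def)

lemma finite_T: "finite T"
  unfolding T_def using finite_Col by (intro finite_cartesian_product) auto

lemma col_Col: "i < k \<Longrightarrow> F \<in> rest \<Longrightarrow> col i F \<in> Col" by (auto simp: Col_def)

lemma perm_image: "i < k \<Longrightarrow> j < k \<Longrightarrow> c \<subseteq> Col \<Longrightarrow> perm i j ` c \<subseteq> Col"
  using perm_props(1)[of i j] unfolding bij_betw_def by blast

lemma perm_image_back:
  assumes "i < k" "j < k" "c \<subseteq> Col" shows "perm j i ` perm i j ` c = c"
proof -
  have "perm j i ` perm i j ` c = (\<lambda>x. x) ` c" unfolding image_image
    by (rule image_cong) (use perm_props(3)[OF assms(1,2)] assms(3) in auto)
  then show ?thesis by simp
qed

lemma ldet_E: "i < k \<Longrightarrow> a \<in> N3 \<Longrightarrow> ldet (E i a) = 1 \<or> ldet (E i a) = -1"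
  using ldet_cases L_facts(5) by blast

lemma ldet_E_back: assumes "i < k" "a \<in> N3" shows "ldet (E (t.nb3 i a) (t.L i a a)) * ldet (E i a) = 1"
proof -
  note f = L_facts[OF assms]
  have "E (t.nb3 i a) (t.L i a a) \<circ> E i a = id" using f(10) by (simp add: fun_eq_iff)
  then show ?thesis using ldet_comp[OF L_facts(5)[OF f(6,7)] f(5)] by simp
qed

lemma nb_T: assumes "t \<in> T" "F \<in> N4" shows "nb t F \<in> T"
proof -
  obtain i \<epsilon> c z where t: "t = (i, \<epsilon>, c, z)" "i < k" "\<epsilon> = 1 \<or> \<epsilon> = -1" "c \<subseteq> Col" using T_cases[OF assms(1)] by metis
  have m: "- \<epsilon> = 1 \<or> - \<epsilon> = -1" using t(3) by auto
  show ?thesis using assms(2)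
  proof (cases rule: walls_cases)
    case 1 then show ?thesis using TI[OF t(2) m t(4)] by (simp add: t(1) nb_simps)
  next
    case (2 a)
    have "- \<epsilon> * ldet (E i a) = 1 \<or> - \<epsilon> * ldet (E i a) = -1" using ldet_E[OF t(2) 2(1)] t(3) by auto
    then show ?thesis using TI[OF L_facts(6)[OF t(2) 2(1)] _ t(4)] 2 by (simp add: t(1) nb_simps)
  next
    case 3 then show ?thesis using TI[OF t(2) m t(4)] by (simp add: t(1) nb_simps)
  next
    case 4
    then show ?thesis using TI[OF mate(1)[OF t(2)] m perm_image[OF t(2) mate(1)[OF t(2)] t(4)]] by (simp add: t(1) nb_simps)
  next
    case 5
    have "sdiff c {col i F} \<subseteq> Col" using t(4) col_Col[OF t(2) 5] by (auto simp: sdiff_def)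
    then show ?thesis using TI[OF t(2) m] 5 by (simp add: t(1) nb_simps)
  qed
qed

lemma sy_props:
  assumes "t \<in> T" "F \<in> N4"
  shows "lor (sy t F)" "sy t F e0 = e0" "w \<in> N4 \<Longrightarrow> sy t F w \<in> N4"
    "nb (nb t F) (sy t F F) = t" "sy (nb t F) (sy t F F) (sy t F x) = x"
proof -
  obtain i \<epsilon> c z where t: "t = (i, \<epsilon>, c, z)" "i < k" "\<epsilon> = 1 \<or> \<epsilon> = -1" "c \<subseteq> Col" using T_cases[OF assms(1)] by metis
  have "lor (sy t F) \<and> sy t F e0 = e0 \<and> (w \<in> N4 \<longrightarrow> sy t F w \<in> N4) \<and>
    nb (nb t F) (sy t F F) = t \<and> sy (nb t F) (sy t F F) (sy t F x) = x"
    using assms(2)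
  proof (cases rule: walls_cases)
    case 1 then show ?thesis by (simp add: t(1) nb_simps lor_id)
  next
    case (2 a)
    note f = L_facts[OF t(2) 2(1)]
    have "nb (nb t F) (sy t F F) = t"
      using 2 f(7,8) ldet_E_back[OF t(2) 2(1)] by (simp add: t(1) nb_simps E_iota[OF t(2) 2(1)] mult.commute)
    moreover have "E i a e0 = e0" using ext_e0[OF f(1,3)] .
    moreover have "sy (nb t F) (sy t F F) (sy t F x) = x"
      using 2 f(7,10) by (simp add: t(1) nb_simps E_iota[OF t(2) 2(1)])
    moreover have "sy t F = E i a" using 2 by (simp add: t(1) nb_simps)
    ultimately show ?thesis using f(5) E_N4[OF t(2) 2(1)] by simp
  next
    case 3 then show ?thesis by (simp add: t(1) nb_simps lor_id)
  next
    case 4 then show ?thesis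
      using mate[OF t(2)] perm_image_back[OF t(2) mate(1)[OF t(2)] t(4)] by (simp add: t(1) nb_simps lor_id)
  next
    case 5 then show ?thesis by (simp add: t(1) nb_simps lor_id sdiff_props)
  qed
  then show "lor (sy t F)" "sy t F e0 = e0" "w \<in> N4 \<Longrightarrow> sy t F w \<in> N4"
    "nb (nb t F) (sy t F F) = t" "sy (nb t F) (sy t F F) (sy t F x) = x" by blast+
qed

definition comm_at :: "tile \<Rightarrow> 4 mink \<Rightarrow> 4 mink \<Rightarrow> bool" where
  "comm_at t v w \<longleftrightarrow> nb (nb t v) (sy t v w) = nb (nb t w) (sy t w v) \<and>
     (\<forall>x. sy (nb t v) (sy t v w) (sy t v x) = sy (nb t w) (sy t w v) (sy t w x))"

lemma comm_at_sym: "comm_at t v w \<Longrightarrow> comm_at t w v"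
  by (simp add: comm_at_def)

lemma comm_f0: assumes "a \<in> N3" "i < k" shows "comm_at (i, \<epsilon>, c, z) f0 (\<iota> a)"
  using assms by (simp add: comm_at_def nb_simps E_f0)

text \<open>Inherited from M by \<open>mirror3_comm\<close>. Both orders extend the same map of the
  polyhedron, so their determinants, and with them the signs of the tiles, agree as well.\<close>

lemma comm_iota_iota:
  assumes "a \<in> N3" "b \<in> N3" "lorentz a b = 0" "i < k" shows "comm_at (i, \<epsilon>, c, z) (\<iota> a) (\<iota> b)"
proof -
  have 1: "t.nb3 (t.nb3 i a) (t.L i a b) = t.nb3 (t.nb3 i b) (t.L i b a)"
    "t.L (t.nb3 i a) (t.L i a b) (t.L i a x) = t.L (t.nb3 i b) (t.L i b a) (t.L i b x)" for x
    using t.mirror3_comm[OF assms(4,1,2,3)] by auto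
  note fa = L_facts[OF assms(4,1)] and fb = L_facts[OF assms(4,2)]
  note fab = L_facts[OF fa(6) fa(4)[OF assms(2)]] and fba = L_facts[OF fb(6) fb(4)[OF assms(1)]]
  have 2: "t.L (t.nb3 i a) (t.L i a b) \<circ> t.L i a = t.L (t.nb3 i b) (t.L i b a) \<circ> t.L i b"
    using 1(2) by (simp add: fun_eq_iff)
  have 3: "E (t.nb3 i a) (t.L i a b) (E i a x) = E (t.nb3 i b) (t.L i b a) (E i b x)" for x
    using ext_comp[OF fab(2) fa(2)] ext_comp[OF fba(2) fb(2)] 2 by simp
  then have "E (t.nb3 i a) (t.L i a b) \<circ> E i a = E (t.nb3 i b) (t.L i b a) \<circ> E i b" by (simp add: fun_eq_iff)
  then have "ldet (E (t.nb3 i a) (t.L i a b)) * ldet (E i a) = ldet (E (t.nb3 i b) (t.L i b a)) * ldet (E i b)"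
    using ldet_comp[OF fab(5) fa(5)] ldet_comp[OF fba(5) fb(5)] by simp
  then show ?thesis using 1(1) 3 assms fa(4)[OF assms(2)] fb(4)[OF assms(1)]
    by (simp add: comm_at_def nb_simps E_iota mult.commute mult.left_commute)
qed

lemma comm_iota_Z:
  assumes "a \<in> N3" "F \<in> Z4" "lorentz (\<iota> a) F = 0" "i < k" shows "comm_at (i, \<epsilon>, c, z) (\<iota> a) F"
  using assms E_Z[OF assms(4,1,2,3)] by (simp add: comm_at_def nb_simps)

lemma comm_iota_rest:
  assumes "a \<in> N3" "F \<in> rest" "lorentz (\<iota> a) F = 0" "i < k" shows "comm_at (i, \<epsilon>, c, z) (\<iota> a) F"
  using assms E_rest[OF assms(4,1,2,3)] col_step[OF assms(4,1,2,3)] by (simp add: comm_at_def nb_simps)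

lemma comm_Z_rest: "F \<in> Z4 \<Longrightarrow> F' \<in> rest \<Longrightarrow> comm_at (i, \<epsilon>, c, z) F F'"
  by (simp add: comm_at_def nb_simps)

lemma comm_rest_rest: "F \<in> rest \<Longrightarrow> F' \<in> rest \<Longrightarrow> comm_at (i, \<epsilon>, c, z) F F'"
  using sdiff_props(2) by (simp add: comm_at_def nb_simps)

text \<open>This is the purpose of \<open>perm\<close>: it turns toggling the colour of
  \<open>F\<close> at copy \<open>i\<close> into toggling the colour of \<open>F\<close> at the
  partner.\<close>

lemma comm_opp_rest:
  assumes "F \<in> rest" "i < k" "c \<subseteq> Col" shows "comm_at (i, \<epsilon>, c, z) opp0 F"
proof -
  let ?j = "mate z i"
  have j: "?j < k" by (rule mate(1)[OF assms(2)])
  have "perm i ?j ` sdiff c {col i F} = sdiff (perm i ?j ` c) (perm i ?j ` {col i F})"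
    using perm_props(1)[OF assms(2) j] col_Col[OF assms(2,1)] assms(3)
    by (intro sdiff_image[where D = Col]) (auto simp: bij_betw_def)
  also have "perm i ?j ` {col i F} = {col ?j F}" using perm_props(2)[OF assms(2) j assms(1)] by simp
  finally show ?thesis using assms(1) by (simp add: comm_at_def nb_simps)
qed

text \<open>The pairs of facets not covered by the preceding lemmas are never orthogonal.\<close>

lemma all_comm:
  assumes t: "t \<in> T" and v: "v \<in> N4" "w \<in> N4" "lorentz v w = 0" shows "comm_at t v w"
proof -
  obtain i \<epsilon> c z where t: "t = (i, \<epsilon>, c, z)" "i < k" "c \<subseteq> Col" using T_cases[OF t] by metis
  have wv: "lorentz w v = 0" using v by (simp add: lorentz_sym)
  have f: "comm_at t f0 w" if w: "w \<in> N4" "lorentz f0 w = 0" for w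
  proof -
    obtain a where "a \<in> N3" "w = \<iota> a" using orth_f0[OF w] by blast
    then show ?thesis using comm_f0 t by simp
  qed
  have a: "comm_at t (\<iota> a) w" if a: "a \<in> N3" and w: "w \<in> N4" "lorentz (\<iota> a) w = 0" for a w
    using w(1)
  proof (cases rule: walls_cases)
    case 1
    then show ?thesis using comm_at_sym comm_f0[OF a t(2)] t(1) by simp
  next
    case (2 b)
    then show ?thesis using comm_iota_iota[OF a, of b i] w(2) t by (simp add: iota_lorentz)
  next
    case 3 then show ?thesis using comm_iota_Z[OF a 3 w(2) t(2)] t(1) by simp
  next
    case 4 then show ?thesis using opp_facts(3)[OF a] w(2) by (simp add: lorentz_sym)
  next
    case 5 then show ?thesis using comm_iota_rest[OF a 5 w(2) t(2)] t(1) by simp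
  qed
  have z: "comm_at t F w" if F: "F \<in> Z4" and w: "w \<in> N4" "lorentz F w = 0" "w \<notin> \<iota> ` N3" for F w
    using w(1)
  proof (cases rule: walls_cases)
    case 1 then show ?thesis using Z_facts(4)[OF F] w(2) by simp
  next
    case (2 b) then show ?thesis using w(3) by blast
  next
    case 3 then show ?thesis using Z_facts(6)[OF F 3] w(2) by simp
  next
    case 4 then show ?thesis using Z_facts(5)[OF F] w(2) by simp
  next
    case 5 then show ?thesis using comm_Z_rest[OF F 5] t(1) by simp
  qed
  have o: "comm_at t opp0 w" if w: "w \<in> N4" "lorentz opp0 w = 0" for w
    using w(1)
  proof (cases rule: walls_cases)
    case 1 then show ?thesis using opp_facts(4) w(2) by simp
  next
    case (2 b) then show ?thesis using opp_facts(3) w(2) by simp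
  next
    case 3 then show ?thesis using Z_facts(5)[OF 3] w(2) by (simp add: lorentz_sym)
  next
    case 4 then show ?thesis using right_angledD(3)[OF ra4 w(1)] w(2) by simp
  next
    case 5 then show ?thesis using comm_opp_rest[OF 5 t(2,3)] t(1) by simp
  qed
  show ?thesis using v(1)
  proof (cases rule: walls_cases)
    case 1 then show ?thesis using f v by simp
  next
    case (2 b) then show ?thesis using a v by simp
  next
    case 3
    show ?thesis
    proof (cases "w \<in> \<iota> ` N3")
      case True
      then show ?thesis using a[of _ v] v(1) wv comm_at_sym by blast
    next
      case False then show ?thesis using z[OF 3 v(2,3)] by simp
    qed
  next
    case 4 then show ?thesis using o v by simp
  next
    case 5
    show ?thesis using v(2)
    proof (cases rule: walls_cases)
      case 1 then show ?thesis using f[OF v(1)] wv comm_at_sym by simp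
    next
      case (2 b) then show ?thesis using a[OF 2(1) v(1)] wv comm_at_sym by simp
    next
      case 3
      have "v \<notin> \<iota> ` N3" using walls_distinct(9)[OF 5] by blast
      then show ?thesis using z[OF 3 v(1) wv] comm_at_sym by blast
    next
      case 4 then show ?thesis using o[OF v(1)] wv comm_at_sym by simp
    next
      case rest: 5
      show ?thesis using comm_rest_rest[OF 5 rest] t(1) by simp
    qed
  qed
qed

sublocale m: mirror N4 s T nb sy
proof
  show "right_angled N4 s" by (rule ra4)
  fix t v w x assume a: "t \<in> T" "v \<in> N4"
  show "nb t v \<in> T" "lor (sy t v)" "sy t v e0 = e0" "nb (nb t v) (sy t v v) = t" "sy (nb t v) (sy t v v) (sy t v x) = x"
    using nb_T sy_props a by auto
  assume w: "w \<in> N4"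
  show "sy t v w \<in> N4" using sy_props(3) a w by auto
  assume "lorentz v w = 0"
  then show "nb (nb t v) (sy t v w) = nb (nb t w) (sy t w v)"
    "sy (nb t v) (sy t v w) (sy t v x) = sy (nb t w) (sy t w v) (sy t w x)"
    using all_comm[OF a w] by (auto simp: comm_at_def)
qed

definition sgn_of :: "tile \<Rightarrow> real" where "sgn_of t = fst (snd t)"

sublocale m: oriented_mirror N4 s T nb sy sgn_of
proof
  fix t v assume a: "t \<in> T"
  obtain i \<epsilon> c z where t: "t = (i, \<epsilon>, c, z)" "i < k" "\<epsilon> = 1 \<or> \<epsilon> = -1" using T_cases[OF a] by metis
  show "sgn_of t \<noteq> 0" using t by (auto simp: sgn_of_def)
  assume v: "v \<in> N4"
  show "sgn_of (nb t v) = - sgn_of t * ldet (sy t v)" using v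
    by (cases rule: walls_cases) (simp_all add: t sgn_of_def nb_simps)
qed

end

section \<open>Freeness\<close>

text \<open>The product of the reflections in pairwise orthogonal normals, written as one sum so
  that no order has to be chosen.\<close>

definition rfl :: "'n::finite mink set \<Rightarrow> 'n mink \<Rightarrow> 'n mink" where
  "rfl W x = x - (\<Sum>w\<in>W. lorentz w x *\<^sub>R w)"

lemma rfl_empty [simp]: "rfl {} = id"
  by (simp add: rfl_def fun_eq_iff)

lemma rfl_fix: "(\<And>w. w \<in> W \<Longrightarrow> lorentz w x = 0) \<Longrightarrow> rfl W x = x"
  by (simp add: rfl_def)

lemma lorentz_rfl: "(\<And>w. w \<in> W \<Longrightarrow> lorentz v w = 0) \<Longrightarrow> lorentz v (rfl W x) = lorentz v x"
  by (simp add: rfl_def lorentz_sum)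

lemma rfl_commute:
  assumes "\<And>w. w \<in> W \<Longrightarrow> lorentz v w = 0" shows "lrefl v (rfl W x) = rfl W (lrefl v x)"
proof -
  have "lorentz w (lrefl v x) = lorentz w x" if "w \<in> W" for w
    using assms[OF that] by (simp add: lrefl_def lorentz_sym[of w v])
  then have "rfl W (lrefl v x) = lrefl v x - (\<Sum>w\<in>W. lorentz w x *\<^sub>R w)" by (simp add: rfl_def)
  then show ?thesis using lorentz_rfl[of W v x] assms by (simp add: rfl_def lrefl_def)
qed

text \<open>Crossing a wall twice cancels, so reflections toggle membership in \<open>W\<close> in
  the same way as the tiles toggle colours.\<close>

lemma rfl_toggle:
  assumes W: "finite W" "\<And>w. w \<in> W \<Longrightarrow> w \<noteq> v \<Longrightarrow> lorentz v w = 0" and v: "lorentz v v = 2"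
  shows "lrefl v (rfl W x) = rfl (sdiff W {v}) x"
proof (cases "v \<in> W")
  case False
  then have "sdiff W {v} = insert v W" by (auto simp: sdiff_def)
  moreover have "lorentz v (rfl W x) = lorentz v x" using W False by (intro lorentz_rfl) metis
  ultimately show ?thesis using W(1) False by (simp add: rfl_def lrefl_def)
next
  case True
  define W' where "W' = W - {v}"
  have W': "W = insert v W'" "v \<notin> W'" "finite W'" using True W(1) by (auto simp: W'_def)
  have "lorentz v (rfl W' x) = lorentz v x" using W(2) by (intro lorentz_rfl) (auto simp: W'_def)
  moreover have "rfl W x = rfl W' x - lorentz v x *\<^sub>R v" using W'(2,3) by (simp add: rfl_def W'(1))
  moreover have "sdiff W {v} = W'" using True by (auto simp: sdiff_def W'_def)
  ultimately show ?thesis using v by (simp add: lrefl_def)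
qed

context coloured_cell
begin

lemma iota_rho: "lorentz (\<iota> a) y = lorentz a (\<rho> y)"
  by (subst (1) decomp[of y]) (simp add: iota_lorentz f0_iota lorentz_sym[of "\<iota> a" f0])

lemma ext_lrefl: "ext (lrefl a) y = lrefl (\<iota> a) y"
proof -
  have "ext (lrefl a) y = \<iota> (\<rho> y) + (lorentz f0 y / 2) *\<^sub>R f0 - lorentz a (\<rho> y) *\<^sub>R \<iota> a"
    by (simp add: ext_def lrefl_def linear_diff[OF iota_linear] linear_cmul[OF iota_linear])
  then show ?thesis using decomp[of y] by (simp add: lrefl_def iota_rho)
qed

lemma ext_cross:
  assumes "linear M" "i < k" "a \<in> N3"
  shows "E i a (lrefl (\<iota> a) (ext M y)) = ext (t.L i a \<circ> lrefl a \<circ> M) y"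
  using ext_comp[OF refl_linear assms(1)] ext_comp[OF L_facts(2)[OF assms(2,3)] linear_compose[OF assms(1) refl_linear]]
  by (simp add: ext_lrefl[symmetric] comp_assoc)

lemma f0_ext: "lorentz f0 (ext M y) = lorentz f0 y"
  by (simp add: ext_def f0_iota f0_f0)

lemma rho_ext: "\<rho> (ext M y) = M (\<rho> y)"
  by (simp add: ext_def linear_add[OF rho_linear] linear_cmul[OF rho_linear] rho_iota rho_f0)

lemma ext_lrefl_f0: assumes "linear M" shows "lrefl f0 (ext M y) = ext M (lrefl f0 y)"
proof -
  have "linear (ext M)"
    by (rule linearI) (simp_all add: ext_def linear_add[OF rho_linear] linear_cmul[OF rho_linear] linear_add[OF assms]
        linear_cmul[OF assms] linear_add[OF iota_linear] linear_cmul[OF iota_linear] algebra_simps add_divide_distrib)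
  then show ?thesis using ext_f0[OF assms] by (simp add: lrefl_def f0_ext linear_diff linear_cmul)
qed

lemma nrm4: "F \<in> N4 \<Longrightarrow> lorentz F F = 2"
  using right_angledD(3)[OF ra4] .

lemma orth_at:
  "F \<in> N4 \<Longrightarrow> F' \<in> N4 \<Longrightarrow> x \<in> hpoly N4 \<Longrightarrow> lorentz F x = 0 \<Longrightarrow> lorentz F' x = 0 \<Longrightarrow> F \<noteq> F' \<Longrightarrow> lorentz F F' = 0"
  using right_angled_orth[OF ra4, of F F' x] by (simp add: hpoly_def)

lemma toggle_col:
  assumes "i < k" "W \<subseteq> rest" "F \<in> rest"
  shows "sdiff (sdiff c (col i ` W)) {col i F} = sdiff c (col i ` sdiff W {F})"
  using sdiff_image[OF col_inj[OF assms(1)] assms(2), of "{F}"] assms(3) by (simp add: sdiff_props(3))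

text \<open>All other facets through a point of \<open>opp0\<close> are in \<open>rest\<close>. The
  set \<open>W\<close> of those crossed an odd number of times appears both in the isometry and in
  the colours of the tile, which lets the tile determine the isometry up to the reflection in
  \<open>opp0\<close>.\<close>

lemma zreach_opp:
  assumes "m.zreach (i, \<epsilon>, c, z) x t' B" and x: "x \<in> hpoly N4" "lorentz opp0 x = 0" and i: "i < k" and c: "c \<subseteq> Col"
  shows "\<exists>W j \<epsilon>'. W \<subseteq> {F \<in> rest. lorentz F x = 0} \<and>
    (j = i \<and> B = rfl W \<or> j = mate z i \<and> B = rfl W \<circ> lrefl opp0) \<and>
    t' = (j, \<epsilon>', perm i j ` sdiff c (col i ` W), z)"
  using assms(1)
proof (induction rule: m.zreach.induct)
  case start
  show ?case by (rule exI[of _ "{}"], rule exI[of _ i], rule exI[of _ \<epsilon>])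
      (use perm_props(4)[OF i i] in \<open>simp add: sdiff_props\<close>)
next
  case (cross t' B v)
  then obtain W j \<epsilon>' where W: "W \<subseteq> {F \<in> rest. lorentz F x = 0}"
    and jA: "j = i \<and> B = rfl W \<or> j = mate z i \<and> B = rfl W \<circ> lrefl opp0"
    and t': "t' = (j, \<epsilon>', perm i j ` sdiff c (col i ` W), z)" by blast
  have mi: "mate z i < k" by (rule mate(1)[OF i])
  have j: "j < k" using jA i mi by auto
  have WN: "w \<in> N4" "lorentz w x = 0" if "w \<in> W" for w using W that walls_distinct(9) by auto
  have fin: "finite W" using WN right_angledD(1)[OF ra4] by (metis finite_subset subsetI)
  have Ax: "B x = x" using jA rfl_fix[of W x] WN refl_fix[OF x(2)] by auto
  have vx: "lorentz v x = 0" using cross Ax by simp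
  have cW: "sdiff c (col i ` W) \<subseteq> Col" using c W col_Col[OF i] by (auto simp: sdiff_def)
  have vW: "lorentz v w = 0" if "w \<in> W" "w \<noteq> v" for w
    using orth_at[OF cross(2) WN(1)[OF that(1)] x(1) vx WN(2)[OF that(1)]] that(2) by blast
  show ?case
  proof (cases "v = opp0")
    case True
    have oW: "lorentz opp0 w = 0" if "w \<in> W" for w
      using vW[OF that] True that W walls_distinct(6) by blast
    have c1: "lrefl opp0 (rfl W y) = rfl W (lrefl opp0 y)" for y using rfl_commute oW by blast
    have c2: "lrefl opp0 (lrefl opp0 y) = y" for y using refl_refl nrm4 opp_facts(1) by blast
    have n: "nb t' v = (mate z j, - \<epsilon>', perm j (mate z j) ` perm i j ` sdiff c (col i ` W), z)" "sy t' v = id"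
      unfolding True t' by (simp_all add: nb_simps)
    show ?thesis
    proof (cases "j = i \<and> B = rfl W")
      case t: True
      have "id \<circ> lrefl v \<circ> B = rfl W \<circ> lrefl opp0" using t c1 by (simp add: fun_eq_iff True)
      then show ?thesis unfolding n using t perm_props(4)[OF i i] W by (metis id_apply image_id)
    next
      case False
      then have t: "j = mate z i" "B = rfl W \<circ> lrefl opp0" using jA by auto
      have m: "mate z j = i" using t mate(2)[OF i] by simp
      have "perm j (mate z j) ` perm i j ` sdiff c (col i ` W) = sdiff c (col i ` W)"
        unfolding m by (rule perm_image_back[OF i j cW])
      moreover have "id \<circ> lrefl v \<circ> B = rfl W" using t c1 c2 by (simp add: fun_eq_iff True)
      ultimately show ?thesis unfolding n using m W perm_props(4)[OF i i] by (metis id_apply image_id)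
    qed
  next
    case False
    then have ov: "lorentz opp0 v = 0" using orth_at[OF opp_facts(1) cross(2) x vx] by blast
    have v: "v \<in> rest" using cross(2)
    proof (cases rule: walls_cases)
      case 1 then show ?thesis using ov opp_facts(4) by simp
    next
      case (2 a) then show ?thesis using ov opp_facts(3) by simp
    next
      case 3 then show ?thesis using ov Z_facts(5) by (simp add: lorentz_sym)
    qed (use False in auto)
    let ?W = "sdiff W {v}"
    have W': "?W \<subseteq> {F \<in> rest. lorentz F x = 0}" using W v vx by (auto simp: sdiff_def)
    have r: "lrefl v (rfl W y) = rfl ?W y" for y using rfl_toggle[OF fin _ nrm4[OF cross(2)]] vW by blast
    have "sdiff (perm i j ` sdiff c (col i ` W)) {col j v} = sdiff (perm i j ` sdiff c (col i ` W)) (perm i j ` {col i v})"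
      using perm_props(2)[OF i j v] by simp
    also have "\<dots> = perm i j ` sdiff (sdiff c (col i ` W)) {col i v}"
      using sdiff_image[of "perm i j" Col, OF _ cW, of "{col i v}"] perm_props(1)[OF i j] col_Col[OF i v]
      by (simp add: bij_betw_def)
    also have "sdiff (sdiff c (col i ` W)) {col i v} = sdiff c (col i ` ?W)"
      using toggle_col[OF i _ v] W by auto
    finally have n: "nb t' v = (j, - \<epsilon>', perm i j ` sdiff c (col i ` ?W), z)" "sy t' v = id"
      unfolding t' using v by (simp_all add: nb_simps)
    have "j = i \<and> id \<circ> lrefl v \<circ> B = rfl ?W \<or> j = mate z i \<and> id \<circ> lrefl v \<circ> B = rfl ?W \<circ> lrefl opp0"
      using jA r by (auto simp: fun_eq_iff)
    then show ?thesis unfolding n using W' by blast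
  qed
qed

text \<open>Only \<open>f0\<close> and walls pass through such a point, and the reflection in
  \<open>f0\<close> commutes with all extensions; so the chain projects to a chain of crossings in
  M.\<close>

lemma zreach_f0:
  assumes "m.zreach (i, \<epsilon>, c, z) x t' B" and x: "x \<in> hpoly N4" "lorentz f0 x = 0" and i: "i < k"
  shows "\<exists>j \<epsilon>' M. t' = (j, \<epsilon>', c, z) \<and> t.m3.zreach i (\<rho> x) j M \<and> (B = ext M \<or> B = ext M \<circ> lrefl f0)"
  using assms(1)
proof (induction rule: m.zreach.induct)
  case start
  have "t.m3.zreach i (\<rho> x) i id" using i by (intro t.m3.zreach.start) simp
  moreover have "ext id = id" by (simp add: fun_eq_iff ext_id)
  ultimately show ?case by metis
next
  case (cross t' B v)
  then obtain j \<epsilon>' M where t': "t' = (j, \<epsilon>', c, z)" and M: "t.m3.zreach i (\<rho> x) j M"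
    and B: "B = ext M \<or> B = ext M \<circ> lrefl f0" by blast
  have jM: "j < k" "lor M" "linear M" using t.m3.reach_props[OF t.m3.zreach_reach[OF M]] lor_linear by auto
  have Ax: "B x = ext M x" using B refl_fix[OF x(2)] by auto
  have fA: "lorentz f0 (B x) = 0" using x(2) by (simp add: Ax f0_ext)
  have AP: "B x \<in> hpoly N4" using m.zreach_hpoly[OF cross(1) x(1)] .
  show ?case
  proof (cases "v = f0")
    case True
    have "id \<circ> lrefl v \<circ> ext M = ext M \<circ> lrefl f0" "id \<circ> lrefl v \<circ> (ext M \<circ> lrefl f0) = ext M"
      using ext_lrefl_f0[OF jM(3)] refl_refl[OF f0_f0] by (simp_all add: fun_eq_iff True)
    then have "id \<circ> lrefl v \<circ> B = ext M \<or> id \<circ> lrefl v \<circ> B = ext M \<circ> lrefl f0" using B by metis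
    moreover have "nb t' v = (j, - \<epsilon>', c, z)" "sy t' v = id" unfolding True t' by (simp_all add: nb_simps)
    ultimately show ?thesis using M by metis
  next
    case False
    then have "lorentz f0 v = 0" using orth_at[OF f0_N4 cross(2) AP fA cross(3)] by blast
    then obtain a where a: "a \<in> N3" "v = \<iota> a" using orth_f0[OF cross(2)] by blast
    have "lorentz a (M (\<rho> x)) = 0" using cross(3) by (simp add: a Ax iota_rho rho_ext)
    then have M': "t.m3.zreach i (\<rho> x) (t.nb3 j a) (t.L j a \<circ> lrefl a \<circ> M)" by (rule t.m3.zreach.cross[OF M a(1)])
    have "E j a \<circ> lrefl v \<circ> ext M = ext (t.L j a \<circ> lrefl a \<circ> M)"
      "E j a \<circ> lrefl v \<circ> (ext M \<circ> lrefl f0) = ext (t.L j a \<circ> lrefl a \<circ> M) \<circ> lrefl f0"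
      using ext_cross[OF jM(3,1) a(1)] unfolding a(2) fun_eq_iff comp_apply by blast+
    then have "E j a \<circ> lrefl v \<circ> B = ext (t.L j a \<circ> lrefl a \<circ> M) \<or>
      E j a \<circ> lrefl v \<circ> B = ext (t.L j a \<circ> lrefl a \<circ> M) \<circ> lrefl f0" using B by metis
    moreover have "nb t' v = (t.nb3 j a, - \<epsilon>' * ldet (E j a), c, z)" "sy t' v = E j a"
      unfolding a(2) t' using a(1) by (simp_all add: nb_simps)
    ultimately show ?thesis using M' by metis
  qed
qed

lemma zreach_generic:
  assumes "m.zreach (i, \<epsilon>, c, z) x t' B" and x: "x \<in> hpoly N4" "lorentz f0 x \<noteq> 0" "lorentz opp0 x \<noteq> 0"
    and i: "i < k" and p: "\<rho> x = r *\<^sub>R p" "r > 0"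
  shows "\<exists>j \<epsilon>' M W. W \<subseteq> {F \<in> rest \<union> Z4. lorentz F x = 0} \<and>
    t' = (j, \<epsilon>', sdiff c (col i ` (W \<inter> rest)), z \<noteq> (W \<inter> Z4 \<noteq> {})) \<and> t.m3.zreach i p j M \<and> B = ext M \<circ> rfl W \<and>
    lorentz opp0 (B x) \<noteq> 0 \<and>
    (\<forall>F\<in>rest. lorentz F (B x) = 0 \<longrightarrow> (\<exists>F0\<in>rest. lorentz F0 x = 0 \<and> ext M F0 = F \<and> col j F = col i F0)) \<and>
    (\<forall>F\<in>Z4. lorentz F (B x) = 0 \<longrightarrow> (\<exists>F0\<in>Z4. lorentz F0 x = 0 \<and> ext M F0 = F))"
  using assms(1)
proof (induction rule: m.zreach.induct)
  case start
  have "t.m3.zreach i p i id" using i by (intro t.m3.zreach.start) simp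
  then show ?case
    using \<open>t.m3.zreach i p i id\<close>[unfolded id_def]
    by (intro exI[of _ i] exI[of _ \<epsilon>] exI[of _ id] exI[of _ "{}"])
      (use x ext_id in \<open>auto simp: sdiff_props fun_eq_iff id_def\<close>)
next
  case (cross t' B v)
  from cross(4) obtain j \<epsilon>' M W where IH: "W \<subseteq> {F \<in> rest \<union> Z4. lorentz F x = 0} \<and>
    t' = (j, \<epsilon>', sdiff c (col i ` (W \<inter> rest)), z \<noteq> (W \<inter> Z4 \<noteq> {})) \<and> t.m3.zreach i p j M \<and> B = ext M \<circ> rfl W \<and>
    lorentz opp0 (B x) \<noteq> 0 \<and>
    (\<forall>F\<in>rest. lorentz F (B x) = 0 \<longrightarrow> (\<exists>F0\<in>rest. lorentz F0 x = 0 \<and> ext M F0 = F \<and> col j F = col i F0)) \<and>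
    (\<forall>F\<in>Z4. lorentz F (B x) = 0 \<longrightarrow> (\<exists>F0\<in>Z4. lorentz F0 x = 0 \<and> ext M F0 = F))" by (elim exE)
  note W = IH[THEN conjunct1] and t' = IH[THEN conjunct2, THEN conjunct1] and M = IH[THEN conjunct2, THEN conjunct2, THEN conjunct1]
    and B = IH[THEN conjunct2, THEN conjunct2, THEN conjunct2, THEN conjunct1]
    and oA = IH[THEN conjunct2, THEN conjunct2, THEN conjunct2, THEN conjunct2, THEN conjunct1]
    and IR = IH[THEN conjunct2, THEN conjunct2, THEN conjunct2, THEN conjunct2, THEN conjunct2, THEN conjunct1, rule_format]
    and IZ = IH[THEN conjunct2, THEN conjunct2, THEN conjunct2, THEN conjunct2, THEN conjunct2, THEN conjunct2, rule_format]
  have jM: "j < k" "lor M" "linear M" using t.m3.reach_props[OF t.m3.zreach_reach[OF M]] lor_linear by auto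
  have WN: "w \<in> N4" "lorentz w x = 0" if "w \<in> W" for w using W that walls_distinct(8,9) by auto
  have fin: "finite W" using WN right_angledD(1)[OF ra4] by (metis finite_subset subsetI)
  have Ax: "B x = ext M x" using B rfl_fix[of W x] WN by auto
  have AP: "B x \<in> hpoly N4" using m.zreach_hpoly[OF cross(1) x(1)] .
  show ?case
  proof (cases "v \<in> \<iota> ` N3")
    case True
    then obtain a where a: "a \<in> N3" "v = \<iota> a" by blast
    note f = L_facts[OF jM(1) a(1)]
    let ?j = "t.nb3 j a" and ?M = "t.L j a \<circ> lrefl a \<circ> M" and ?b = "t.L j a a"
    have "lorentz a (M (\<rho> x)) = 0" using cross(3) by (simp add: a Ax iota_rho rho_ext)
    then have "lorentz a (M p) = 0" using p by (simp add: linear_cmul[OF jM(3)])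
    then have M': "t.m3.zreach i p ?j ?M" by (rule t.m3.zreach.cross[OF M a(1)])
    have e: "ext ?M y = E j a (lrefl v (ext M y))" for y using ext_cross[OF jM(3,1) a(1)] unfolding a(2) by simp
    have "(E j a \<circ> lrefl v \<circ> B) y = (ext ?M \<circ> rfl W) y" for y using e[of "rfl W y"] B by (metis comp_apply)
    then have A': "E j a \<circ> lrefl v \<circ> B = ext ?M \<circ> rfl W" by (rule HOL.ext)
    have A'x: "(E j a \<circ> lrefl v \<circ> B) x = E j a (B x)" using refl_fix[OF cross(3)] by simp
    have ib: "lorentz (\<iota> ?b) (E j a (B x)) = 0" using E_orth[OF jM(1) a(1)] cross(3) a(2) by simp
    have EP: "E j a (B x) \<in> hpoly N4"
      using m.zreach_hpoly[OF m.zreach.cross[OF cross(1,2,3)] x(1)] refl_fix[OF cross(3)] a t' by (simp add: nb_simps)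
    \<comment> \<open>A facet through the new point other than the wall just crossed is orthogonal
      to that wall, so it comes back through it and keeps its class.\<close>
    have lift: "\<exists>F. E j a F = F' \<and> lorentz F (B x) = 0 \<and> lrefl v F = F \<and> (F' \<in> rest \<longrightarrow> F \<in> rest \<and> col j F = col ?j F') \<and> (F' \<in> Z4 \<longrightarrow> F \<in> Z4)"
      if F': "F' \<in> N4" "F' \<noteq> \<iota> ?b" "lorentz F' (E j a (B x)) = 0" for F'
    proof -
      let ?F = "E ?j ?b F'"
      have Ib: "\<iota> ?b \<in> N4" using walls_distinct(10)[OF f(7)] by blast
      have o: "lorentz (\<iota> ?b) F' = 0" using orth_at[OF Ib F'(1) EP ib F'(3)] F'(2) by blast
      have EF: "E j a ?F = F'" using L_facts(10)[OF f(6,7), of F'] f(8) t.L_back(2)[OF jM(1) a(1)] t.L_props(2)[OF jM(1) a(1)]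
          t.L_props(2)[OF t.pairing(1,2)[OF jM(1) a(1)]] by simp
      have va: "lorentz v ?F = 0" using E_orth[OF jM(1) a(1), of ?F] EF o a(2) by simp
      have 1: "lorentz ?F (B x) = 0" using lor_lorentz[OF f(5), of ?F "B x"] EF F'(3) by simp
      have 2: "F' \<in> rest \<Longrightarrow> ?F \<in> rest" using E_rest[OF f(6,7) _ o] by blast
      have 3: "F' \<in> Z4 \<Longrightarrow> ?F \<in> Z4" using E_Z[OF f(6,7) _ o] by blast
      have 4: "F' \<in> rest \<Longrightarrow> col j ?F = col ?j F'" using col_step[OF f(6,7) _ o] f(8) by simp
      show ?thesis using EF 1 2 3 4 refl_fix[OF va] by blast
    qed
    have o1: "lorentz opp0 ((E j a \<circ> lrefl v \<circ> B) x) \<noteq> 0"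
      unfolding A'x using lor_lorentz[OF f(5), of opp0 "B x"] E_opp0[OF jM(1) a(1)] oA by simp
    have r1: "\<exists>F0\<in>rest. lorentz F0 x = 0 \<and> ext ?M F0 = F \<and> col ?j F = col i F0"
      if F: "F \<in> rest" "lorentz F ((E j a \<circ> lrefl v \<circ> B) x) = 0" for F
    proof -
      have "F \<noteq> \<iota> ?b" "F \<in> N4" using walls_distinct(9)[OF F(1)] f(7) by auto
      then obtain F1 where F1: "E j a F1 = F" "lorentz F1 (B x) = 0" "lrefl v F1 = F1" "F1 \<in> rest" "col j F1 = col ?j F"
        using lift[of F] F A'x by auto
      obtain F0 where "F0 \<in> rest" "lorentz F0 x = 0" "ext M F0 = F1" "col j F1 = col i F0" using IR[OF F1(4,2)] by blast
      then show ?thesis using e[of F0] F1 by metis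
    qed
    have z1: "\<exists>F0\<in>Z4. lorentz F0 x = 0 \<and> ext ?M F0 = F"
      if F: "F \<in> Z4" "lorentz F ((E j a \<circ> lrefl v \<circ> B) x) = 0" for F
    proof -
      have "F \<noteq> \<iota> ?b" "F \<in> N4" using walls_distinct(8)[OF F(1)] f(7) by auto
      then obtain F1 where F1: "E j a F1 = F" "lorentz F1 (B x) = 0" "lrefl v F1 = F1" "F1 \<in> Z4"
        using lift[of F] F A'x by auto
      obtain F0 where "F0 \<in> Z4" "lorentz F0 x = 0" "ext M F0 = F1" using IZ[OF F1(4,2)] by blast
      then show ?thesis using e[of F0] F1 by metis
    qed
    have n1: "nb t' v = (?j, - \<epsilon>' * ldet (E j a), sdiff c (col i ` (W \<inter> rest)), z \<noteq> (W \<inter> Z4 \<noteq> {}))" "sy t' v = E j a"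
      unfolding a(2) t' using a(1) by (simp_all add: nb_simps)
    have "W \<subseteq> {F \<in> rest \<union> Z4. lorentz F x = 0} \<and>
      nb t' v = (?j, - \<epsilon>' * ldet (E j a), sdiff c (col i ` (W \<inter> rest)), z \<noteq> (W \<inter> Z4 \<noteq> {})) \<and>
      t.m3.zreach i p ?j ?M \<and> E j a \<circ> lrefl v \<circ> B = ext ?M \<circ> rfl W \<and> lorentz opp0 ((E j a \<circ> lrefl v \<circ> B) x) \<noteq> 0 \<and>
      (\<forall>F\<in>rest. lorentz F ((E j a \<circ> lrefl v \<circ> B) x) = 0 \<longrightarrow> (\<exists>F0\<in>rest. lorentz F0 x = 0 \<and> ext ?M F0 = F \<and> col ?j F = col i F0)) \<and>
      (\<forall>F\<in>Z4. lorentz F ((E j a \<circ> lrefl v \<circ> B) x) = 0 \<longrightarrow> (\<exists>F0\<in>Z4. lorentz F0 x = 0 \<and> ext ?M F0 = F))"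
      using r1 z1 by (intro conjI W n1 M' A' o1 ballI impI)
    then show ?thesis unfolding n1(2) by (intro exI)
  next
    case False
    have "v \<noteq> f0" using cross(3) x(2) by (auto simp: Ax f0_ext)
    moreover have "v \<noteq> opp0" using cross(3) oA by auto
    ultimately have v: "v \<in> rest \<or> v \<in> Z4" using walls_cases[OF cross(2)] False by blast
    have "\<exists>F0. (v \<in> rest \<longrightarrow> F0 \<in> rest \<and> col j v = col i F0) \<and> (v \<in> Z4 \<longrightarrow> F0 \<in> Z4) \<and> lorentz F0 x = 0 \<and> ext M F0 = v"
      using v IR[OF _ cross(3)] IZ[OF _ cross(3)] walls_distinct(8,9) by meson
    then obtain F0 where F0: "v \<in> rest \<Longrightarrow> F0 \<in> rest \<and> col j v = col i F0" "v \<in> Z4 \<Longrightarrow> F0 \<in> Z4"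
      "lorentz F0 x = 0" "ext M F0 = v" by blast
    have F0N: "F0 \<in> N4" using v F0 walls_distinct(8,9) by blast
    let ?W = "sdiff W {F0}"
    have W': "?W \<subseteq> {F \<in> rest \<union> Z4. lorentz F x = 0}" using W v F0 by (auto simp: sdiff_def)
    have vW: "lorentz F0 w = 0" if "w \<in> W" "w \<noteq> F0" for w
      using orth_at[OF F0N WN(1)[OF that(1)] x(1) F0(3) WN(2)[OF that(1)]] that(2) by blast
    have r: "lrefl F0 (rfl W y) = rfl ?W y" for y using rfl_toggle[OF fin _ nrm4[OF F0N]] vW by blast
    have A': "id \<circ> lrefl v \<circ> B = ext M \<circ> rfl ?W"
      using lor_refl[OF ext_lor[OF jM(2)], of F0] F0(4) r unfolding B fun_eq_iff comp_apply id_apply by metis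
    have A'x: "(id \<circ> lrefl v \<circ> B) x = B x" using refl_fix[OF cross(3)] by simp
    have nb: "nb t' v = (j, - \<epsilon>', sdiff c (col i ` (?W \<inter> rest)), z \<noteq> (?W \<inter> Z4 \<noteq> {}))" "sy t' v = id"
    proof -
      show "sy t' v = id" using v by (auto simp: nb_simps)
      show "nb t' v = (j, - \<epsilon>', sdiff c (col i ` (?W \<inter> rest)), z \<noteq> (?W \<inter> Z4 \<noteq> {}))"
      proof (cases "v \<in> rest")
        case True
        then have F: "F0 \<in> rest" "F0 \<notin> Z4" "col j v = col i F0" using F0 walls_distinct(9) by blast+
        have "?W \<inter> rest = sdiff (W \<inter> rest) {F0}" "?W \<inter> Z4 = W \<inter> Z4" using F by (auto simp: sdiff_def)
        then show ?thesis using toggle_col[OF i _ F(1), of "W \<inter> rest"] True F(3) by (simp add: t' nb_simps)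
      next
        case F: False
        then have z: "v \<in> Z4" "F0 \<in> Z4" "F0 \<notin> rest" using v F0 walls_distinct(8) by blast+
        \<comment> \<open>Facets of \<open>Z4\<close> are never orthogonal, so at most one of them
          passes through \<open>x\<close>, and the flag records the parity of its crossings.\<close>
        have "W \<inter> Z4 \<subseteq> {F0}" using vW Z_facts(6)[OF z(2)] by blast
        then have "(?W \<inter> Z4 \<noteq> {}) = (W \<inter> Z4 = {})" using z by (auto simp: sdiff_def)
        moreover have "?W \<inter> rest = W \<inter> rest" using z by (auto simp: sdiff_def)
        ultimately show ?thesis using z by (auto simp: t' nb_simps)
      qed
    qed
    show ?thesis unfolding nb A'x using W' A' M oA IR IZ
      by (intro exI[of _ j] exI[of _ "- \<epsilon>'"] exI[of _ M] exI[of _ ?W]) blast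
  qed
qed

lemma rho_time: assumes "x \<in> hyp" shows "lorentz (\<rho> x) (\<rho> x) < 0" "\<rho> x $ None > 0"
proof -
  have "lorentz x x = lorentz (\<rho> x) (\<rho> x) + (lorentz f0 x)\<^sup>2 / 2"
  proof -
    have "lorentz (\<iota> u + b *\<^sub>R f0) (\<iota> u + b *\<^sub>R f0) = lorentz u u + 2 * b\<^sup>2" for u b
      using lorentz_sym[of "\<iota> u" f0] by (simp add: iota_lorentz f0_iota f0_f0 power2_eq_square)
    from this[of "\<rho> x" "lorentz f0 x / 2"] have "lorentz x x = lorentz (\<rho> x) (\<rho> x) + 2 * (lorentz f0 x / 2)\<^sup>2"
      unfolding decomp[of x, symmetric] .
    moreover have "2 * (lorentz f0 x / 2)\<^sup>2 = (lorentz f0 x)\<^sup>2 / 2" by (simp add: power_divide)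
    ultimately show ?thesis by (rule trans[OF _ arg_cong])
  qed
  then show n: "lorentz (\<rho> x) (\<rho> x) < 0" using hyp_self[OF assms] zero_le_power2[of "lorentz f0 x"] by linarith
  have "S\<^sup>2 < C\<^sup>2" using par(2) by linarith
  then have S: "S < C" by (rule power2_less_imp_less) (use pos in simp)
  have "\<bar>sp x $ 1\<bar> \<le> norm (sp x)" by (rule component_le_norm_cart)
  also have "norm (sp x) < x $ None"
  proof -
    have "(norm (sp x))\<^sup>2 = (x $ None)\<^sup>2 - 1" using hyp_self[OF assms] lorentz_self[of x] by simp
    then have "(norm (sp x))\<^sup>2 < (x $ None)\<^sup>2" by linarith
    then show ?thesis by (rule power2_less_imp_less) (use hyp_pos[OF assms] in simp)
  qed
  finally have "S * sp x $ 1 \<le> S * x $ None" using pos by (intro mult_left_mono) auto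
  also have "\<dots> < C * x $ None" using S hyp_pos[OF assms] by simp
  finally show "\<rho> x $ None > 0" by (simp add: \<rho>_def)
qed

text \<open>In each of the three positions of \<open>x\<close> the return to the same tile cancels
  the coloured crossings, and \<open>zreach_free\<close> cancels those taken from M. A remaining
  reflection in \<open>opp0\<close> or \<open>f0\<close> would have determinant -1, against the
  orientation.\<close>

lemma free: assumes t: "t \<in> T" and x: "x \<in> hpoly N4" "m.zreach t x t B" "B x = x" shows "B = id"
proof -
  obtain i \<epsilon> c z where t: "t = (i, \<epsilon>, c, z)" "i < k" "c \<subseteq> Col" using T_cases[OF t] by metis
  have det: "ldet B = 1" using m.reach_self_ldet[OF m.zreach_reach[OF x(2)]] .
  have z: "m.zreach (i, \<epsilon>, c, z) x (i, \<epsilon>, c, z) B" using x(2) t(1) by simp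
  have xh: "x \<in> hyp" using x(1) by (simp add: hpoly_def)
  have dr: "ldet (lrefl v) \<noteq> 1" if "v \<in> N4" for v using ldet_lrefl[OF nrm4[OF that]] by simp
  show ?thesis
  proof (cases "lorentz opp0 x = 0")
    case True
    then obtain W j \<epsilon>' where W: "W \<subseteq> {F \<in> rest. lorentz F x = 0}"
      "j = i \<and> B = rfl W \<or> j = mate z i \<and> B = rfl W \<circ> lrefl opp0"
      "(i, \<epsilon>, c, z) = (j, \<epsilon>', perm i j ` sdiff c (col i ` W), z)"
      using zreach_opp[OF z x(1) _ t(2,3)] by blast
    then have "j = i" "c = sdiff c (col i ` W)" using perm_props(4)[OF t(2,2)] by auto
    then have "W = {}" using sdiff_props(4) by (metis image_is_empty)
    then have "B = id \<or> B = lrefl opp0" using W(2) by auto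
    then show ?thesis using det dr[OF opp_facts(1)] by blast
  next
    case o: False
    define p where "p = nrm (\<rho> x)"
    define r where "r = sqrt (- lorentz (\<rho> x) (\<rho> x))"
    have r: "r > 0" using rho_time(1)[OF xh] by (simp add: r_def)
    have rp: "\<rho> x = r *\<^sub>R p" using r by (simp add: p_def nrm_def r_def)
    have "lorentz a p \<le> 0" if a: "a \<in> N3" for a
    proof -
      have "lorentz (\<iota> a) x \<le> 0" using x(1) walls_distinct(10)[OF a] by (simp add: hpoly_def)
      then have "r * lorentz a p \<le> 0" by (simp add: iota_rho rp)
      then show ?thesis using r by (simp add: mult_le_0_iff)
    qed
    then have pP: "p \<in> hpoly N3" using nrm_hyp[OF rho_time[OF xh]] by (simp add: hpoly_def p_def)
    show ?thesis
    proof (cases "lorentz f0 x = 0")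
      case True
      obtain M where M: "t.m3.zreach i (\<rho> x) i M" "B = ext M \<or> B = ext M \<circ> lrefl f0"
        using zreach_f0[OF z x(1) True t(2)] by auto
      have "B x = ext M x" using M(2) refl_fix[OF True] by auto
      then have "M (\<rho> x) = \<rho> x" using x(3) rho_ext by metis
      moreover have "\<rho> x = p"
      proof -
        have "x = \<iota> (\<rho> x)" using decomp[of x] True by simp
        then have "lorentz (\<rho> x) (\<rho> x) = -1" using hyp_self[OF xh] iota_lorentz by metis
        then show ?thesis by (simp add: p_def nrm_def)
      qed
      ultimately have "M = id" using t.zreach_free M(1) pP by metis
      moreover have "ext id = id" using ext_id(2) by (simp add: fun_eq_iff)
      ultimately have "B = id \<or> B = lrefl f0" using M(2) by (metis id_comp)
      then show ?thesis using det dr[OF f0_N4] by blast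
    next
      case False
      obtain \<epsilon>' M W where W: "W \<subseteq> {F \<in> rest \<union> Z4. lorentz F x = 0}"
        "c = sdiff c (col i ` (W \<inter> rest))" "z = (z \<noteq> (W \<inter> Z4 \<noteq> {}))" "t.m3.zreach i p i M" "B = ext M \<circ> rfl W"
        using zreach_generic[OF z x(1) False o t(2) rp r] by auto
      have "W \<inter> rest = {}" using W(2) sdiff_props(4) by (metis image_is_empty)
      moreover have "W \<inter> Z4 = {}" using W(3) by blast
      ultimately have "W = {}" using W(1) by blast
      then have B: "B = ext M" using W(5) by simp
      then have "M (\<rho> x) = \<rho> x" using x(3) rho_ext by metis
      moreover have "linear M" using t.m3.reach_props[OF t.m3.zreach_reach[OF W(4)]] lor_linear by blast
      ultimately have "M p = p" using r by (simp add: rp linear_cmul)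
      then have "M = id" using t.zreach_free W(4) pP by blast
      then show ?thesis using B ext_id(2) by (intro ext) (simp only: id_apply)
    qed
  qed
qed

sublocale m: free_mirror N4 s T nb sy sgn_of
  by standard (rule free)

end

section \<open>Local finiteness of the tiling\<close>

context mirror
begin

lemma sy_time: "t \<in> T \<Longrightarrow> v \<in> \<N> \<Longrightarrow> sy t v y $ None = y $ None"
  using lor_lorentz[OF sylor, of t v e0 y] sye0[of t v] by simp

lemma zreach_time: "zreach t0 x t A \<Longrightarrow> A x $ None = x $ None"
proof (induction rule: zreach.induct)
  case (cross t A v)
  then show ?case using sy_time reach_props[OF zreach_reach[OF cross(1)]] by (simp add: refl_fix)
qed simp

text \<open>Folding lowers the time component and crossings through \<open>x\<close> keep it.
  Consequently no tile centre is closer to a point of the cell than \<open>e0\<close>.\<close>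

lemma folds_time: "folds t0 x t A \<Longrightarrow> x $ None \<le> A x $ None"
proof (induction rule: folds.induct)
  case (zero t A)
  then show ?case using zreach_time by simp
next
  case (fold t A v)
  have "(sy t v \<circ> lrefl v \<circ> A) x $ None = A x $ None - lorentz v (A x) * s"
    using fold sy_time right_angledD(4)[OF ra] by (simp add: lrefl_def)
  moreover have "lorentz v (A x) * s > 0" using fold right_angledD(2)[OF ra] by simp
  ultimately show ?case using fold.IH by linarith
qed

lemma reach_time: "reach t0 t A \<Longrightarrow> x \<in> hpoly \<N> \<Longrightarrow> x $ None \<le> A x $ None"
  using folds_time reach_folds by blast

text \<open>A tile with a point \<open>y\<close> in the ball has its centre at least as close to
  \<open>y\<close> as \<open>e0\<close> is, so the centre is within 2 R of \<open>e0\<close>.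
  Composing with \<open>inv B0\<close> for one such \<open>B0\<close> reduces the count to elements
  of the group.\<close>

lemma tiles_finite: "finite {B. reach t0 t B \<and> (\<exists>y\<in>hyp. y $ None \<le> c \<and> B y \<in> hpoly \<N>)}"
proof (cases "\<exists>B0. reach t0 t B0 \<and> (\<exists>y\<in>hyp. y $ None \<le> c \<and> B0 y \<in> hpoly \<N>)")
  case False
  then have "{B. reach t0 t B \<and> (\<exists>y\<in>hyp. y $ None \<le> c \<and> B y \<in> hpoly \<N>)} = {}" by blast
  then show ?thesis by (simp only: finite.emptyI)
next
  case True
  \<comment> \<open>The maximum keeps the argument in the domain of \<open>arcosh\<close>; points of
    \<open>hyp\<close> have time component at least 1.\<close>
  define R where "R = arcosh (max 1 c)"
  have R: "R \<ge> 0" "cosh R = max 1 c" by (simp_all add: R_def)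
  have bound: "hdist e0 (B e0) \<le> 2 * R" if B: "reach t0 t B" "y \<in> hyp" "y $ None \<le> c" "B y \<in> hpoly \<N>" for B y
  proof -
    have l: "lor B" using reach_props[OF B(1)] by blast
    have h: "B y \<in> hyp" "B e0 \<in> hyp" using lor_hyp[OF l] B(2) e0_hyp by auto
    have "B y $ None \<le> inv B (B y) $ None" by (rule reach_time[OF reach_inv[OF B(1)] B(4)])
    then have "B y $ None \<le> y $ None" by (simp add: lor_inv_simps(2)[OF l])
    then have "hdist e0 (B y) \<le> R" "hdist e0 y \<le> R"
      using hdist_le_iff[OF e0_hyp h(1) R(1)] hdist_le_iff[OF e0_hyp B(2) R(1)] B(3) R(2) by auto
    moreover have "hdist e0 (B e0) \<le> hdist e0 (B y) + hdist (B y) (B e0)"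
      by (rule hdist_triangle) (use h e0_hyp in auto)
    moreover have "hdist (B y) (B e0) = hdist e0 y" using hdist_lor[OF l] hdist_sym by metis
    ultimately show ?thesis by linarith
  qed
  obtain B0 y0 where B0: "reach t0 t B0" "y0 \<in> hyp" "y0 $ None \<le> c" "B0 y0 \<in> hpoly \<N>" using True by blast
  have l0: "lor B0" using reach_props[OF B0(1)] by blast
  let ?S = "{B. reach t0 t B \<and> (\<exists>y\<in>hyp. y $ None \<le> c \<and> B y \<in> hpoly \<N>)}"
  let ?f = "\<lambda>B. inv B0 \<circ> B"
  have "?f ` ?S \<subseteq> {A. reach t0 t0 A \<and> - lorentz e0 (A e0) \<le> cosh (4 * R)}"
  proof
    fix A assume "A \<in> ?f ` ?S"
    then obtain B y where B: "reach t0 t B" "y \<in> hyp" "y $ None \<le> c" "B y \<in> hpoly \<N>" "A = inv B0 \<circ> B" by blast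
    have l: "lor B" using reach_props[OF B(1)] by blast
    have h: "B0 e0 \<in> hyp" "B e0 \<in> hyp" "inv B0 (B e0) \<in> hyp"
      using lor_hyp[OF l0 e0_hyp] lor_hyp[OF l e0_hyp] lor_hyp[OF lor_inv[OF l0]] by auto
    have "hdist e0 (inv B0 (B e0)) = hdist (B0 e0) (B e0)"
      using hdist_lor[OF l0, of e0 "inv B0 (B e0)"] by (simp add: lor_inv_simps[OF l0])
    also have "\<dots> \<le> hdist (B0 e0) e0 + hdist e0 (B e0)" by (rule hdist_triangle) (use h e0_hyp in auto)
    also have "\<dots> \<le> 4 * R" using bound[OF B0] bound[OF B(1-4)] by (simp add: hdist_sym)
    finally have "- lorentz e0 (inv B0 (B e0)) \<le> cosh (4 * R)"
      using hdist_le_iff[OF e0_hyp h(3), of "4 * R"] R(1) by simp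
    moreover have "reach t0 t0 A" unfolding B(5) by (rule reach_trans[OF reach_inv[OF B0(1)] B(1)])
    ultimately show "A \<in> {A. reach t0 t0 A \<and> - lorentz e0 (A e0) \<le> cosh (4 * R)}" by (simp add: B(5))
  qed
  then have "finite (?f ` ?S)" using reach_finite finite_subset by blast
  moreover have "inj_on ?f ?S"
  proof (rule inj_onI)
    fix B B' assume "inv B0 \<circ> B = inv B0 \<circ> B'"
    then have "inv B0 (B y) = inv B0 (B' y)" for y by (metis comp_apply)
    then have "B y = B' y" for y using lor_inv_simps(1)[OF l0] by metis
    then show "B = B'" by blast
  qed
  ultimately show ?thesis by (rule finite_imageD)
qed

text \<open>By local finiteness only finitely many of the closed preimages of \<open>K\<close> meet
  a neighbourhood of a given point.\<close>

lemma closed_orbit: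
  assumes K: "closed K" "K \<subseteq> hpoly \<N>"
  shows "closed {y \<in> hyp. \<exists>B. reach t0 t B \<and> B y \<in> K}"
proof -
  let ?S = "{y \<in> hyp. \<exists>B. reach t0 t B \<and> B y \<in> K}"
  have "y \<in> ?S" if y: "y \<in> closure ?S" for y
  proof -
    have "closure ?S \<subseteq> hyp" by (rule closure_minimal) (use hyp_closed in auto)
    then have yh: "y \<in> hyp" using y by blast
    let ?F = "{B. reach t0 t B \<and> (\<exists>z\<in>hyp. z $ None \<le> y $ None + 1 \<and> B z \<in> hpoly \<N>)}"
    have "y \<in> ball y 1 \<inter> closure ?S" using y by simp
    then have 1: "y \<in> closure (ball y 1 \<inter> ?S)" using open_Int_closure_subset[of "ball y 1" ?S] by blast
    have 2: "ball y 1 \<inter> ?S \<subseteq> (\<Union>B\<in>?F. inv B ` K)"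
    proof
      fix z assume z: "z \<in> ball y 1 \<inter> ?S"
      then obtain B where B: "reach t0 t B" "B z \<in> K" "z \<in> hyp" by blast
      have l: "lor B" using reach_props[OF B(1)] by blast
      have "\<bar>(z - y) $ None\<bar> \<le> norm (z - y)" by (rule component_le_norm_cart)
      also have "\<dots> < 1" using z by (simp add: dist_norm norm_minus_commute)
      finally have "z $ None \<le> y $ None + 1" by simp
      then have "B \<in> ?F" using B K by blast
      moreover have "z = inv B (B z)" using lor_inv_simps(2)[OF l] by simp
      ultimately show "z \<in> (\<Union>B\<in>?F. inv B ` K)" using B(2) by blast
    qed
    have l: "lor B" if "B \<in> ?F" for B using that reach_props by blast
    have "closed (\<Union>B\<in>?F. inv B ` K)"
    proof (rule closed_UN[OF tiles_finite], rule ballI)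
      fix B assume "B \<in> ?F"
      then have "lor (inv B)" using l lor_inv by blast
      then show "closed (inv B ` K)" by (intro closed_injective_linear_image[OF K(1)] lor_linear lor_inj)
    qed
    then have "y \<in> (\<Union>B\<in>?F. inv B ` K)" using closure_minimal[OF 2] 1 by blast
    then obtain B x where B: "B \<in> ?F" "x \<in> K" "y = inv B x" by blast
    then have "B y \<in> K" using lor_inv_simps(1)[OF l[OF B(1)]] by simp
    then show ?thesis using B(1) yh by blast
  qed
  then have "closure ?S \<subseteq> ?S" by (rule subsetI)
  then show ?thesis by (simp only: closure_subset_eq)
qed

end

lemma openin_discrete_prod:
  "openin (prod_topology (discrete_topology I) X) W \<longleftrightarrow>
     W \<subseteq> I \<times> topspace X \<and> (\<forall>i\<in>I. openin X {x. (i, x) \<in> W})"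
proof (intro iffI conjI ballI)
  assume W: "openin (prod_topology (discrete_topology I) X) W"
  show s: "W \<subseteq> I \<times> topspace X" using openin_subset[OF W] by simp
  fix i assume i: "i \<in> I"
  have "continuous_map X (prod_topology (discrete_topology I) X) (\<lambda>x. (i, x))"
    using i by (intro continuous_map_pairedI) auto
  from openin_continuous_map_preimage[OF this W] have "openin X {x \<in> topspace X. (i, x) \<in> W}" .
  moreover have "{x \<in> topspace X. (i, x) \<in> W} = {x. (i, x) \<in> W}" using s by auto
  ultimately show "openin X {x. (i, x) \<in> W}" by simp
next
  assume a: "W \<subseteq> I \<times> topspace X \<and> (\<forall>i\<in>I. openin X {x. (i, x) \<in> W})"
  have "W = (\<Union>i\<in>I. {i} \<times> {x. (i, x) \<in> W})" using a by auto
  moreover have "openin (prod_topology (discrete_topology I) X) (\<Union>i\<in>I. {i} \<times> {x. (i, x) \<in> W})"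
    by (intro openin_Union) (use a in \<open>auto simp: openin_prod_Times_iff\<close>)
  ultimately show "openin (prod_topology (discrete_topology I) X) W" by simp
qed

section \<open>The embedding\<close>

locale nonempty_cell = coloured_cell +
  assumes kpos: "0 < k"
begin

definition st :: "nat \<Rightarrow> tile" where "st i = (i, 1, {}, False)"

lemma st_T: "i < k \<Longrightarrow> st i \<in> T" by (simp add: st_def TI)

lemma reach_step: "m.reach t0 (i, \<epsilon>, c, z) B \<Longrightarrow> v \<in> N4 \<Longrightarrow> nb (i, \<epsilon>, c, z) v = t' \<Longrightarrow> \<exists>B'. m.reach t0 t' B'"
  using m.reach.cross by blast

text \<open>For even \<open>i\<close> the opposite facet leads to the next index; for odd
  \<open>i\<close> a facet of \<open>Z4\<close> is crossed before and after it to set and clear the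
  flag. Either route has an odd number of crossings, and \<open>f0\<close> restores the
  sign.\<close>

lemma st_reach: "i < k \<Longrightarrow> \<exists>B. m.reach (st 0) (st i) B"
proof (induction i)
  case 0
  show ?case using m.reach.start[OF st_T[OF kpos]] by blast
next
  case (Suc i)
  then obtain B where B: "m.reach (st 0) (i, 1, {}, False) B" by (auto simp: st_def)
  have "\<exists>B. m.reach (st 0) (Suc i, -1, {}, False) B"
  proof (cases "even i")
    case True
    then have "mate False i = Suc i" using Suc by (simp add: mate_def)
    then show ?thesis using reach_step[OF B opp_facts(1)] by (simp add: nb_simps)
  next
    case False
    obtain z where z: "z \<in> Z4" "z \<in> N4" using Z_nonempty Z_facts(1) by blast
    have m: "mate True i = Suc i" using Suc False by (simp add: mate_def)
    obtain B1 where B1: "m.reach (st 0) (i, -1, {}, True) B1" using reach_step[OF B z(2) nb_simps(3)[OF z(1)]] by auto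
    obtain B2 where B2: "m.reach (st 0) (Suc i, 1, {}, True) B2" using reach_step[OF B1 opp_facts(1) nb_simps(4)] m by auto
    show ?thesis using reach_step[OF B2 z(2)] z(1) by (simp add: nb_simps)
  qed
  then obtain B where "m.reach (st 0) (Suc i, -1, {}, False) B" by blast
  then show ?case using reach_step[OF _ f0_N4] by (simp add: nb_simps st_def)
qed

definition pth :: "nat \<Rightarrow> 4 mink \<Rightarrow> 4 mink" where "pth i = (SOME B. m.reach (st 0) (st i) B)"

lemma pth: assumes "i < k" shows "m.reach (st 0) (st i) (pth i)" "lor (pth i)"
proof -
  show 1: "m.reach (st 0) (st i) (pth i)" unfolding pth_def by (rule someI_ex[OF st_reach[OF assms]])
  show "lor (pth i)" using m.reach_props[OF 1] by blast
qed

sublocale dg: disc_group "m.\<Gamma> (st 0)" by (rule m.gamma_disc[OF st_T[OF kpos]])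

text \<open>The cells over M follow a path of crossings in M. When the sign comes out negative,
  crossing \<open>f0\<close> corrects it without moving the points of its hyperplane.\<close>

lemma m3_lift:
  assumes "t.m3.reach i j M" shows "\<exists>B. m.reach (st i) (st j) B \<and> (\<forall>y. B (\<iota> y) = \<iota> (M y))"
proof -
  have fix0: "lrefl f0 (\<iota> y) = \<iota> y" for y by (rule refl_fix[OF f0_iota])
  have flip: "\<exists>B. m.reach (st i) (st j) B \<and> (\<forall>y. B (\<iota> y) = \<iota> (M y))"
    if B: "m.reach (st i) (j, -1, {}, False) B" "\<And>y. B (\<iota> y) = \<iota> (M y)" for j B M
  proof -
    have "m.reach (st i) (st j) (id \<circ> lrefl f0 \<circ> B)"
      using m.reach.cross[OF B(1) f0_N4] by (simp add: nb_simps st_def)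
    moreover have "\<forall>y. (id \<circ> lrefl f0 \<circ> B) (\<iota> y) = \<iota> (M y)" using B(2) fix0 by simp
    ultimately show ?thesis by blast
  qed
  show ?thesis using assms
  proof (induction rule: t.m3.reach.induct)
    case start
    then have "m.reach (st i) (st i) id" using st_T by (intro m.reach.start) simp
    then show ?case by (metis id_apply)
  next
    case (cross j M a)
    then obtain B where B: "m.reach (st i) (st j) B" "\<And>y. B (\<iota> y) = \<iota> (M y)" by blast
    have j: "j < k" using t.m3.reach_props[OF cross(1)] by simp
    have aN: "\<iota> a \<in> N4" using walls_distinct(10)[OF cross(2)] by blast
    let ?B = "E j a \<circ> lrefl (\<iota> a) \<circ> B" and ?M = "t.L j a \<circ> lrefl a \<circ> M"
    have r: "m.reach (st i) (t.nb3 j a, - ldet (E j a), {}, False) ?B"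
      using m.reach.cross[OF B(1) aN] cross(2) by (simp add: st_def nb_simps)
    have l: "lrefl (\<iota> a) (\<iota> y) = \<iota> (lrefl a y)" for y
      by (simp add: lrefl_def iota_lorentz linear_diff[OF iota_linear] linear_cmul[OF iota_linear])
    have e: "?B (\<iota> y) = \<iota> (?M y)" for y using B(2) l E_iota[OF j cross(2)] by simp
    show ?case
    proof (cases "ldet (E j a) = 1")
      case True
      then have "m.reach (st i) (t.nb3 j a, -1, {}, False) ?B" using r by simp
      from flip[OF this e] show ?thesis .
    next
      case False
      then have "- ldet (E j a) = 1" using ldet_E[OF j cross(2)] by auto
      then have "m.reach (st i) (st (t.nb3 j a)) ?B" using r by (simp only: st_def)
      then show ?thesis using e by blast
    qed
  qed
qed

lemma glue_class:
  assumes "i < k" "j < k" "x \<in> t.P" "y \<in> t.P"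
  shows "h (i, x) = h (j, y) \<longleftrightarrow> (\<exists>M. t.m3.zreach i x j M \<and> M x = y)"
proof
  assume "h (i, x) = h (j, y)"
  then have "((i, x), (j, y)) \<in> (face_glue N3 k \<tau> g)\<^sup>*" using t.glue_iff assms by blast
  from t.glue_zreach[OF this assms(1,3)] show "\<exists>M. t.m3.zreach i x j M \<and> M x = y" by simp
next
  assume "\<exists>M. t.m3.zreach i x j M \<and> M x = y"
  then obtain M where M: "t.m3.zreach i x j M" "M x = y" by blast
  obtain V \<phi> G where "(V, \<phi>) \<in> Ac" "lor G" "t.dev V \<phi> G i x" using t.dev_exists[OF assms(1,3)] by metis
  then show "h (i, x) = h (j, y)" using t.zreach_dev[OF M(1) assms(3)] M(2) by metis
qed

text \<open>A violated facet would be orthogonal to \<open>f0\<close> by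
  \<open>right_angled_orth\<close>, hence a wall, and the walls are not violated by
  assumption.\<close>

lemma iota_P: assumes "x \<in> t.P" shows "\<iota> x \<in> hpoly N4"
proof -
  have x: "x \<in> hyp" "\<And>a. a \<in> N3 \<Longrightarrow> lorentz a x \<le> 0" using assms by (auto simp: hpoly_def)
  have h: "\<iota> x \<in> hyp" by (rule iota_hyp[OF x(1)])
  have "lorentz F (\<iota> x) \<le> 0" if F: "F \<in> N4" for F
  proof (rule ccontr)
    assume n: "\<not> lorentz F (\<iota> x) \<le> 0"
    then have "F \<noteq> f0" using f0_iota by auto
    then have "lorentz f0 F = 0" using right_angled_orth[OF ra4 f0_N4 F _ h] n f0_iota by auto
    then obtain a where "a \<in> N3" "F = \<iota> a" using orth_f0[OF F] by blast
    then show False using n x(2) iota_lorentz by auto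
  qed
  then show ?thesis using h by (simp add: hpoly_def)
qed

definition place :: "nat \<Rightarrow> 3 mink \<Rightarrow> (nat \<times> 4 mink) set" where
  "place i x = dg.q (inv (pth i) (\<iota> x))"

lemma Gam_iff: "B \<in> m.\<Gamma> (st 0) \<longleftrightarrow> m.reach (st 0) (st 0) B" by (simp add: m.\<Gamma>_def)

lemma place_lift:
  assumes "i < k" "j < k" "m.reach (st i) (st j) B" "B (\<iota> x) = \<iota> y" shows "place i x = place j y"
proof -
  have "inv (pth j) \<circ> B \<circ> pth i \<in> m.\<Gamma> (st 0)"
    unfolding Gam_iff using m.reach_trans[OF m.reach_trans[OF m.reach_inv[OF pth(1)[OF assms(2)]] assms(3)] pth(1)[OF assms(1)]]
    by (simp add: comp_assoc)
  moreover have "inv (pth j) (\<iota> y) = (inv (pth j) \<circ> B \<circ> pth i) (inv (pth i) (\<iota> x))"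
    using lor_inv_simps(1)[OF pth(2)[OF assms(1)]] assms(4) by simp
  ultimately show ?thesis unfolding place_def dg.q_eq by blast
qed

lemma place_eq:
  assumes ij: "i < k" "j < k" and xy: "x \<in> t.P" "y \<in> t.P"
  shows "place i x = place j y \<longleftrightarrow> h (i, x) = h (j, y)"
proof
  assume "h (i, x) = h (j, y)"
  then obtain M where M: "t.m3.zreach i x j M" "M x = y" using glue_class[OF assms] by blast
  obtain B where "m.reach (st i) (st j) B" "\<forall>y. B (\<iota> y) = \<iota> (M y)"
    using m3_lift[OF t.m3.zreach_reach[OF M(1)]] by blast
  then show "place i x = place j y" using place_lift[OF ij] M(2) by blast
next
  assume "place i x = place j y"
  then obtain A0 where A0: "m.reach (st 0) (st 0) A0" "inv (pth j) (\<iota> y) = A0 (inv (pth i) (\<iota> x))"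
    unfolding place_def dg.q_eq using Gam_iff by blast
  define B where "B = pth j \<circ> A0 \<circ> inv (pth i)"
  have B: "m.reach (st i) (st j) B"
    unfolding B_def using m.reach_trans[OF m.reach_trans[OF pth(1)[OF ij(2)] A0(1)] m.reach_inv[OF pth(1)[OF ij(1)]]]
    by (simp add: comp_assoc)
  have Bx: "B (\<iota> x) = \<iota> y" using A0(2)[symmetric] lor_inv_simps(1)[OF pth(2)[OF ij(2)]] by (simp add: B_def)
  \<comment> \<open>Both points lie in the closed cell, so the path can be replaced by crossings
    through one point, which \<open>zreach_f0\<close> projects to M.\<close>
  have z: "m.zreach (st i) (\<iota> x) (st j) B"
    using m.reach_zreach[OF B iota_P[OF xy(1)]] Bx iota_P[OF xy(2)] by simp
  then have "m.zreach (i, 1, {}, False) (\<iota> x) (j, 1, {}, False) B" by (simp add: st_def)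
  from zreach_f0[OF this iota_P[OF xy(1)] f0_iota ij(1)]
  obtain M where M: "t.m3.zreach i x j M" "B = ext M \<or> B = ext M \<circ> lrefl f0" by (auto simp: rho_iota)
  have "linear M" using t.m3.reach_props[OF t.m3.zreach_reach[OF M(1)]] lor_linear by blast
  then have "B (\<iota> x) = \<iota> (M x)" using M(2) refl_fix[OF f0_iota] ext_iota by auto
  then have "M x = y" using Bx iota_inj by metis
  then show "h (i, x) = h (j, y)" using glue_class[OF assms] M(1) by blast
qed

abbreviation Pr where "Pr \<equiv> prod_topology (discrete_topology {..<k}) (top_of_set t.P)"

lemma h_quot: "quotient_map Pr X h" using t.tes by (simp add: tessellation_def)

lemma h_onto: assumes "p \<in> topspace X" obtains i x where "i < k" "x \<in> t.P" "p = h (i, x)"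
proof -
  have "p \<in> h ` ({..<k} \<times> t.P)" using quotient_imp_surjective_map[OF h_quot] assms by simp
  then show ?thesis using that by blast
qed

definition f where
  "f p = (SOME y. \<exists>i x. i < k \<and> x \<in> t.P \<and> p = h (i, x) \<and> y = place i x)"

lemma f_h: assumes "i < k" "x \<in> t.P" shows "f (h (i, x)) = place i x"
proof -
  have "\<exists>y. \<exists>j z. j < k \<and> z \<in> t.P \<and> h (i, x) = h (j, z) \<and> y = place j z" using assms by blast
  then have "\<exists>j z. j < k \<and> z \<in> t.P \<and> h (i, x) = h (j, z) \<and> f (h (i, x)) = place j z"
    unfolding f_def by (rule someI_ex)
  then obtain j z where j: "j < k" "z \<in> t.P" "h (i, x) = h (j, z)" "f (h (i, x)) = place j z" by blast
  then show ?thesis using place_eq[OF assms(1) j(1) assms(2) j(2)] by simp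
qed

lemma pth_iota_hyp: assumes "i < k" "x \<in> hyp" shows "inv (pth i) (\<iota> x) \<in> hyp"
  using lor_hyp[OF lor_inv[OF pth(2)[OF assms(1)]]] iota_hyp[OF assms(2)] by blast

lemma P_hyp: "t.P \<subseteq> hyp" by (auto simp: hpoly_def)

lemma cont_pth_iota: assumes "i < k" shows "continuous_on Q (\<lambda>x. inv (pth i) (\<iota> x))"
proof -
  have "linear (\<lambda>x. inv (pth i) (\<iota> x))"
    using linear_compose[OF iota_linear lor_linear[OF lor_inv[OF pth(2)[OF assms]]]] by (simp add: o_def)
  then show ?thesis by (simp add: linear_continuous_on linear_linear)
qed

lemma place_cont: assumes "i < k" shows "continuous_map (top_of_set t.P) dg.Y (place i)"
proof -
  have "continuous_map (top_of_set t.P) (top_of_set hyp) (\<lambda>x. inv (pth i) (\<iota> x))"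
    using cont_pth_iota[OF assms] pth_iota_hyp[OF assms] P_hyp by (auto simp: continuous_map_in_subtopology)
  from continuous_map_compose[OF this dg.q_cont] show ?thesis by (simp add: o_def place_def[abs_def])
qed

lemma f_cont: "continuous_map X dg.Y f"
proof (rule continuous_compose_quotient_map[OF h_quot])
  have "continuous_map Pr dg.Y (\<lambda>(i, x). place i x)"
    unfolding continuous_map_def
  proof (intro conjI allI impI)
    show "(\<lambda>(i, x). place i x) \<in> topspace Pr \<rightarrow> topspace dg.Y"
      using pth_iota_hyp P_hyp by (auto simp: place_def)
    fix W assume W: "openin dg.Y W"
    have "openin (top_of_set t.P) {x. (i, x) \<in> {a \<in> topspace Pr. (case a of (i, x) \<Rightarrow> place i x) \<in> W}}" if i: "i < k" for i
      using openin_continuous_map_preimage[OF place_cont[OF i] W] i by simp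
    then show "openin Pr {a \<in> topspace Pr. (case a of (i, x) \<Rightarrow> place i x) \<in> W}"
      unfolding openin_discrete_prod by auto
  qed
  then show "continuous_map Pr dg.Y (f \<circ> h)"
    by (rule continuous_map_eq) (auto simp: f_h)
qed

lemma f_inj: "inj_on f (topspace X)"
proof (rule inj_onI)
  fix p p' assume "p \<in> topspace X" "p' \<in> topspace X" and e: "f p = f p'"
  then obtain i x j y where "i < k" "x \<in> t.P" "p = h (i, x)" "j < k" "y \<in> t.P" "p' = h (j, y)" by (metis h_onto)
  then show "p = p'" using e f_h place_eq by simp
qed

lemma place_closed:
  assumes i: "i < k" and K: "closedin (top_of_set t.P) K" shows "closedin dg.Y (place i ` K)"
proof -
  have KP: "K \<subseteq> t.P" using closedin_imp_subset[OF K] .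
  have "closed K" using K hpoly_closed closedin_closed_trans by blast
  then have cK: "closed (\<iota> ` K)"
    by (rule closed_injective_linear_image[OF _ iota_linear]) (use iota_inj in \<open>blast intro: injI\<close>)
  have KP4: "\<iota> ` K \<subseteq> hpoly N4" using KP iota_P by blast
  have sub: "place i ` K \<subseteq> dg.q ` hyp" using KP P_hyp pth_iota_hyp[OF i] by (auto simp: place_def)
  have "hyp \<inter> dg.q -` (place i ` K) = {y \<in> hyp. \<exists>B. m.reach (st 0) (st i) B \<and> B y \<in> \<iota> ` K}"
  proof (intro equalityI subsetI)
    fix y assume "y \<in> hyp \<inter> dg.q -` (place i ` K)"
    then obtain x where x: "y \<in> hyp" "x \<in> K" "dg.q y = dg.q (inv (pth i) (\<iota> x))" by (auto simp: place_def)
    then obtain A0 where A0: "m.reach (st 0) (st 0) A0" "inv (pth i) (\<iota> x) = A0 y"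
      unfolding dg.q_eq using Gam_iff by blast
    have "(pth i \<circ> A0) y = \<iota> x" using A0(2)[symmetric] lor_inv_simps(1)[OF pth(2)[OF i]] by simp
    then show "y \<in> {y \<in> hyp. \<exists>B. m.reach (st 0) (st i) B \<and> B y \<in> \<iota> ` K}"
      using x m.reach_trans[OF pth(1)[OF i] A0(1)] by blast
  next
    fix y assume "y \<in> {y \<in> hyp. \<exists>B. m.reach (st 0) (st i) B \<and> B y \<in> \<iota> ` K}"
    then obtain B x where B: "y \<in> hyp" "m.reach (st 0) (st i) B" "x \<in> K" "B y = \<iota> x" by blast
    have "inv (pth i) \<circ> B \<in> m.\<Gamma> (st 0)"
      unfolding Gam_iff by (rule m.reach_trans[OF m.reach_inv[OF pth(1)[OF i]] B(2)])
    then have "dg.q y = dg.q (inv (pth i) (\<iota> x))" unfolding dg.q_eq using B(4) by (metis comp_apply)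
    then show "y \<in> hyp \<inter> dg.q -` (place i ` K)" using B by (auto simp: place_def)
  qed
  then have "closed (hyp \<inter> dg.q -` (place i ` K))" using m.closed_orbit[OF cK KP4] by simp
  then have "openin (top_of_set hyp) (hyp - (hyp \<inter> dg.q -` (place i ` K)))"
    by (intro openin_diff closed_subset) auto
  moreover have "hyp - (hyp \<inter> dg.q -` (place i ` K)) = hyp \<inter> dg.q -` (dg.q ` hyp - place i ` K)" by auto
  ultimately have "openin dg.Y (dg.q ` hyp - place i ` K)" unfolding dg.openin_Y by simp
  then show ?thesis using sub by (simp add: closedin_def)
qed

text \<open>Closedness, which promotes the continuous injection to an embedding, can be checked on
  the finitely many closed copies.\<close>

lemma f_closed: "closed_map X dg.Y f"
  unfolding closed_map_def
proof (intro allI impI)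
  fix K assume K: "closedin X K"
  have KX: "K \<subseteq> topspace X" using closedin_subset[OF K] .
  have "f ` K = (\<Union>i<k. place i ` {x \<in> t.P. h (i, x) \<in> K})"
  proof (intro equalityI subsetI)
    fix y assume "y \<in> f ` K"
    then obtain p where p: "p \<in> K" "y = f p" by blast
    obtain i x where "i < k" "x \<in> t.P" "p = h (i, x)" using h_onto KX p by blast
    then show "y \<in> (\<Union>i<k. place i ` {x \<in> t.P. h (i, x) \<in> K})" using p f_h by auto
  next
    fix y assume "y \<in> (\<Union>i<k. place i ` {x \<in> t.P. h (i, x) \<in> K})"
    then obtain i x where "i < k" "x \<in> t.P" "h (i, x) \<in> K" "y = place i x" by blast
    then show "y \<in> f ` K" using f_h by (metis imageI)
  qed
  moreover have "closedin dg.Y (place i ` {x \<in> t.P. h (i, x) \<in> K})" if i: "i < k" for i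
    using place_closed[OF i] closedin_continuous_map_preimage[OF t.h_cont[OF i] K] by simp
  then have "closedin dg.Y (\<Union>i<k. place i ` {x \<in> t.P. h (i, x) \<in> K})"
    by (intro closedin_Union) auto
  ultimately show "closedin dg.Y (f ` K)" by simp
qed

lemma f_embedding: "embedding_map X dg.Y f"
  by (rule injective_closed_imp_embedding_map[OF f_cont f_closed f_inj])

text \<open>The image under \<open>h\<close> of a closed set is the preimage under the injection
  \<open>f\<close> of a closed union of placed pieces. This provides saturated neighbourhoods in
  \<open>f_geodesic\<close>.\<close>

lemma h_closed: "closed_map Pr X h"
  unfolding closed_map_def
proof (intro allI impI)
  fix K assume K: "closedin Pr K"
  have Ks: "K \<subseteq> {..<k} \<times> t.P" using closedin_subset[OF K] by simp
  have Ki: "closedin (top_of_set t.P) {x. (i, x) \<in> K}" if i: "i < k" for i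
  proof -
    have "continuous_map (top_of_set t.P) Pr (\<lambda>x. (i, x))" using i by (intro continuous_map_pairedI) auto
    from closedin_continuous_map_preimage[OF this K] show ?thesis using Ks by (simp add: subset_iff) (metis (no_types, lifting) Collect_cong)
  qed
  have "closedin dg.Y (\<Union>i<k. place i ` {x. (i, x) \<in> K})"
    using place_closed Ki by (intro closedin_Union) auto
  from closedin_continuous_map_preimage[OF f_cont this]
  have "closedin X {p \<in> topspace X. f p \<in> (\<Union>i<k. place i ` {x. (i, x) \<in> K})}" .
  moreover have "{p \<in> topspace X. f p \<in> (\<Union>i<k. place i ` {x. (i, x) \<in> K})} = h ` K"
  proof (intro equalityI subsetI)
    fix p assume "p \<in> {p \<in> topspace X. f p \<in> (\<Union>i<k. place i ` {x. (i, x) \<in> K})}"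
    then obtain i x where i: "p \<in> topspace X" "i < k" "(i, x) \<in> K" "f p = place i x" by blast
    have xP: "x \<in> t.P" using Ks i by blast
    have "f p = f (h (i, x))" using f_h[OF i(2) xP] i(4) by simp
    then have "p = h (i, x)" using inj_onD[OF f_inj] i(1) t.h_topspace[OF i(2) xP] by blast
    then show "p \<in> h ` K" using i by blast
  next
    fix p assume "p \<in> h ` K"
    then obtain i x where i: "(i, x) \<in> K" "p = h (i, x)" by auto
    then have "i < k" "x \<in> t.P" using Ks by auto
    then show "p \<in> {p \<in> topspace X. f p \<in> (\<Union>i<k. place i ` {x. (i, x) \<in> K})}"
      using i f_h t.h_topspace by auto
  qed
  ultimately show "closedin X (h ` K)" by simp
qed

lemma f_geodesic:
  assumes p: "p \<in> topspace X"
  shows "\<exists>(V, \<phi>) \<in> Ac. \<exists>(V', \<psi>) \<in> dg.charts. \<exists>N H. openin X N \<and> p \<in> N \<and> N \<subseteq> V \<and> f ` N \<subseteq> V' \<and>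
    hyp_hyperplane H \<and> \<psi> ` f ` N \<subseteq> H \<and> (\<forall>x\<in>N. \<forall>y\<in>N. hdist (\<psi> (f x)) (\<psi> (f y)) = hdist (\<phi> x) (\<phi> y))"
proof -
  obtain i x where ix: "i < k" "x \<in> t.P" "p = h (i, x)" using h_onto[OF p] .
  obtain V \<phi> G where V: "(V, \<phi>) \<in> Ac" "lor G" "t.dev V \<phi> G i x" using t.dev_exists[OF ix(1,2)] by metis
  \<comment> \<open>The position in hyperbolic four-space of the point that the chart shows at
    \<open>z\<close>.\<close>
  define \<Psi> where "\<Psi> z = inv (pth i) (\<iota> (inv G z))" for z
  define y0 where "y0 = inv (pth i) (\<iota> x)"
  note li = lor_inv[OF pth(2)[OF ix(1)]] and lG = lor_inv[OF V(2)]
  have y0: "y0 \<in> hyp" using pth_iota_hyp[OF ix(1)] ix(2) P_hyp by (auto simp: y0_def)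
  obtain r where r: "r > 0" "inj_on dg.q (hball y0 r)" using dg.inj_ball[OF y0] .
  define V' where "V' = dg.q ` hball y0 r"
  define \<psi> where "\<psi> = inv_into (hball y0 r) dg.q"
  have ch: "(V', \<psi>) \<in> dg.charts" using y0 r by (auto simp: dg.charts_def V'_def \<psi>_def)
  define good where "good a \<longleftrightarrow> h a \<in> V \<and> f (h a) = dg.q (\<Psi> (\<phi> (h a))) \<and> \<Psi> (\<phi> (h a)) \<in> hball y0 r" for a
  \<comment> \<open>The largest open set of good points; it will be seen to contain the whole fibre
    over \<open>p\<close>, that is, \<open>p\<close> as seen from every copy that contains
    it.\<close>
  define Q where "Q = \<Union>{W. openin Pr W \<and> (\<forall>a\<in>W. good a)}"
  have Q: "openin Pr Q" "\<And>a. a \<in> Q \<Longrightarrow> good a" unfolding Q_def by (blast intro: openin_Union)+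
  have fibre: "(j, y) \<in> Q" if j: "j < k" "y \<in> t.P" "h (j, y) = p" for j y
  proof -
    obtain M where M: "t.m3.zreach i x j M" "M x = y"
      using glue_class[OF ix(1) j(1) ix(2) j(2)] j(3) ix(3) by auto
    have lM: "lor M" using t.m3.reach_props[OF t.m3.zreach_reach[OF M(1)]] by blast
    have "t.dev V \<phi> (G \<circ> inv M) j y" using t.zreach_dev[OF M(1) ix(2) V(1,3,2)] M(2) by simp
    then obtain N0 where N0: "openin (top_of_set t.P) N0" "y \<in> N0"
      "\<And>y'. y' \<in> N0 \<Longrightarrow> h (j, y') \<in> V \<and> \<phi> (h (j, y')) = G (inv M y')" unfolding t.dev_def by (metis comp_apply)
    obtain B where B: "m.reach (st i) (st j) B" "\<And>y. B (\<iota> y) = \<iota> (M y)"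
      using m3_lift[OF t.m3.zreach_reach[OF M(1)]] by blast
    let ?c = "\<lambda>y'. inv (pth i) (\<iota> (inv M y'))"
    define N1 where "N1 = N0 \<inter> {y'. - lorentz y0 (?c y') < cosh r}"
    have N0P: "N0 \<subseteq> t.P" using openin_imp_subset[OF N0(1)] .
    have "continuous_on UNIV ?c"
      by (rule continuous_on_compose2[OF cont_pth_iota[OF ix(1)] lor_continuous[OF lor_inv[OF lM]] subset_UNIV])
    then have "open {y'. - lorentz y0 (?c y') < cosh r}"
      by (intro open_Collect_less continuous_intros)
    then have N1: "openin (top_of_set t.P) N1" unfolding N1_def using N0(1) openin_Int_open by blast
    have inM: "inv M y = x" using M(2) lor_inv_simps(2)[OF lM] by blast
    have "?c y = y0" by (simp add: inM y0_def)
    then have yN1: "y \<in> N1" using N0(2) hball_iff[OF y0 r(1), of y0] y0 r(1) by (simp add: N1_def hball_def)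
    have "good (j, y')" if y': "y' \<in> N1" for y'
    proof -
      have y'0: "y' \<in> N0" "y' \<in> t.P" "- lorentz y0 (?c y') < cosh r" using y' N0P by (auto simp: N1_def)
      have e: "\<Psi> (\<phi> (h (j, y'))) = ?c y'" using N0(3)[OF y'0(1)] lor_inv_simps(2)[OF V(2)] by (simp add: \<Psi>_def)
      have "?c y' \<in> hyp" using pth_iota_hyp[OF ix(1) lor_hyp[OF lor_inv[OF lM]]] y'0(2) P_hyp by blast
      then have b: "?c y' \<in> hball y0 r" using y'0(3) hball_iff[OF y0 r(1)] by blast
      have "B (\<iota> (inv M y')) = \<iota> y'" using B(2) lor_inv_simps(1)[OF lM] by simp
      then have "place i (inv M y') = place j y'" by (rule place_lift[OF ix(1) j(1) B(1)])
      then have "f (h (j, y')) = dg.q (?c y')" using f_h[OF j(1) y'0(2)] by (simp add: place_def)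
      then show ?thesis unfolding good_def e using N0(3)[OF y'0(1)] b by simp
    qed
    then have "\<forall>a\<in>{j} \<times> N1. good a" by blast
    moreover have "openin Pr ({j} \<times> N1)" using j(1) N1 by (simp add: openin_prod_Times_iff)
    ultimately show ?thesis unfolding Q_def using yN1 by blast
  qed
  \<comment> \<open>All preimages of points of \<open>N\<close> are good; \<open>N\<close> is open
    because \<open>h\<close> is a closed map.\<close>
  define N where "N = topspace X - h ` (topspace Pr - Q)"
  have "closedin Pr (topspace Pr - Q)" using Q(1) by (intro closedin_diff closedin_topspace)
  then have "closedin X (h ` (topspace Pr - Q))" using h_closed unfolding closed_map_def by blast
  then have N: "openin X N" unfolding N_def by (intro openin_diff openin_topspace)
  have pN: "p \<in> N"
  proof -
    have "p \<noteq> h a" if "a \<in> topspace Pr - Q" for a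
    proof
      assume "p = h a"
      moreover obtain j y where "a = (j, y)" by (cases a)
      ultimately show False using that fibre[of j y] by simp
    qed
    then show ?thesis using p by (auto simp: N_def)
  qed
  have g: "good' \<in> V \<and> f good' = dg.q (\<Psi> (\<phi> good')) \<and> \<Psi> (\<phi> good') \<in> hball y0 r" if p': "good' \<in> N" for good'
  proof -
    have "good' \<in> topspace X" using p' by (simp add: N_def)
    then obtain j y where jy: "j < k" "y \<in> t.P" "good' = h (j, y)" by (rule h_onto)
    then have "(j, y) \<in> Q" using p' by (auto simp: N_def)
    then show ?thesis using Q(2) jy(3) by (auto simp: good_def)
  qed
  have \<psi>f: "\<psi> (f p') = \<Psi> (\<phi> p')" if "p' \<in> N" for p'
    using g[OF that] r(2) by (simp add: \<psi>_def)
  define H where "H = {y \<in> hyp. lorentz (inv (pth i) f0) y = 0}"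
  have "lorentz (inv (pth i) f0) (inv (pth i) f0) = 2" using lor_lorentz[OF li] f0_f0 by simp
  then have H: "hyp_hyperplane H" unfolding hyp_hyperplane_def H_def by (intro exI[of _ "inv (pth i) f0"]) simp
  have "\<psi> ` f ` N \<subseteq> H"
  proof
    fix y assume "y \<in> \<psi> ` f ` N"
    then obtain p' where p': "p' \<in> N" "y = \<psi> (f p')" by blast
    then have "y = \<Psi> (\<phi> p')" "y \<in> hyp" using \<psi>f[OF p'(1)] g[OF p'(1)] by (auto simp: hball_def)
    moreover have "lorentz (inv (pth i) f0) (\<Psi> (\<phi> p')) = 0"
      unfolding \<Psi>_def using lor_lorentz[OF li] f0_iota by simp
    ultimately show "y \<in> H" by (simp add: H_def)
  qed
  moreover have "hdist (\<psi> (f a)) (\<psi> (f b)) = hdist (\<phi> a) (\<phi> b)" if "a \<in> N" "b \<in> N" for a b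
  proof -
    have "lorentz (\<Psi> (\<phi> a)) (\<Psi> (\<phi> b)) = lorentz (\<phi> a) (\<phi> b)"
      unfolding \<Psi>_def using lor_lorentz[OF li] lor_lorentz[OF lG] iota_lorentz by simp
    then show ?thesis using \<psi>f that by (simp add: hdist_def)
  qed
  moreover have "f ` N \<subseteq> V'" using g by (auto simp: V'_def)
  moreover have "N \<subseteq> V" using g by blast
  ultimately have "openin X N \<and> p \<in> N \<and> N \<subseteq> V \<and> f ` N \<subseteq> V' \<and> hyp_hyperplane H \<and> \<psi> ` f ` N \<subseteq> H \<and>
      (\<forall>x\<in>N. \<forall>y\<in>N. hdist (\<psi> (f x)) (\<psi> (f y)) = hdist (\<phi> x) (\<phi> y))"
    using N pN H by blast
  then have "\<exists>N H. openin X N \<and> p \<in> N \<and> N \<subseteq> V \<and> f ` N \<subseteq> V' \<and> hyp_hyperplane H \<and> \<psi> ` f ` N \<subseteq> H \<and>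
      (\<forall>x\<in>N. \<forall>y\<in>N. hdist (\<psi> (f x)) (\<psi> (f y)) = hdist (\<phi> x) (\<phi> y))" by (intro exI)
  then show ?thesis by (intro bexI[OF _ V(1)] case_prodI bexI[OF _ ch])
qed

lemma embeds: "geodesic_hypersurface_embedding X Ac dg.Y dg.charts f"
  unfolding geodesic_hypersurface_embedding_def using f_embedding f_geodesic by simp

end

section \<open>Finite volume\<close>

lemma golden_powers: "golden\<^sup>2 = golden + 1" "golden ^ 3 = 2 * golden + 1"
  using golden_sq by (simp_all add: power2_eq_square power3_eq_cube distrib_right)

lemma golden_bounds: "1618 / 1000 < golden" "golden < 1619 / 1000"
proof -
  have "golden > 0" using golden_gt_1 by simp
  show "1618 / 1000 < golden"
  proof (rule ccontr)
    assume "\<not> 1618 / 1000 < golden"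
    then have "golden * golden \<le> 1618 / 1000 * golden" using \<open>golden > 0\<close> by simp
    then show False using golden_sq \<open>\<not> 1618 / 1000 < golden\<close> golden_gt_1 by simp
  qed
  show "golden < 1619 / 1000"
  proof (rule ccontr)
    assume "\<not> golden < 1619 / 1000"
    then have "golden * golden \<ge> 1619 / 1000 * golden" using \<open>golden > 0\<close> by simp
    then show False using golden_sq \<open>\<not> golden < 1619 / 1000\<close> by simp
  qed
qed

text \<open>The density is at most 1, so Lebesgue measure in the space coordinates bounds the
  volume.\<close>

lemma vol_finite:
  fixes S :: "'n::finite mink set" and B :: "(real ^ 'n) set"
  assumes S: "S \<in> sets borel" and B: "B \<in> sets borel" "\<And>u. mvec (sqrt (1 + u \<bullet> u)) u \<in> S \<Longrightarrow> u \<in> B"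
    "emeasure lborel B < \<infinity>"
  shows "emeasure hyp_volume S < \<infinity>"
proof -
  have "emeasure hyp_volume S \<le> (\<integral>\<^sup>+u. indicator B u \<partial>lborel)"
    unfolding hyp_volume_eq[OF S]
  proof (rule nn_integral_mono)
    fix u :: "real ^ 'n"
    have "1 + u \<bullet> u > 0" using inner_ge_zero[of u] by linarith
    then have "1 / sqrt (1 + u \<bullet> u) \<le> 1" by (simp add: divide_le_eq_1)
    then have "ennreal (1 / sqrt (1 + u \<bullet> u)) \<le> 1" by (metis ennreal_1 ennreal_leI)
    then show "indicator S (mvec (sqrt (1 + u \<bullet> u)) u) * ennreal (1 / sqrt (1 + u \<bullet> u)) \<le> indicator B u"
      using B(2)[of u] by (auto simp: indicator_def)
  qed
  also have "\<dots> = emeasure lborel B" using B(1) by simp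
  finally show ?thesis using B(3) by (rule le_less_trans)
qed

text \<open>The normals are closed under changing the sign of a coordinate, and the coordinates of
  \<open>x\<close> can be made non-negative one after the other.\<close>

lemma (in cell_data) hpoly_signs:
  assumes flips: "list_all (\<lambda>u. list_all (\<lambda>i. u[i := zneg (u ! i)] \<in> set U) [0, 1, 2, 3]) U"
    and x: "x \<in> hpoly N4" and u: "u \<in> set U"
  shows "\<kappa> * (zval (u ! 0) * \<bar>sp x $ 1\<bar> + zval (u ! 1) * \<bar>sp x $ 2\<bar> + zval (u ! 2) * \<bar>sp x $ 3\<bar> + zval (u ! 3) * \<bar>sp x $ 4\<bar>)
    \<le> s * x $ None"
proof -
  define Q where "Q y1 y2 y3 y4 \<longleftrightarrow> (\<forall>u\<in>set U. \<kappa> * (zval (u ! 0) * y1 + zval (u ! 1) * y2 + zval (u ! 2) * y3 + zval (u ! 3) * y4)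
    \<le> s * x $ None)" for y1 y2 y3 y4
  have fl: "u[i := zneg (u ! i)] \<in> set U" "length u = 4" if "u \<in> set U" "i \<in> {0, 1, 2, 3}" for u i
    using that flips lenU by (auto simp: list_all_iff)
  have "Q (sp x $ 1) (sp x $ 2) (sp x $ 3) (sp x $ 4)"
    unfolding Q_def
  proof
    fix u assume u: "u \<in> set U"
    then have "lorentz (n4 u) x \<le> 0" using x by (auto simp: hpoly_def N4_def)
    then show "\<kappa> * (zval (u ! 0) * sp x $ 1 + zval (u ! 1) * sp x $ 2 + zval (u ! 2) * sp x $ 3 + zval (u ! 3) * sp x $ 4) \<le> s * x $ None"
      by (simp add: n4_def lorentz_sp inner_vec_def sum_4 vec4_def algebra_simps)
  qed
  moreover have "Q (- y1) y2 y3 y4" if "Q y1 y2 y3 y4" for y1 y2 y3 y4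
    unfolding Q_def using that[unfolded Q_def, rule_format, OF fl(1), of _ 0] fl(2)[of _ 0] by fastforce
  moreover have "Q y1 (- y2) y3 y4" if "Q y1 y2 y3 y4" for y1 y2 y3 y4
    unfolding Q_def using that[unfolded Q_def, rule_format, OF fl(1), of _ 1] fl(2)[of _ 1] by fastforce
  moreover have "Q y1 y2 (- y3) y4" if "Q y1 y2 y3 y4" for y1 y2 y3 y4
    unfolding Q_def using that[unfolded Q_def, rule_format, OF fl(1), of _ 2] fl(2)[of _ 2] by fastforce
  moreover have "Q y1 y2 y3 (- y4)" if "Q y1 y2 y3 y4" for y1 y2 y3 y4
    unfolding Q_def using that[unfolded Q_def, rule_format, OF fl(1), of _ 3] fl(2)[of _ 3] by fastforce
  ultimately have "Q \<bar>sp x $ 1\<bar> \<bar>sp x $ 2\<bar> \<bar>sp x $ 3\<bar> \<bar>sp x $ 4\<bar>"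
    unfolding abs_real_def by presburger
  then show ?thesis using u by (simp add: Q_def)
qed

text \<open>\<open>a\<close> and \<open>b\<close> stand for the two largest coordinates,
  \<open>q\<close> for the sum of the others and \<open>r\<close> for the sum of their squares. With
  w = a + b the hypotheses read (a - b) w \<le> 1 + q^2 and 2 q w \<le> 2 + (a - b)^2 + q^2, and
  they improve each other to bounds of order 1 / a.\<close>

lemma cusp_estimate:
  fixes a b q r :: real
  assumes ab: "a \<ge> b" "b \<ge> 0" "a > 2" and q: "q \<ge> 0" "q \<le> 2 * b" and r: "r \<le> q\<^sup>2" "r \<le> 2 * b\<^sup>2"
    and 1: "a\<^sup>2 \<le> 1 + b\<^sup>2 + r" and 2: "(a + b + q)\<^sup>2 \<le> 2 * (1 + a\<^sup>2 + b\<^sup>2 + r)"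
  shows "a - b \<le> 4 / a" "q \<le> 4 / a"
proof -
  have b: "b \<ge> a / 2"
  proof (rule ccontr)
    assume "\<not> a / 2 \<le> b"
    then have "b\<^sup>2 \<le> (a / 2)\<^sup>2" using ab by (intro power_mono) auto
    then have "a\<^sup>2 \<le> 4" using 1 r(2) by (simp add: power_divide)
    moreover have "a\<^sup>2 > 2\<^sup>2" using ab by (intro power_strict_mono) auto
    ultimately show False by simp
  qed
  define p where "p = a - b"
  define w where "w = a + b"
  have w: "w \<ge> 3 / 2 * a" "w > 3" "p \<ge> 0" "p \<le> w / 3" "q \<le> w" using b ab q by (auto simp: p_def w_def)
  have "p * w = a\<^sup>2 - b\<^sup>2" by (simp add: p_def w_def power2_eq_square algebra_simps)
  then have pw: "p * w \<le> 1 + q\<^sup>2" using 1 r(1) by linarith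
  have "2 * (q * w) = (a + b + q)\<^sup>2 - w\<^sup>2 - q\<^sup>2" by (simp add: w_def power2_eq_square algebra_simps)
  moreover have "2 * (1 + a\<^sup>2 + b\<^sup>2 + r) = 2 + w\<^sup>2 + p\<^sup>2 + 2 * r" by (simp add: p_def w_def power2_eq_square algebra_simps)
  ultimately have qw: "2 * (q * w) \<le> 2 + p\<^sup>2 + q\<^sup>2" using 2 r(1) by linarith
  have "q\<^sup>2 \<le> q * w" using w q by (simp add: power2_eq_square mult_left_mono)
  moreover have "p\<^sup>2 \<le> p * w / 3" using mult_left_mono[OF w(4,3)] by (simp add: power2_eq_square)
  ultimately have qw': "q * w \<le> 7 / 2" using qw pw by linarith
  have "q * 3 \<le> q * w" using w q by (intro mult_left_mono) auto
  then have "q \<le> 7 / 6" using qw' by linarith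
  then have "q\<^sup>2 \<le> (7 / 6)\<^sup>2" using q by (intro power_mono) auto
  then have "p * w \<le> 4" using pw by (simp add: power2_eq_square)
  moreover have "p * (3 / 2 * a) \<le> p * w" "q * (3 / 2 * a) \<le> q * w" using mult_left_mono[OF w(1,3)] mult_left_mono[OF w(1) q(1)] by (simp_all only:)
  ultimately have "p * a \<le> 4" "q * a \<le> 4" using qw' by linarith+
  then show "a - b \<le> 4 / a" "q \<le> 4 / a" using ab by (simp_all add: p_def pos_le_divide_eq)
qed

text \<open>The cusps of the 24-cell point in the directions with two coordinates 1 or -1 and two
  coordinates 0. Where the large coordinates are near sqrt m the cusp has width of order 1 / sqrt m,
  so a box has volume of order 1 / m^2, which is summable.\<close>

definition cusp_box :: "nat \<Rightarrow> 4 \<times> 4 \<times> bool \<times> bool \<Rightarrow> (real ^ 4) set" where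
  "cusp_box m = (\<lambda>(i, j, \<sigma>, \<tau>).
     let c = (\<chi> l. if l = i then (if \<sigma> then sqrt m else - sqrt m) else if l = j then (if \<tau> then sqrt m else - sqrt m) else 0)
     in cbox (c - (5 / sqrt m) *\<^sub>R 1) (c + (5 / sqrt m) *\<^sub>R 1))"

lemma cusp_box_volume: "emeasure lborel (cusp_box m x) = ennreal (10000 * inverse ((real m)\<^sup>2))"
proof -
  obtain i j \<sigma> \<tau> where x: "x = (i, j, \<sigma>, \<tau>)" by (cases x)
  define c :: "real ^ 4" where "c = (\<chi> l. if l = i then (if \<sigma> then sqrt m else - sqrt m) else if l = j then (if \<tau> then sqrt m else - sqrt m) else 0)"
  have one: "(1 :: real ^ 4) \<bullet> b = 1" if "b \<in> Basis" for b
    using that by (auto simp: Basis_vec_def inner_axis)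
  have e: "cusp_box m x = cbox (c - (5 / sqrt m) *\<^sub>R 1) (c + (5 / sqrt m) *\<^sub>R 1)"
    by (simp add: cusp_box_def x c_def Let_def)
  have d: "c + (5 / sqrt m) *\<^sub>R 1 - (c - (5 / sqrt m) *\<^sub>R 1) = (10 / sqrt m) *\<^sub>R 1" by (simp add: vec_eq_iff)
  have "emeasure lborel (cusp_box m x) = ennreal (\<Prod>b\<in>Basis. (c + (5 / sqrt m) *\<^sub>R 1 - (c - (5 / sqrt m) *\<^sub>R 1)) \<bullet> b)"
    unfolding e by (rule emeasure_lborel_cbox) (simp add: inner_diff_left inner_add_left one)
  also have "(\<Prod>b\<in>Basis. (c + (5 / sqrt m) *\<^sub>R 1 - (c - (5 / sqrt m) *\<^sub>R 1)) \<bullet> b) = (\<Prod>b\<in>(Basis :: (real ^ 4) set). 10 / sqrt m)"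
    unfolding d by (rule prod.cong) (simp_all add: one)
  also have "\<dots> = (10 / sqrt m) ^ 4" by simp
  also have "\<dots> = 10000 * inverse ((real m)\<^sup>2)"
  proof -
    have "(sqrt (real m)) ^ 4 = ((sqrt (real m))\<^sup>2)\<^sup>2" by (simp only: power_mult[symmetric]) simp
    then have "(sqrt (real m)) ^ 4 = (real m)\<^sup>2" by simp
    then show ?thesis by (simp add: power_divide divide_inverse power_inverse)
  qed
  finally show ?thesis .
qed

lemma cusp_region:
  fixes u :: "real ^ 4"
  assumes 1: "\<And>i. 2 * (u $ i)\<^sup>2 \<le> 1 + u \<bullet> u" and 2: "(\<Sum>i\<in>UNIV. \<bar>u $ i\<bar>)\<^sup>2 \<le> 2 * (1 + u \<bullet> u)"
  shows "u \<in> cbox (\<chi> l. -2) (\<chi> l. 2) \<union> (\<Union>m. \<Union>x. cusp_box m x)"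
proof (cases "\<forall>i. \<bar>u $ i\<bar> \<le> 2")
  case True
  then have "- 2 \<le> u $ i \<and> u $ i \<le> 2" for i using abs_le_D1 abs_le_D2 by (metis minus_le_iff)
  then show ?thesis by (simp add: mem_box_cart)
next
  case False
  define c where "c i = \<bar>u $ i\<bar>" for i
  obtain i where i: "\<And>l. c l \<le> c i"
  proof -
    have "Max (range c) \<in> range c" by (rule Max_in) auto
    then obtain i where "Max (range c) = c i" by blast
    then show ?thesis using that[of i] Max_ge[of "range c"] by auto
  qed
  obtain j where j: "j \<noteq> i" "\<And>l. l \<noteq> i \<Longrightarrow> c l \<le> c j"
  proof -
    have ne: "UNIV - {i} \<noteq> {}"
    proof
      assume "UNIV - {i} = {}"
      then have "card (UNIV :: 4 set) \<le> card {i}" by (intro card_mono) auto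
      then show False by simp
    qed
    have "Max (c ` (UNIV - {i})) \<in> c ` (UNIV - {i})" by (rule Max_in) (use ne in auto)
    then obtain j where "Max (c ` (UNIV - {i})) = c j" "j \<noteq> i" by blast
    then show ?thesis using that[of j] Max_ge[of "c ` (UNIV - {i})"] by auto
  qed
  define R where "R = UNIV - {i, j}"
  have U: "UNIV = insert i (insert j R)" "i \<notin> insert j R" "j \<notin> R" using j by (auto simp: R_def)
  have cR: "card R = 2" using j by (simp add: R_def card_Diff_subset)
  have sumU: "(\<Sum>l\<in>UNIV. F l) = F i + F j + sum F R" for F :: "4 \<Rightarrow> real" unfolding U(1) using U(2,3) by simp
  define q where "q = (\<Sum>l\<in>R. c l)"
  define r where "r = (\<Sum>l\<in>R. (c l)\<^sup>2)"
  have c0: "c l \<ge> 0" for l by (simp add: c_def)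
  have uu: "u \<bullet> u = (c i)\<^sup>2 + (c j)\<^sup>2 + r"
    unfolding r_def by (subst sumU[of "\<lambda>l. (c l)\<^sup>2", symmetric]) (simp add: inner_vec_def c_def power2_eq_square)
  have a2: "c i > 2" using False i by (metis c_def linorder_not_le order_less_le_trans)
  have rq: "r \<le> q\<^sup>2"
  proof -
    have "L2_set c R \<le> sum c R" by (rule L2_set_le_sum) (use c0 in auto)
    then have "(L2_set c R)\<^sup>2 \<le> q\<^sup>2" unfolding q_def by (intro power_mono) auto
    moreover have "(L2_set c R)\<^sup>2 = r" unfolding r_def L2_set_def by (simp add: sum_nonneg)
    ultimately show ?thesis by simp
  qed
  have Rj: "c l \<le> c j" if "l \<in> R" for l using that j by (auto simp: R_def)
  have q: "q \<ge> 0" "q \<le> 2 * c j" unfolding q_def using c0 sum_bounded_above[of R c "c j"] Rj cR by (auto intro: sum_nonneg)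
  have r: "r \<le> 2 * (c j)\<^sup>2"
    unfolding r_def using sum_bounded_above[of R "\<lambda>l. (c l)\<^sup>2" "(c j)\<^sup>2"] Rj c0 cR by (auto intro: power_mono)
  have e1: "(c i)\<^sup>2 \<le> 1 + (c j)\<^sup>2 + r" using 1[of i] uu by (simp add: c_def)
  have e2: "(c i + c j + q)\<^sup>2 \<le> 2 * (1 + (c i)\<^sup>2 + (c j)\<^sup>2 + r)"
    using 2 uu sumU[of c] by (simp add: q_def c_def)
  have est: "c i - c j \<le> 4 / c i" "q \<le> 4 / c i"
    using cusp_estimate[OF i c0 a2 q rq r e1 e2] by auto
  \<comment> \<open>With this choice sqrt m lies within 1 / sqrt m of the largest coordinate, so the
    discretisation costs no more than the width of the cusp.\<close>
  define m where "m = nat \<lfloor>(c i)\<^sup>2\<rfloor>"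
  have m: "real m \<le> (c i)\<^sup>2" "(c i)\<^sup>2 < real m + 1" by (simp_all add: m_def)
  have "(c i)\<^sup>2 > 2\<^sup>2" using a2 by (intro power_strict_mono) auto
  then have m0: "real m > 0" using m by simp
  define t where "t = sqrt (real m)"
  have t: "t > 0" "t\<^sup>2 = real m" using m0 by (simp_all add: t_def)
  have ta: "t \<le> c i" unfolding t_def using m(1) c0 by (simp add: real_le_lsqrt)
  have "(c i - t) * (c i + t) \<le> 1" using m t by (simp add: power2_eq_square algebra_simps)
  moreover have "(c i - t) * t \<le> (c i - t) * (c i + t)" using ta c0 by (intro mult_left_mono) auto
  ultimately have d: "c i - t \<le> 1 / t" using t by (simp add: pos_le_divide_eq)
  have "4 / c i \<le> 4 / t" using ta t a2 by (intro divide_left_mono) auto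
  then have est': "c i - c j \<le> 4 / t" "q \<le> 4 / t" using est by linarith+
  have inv: "5 / t = 4 / t + 1 / t" "1 / t > 0" using t by (simp_all add: add_divide_distrib[symmetric])
  have bi: "\<bar>c i - t\<bar> \<le> 5 / t" using d ta inv by linarith
  have bj: "\<bar>c j - t\<bar> \<le> 5 / t" using d ta est'(1) i[of j] inv by linarith
  have bl: "c l \<le> 5 / t" if "l \<noteq> i" "l \<noteq> j" for l
  proof -
    have "c l \<le> q" unfolding q_def using that c0 by (intro member_le_sum) (auto simp: R_def)
    then show ?thesis using est'(2) inv by linarith
  qed
  have "u \<in> cusp_box m (i, j, u $ i \<ge> 0, u $ j \<ge> 0)"
  proof -
    have sg: "\<bar>v - (if v \<ge> 0 then t else - t)\<bar> = \<bar>\<bar>v\<bar> - t\<bar>" for v using t by auto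
    define e where "e l = (if l = i then (if u $ i \<ge> 0 then t else - t) else if l = j then (if u $ j \<ge> 0 then t else - t) else 0)" for l
    have "\<bar>u $ l - e l\<bar> \<le> 5 / t" for l
    proof -
      consider "l = i" | "l = j" "l \<noteq> i" | "l \<noteq> i" "l \<noteq> j" by blast
      then show ?thesis
      proof cases
        case 1
        have "e i = (if u $ i \<ge> 0 then t else - t)" by (simp add: e_def)
        then show ?thesis using bi sg[of "u $ i"] 1 by (simp only: c_def)
      next
        case 2
        then have "e j = (if u $ j \<ge> 0 then t else - t)" by (simp add: e_def)
        then show ?thesis using bj sg[of "u $ j"] 2 by (simp only: c_def)
      next
        case 3 then show ?thesis using bl[of l] by (simp add: c_def e_def)
      qed
    qed
    then have "e l - 5 / t \<le> u $ l \<and> u $ l \<le> e l + 5 / t" for l unfolding abs_diff_le_iff .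
    then have "u \<in> cbox ((\<chi> l. e l) - (5 / t) *\<^sub>R 1) ((\<chi> l. e l) + (5 / t) *\<^sub>R 1)" by (simp add: mem_box_cart)
    also have "\<dots> = cusp_box m (i, j, u $ i \<ge> 0, u $ j \<ge> 0)" by (simp only: cusp_box_def Let_def e_def t_def prod.case)
    finally show ?thesis .
  qed
  then show ?thesis by blast
qed

lemma cusp_volume:
  fixes S :: "4 mink set"
  assumes S: "S \<in> sets borel" "S \<subseteq> hyp"
    and 1: "\<And>x i. x \<in> S \<Longrightarrow> 2 * \<bar>sp x $ i\<bar> \<le> sqrt 2 * x $ None"
    and 2: "\<And>x. x \<in> S \<Longrightarrow> (\<Sum>i\<in>UNIV. \<bar>sp x $ i\<bar>) \<le> sqrt 2 * x $ None"
  shows "emeasure hyp_volume S < \<infinity>"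
proof (rule vol_finite[OF S(1)])
  let ?B = "cbox (\<chi> l. -2) (\<chi> l. 2) \<union> (\<Union>m. \<Union>x. cusp_box m x) :: (real ^ 4) set"
  have cb: "cusp_box m x \<in> sets borel" for m x by (cases x) (simp add: cusp_box_def Let_def)
  show B: "?B \<in> sets borel" using cb by auto
  have box: "emeasure lborel (\<Union>x. cusp_box m x) \<le> ennreal (640000 * inverse ((real m)\<^sup>2))" for m
  proof -
    have "emeasure lborel (\<Union>x. cusp_box m x) \<le> (\<Sum>x\<in>UNIV. emeasure lborel (cusp_box m x))"
      by (rule emeasure_subadditive_finite) (use cb in auto)
    also have "\<dots> = (\<Sum>x\<in>(UNIV :: (4 \<times> 4 \<times> bool \<times> bool) set). ennreal (10000 * inverse ((real m)\<^sup>2)))"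
      by (simp only: cusp_box_volume)
    \<comment> \<open>64 counts the choices of two indices and two signs.\<close>
    also have "\<dots> = 64 * ennreal (10000 * inverse ((real m)\<^sup>2))"
      by (simp add: card_cartesian_product UNIV_Times_UNIV[symmetric] del: UNIV_Times_UNIV)
    also have "\<dots> = ennreal (640000 * inverse ((real m)\<^sup>2))"
      using ennreal_mult'[of 64 "10000 * inverse ((real m)\<^sup>2)"] by simp
    finally show ?thesis .
  qed
  have le: "emeasure lborel ?B \<le> emeasure lborel (cbox (\<chi> l. -2) (\<chi> l. 2) :: (real ^ 4) set) + emeasure lborel (\<Union>m. \<Union>x. cusp_box m x)"
    by (rule emeasure_subadditive) (use cb in auto)
  have "emeasure lborel (\<Union>m. \<Union>x. cusp_box m x) \<le> (\<Sum>m. emeasure lborel (\<Union>x. cusp_box m x))"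
    by (rule emeasure_subadditive_countably) (use cb in auto)
  also have "(\<Sum>m. emeasure lborel (\<Union>x. cusp_box m x)) \<le> (\<Sum>m. ennreal (640000 * inverse ((real m)\<^sup>2)))"
    by (rule suminf_le) (use box in auto)
  also have "(\<Sum>m. ennreal (640000 * inverse ((real m)\<^sup>2))) < \<infinity>"
  proof -
    have "summable (\<lambda>m. inverse ((real m)\<^sup>2))" using inverse_power_summable[of 2, where 'a = real] by simp
    then have "summable (\<lambda>m. 640000 * inverse ((real m)\<^sup>2))" by (rule summable_mult)
    then have "(\<Sum>m. ennreal (640000 * inverse ((real m)\<^sup>2))) = ennreal (\<Sum>m. 640000 * inverse ((real m)\<^sup>2))"
      by (intro suminf_ennreal2) auto
    then show ?thesis by simp
  qed
  finally have "emeasure lborel (\<Union>m. \<Union>x. cusp_box m x) < \<infinity>" .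
  moreover have "emeasure lborel (cbox (\<chi> l. -2) (\<chi> l. 2) :: (real ^ 4) set) < \<infinity>" by (rule emeasure_lborel_cbox_finite)
  ultimately have "emeasure lborel (cbox (\<chi> l. -2) (\<chi> l. 2) :: (real ^ 4) set) + emeasure lborel (\<Union>m. \<Union>x. cusp_box m x) < \<infinity>"
    by simp
  then show "emeasure lborel ?B < \<infinity>" using le by (rule le_less_trans[rotated])
  fix u :: "real ^ 4" assume u: "mvec (sqrt (1 + u \<bullet> u)) u \<in> S"
  have sq: "(sqrt 2 * sqrt (1 + u \<bullet> u))\<^sup>2 = 2 * (1 + u \<bullet> u)" by (simp add: power_mult_distrib)
  show "u \<in> ?B"
  proof (rule cusp_region)
    fix i
    have "(2 * \<bar>u $ i\<bar>)\<^sup>2 \<le> (sqrt 2 * sqrt (1 + u \<bullet> u))\<^sup>2"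
      using 1[OF u, of i] by (intro power_mono) auto
    then show "2 * (u $ i)\<^sup>2 \<le> 1 + u \<bullet> u" unfolding sq by (simp add: power_mult_distrib)
    have "(\<Sum>i\<in>UNIV. \<bar>u $ i\<bar>)\<^sup>2 \<le> (sqrt 2 * sqrt (1 + u \<bullet> u))\<^sup>2"
      using 2[OF u] by (intro power_mono sum_nonneg) auto
    then show "(\<Sum>i\<in>UNIV. \<bar>u $ i\<bar>)\<^sup>2 \<le> 2 * (1 + u \<bullet> u)" unfolding sq .
  qed
qed

subsection \<open>The 120-cell is compact\<close>

text \<open>The vertices of the 600-cell lie on even permutations of \<open>(\<phi>, 0, 1/\<phi>, 1)\<close>. For sorted coordinates a few of the
  inequalities suffice; the bounds below are certificates found by linear programming over products of the constraints.\<close>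

definition evens :: "real \<Rightarrow> real \<Rightarrow> real \<Rightarrow> real \<Rightarrow> real \<Rightarrow> bool" where
  "evens m a b c d \<longleftrightarrow> (let P = (\<lambda>p r s. golden * p + (golden - 1) * r + s \<le> m) in
     P a c d \<and> P a d b \<and> P a b c \<and> P b d c \<and> P b a d \<and> P b c a \<and>
     P c b d \<and> P c d a \<and> P c a b \<and> P d c b \<and> P d a c \<and> P d b a)"

lemma evens_rot: "evens m a b c d \<Longrightarrow> evens m b c a d" "evens m a b c d \<Longrightarrow> evens m b a d c" "evens m a b c d \<Longrightarrow> evens m a c d b"
  by (auto simp: evens_def Let_def)

lemma sorted_bound:
  fixes a b c d m :: real
  assumes s: "a \<ge> b" "b \<ge> c" "c \<ge> d" "d \<ge> 0" and m: "2 * a \<le> m" "a + b + c + d \<le> m"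
    and e: "evens m a b c d \<or> evens m b a c d"
  shows "a\<^sup>2 + b\<^sup>2 + c\<^sup>2 + d\<^sup>2 \<le> 305 / 1000 * m\<^sup>2"
proof -
  have nn: "u \<ge> 0 \<Longrightarrow> v \<ge> 0 \<Longrightarrow> u * v \<ge> 0" for u v :: real by simp
  \<comment> \<open>Decimal lower bounds for the golden ratio weaken the constraints slightly but
    make all coefficients of the certificates rational.\<close>
  have x: "1618 / 1000 * y \<le> golden * y" "618 / 1000 * y \<le> (golden - 1) * y" if "y \<ge> 0" for y
    using mult_right_mono[of "1618 / 1000" golden y] mult_right_mono[of "618 / 1000" "golden - 1" y] that golden_bounds by auto
  show ?thesis using e
  proof
    assume "evens m b a c d"
    then have "golden * a + (golden - 1) * c + b \<le> m" by (simp add: evens_def Let_def)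
    then have g1: "1000 * m - 1618 * a - 1000 * b - 618 * c \<ge> 0" using x(1)[of a] x(2)[of c] s by linarith
    have p: "a - b \<ge> 0" "b - c \<ge> 0" "c - d \<ge> 0" "d \<ge> 0" "m - 2 * a \<ge> 0" "m - (a + b + c + d) \<ge> 0" using s m by linarith+
    have "28692677040 * (305 * (m * m) - 1000 * (a * a + b * b + c * c + d * d)) =
      9003197040000 * ((a - b) * (b - c))
      + 16171032667686 * ((a - b) * (c - d))
      + 10972661384200 * ((a - b) * (m - 2 * a))
      + 16524578400 * ((a - b) * (1000 * m - 1618 * a - 1000 * b - 618 * c))
      + 27305446894686 * ((b - c) * (c - d))
      + 17894934442800 * ((b - c) * d)
      + 36214058400 * ((b - c) * (1000 * m - 1618 * a - 1000 * b - 618 * c))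
      + 3537928658172 * ((c - d) * (c - d))
      + 10242719055372 * ((c - d) * d)
      + 44183571027 * ((c - d) * (1000 * m - 1618 * a - 1000 * b - 618 * c))
      + 21987886642800 * (d * (m - (a + b + c + d)))
      + 28956204600 * (d * (1000 * m - 1618 * a - 1000 * b - 618 * c))
      + 34447881400 * ((m - 2 * a) * (m - 2 * a))
      + 6760520215800 * ((m - 2 * a) * (m - (a + b + c + d)))
      + 1956298400 * ((m - 2 * a) * (1000 * m - 1618 * a - 1000 * b - 618 * c))"
      (is "_ = ?R") by (simp add: algebra_simps)
    moreover have "?R \<ge> 0" using p g1 by (intro add_nonneg_nonneg mult_nonneg_nonneg) simp_all
    ultimately have "0 \<le> 28692677040 * (305 * (m * m) - 1000 * (a * a + b * b + c * c + d * d))" by (simp only:)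
    then have "1000 * (a * a + b * b + c * c + d * d) \<le> 305 * (m * m)" by (simp add: zero_le_mult_iff)
    then show ?thesis by (simp add: power2_eq_square)
  next
    assume "evens m a b c d"
    then have "golden * b + (golden - 1) * c + a \<le> m" "golden * a + (golden - 1) * d + b \<le> m" "golden * a + (golden - 1) * b + c \<le> m"
      by (simp_all add: evens_def Let_def)
    then have g: "1000 * m - 1000 * a - 1618 * b - 618 * c \<ge> 0" "1000 * m - 1618 * a - 1000 * b - 618 * d \<ge> 0"
      "1000 * m - 1618 * a - 618 * b - 1000 * c \<ge> 0"
      using x(1)[of a] x(1)[of b] x(2)[of c] x(2)[of d] x(2)[of b] s by linarith+
    have p: "a - b \<ge> 0" "b - c \<ge> 0" "c - d \<ge> 0" "d \<ge> 0" "m - 2 * a \<ge> 0" "m - (a + b + c + d) \<ge> 0" using s m by linarith+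
    have "31397071886043600 * (305 * (m * m) - 1000 * (a * a + b * b + c * c + d * d)) =
      10646237490573894000 * ((a - b) * (m - 2 * a))
      + 18082083285156000 * ((a - b) * (1000 * m - 1618 * a - 618 * b - 1000 * c))
      + 16578754797494588000 * ((b - c) * d)
      + 4726750375474699 * ((b - c) * (1000 * m - 1000 * a - 1618 * b - 618 * c))
      + 34862946813685199 * ((b - c) * (1000 * m - 1618 * a - 1000 * b - 618 * d))
      + 98657661920301 * ((b - c) * (1000 * m - 1618 * a - 618 * b - 1000 * c))
      + 4343119844233305000 * ((c - d) * (m - (a + b + c + d)))
      + 24252218619957699 * ((c - d) * (1000 * m - 1000 * a - 1618 * b - 618 * c))
      + 4727815813037898 * ((c - d) * (1000 * m - 1618 * a - 1000 * b - 618 * d))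
      + 15085870328640102 * ((c - d) * (1000 * m - 1618 * a - 618 * b - 1000 * c))
      + 24060329281361802000 * (d * (m - (a + b + c + d)))
      + 23627269613871398 * (d * (1000 * m - 1618 * a - 1000 * b - 618 * d))
      + 8058168315317602 * (d * (1000 * m - 1618 * a - 618 * b - 1000 * c))
      + 7336742604681798000 * ((m - 2 * a) * (m - (a + b + c + d)))
      + 2239364320561500 * ((m - 2 * a) * (1000 * m - 1000 * a - 1618 * b - 618 * c))"
      (is "_ = ?R") by (simp add: algebra_simps)
    moreover have "?R \<ge> 0" using p g by (intro add_nonneg_nonneg mult_nonneg_nonneg) simp_all
    ultimately have "0 \<le> 31397071886043600 * (305 * (m * m) - 1000 * (a * a + b * b + c * c + d * d))" by (simp only:)
    then have "1000 * (a * a + b * b + c * c + d * d) \<le> 305 * (m * m)" by (simp add: zero_le_mult_iff)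
    then show ?thesis by (simp add: power2_eq_square)
  qed
qed

text \<open>\<open>evens\<close> is invariant under even permutations only. The auxiliary predicate
  \<open>Q\<close> admits both parities, so it survives all transpositions and the coordinates may
  be sorted.\<close>

lemma evens_bound:
  fixes a b c d m :: real
  assumes "a \<ge> 0" "b \<ge> 0" "c \<ge> 0" "d \<ge> 0" "2 * a \<le> m" "2 * b \<le> m" "2 * c \<le> m" "2 * d \<le> m" "a + b + c + d \<le> m"
    and "evens m a b c d"
  shows "a\<^sup>2 + b\<^sup>2 + c\<^sup>2 + d\<^sup>2 \<le> 305 / 1000 * m\<^sup>2"
proof -
  define Q where "Q a b c d \<longleftrightarrow> a \<ge> 0 \<and> b \<ge> 0 \<and> c \<ge> 0 \<and> d \<ge> 0 \<and> 2 * a \<le> m \<and> 2 * b \<le> m \<and> 2 * c \<le> m \<and> 2 * d \<le> m \<and>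
    a + b + c + d \<le> m \<and> (evens m a b c d \<or> evens m b a c d)" for a b c d
  define S where "S a b c d \<longleftrightarrow> (Q a b c d \<longrightarrow> a\<^sup>2 + b\<^sup>2 + c\<^sup>2 + d\<^sup>2 \<le> 305 / 1000 * m\<^sup>2)" for a b c d
  have sw1: "Q a b c d \<Longrightarrow> Q b a c d" for a b c d by (auto simp: Q_def)
  have sw2: "Q a b c d \<Longrightarrow> Q a c b d" for a b c d
    using evens_rot(1)[OF evens_rot(1)[of m a b c d]] evens_rot(1)[of m b a c d] by (auto simp: Q_def)
  have sw3: "Q a b c d \<Longrightarrow> Q a b d c" for a b c d
    using evens_rot(2)[of m a b c d] evens_rot(2)[of m b a c d] by (auto simp: Q_def)
  have S1: "S b a c d \<Longrightarrow> S a b c d" and S2: "S a c b d \<Longrightarrow> S a b c d" and S3: "S a b d c \<Longrightarrow> S a b c d" for a b c d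
    using sw1[of a b c d] sw2[of a b c d] sw3[of a b c d] by (auto simp: S_def algebra_simps)
  have L0: "S a b c d" if "a \<ge> b" "b \<ge> c" "c \<ge> d" for a b c d
    using sorted_bound[OF that] by (auto simp: S_def Q_def)
  have L1: "S a b c d" if "a \<ge> b" "b \<ge> c" for a b c d
    using that L0 S1 S2 S3 by (meson le_cases order_trans)
  have L2: "S a b c d" if "a \<ge> b" for a b c d
    using that L1 S1 S2 by (meson le_cases order_trans)
  have "S a b c d" using L2 S1 by (meson le_cases)
  then show ?thesis using assms by (auto simp: S_def Q_def)
qed

lemma compact_volume:
  fixes S :: "4 mink set"
  assumes S: "S \<in> sets borel"
    and b: "\<And>x. x \<in> S \<Longrightarrow> sp x \<bullet> sp x \<le> C * (x $ None)\<^sup>2" and C: "0 \<le> C" "C < 1"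
  shows "emeasure hyp_volume S < \<infinity>"
proof (rule vol_finite[OF S])
  show "cball 0 (sqrt (C / (1 - C))) \<in> sets (borel :: (real ^ 4) measure)" by simp
  show "emeasure lborel (cball 0 (sqrt (C / (1 - C))) :: (real ^ 4) set) < \<infinity>" by (rule emeasure_lborel_cball_finite)
  fix u :: "real ^ 4" assume u: "mvec (sqrt (1 + u \<bullet> u)) u \<in> S"
  have "u \<bullet> u \<le> C * (1 + u \<bullet> u)" using b[OF u] by simp
  then have "(u \<bullet> u) * (1 - C) \<le> C" by (simp add: algebra_simps)
  then have "u \<bullet> u \<le> C / (1 - C)" using C by (simp add: pos_le_divide_eq)
  then show "u \<in> cball 0 (sqrt (C / (1 - C)))" by (simp add: norm_eq_sqrt_inner)
qed

section \<open>Colours separate the facets of each tile\<close>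

context tessellated_cell
begin

text \<open>With one wall per facet the only moves are across it and back, so a class has at most
  two members, and these lie in different copies.\<close>

lemma colinj_single:
  assumes single: "\<And>F. F \<in> rest \<Longrightarrow> \<exists>a. nbs F \<subseteq> {a}"
    and i: "i < k" "F \<in> rest" and r: "((i, F), (i, F')) \<in> cstep\<^sup>*"
  shows "F = F'"
proof -
  have "q = (i, F) \<or> (\<exists>a\<in>nbs F. q = (t.nb3 i a, E i a F))" if "((i, F), q) \<in> cstep\<^sup>*" for q
    using that
  proof (induction rule: rtrancl_induct)
    case (step q q')
    from step(3) show ?case
    proof
      assume "q = (i, F)"
      then show ?thesis using step(2) by (auto simp: cstep_def)
    next
      assume "\<exists>a\<in>nbs F. q = (t.nb3 i a, E i a F)"
      then obtain a where a: "a \<in> nbs F" "q = (t.nb3 i a, E i a F)" by blast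
      have aN: "a \<in> N3" "lorentz (\<iota> a) F = 0" using a by (auto simp: nbs_def)
      obtain b where b: "b \<in> nbs (E i a F)" "E i a F \<in> rest" "q' = (t.nb3 (t.nb3 i a) b, E (t.nb3 i a) b (E i a F))"
        using step(2) a(2) by (auto simp: cstep_def)
      have "t.L i a a \<in> nbs (E i a F)"
        using E_orth[OF i(1) aN(1)] aN(2) L_facts(7)[OF i(1) aN(1)] by (simp add: nbs_def)
      then have "b = t.L i a a" using single[OF b(2)] b(1) by blast
      then show ?thesis using b(3) L_facts(8,10)[OF i(1) aN(1)] by simp
    qed
  qed simp
  from this[OF r] show ?thesis
  proof
    assume "\<exists>a\<in>nbs F. (i, F') = (t.nb3 i a, E i a F)"
    then obtain a where "a \<in> N3" "t.nb3 i a = i" by (auto simp: nbs_def)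
    then show ?thesis using t.pairing(7)[OF i(1)] by blast
  qed simp
qed

lemma center_image:
  assumes "lor M" "M e0 = e0" shows "t.center (M ` V) = M (t.center V)"
proof -
  have "\<Sum>(M ` V) = M (\<Sum>V)"
    using sum.reindex[OF inj_on_subset[OF lor_inj[OF assms(1)] subset_UNIV, of V], of "\<lambda>x. x"]
      linear_sum[OF lor_linear[OF assms(1)], of "\<lambda>x. x" V] by (simp add: o_def)
  then have "t.mid (M ` V) = M (t.mid V)" using assms by (simp add: t.mid_def lor_simps)
  then show ?thesis using assms(1) by (simp add: t.center_def nrm_def lor_lorentz lor_simps)
qed

lemma nbs_E:
  assumes "i < k" "a \<in> N3" shows "nbs (E i a F) = t.L i a ` nbs F"
proof -
  note f = L_facts[OF assms]
  have o: "lorentz (\<iota> (t.L i a b)) (E i a F) = lorentz (\<iota> b) F" for b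
    using lor_lorentz[OF f(5), of "\<iota> b" F] E_iota[OF assms] by simp
  have "b \<in> t.L i a ` N3" if "b \<in> N3" for b
  proof -
    have "t.L i a (t.L (t.nb3 i a) (t.L i a a) b) = b"
      using L_facts(9)[OF f(6,7), of b] f(8) t.L_back(2)[OF assms] t.L_props(2)[OF assms] t.L_props(2)[OF t.pairing(1,2)[OF assms]]
      by simp
    then show ?thesis using L_facts(4)[OF f(6,7) that] by (metis imageI)
  qed
  then show ?thesis using o f(4) by (force simp: nbs_def)
qed

lemma orthset_nbs: "F \<in> rest \<Longrightarrow> t.orthset (nbs F)"
  using nbs_facts(1) by (auto simp: t.orthset_def nbs_def)

text \<open>The colour class of a facet consists of the facets around a point of the tessellated manifold.\<close>

lemma colinj_embedded:
  assumes emb: "\<And>i. i < k \<Longrightarrow> inj_on (\<lambda>x. h (i, x)) t.P"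
    and i: "i < k" and F: "F \<in> rest" and F': "F' \<in> rest" and r: "((i, F), (i, F')) \<in> cstep\<^sup>*"
  shows "F = F'"
proof -
  have "fst q < k \<and> snd q \<in> rest \<and> h (fst q, t.center (nbs (snd q))) = h (i, t.center (nbs F)) \<and> (nbs F = {} \<longrightarrow> q = (i, F))"
    if "((i, F), q) \<in> cstep\<^sup>*" for q
    using that
  proof (induction rule: rtrancl_induct)
    case (step q q')
    obtain j G a where q: "q = (j, G)" "q' = (t.nb3 j a, E j a G)" "j < k" "G \<in> rest" "a \<in> nbs G"
      using step(2) by (auto simp: cstep_def)
    have a: "a \<in> N3" "lorentz (\<iota> a) G = 0" using q(5) by (auto simp: nbs_def)
    note f = L_facts[OF q(3) a(1)] and c = t.center_facts[OF orthset_nbs[OF q(4)]]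
    have "t.center (nbs (E j a G)) = t.L j a (t.center (nbs G))"
      unfolding nbs_E[OF q(3) a(1)] by (rule center_image[OF f(1,3)])
    moreover have "h (t.nb3 j a, t.L j a (t.center (nbs G))) = h (j, t.center (nbs G))"
      by (rule t.glue_step[OF q(3) a(1) c(4)]) (rule c(2)[OF q(5)])
    moreover have "nbs F \<noteq> {}" using step.IH q by auto
    ultimately show ?case using step.IH q f(6) E_rest[OF q(3) a(1) q(4) a(2)] by simp
  qed (use i F in simp)
  from this[OF r] have e: "h (i, t.center (nbs F')) = h (i, t.center (nbs F))" "nbs F = {} \<longrightarrow> F' = F" by auto
  note c = t.center_facts[OF orthset_nbs[OF F]] and c' = t.center_facts[OF orthset_nbs[OF F']]
  \<comment> \<open>Embeddedness brings the coincidence from the manifold back to the copy. The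
    centre determines the walls through it, and the walls determine the facet.\<close>
  have "t.center (nbs F') = t.center (nbs F)" using inj_onD[OF emb[OF i] e(1)] c(4) c'(4) by blast
  then have "nbs F = nbs F'" using c(5) c'(5) by metis
  then show ?thesis using nbs_facts(2)[OF F F'] e(2) by blast
qed

end

text \<open>Otherwise the centre of the face would be glued to a point of another face of the same
  copy, and no other face contains it.\<close>

lemma (in ra_polytope) embedded_distinct:
  assumes tes: "tessellation \<N> X Ac k \<tau> g h" and emb: "inj_on (\<lambda>x. h (i, x)) P" and i: "i < k" "v \<in> \<N>"
  shows "fst (\<tau> (i, v)) \<noteq> i"
proof
  assume e: "fst (\<tau> (i, v)) = i"
  define w where "w = snd (\<tau> (i, v))"
  have t: "\<tau> (i, v) = (i, w)" using e by (simp add: w_def prod_eq_iff)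
  have fp: "face_pairing \<N> k \<tau> g" using tes by (simp add: tessellation_def)
  from this[unfolded face_pairing_def, rule_format, of "(i, v)"] i t
  have w: "w \<in> \<N>" "w \<noteq> v" "bij_betw (g (i, v)) (hface \<N> v) (hface \<N> w)" by auto
  have V: "orthset {v}" using i by (auto simp: orthset_def)
  let ?x = "center {v}"
  have x: "?x \<in> hface \<N> v" "lorentz w ?x < 0" using center_facts[OF V] w by (auto simp: hface_def)
  have gx: "g (i, v) ?x \<in> hface \<N> w" using bij_betwE[OF w(3)] x(1) by blast
  have "((i, ?x), (i, g (i, v) ?x)) \<in> face_glue \<N> k \<tau> g"
    unfolding face_glue_def using i x(1) e by auto
  then have "h (i, ?x) = h (i, g (i, v) ?x)"
    using tes x(1) gx i(1) unfolding tessellation_def hface_def by blast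
  then have "?x = g (i, v) ?x" using inj_onD[OF emb] x(1) gx by (auto simp: hface_def)
  then show False using gx x(2) by (auto simp: hface_def)
qed

section \<open>Assembling the four-manifold\<close>

text \<open>Covers \<open>k = 0\<close>, where there is no tile to start from; the empty space then
  serves as the four-manifold.\<close>

lemma empty_embedding:
  fixes X :: "'p topology" and Ac :: "('p, 3) hchart set"
  assumes "topspace X = {}"
  shows "\<exists>(Y :: mfd4_point topology) (B :: (mfd4_point, 4) hchart set).
    hyp_manifold Y B \<and> connected_space Y \<and> hyp_complete Y B \<and> hyp_finite_volume Y B \<and>
    hyp_orientable Y B \<and> (\<exists>f. geodesic_hypersurface_embedding X Ac Y B f)"
proof -
  let ?Y = "discrete_topology {} :: mfd4_point topology"
  let ?B = "{} :: (mfd4_point, 4) hchart set"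
  have atlas: "hyp_atlas ?Y ?B" by (simp add: hyp_atlas_def)
  have "second_countable ?Y" unfolding second_countable_def by (intro exI[of _ "{}"]) auto
  then have "hyp_manifold ?Y ?B" using atlas by (simp add: hyp_manifold_def)
  moreover have "connected_space ?Y" by (simp add: connected_space_def)
  moreover have "hyp_complete ?Y ?B" by (simp add: hyp_complete_def)
  moreover have "hyp_finite_volume ?Y ?B" unfolding hyp_finite_volume_def
  proof (intro exI conjI)
    have "sigma_sets {} {U. openin ?Y U} = Pow {}"
      using sigma_sets.Empty by (auto dest: sigma_sets_into_sp[rotated])
    then show "is_volume ?Y ?B (count_space {})" by (simp add: is_volume_def)
    show "emeasure (count_space {}) (topspace ?Y) < \<infinity>" by simp
  qed
  moreover have "hyp_orientable ?Y ?B" unfolding hyp_orientable_def using atlas by (intro exI[of _ "{}"]) simp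
  moreover have "geodesic_hypersurface_embedding X Ac ?Y ?B (\<lambda>_. {})"
  proof -
    have "embedding_map X ?Y (\<lambda>_. {})"
      by (rule injective_closed_imp_embedding_map)
        (use assms in \<open>auto simp: continuous_map_def closed_map_def closedin_def\<close>)
    then show ?thesis using assms by (simp add: geodesic_hypersurface_embedding_def)
  qed
  ultimately show ?thesis by blast
qed

theorem (in coloured_cell) embedding_exists:
  assumes vol: "emeasure hyp_volume (hpoly N4) < \<infinity>"
  shows "\<exists>(Y :: mfd4_point topology) (B :: (mfd4_point, 4) hchart set).
    hyp_manifold Y B \<and> connected_space Y \<and> hyp_complete Y B \<and> hyp_finite_volume Y B \<and>
    hyp_orientable Y B \<and> (\<exists>f. geodesic_hypersurface_embedding X Ac Y B f)"
proof (cases "k = 0")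
  case True
  have "quotient_map (prod_topology (discrete_topology {..<k}) (top_of_set t.P)) X h"
    using t.tes by (simp add: tessellation_def)
  then have "topspace X = {}" using quotient_imp_surjective_map True by fastforce
  then show ?thesis by (rule empty_embedding)
next
  case False
  then interpret n: nonempty_cell \<kappa> s C S A U Z a0 dadj dtup forms lows offs X Ac k \<tau> g h
    by unfold_locales simp
  note q = m.quotient_manifold[OF n.st_T[OF n.kpos] finite_T vol]
  show ?thesis using q n.embeds by blast
qed

section \<open>Links of the faces\<close>

lemma lorentz_mvec3: "lorentz x (mvec t (vector [a, b, c])) = sp x $ 1 * a + sp x $ 2 * b + sp x $ 3 * c - x $ None * t"
  for x :: "3 mink"
  by (simp add: lorentz_sp inner_vec_def sum_3)

lemma mink3_eq0: "sp x $ 1 = 0 \<Longrightarrow> sp x $ 2 = 0 \<Longrightarrow> sp x $ 3 = 0 \<Longrightarrow> x $ None = 0 \<Longrightarrow> x = 0" for x :: "3 mink"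
  by (intro mink_eqI) (simp_all add: vec_eq_iff forall_3 sp_def)

text \<open>The neighbours of a face arise by changing one sign of its normal; with the face itself
  they give four independent equations.\<close>

lemma octahedron_nondegenerate:
  fixes x :: "3 mink"
  assumes v: "v \<in> octahedron_normals" "lorentz x v = 0"
    and adj: "\<And>u. u \<in> octahedron_normals \<Longrightarrow> lorentz u v = 0 \<Longrightarrow> lorentz x u = 0"
  shows "x = 0"
proof -
  obtain a b c where abc: "a \<in> {-1, 1}" "b \<in> {-1, 1}" "c \<in> {-1, 1}" "v = mvec 1 (vector [a, b, c])"
    using v(1) by (auto simp: octahedron_normals_def)
  have sq: "a * a = 1" "b * b = 1" "c * c = 1" using abc by auto
  have u: "lorentz x (mvec 1 (vector [a', b', c'])) = 0"
    if "a' \<in> {-1, 1}" "b' \<in> {-1, 1}" "c' \<in> {-1, 1}" "a' * a + b' * b + c' * c = 1" for a' b' c' :: real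
  proof (rule adj)
    show "mvec 1 (vector [a', b', c']) \<in> octahedron_normals" using that by (auto simp: octahedron_normals_def)
    show "lorentz (mvec 1 (vector [a', b', c'])) v = 0"
      using that(4) by (simp add: abc(4) lorentz_mvec inner_vec_def sum_3)
  qed
  have "lorentz x (mvec 1 (vector [- a, b, c])) = 0" "lorentz x (mvec 1 (vector [a, - b, c])) = 0"
    "lorentz x (mvec 1 (vector [a, b, - c])) = 0"
    by (rule u; use abc sq in auto)+
  then show ?thesis using v(2) abc by (intro mink3_eq0) (auto simp: lorentz_mvec3)
qed

text \<open>The face and three of its neighbours give four independent equations. The three shapes
  of normals are cyclic shifts of one another, so \<open>zero\<close> solves the system once for all
  of them.\<close>

lemma dodecahedron_nondegenerate:
  fixes x :: "3 mink"
  assumes v: "v \<in> dodecahedron_normals" "lorentz x v = 0"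
    and adj: "\<And>u. u \<in> dodecahedron_normals \<Longrightarrow> lorentz u v = 0 \<Longrightarrow> lorentz x u = 0"
  shows "x = 0"
proof -
  have g: "golden > 0" "sqrt golden * sqrt golden = golden" "sqrt golden \<noteq> 0" using golden_gt_1 by simp_all
  let ?n1 = "\<lambda>a b. mvec (sqrt golden) (vector [0, a, b * golden]) :: 3 mink"
  let ?n2 = "\<lambda>a b. mvec (sqrt golden) (vector [a, b * golden, 0]) :: 3 mink"
  let ?n3 = "\<lambda>a b. mvec (sqrt golden) (vector [b * golden, 0, a]) :: 3 mink"
  obtain a b :: real where ab: "a \<in> {-1, 1}" "b \<in> {-1, 1}" and cases: "v = ?n1 a b \<or> v = ?n2 a b \<or> v = ?n3 a b"
    using v(1) unfolding dodecahedron_normals_def by blast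
  have mem: "?n1 p q \<in> dodecahedron_normals" "?n2 p q \<in> dodecahedron_normals" "?n3 p q \<in> dodecahedron_normals"
    if "p \<in> {-1, 1}" "q \<in> {-1, 1}" for p q using that unfolding dodecahedron_normals_def by blast+
  have l: "lorentz (mvec (sqrt golden) (vector [p1, p2, p3])) (mvec (sqrt golden) (vector [q1, q2, q3]) :: 3 mink) =
      p1 * q1 + p2 * q2 + p3 * q3 - golden" for p1 p2 p3 q1 q2 q3
    using g(2) by (simp add: lorentz_mvec inner_vec_def sum_3)
  have sq: "a * a = 1" "b * b = 1" "a * (a * golden) = golden" "b * (b * golden) = golden"
    "b * golden * (b * golden) = golden + 1" using ab golden_sq by auto
  have pm: "- a \<in> {-1, 1}" "(1 :: real) \<in> {-1, 1}" "(-1 :: real) \<in> {-1, 1}" using ab by auto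
  have zero: "y1 = 0 \<and> y2 = 0 \<and> y3 = 0 \<and> y0 = 0"
    if "y2 * a + y3 * (b * golden) - y0 * sqrt golden = 0" "y2 * - a + y3 * (b * golden) - y0 * sqrt golden = 0"
      "y1 * 1 + y2 * (a * golden) - y0 * sqrt golden = 0" "y1 * -1 + y2 * (a * golden) - y0 * sqrt golden = 0" for y0 y1 y2 y3
  proof -
    have "y2 * a = 0" using that(1,2) by linarith
    then have "y2 = 0" using ab by auto
    moreover then have "y1 = 0" "y0 * sqrt golden = 0" using that(3,4) by auto
    moreover then have "y0 = 0" "y3 * (b * golden) = 0" using that(1) g(3) \<open>y2 = 0\<close> by auto
    ultimately show ?thesis using ab g(1) by auto
  qed
  from cases show ?thesis
  proof (elim disjE)
    assume e: "v = ?n1 a b"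
    have "lorentz x (?n1 (- a) b) = 0" "lorentz x (?n2 1 a) = 0" "lorentz x (?n2 (-1) a) = 0"
      by (rule adj; use mem ab pm sq in \<open>simp add: e l\<close>)+
    then show ?thesis using v(2) zero[of "sp x $ 2" "sp x $ 3" "x $ None" "sp x $ 1"]
      by (intro mink3_eq0) (simp_all add: e lorentz_mvec3 algebra_simps)
  next
    assume e: "v = ?n2 a b"
    have "lorentz x (?n2 (- a) b) = 0" "lorentz x (?n3 1 a) = 0" "lorentz x (?n3 (-1) a) = 0"
      by (rule adj; use mem ab pm sq in \<open>simp add: e l\<close>)+
    then show ?thesis using v(2) zero[of "sp x $ 1" "sp x $ 2" "x $ None" "sp x $ 3"]
      by (intro mink3_eq0) (simp_all add: e lorentz_mvec3 algebra_simps)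
  next
    assume e: "v = ?n3 a b"
    have "lorentz x (?n3 (- a) b) = 0" "lorentz x (?n1 1 a) = 0" "lorentz x (?n1 (-1) a) = 0"
      by (rule adj; use mem ab pm sq in \<open>simp add: e l\<close>)+
    then show ?thesis using v(2) zero[of "sp x $ 3" "sp x $ 1" "x $ None" "sp x $ 2"]
      by (intro mink3_eq0) (simp_all add: e lorentz_mvec3 algebra_simps)
  qed
qed

section \<open>The normals of the two cells\<close>

definition pms :: "zphi \<Rightarrow> zphi list" where "pms p = [p, zneg p]"

definition A24 :: "zphi list list" where
  "A24 = concat (map (\<lambda>a. concat (map (\<lambda>b. map (\<lambda>c. [a, b, c]) (pms (1, 0))) (pms (1, 0)))) (pms (1, 0)))"

text \<open>The six facets on the equator with respect to \<open>f0\<close>. As a set they are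
  determined by their product with \<open>f0\<close>, hence invariant under all extended
  symmetries.\<close>

definition Z24 :: "zphi list list" where
  "Z24 = concat (map (\<lambda>a. [[(0, 0), a, (0, 0), (0, 0)], [(0, 0), (0, 0), a, (0, 0)], [(0, 0), (0, 0), (0, 0), a]]) (pms (2, 0)))"

definition U24 :: "zphi list list" where
  "U24 = [[(2, 0), (0, 0), (0, 0), (0, 0)], [(-2, 0), (0, 0), (0, 0), (0, 0)]] @ Z24 @
     map ((#) (1, 0)) A24 @ map ((#) (-1, 0)) A24"

definition A120 :: "zphi list list" where
  "A120 = concat (map (\<lambda>b. concat (map (\<lambda>c. [[(0, 0), b, c], [b, c, (0, 0)], [c, (0, 0), b]]) (pms (1, 0)))) (pms (-1, 1)))"

text \<open>One entry per layer of facets with a common first coordinate: this coordinate, a scaling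
  factor, and the size of the cliques of walls that are summed.\<close>

definition forms24 :: "(zphi \<times> zphi \<times> nat) list" where
  "forms24 = [((2, 0), (0, 0), 0), ((1, 0), (1, 0), 1), ((0, 0), (1, 0), 2), ((-1, 0), (1, 0), 1), ((-2, 0), (0, 0), 0)]"

definition forms120 :: "(zphi \<times> zphi \<times> nat) list" where
  "forms120 = [((2, 0), (0, 0), 0), ((0, 1), (1, 0), 1), ((1, 0), (-1, 1), 3), ((-1, 1), (0, 1), 1), ((0, 0), (1, 0), 2),
     ((1, -1), (0, 1), 1), ((-1, 0), (-1, 1), 3), ((0, -1), (1, 0), 1), ((-2, 0), (0, 0), 0)]"

text \<open>The vertices of the 600-cell, scaled by 2.\<close>

definition U120 :: "zphi list list" where
  "U120 = [
    [(2, 0), (0, 0), (0, 0), (0, 0)], [(0, 1), (0, 0), (-1, 1), (1, 0)],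
    [(0, 1), (-1, 1), (1, 0), (0, 0)], [(0, 1), (1, 0), (0, 0), (-1, 1)],
    [(0, 1), (0, 0), (-1, 1), (-1, 0)], [(0, 1), (-1, 1), (-1, 0), (0, 0)],
    [(0, 1), (-1, 0), (0, 0), (-1, 1)], [(0, 1), (0, 0), (1, -1), (1, 0)],
    [(0, 1), (1, -1), (1, 0), (0, 0)], [(0, 1), (1, 0), (0, 0), (1, -1)],
    [(0, 1), (0, 0), (1, -1), (-1, 0)], [(0, 1), (1, -1), (-1, 0), (0, 0)],
    [(0, 1), (-1, 0), (0, 0), (1, -1)], [(1, 0), (1, 0), (1, 0), (1, 0)],
    [(1, 0), (-1, 1), (0, 0), (0, 1)], [(1, 0), (1, 0), (-1, 0), (1, 0)],
    [(1, 0), (1, -1), (0, 0), (0, 1)], [(1, 0), (0, 0), (0, 1), (-1, 1)],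
    [(1, 0), (0, 0), (0, 1), (1, -1)], [(1, 0), (-1, 0), (1, 0), (1, 0)],
    [(1, 0), (0, 1), (-1, 1), (0, 0)], [(1, 0), (1, 0), (1, 0), (-1, 0)],
    [(1, 0), (0, 1), (1, -1), (0, 0)], [(1, 0), (-1, 1), (0, 0), (0, -1)],
    [(1, 0), (1, 0), (-1, 0), (-1, 0)], [(1, 0), (0, 0), (0, -1), (-1, 1)],
    [(1, 0), (-1, 0), (-1, 0), (1, 0)], [(1, 0), (0, 0), (0, -1), (1, -1)],
    [(1, 0), (-1, 0), (1, 0), (-1, 0)], [(1, 0), (0, -1), (-1, 1), (0, 0)],
    [(1, 0), (1, -1), (0, 0), (0, -1)], [(1, 0), (0, -1), (1, -1), (0, 0)],
    [(1, 0), (-1, 0), (-1, 0), (-1, 0)], [(-1, 1), (0, 0), (1, 0), (0, 1)],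
    [(-1, 1), (1, 0), (0, 1), (0, 0)], [(-1, 1), (0, 1), (0, 0), (1, 0)],
    [(-1, 1), (0, 0), (1, 0), (0, -1)], [(-1, 1), (1, 0), (0, -1), (0, 0)],
    [(-1, 1), (0, -1), (0, 0), (1, 0)], [(-1, 1), (0, 0), (-1, 0), (0, 1)],
    [(-1, 1), (-1, 0), (0, 1), (0, 0)], [(-1, 1), (0, 1), (0, 0), (-1, 0)],
    [(-1, 1), (0, 0), (-1, 0), (0, -1)], [(-1, 1), (-1, 0), (0, -1), (0, 0)],
    [(-1, 1), (0, -1), (0, 0), (-1, 0)], [(0, 0), (-1, 1), (0, 1), (1, 0)],
    [(0, 0), (1, 0), (-1, 1), (0, 1)], [(0, 0), (0, 1), (1, 0), (-1, 1)],
    [(0, 0), (-1, 1), (0, 1), (-1, 0)], [(0, 0), (0, 1), (-1, 0), (-1, 1)],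
    [(0, 0), (-1, 0), (-1, 1), (0, 1)], [(0, 0), (0, 0), (0, 0), (2, 0)],
    [(0, 0), (1, 0), (1, -1), (0, 1)], [(0, 0), (-1, 1), (0, -1), (1, 0)],
    [(0, 0), (-1, 0), (1, -1), (0, 1)], [(0, 0), (1, -1), (0, 1), (1, 0)],
    [(0, 0), (0, 0), (2, 0), (0, 0)], [(0, 0), (1, -1), (0, 1), (-1, 0)],
    [(0, 0), (0, -1), (1, 0), (-1, 1)], [(0, 0), (0, 1), (1, 0), (1, -1)],
    [(0, 0), (2, 0), (0, 0), (0, 0)], [(0, 0), (1, 0), (-1, 1), (0, -1)],
    [(0, 0), (0, 1), (-1, 0), (1, -1)], [(0, 0), (0, 0), (0, 0), (-2, 0)],
    [(0, 0), (-1, 1), (0, -1), (-1, 0)], [(0, 0), (1, 0), (1, -1), (0, -1)],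
    [(0, 0), (0, 0), (-2, 0), (0, 0)], [(0, 0), (0, -1), (-1, 0), (-1, 1)],
    [(0, 0), (1, -1), (0, -1), (1, 0)], [(0, 0), (1, -1), (0, -1), (-1, 0)],
    [(0, 0), (-1, 0), (-1, 1), (0, -1)], [(0, 0), (-2, 0), (0, 0), (0, 0)],
    [(0, 0), (0, -1), (1, 0), (1, -1)], [(0, 0), (-1, 0), (1, -1), (0, -1)],
    [(0, 0), (0, -1), (-1, 0), (1, -1)], [(1, -1), (0, 0), (1, 0), (0, 1)],
    [(1, -1), (1, 0), (0, 1), (0, 0)], [(1, -1), (0, 1), (0, 0), (1, 0)],
    [(1, -1), (0, 0), (1, 0), (0, -1)], [(1, -1), (1, 0), (0, -1), (0, 0)],
    [(1, -1), (0, -1), (0, 0), (1, 0)], [(1, -1), (0, 0), (-1, 0), (0, 1)],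
    [(1, -1), (-1, 0), (0, 1), (0, 0)], [(1, -1), (0, 1), (0, 0), (-1, 0)],
    [(1, -1), (0, 0), (-1, 0), (0, -1)], [(1, -1), (-1, 0), (0, -1), (0, 0)],
    [(1, -1), (0, -1), (0, 0), (-1, 0)], [(-1, 0), (1, 0), (1, 0), (1, 0)],
    [(-1, 0), (-1, 1), (0, 0), (0, 1)], [(-1, 0), (1, 0), (-1, 0), (1, 0)],
    [(-1, 0), (1, -1), (0, 0), (0, 1)], [(-1, 0), (0, 0), (0, 1), (-1, 1)],
    [(-1, 0), (0, 0), (0, 1), (1, -1)], [(-1, 0), (-1, 0), (1, 0), (1, 0)],
    [(-1, 0), (0, 1), (-1, 1), (0, 0)], [(-1, 0), (1, 0), (1, 0), (-1, 0)],
    [(-1, 0), (0, 1), (1, -1), (0, 0)], [(-1, 0), (-1, 1), (0, 0), (0, -1)],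
    [(-1, 0), (1, 0), (-1, 0), (-1, 0)], [(-1, 0), (0, 0), (0, -1), (-1, 1)],
    [(-1, 0), (-1, 0), (-1, 0), (1, 0)], [(-1, 0), (0, 0), (0, -1), (1, -1)],
    [(-1, 0), (-1, 0), (1, 0), (-1, 0)], [(-1, 0), (0, -1), (-1, 1), (0, 0)],
    [(-1, 0), (1, -1), (0, 0), (0, -1)], [(-1, 0), (0, -1), (1, -1), (0, 0)],
    [(-1, 0), (-1, 0), (-1, 0), (-1, 0)], [(0, -1), (0, 0), (-1, 1), (1, 0)],
    [(0, -1), (-1, 1), (1, 0), (0, 0)], [(0, -1), (1, 0), (0, 0), (-1, 1)],
    [(0, -1), (0, 0), (-1, 1), (-1, 0)], [(0, -1), (-1, 1), (-1, 0), (0, 0)],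
    [(0, -1), (-1, 0), (0, 0), (-1, 1)], [(0, -1), (0, 0), (1, -1), (1, 0)],
    [(0, -1), (1, -1), (1, 0), (0, 0)], [(0, -1), (1, 0), (0, 0), (1, -1)],
    [(0, -1), (0, 0), (1, -1), (-1, 0)], [(0, -1), (1, -1), (-1, 0), (0, 0)],
    [(0, -1), (-1, 0), (0, 0), (1, -1)], [(-2, 0), (0, 0), (0, 0), (0, 0)]]"

text \<open>One equatorial facet suffices for toggling the flag. It is orthogonal to no wall, so no
  symmetry has to preserve it.\<close>

definition Z120 :: "zphi list list" where "Z120 = [[(0, 0), (2, 0), (0, 0), (0, 0)]]"

text \<open>The inner products of distinct facets that are not adjacent, from the closest pairs to
  the antipodal ones.\<close>

definition lows24 :: "zphi list" where "lows24 = [(0, 0), (-2, 0), (-4, 0)]"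
definition lows120 :: "zphi list" where "lows120 = [(2, 0), (-2, 2), (0, 0), (2, -2), (-2, 0), (0, -2), (-4, 0)]"

text \<open>Adjacent vectors have inner product 2, so \<open>par\<close> requires \<kappa>^2 (4 - 2)
  = 2; the other parameters follow from \<kappa> = 1.\<close>

interpretation cell24: cell_data 1 "sqrt 2" "sqrt 2" 1 A24 U24 Z24 "(1, 0)" "(2, 0)" "(-1, 0)"
  forms24 lows24 "[(3, 0), (1, 0), (-3, 0)]"
proof (rule cell_data.intro)
  show "set (gens A24 (-1, 0) forms24) = set U24"
  proof -
    have "list_all (\<lambda>v. v \<in> set U24) (gens A24 (-1, 0) forms24)" by code_simp
    moreover have "list_all (\<lambda>v. v \<in> set (gens A24 (-1, 0) forms24)) U24" by code_simp
    ultimately show ?thesis unfolding list_all_iff by blast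
  qed
  show "d \<in> set lows24 \<Longrightarrow> 1\<^sup>2 * (zval d - zval (2, 0)) \<le> -2" for d by (auto simp: lows24_def zval_def)
  show "d \<in> set [(3, 0), (1, 0), (-3, 0)] \<Longrightarrow> zval d \<noteq> zval (-1, 0)" for d by (auto simp: zval_def)
  show "(1::real) > 0" "sqrt 2 > 0" "sqrt 2 > 0" "(1::real) > 0" by simp_all
  show "4 * 1\<^sup>2 - (sqrt 2)\<^sup>2 = 2" "(sqrt 2)\<^sup>2 - 1\<^sup>2 = 1" "2 * 1 * 1 = sqrt 2 * sqrt 2"
    "(sqrt 2)\<^sup>2 = 1\<^sup>2 * zval (2, 0)" "1 * sqrt 2 = 1 * zval (1, 0) * sqrt 2" by (simp_all add: zval_def)
qed code_simp+

lemma U120_gens: "gens A120 (-1, 1) forms120 = U120" by code_simp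

lemma U120_dot: "list_all (\<lambda>u. list_all (\<lambda>w. u = w \<or> zdot u w = (0, 2) \<or> zdot u w \<in> set lows120) U120) U120"
  by code_simp

lemma U120_nb: "list_all (\<lambda>u. u \<in> set Z120 \<or> u = [(-2, 0), (0, 0), (0, 0), (0, 0)] \<or> u = [(2, 0), (0, 0), (0, 0), (0, 0)] \<or>
       u \<in> set (map ((#) (0, 1)) A120) \<or>
       (let n = filter (\<lambda>a. zdot ((0, 1) # a) u = (0, 2)) A120 in
         list_all (\<lambda>a. list_all (\<lambda>b. a = b \<or> zdot ((0, 1) # a) ((0, 1) # b) = (0, 2)) n) n \<and>
         (n = [] \<or> list_all (\<lambda>w. u = w \<or> w \<in> set Z120 \<or> filter (\<lambda>a. zdot ((0, 1) # a) w = (0, 2)) A120 \<noteq> n) U120))) U120"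
  by code_simp

text \<open>With adjacency value 2 golden the equations \<open>par\<close> give \<kappa>^2 (4 - 2
  golden) = 2, so \<kappa>^2 = 1 / (2 - golden) = golden^2. Then s^2 = 2 golden \<kappa>^2, C^2 = 2
  \<kappa>^2 and S^2 = s^2 / 2.\<close>

interpretation cell120: cell_data golden "sqrt (2 * golden ^ 3)" "sqrt 2 * golden" "sqrt (golden ^ 3)" A120 U120 Z120
  "(0, 1)" "(0, 2)" "(-1, 1)" forms120 lows120 "[(3, -1), (1, -1), (-3, 1)]"
proof (rule cell_data.intro)
  have g: "golden > 0" using golden_gt_1 by simp
  show "set (gens A120 (-1, 1) forms120) = set U120" by (simp only: U120_gens)
  show "d \<in> set lows120 \<Longrightarrow> golden\<^sup>2 * (zval d - zval (0, 2)) \<le> -2" for d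
  proof -
    assume "d \<in> set lows120"
    then have "zval d \<le> 2" using golden_bounds by (auto simp: lows120_def zval_def)
    then have "golden\<^sup>2 * (zval d - zval (0, 2)) \<le> golden\<^sup>2 * (2 - 2 * golden)"
      by (intro mult_left_mono) (simp_all add: zval_def)
    also have "\<dots> = 2 - 2 * (golden * golden)" by (simp add: golden_powers(1) algebra_simps)
    also have "\<dots> = - 2 * golden" unfolding golden_sq by simp
    finally show ?thesis using golden_gt_1 by simp
  qed
  show "d \<in> set [(3, -1), (1, -1), (-3, 1)] \<Longrightarrow> zval d \<noteq> zval (-1, 1)" for d
    using golden_bounds by (auto simp: zval_def)
  show "golden > 0" "sqrt (2 * golden ^ 3) > 0" "sqrt 2 * golden > 0" "sqrt (golden ^ 3) > 0" using g by simp_all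
  have q: "(sqrt (golden ^ 3))\<^sup>2 = golden ^ 3" "sqrt (golden ^ 3) * sqrt (golden ^ 3) = golden ^ 3" using g by simp_all
  have s: "sqrt (2 * golden ^ 3) = sqrt 2 * sqrt (golden ^ 3)" by (simp add: real_sqrt_mult)
  show "4 * golden\<^sup>2 - (sqrt (2 * golden ^ 3))\<^sup>2 = 2" "(sqrt 2 * golden)\<^sup>2 - (sqrt (golden ^ 3))\<^sup>2 = 1"
    unfolding s power_mult_distrib q by (simp_all add: golden_powers)
  show "2 * golden * sqrt (golden ^ 3) = sqrt (2 * golden ^ 3) * (sqrt 2 * golden)" unfolding s by simp
  show "(sqrt (2 * golden ^ 3))\<^sup>2 = golden\<^sup>2 * zval (0, 2)"
    unfolding s power_mult_distrib q by (simp add: zval_def power3_eq_cube power2_eq_square)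
  have "sqrt (golden ^ 3) * sqrt (2 * golden ^ 3) = sqrt 2 * (sqrt (golden ^ 3) * sqrt (golden ^ 3))" unfolding s by simp
  also have "\<dots> = golden * zval (0, 1) * (sqrt 2 * golden)" unfolding q by (simp add: zval_def power3_eq_cube)
  finally show "sqrt (golden ^ 3) * sqrt (2 * golden ^ 3) = golden * zval (0, 1) * (sqrt 2 * golden)" .
qed (rule U120_dot U120_nb | code_simp)+

lemma N3_24: "cell24.N3 = octahedron_normals"
proof -
  have "cell24.N3 = cell24.n3 ` set [[(1,0),(1,0),(1,0)],[(1,0),(1,0),(-1,0)],[(1,0),(-1,0),(1,0)],[(1,0),(-1,0),(-1,0)],
    [(-1,0),(1,0),(1,0)],[(-1,0),(1,0),(-1,0)],[(-1,0),(-1,0),(1,0)],[(-1,0),(-1,0),(-1,0)]]"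
    unfolding cell24.N3_def by (simp add: A24_def pms_def)
  also have "\<dots> = octahedron_normals"
    unfolding octahedron_normals_def by (auto simp: cell24.n3_def vec3_def zval_def)
  finally show ?thesis .
qed

lemma N3_120: "cell120.N3 = dodecahedron_normals"
proof -
  have g: "golden > 0" using golden_gt_1 by simp
  have "sqrt (2 * golden ^ 3) / (sqrt 2 * golden) = sqrt (golden ^ 3) / golden" by (simp add: real_sqrt_mult)
  also have "\<dots> = sqrt (golden ^ 3 / golden\<^sup>2)" using g by (simp add: real_sqrt_divide)
  also have "golden ^ 3 / golden\<^sup>2 = golden" using g by (simp add: power3_eq_cube power2_eq_square)
  finally have t: "sqrt (2 * golden ^ 3) / (sqrt 2 * golden) = sqrt golden" .
  \<comment> \<open>\<open>golden - 1\<close> is the inverse of \<open>golden\<close>, so scaling by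
    \<open>golden\<close> turns the coordinates 0, \<open>golden - 1\<close>, 1 into 0, 1,
    \<open>golden\<close>.\<close>
  have i: "golden * (golden - 1) = 1" "golden * (1 - golden) = -1" using golden_sq by (simp_all add: algebra_simps)
  have v: "c *\<^sub>R (vector [x, y, z] :: real ^ 3) = vector [c * x, c * y, c * z]" for c x y z
    by (simp add: vec_eq_iff forall_3)
  have "cell120.N3 = cell120.n3 ` set [[(0,0),(-1,1),(1,0)],[(-1,1),(1,0),(0,0)],[(1,0),(0,0),(-1,1)],
    [(0,0),(-1,1),(-1,0)],[(-1,1),(-1,0),(0,0)],[(-1,0),(0,0),(-1,1)],
    [(0,0),(1,-1),(1,0)],[(1,-1),(1,0),(0,0)],[(1,0),(0,0),(1,-1)],
    [(0,0),(1,-1),(-1,0)],[(1,-1),(-1,0),(0,0)],[(-1,0),(0,0),(1,-1)]]"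
    unfolding cell120.N3_def by (simp add: A120_def pms_def)
  also have "\<dots> = dodecahedron_normals"
    unfolding dodecahedron_normals_def by (auto simp: cell120.n3_def vec3_def zval_def t v i)
  finally show ?thesis .
qed

lemma U24_flips: "list_all (\<lambda>u. list_all (\<lambda>i. u[i := zneg (u ! i)] \<in> set U24) [0, 1, 2, 3]) U24"
  by code_simp

lemma U120_flips: "list_all (\<lambda>u. list_all (\<lambda>i. u[i := zneg (u ! i)] \<in> set U120) [0, 1, 2, 3]) U120"
  by code_simp

lemma U24_sample: "list_all (\<lambda>u. u \<in> set U24) [[(2, 0), (0, 0), (0, 0), (0, 0)], [(0, 0), (2, 0), (0, 0), (0, 0)],
    [(0, 0), (0, 0), (2, 0), (0, 0)], [(0, 0), (0, 0), (0, 0), (2, 0)], [(1, 0), (1, 0), (1, 0), (1, 0)]]"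
  by code_simp

lemma U120_sample: "list_all (\<lambda>u. u \<in> set U120) [[(0, 1), (0, 0), (-1, 1), (1, 0)],
    [(0, 1), (1, 0), (0, 0), (-1, 1)],
    [(0, 1), (-1, 1), (1, 0), (0, 0)],
    [(0, 0), (0, 1), (1, 0), (-1, 1)],
    [(-1, 1), (0, 1), (0, 0), (1, 0)],
    [(1, 0), (0, 1), (-1, 1), (0, 0)],
    [(0, 0), (-1, 1), (0, 1), (1, 0)],
    [(1, 0), (0, 0), (0, 1), (-1, 1)],
    [(-1, 1), (1, 0), (0, 1), (0, 0)],
    [(0, 0), (1, 0), (-1, 1), (0, 1)],
    [(-1, 1), (0, 0), (1, 0), (0, 1)],
    [(1, 0), (-1, 1), (0, 0), (0, 1)],
    [(2, 0), (0, 0), (0, 0), (0, 0)],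
    [(0, 0), (2, 0), (0, 0), (0, 0)],
    [(0, 0), (0, 0), (2, 0), (0, 0)],
    [(0, 0), (0, 0), (0, 0), (2, 0)],
    [(1, 0), (1, 0), (1, 0), (1, 0)]]"
  by code_simp

lemma U24_equator:
  "list_all (\<lambda>u. u \<in> set Z24 \<or> zdot [(2, 0), (0, 0), (0, 0), (0, 0)] u \<in> set [(4, 0), (2, 0), (-2, 0), (-4, 0)]) U24"
  "list_all (\<lambda>z. zdot [(2, 0), (0, 0), (0, 0), (0, 0)] z = (0, 0)) Z24"
  by code_simp+

lemma U24_nb: "list_all (\<lambda>u. u \<in> set Z24 \<or> u = [(-2, 0), (0, 0), (0, 0), (0, 0)] \<or> u = [(2, 0), (0, 0), (0, 0), (0, 0)] \<or>
    u \<in> set (map ((#) (1, 0)) A24) \<or> length (filter (\<lambda>a. zdot ((1, 0) # a) u = (2, 0)) A24) \<le> 1) U24"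
  by code_simp

lemma Z120_nb: "list_all (\<lambda>z. filter (\<lambda>a. zdot ((0, 1) # a) z = (0, 2)) A120 = []) Z120"
  by code_simp

section \<open>The main theorem\<close>

lemma (in cell_data) nbs_n4:
  assumes "u \<in> set U" shows "nbs (n4 u) = n3 ` set (filter (\<lambda>a. zdot (a0 # a) u = dadj) A)"
  using n4_cases(3)[OF AU' assms] iota_n3 by (auto simp: nbs_def N3_def)

text \<open>The equator is characterised by a product that \<open>ext\<close> preserves, which is
  how the invariance of \<open>Z4\<close> is obtained.\<close>

lemma Z24_iff:
  assumes "F \<in> cell24.N4" shows "F \<in> cell24.Z4 \<longleftrightarrow> lorentz cell24.f0 F = -2"
proof -
  obtain u where u: "u \<in> set U24" "F = cell24.n4 u" using assms by (auto simp: cell24.N4_def)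
  let ?f = "[(2, 0), (0, 0), (0, 0), (0, 0)] :: zphi list"
  have l: "lorentz cell24.f0 F = zval (zdot ?f u) - 2"
    using cell24.n4_lorentz[of ?f u] cell24.lenU[OF u(1)] by (simp add: u(2) cell24.f0_n4 zval_def)
  show ?thesis
  proof (cases "u \<in> set Z24")
    case True
    then have "zdot ?f u = (0, 0)" using U24_equator(2) by (auto simp: list_all_iff)
    then show ?thesis using True u(2) l by (simp add: cell24.Z4_def)
  next
    case False
    then have d: "zdot ?f u \<in> set [(4, 0), (2, 0), (-2, 0), (-4, 0)]" using U24_equator(1) u(1) unfolding list_all_iff by blast
    have "F \<notin> cell24.Z4"
    proof
      assume "F \<in> cell24.Z4"
      then obtain z where z: "z \<in> set Z24" "F = cell24.n4 z" by (auto simp: cell24.Z4_def)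
      then have "z \<in> set U24" by (auto simp: U24_def)
      then show False using cell24.n4_inj[OF u(1)] z u(2) False by metis
    qed
    moreover have "lorentz cell24.f0 F \<noteq> -2" using d l by (auto simp: zval_def)
    ultimately show ?thesis by blast
  qed
qed

lemma rest24_single: assumes "F \<in> cell24.rest" shows "\<exists>a. cell24.nbs F \<subseteq> {a}"
proof -
  have F: "F \<in> cell24.N4" "F \<notin> cell24.Z4" "F \<noteq> cell24.f0" "F \<noteq> cell24.opp0" "F \<notin> cell24.\<iota> ` cell24.N3"
    using assms by (auto simp: cell24.rest_def)
  obtain u where u: "u \<in> set U24" "F = cell24.n4 u" using F(1) by (auto simp: cell24.N4_def)
  have "u \<notin> set Z24" using F(2) u by (auto simp: cell24.Z4_def)
  moreover have "u \<noteq> [(2, 0), (0, 0), (0, 0), (0, 0)]" "u \<noteq> [(-2, 0), (0, 0), (0, 0), (0, 0)]"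
    using F(3,4) u cell24.f0_n4 cell24.opp0_n4 by auto
  moreover have "u \<notin> set (map ((#) (1, 0)) A24)"
  proof
    assume "u \<in> set (map ((#) (1, 0)) A24)"
    then obtain a where a: "a \<in> set A24" "u = (1, 0) # a" by auto
    then have "F = cell24.\<iota> (cell24.n3 a)" using cell24.iota_n3[OF a(1)] u by simp
    then show False using F(5) a(1) by (auto simp: cell24.N3_def)
  qed
  ultimately have "length (filter (\<lambda>a. zdot ((1, 0) # a) u = (2, 0)) A24) \<le> 1"
    using U24_nb u(1) unfolding list_all_iff by blast
  then obtain ys where ys: "filter (\<lambda>a. zdot ((1, 0) # a) u = (2, 0)) A24 = ys" "length ys \<le> 1" by blast
  have "cell24.nbs F = cell24.n3 ` set ys" using cell24.nbs_n4[OF u(1)] ys(1) u(2) by simp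
  moreover have "\<exists>a. cell24.n3 ` set ys \<subseteq> {a}" using ys(2) by (cases ys) auto
  ultimately show ?thesis by simp
qed

lemma Z120_nbs: assumes "F \<in> cell120.Z4" shows "cell120.nbs F = {}"
proof -
  obtain z where z: "z \<in> set Z120" "F = cell120.n4 z" using assms by (auto simp: cell120.Z4_def)
  have "z \<in> set U120"
  proof -
    have "cell120.n4 z \<in> cell120.N4" using cell120.Z_facts(1)[OF assms] z(2) by simp
    then show ?thesis using cell120.ZU(1) z(1) by (auto simp: list_all_iff)
  qed
  moreover have "filter (\<lambda>a. zdot ((0, 1) # a) z = (0, 2)) A120 = []" using Z120_nb z(1) by (auto simp: list_all_iff)
  ultimately show ?thesis by (simp only: z(2) cell120.nbs_n4 list.set image_empty)
qed

lemma volume24: "emeasure hyp_volume (hpoly cell24.N4) < \<infinity>"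
proof (rule cusp_volume)
  show "hpoly cell24.N4 \<in> sets borel" using hpoly_closed by (rule borel_closed)
  show "hpoly cell24.N4 \<subseteq> hyp" by (auto simp: hpoly_def)
  have u: "u \<in> set U24" if "u \<in> set [[(2, 0), (0, 0), (0, 0), (0, 0)], [(0, 0), (2, 0), (0, 0), (0, 0)],
    [(0, 0), (0, 0), (2, 0), (0, 0)], [(0, 0), (0, 0), (0, 0), (2, 0)], [(1, 0), (1, 0), (1, 0), (1, 0)]]" for u
    using U24_sample that unfolding list_all_iff by blast
  fix x assume x: "x \<in> hpoly cell24.N4"
  note b = cell24.hpoly_signs[OF U24_flips x u]
  have "2 * \<bar>sp x $ 1\<bar> \<le> sqrt 2 * x $ None" "2 * \<bar>sp x $ 2\<bar> \<le> sqrt 2 * x $ None"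
    "2 * \<bar>sp x $ 3\<bar> \<le> sqrt 2 * x $ None" "2 * \<bar>sp x $ 4\<bar> \<le> sqrt 2 * x $ None"
    using b[of "[(2, 0), (0, 0), (0, 0), (0, 0)]"] b[of "[(0, 0), (2, 0), (0, 0), (0, 0)]"]
      b[of "[(0, 0), (0, 0), (2, 0), (0, 0)]"] b[of "[(0, 0), (0, 0), (0, 0), (2, 0)]"]
    by (simp_all add: zval_def)
  then have "\<forall>i. 2 * \<bar>sp x $ i\<bar> \<le> sqrt 2 * x $ None" by (simp add: forall_4)
  then show "2 * \<bar>sp x $ i\<bar> \<le> sqrt 2 * x $ None" for i by blast
  show "(\<Sum>i\<in>UNIV. \<bar>sp x $ i\<bar>) \<le> sqrt 2 * x $ None"
    using b[of "[(1, 0), (1, 0), (1, 0), (1, 0)]"] by (simp add: zval_def sum_4)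
qed

lemma volume120: "emeasure hyp_volume (hpoly cell120.N4) < \<infinity>"
proof (rule compact_volume)
  show "hpoly cell120.N4 \<in> sets borel" using hpoly_closed by (rule borel_closed)
  \<comment> \<open>1 / (2 golden) is about 0.309, so the constant 0.305 of the certificates is just
    small enough.\<close>
  show "0 \<le> 305 / 1000 * (2 * golden)" "305 / 1000 * (2 * golden) < 1" using golden_bounds by auto
  fix x assume x: "x \<in> hpoly cell120.N4"
  \<comment> \<open>The scale in which the inequality of every facet bounds a combination of
    absolute coordinates by \<open>m\<close> itself.\<close>
  define m where "m = sqrt (2 * golden ^ 3) / golden * x $ None"
  have g: "golden > 0" using golden_gt_1 by simp
  have m2: "m\<^sup>2 = 2 * golden * (x $ None)\<^sup>2"
  proof -
    have "(sqrt (2 * golden ^ 3))\<^sup>2 = 2 * golden ^ 3" using g by simp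
    then have "m\<^sup>2 = 2 * golden ^ 3 / golden\<^sup>2 * (x $ None)\<^sup>2" by (simp only: m_def power_mult_distrib power_divide)
    also have "2 * golden ^ 3 / golden\<^sup>2 = 2 * golden" using g by (simp add: power3_eq_cube power2_eq_square)
    finally show ?thesis .
  qed
  have u: "zval (u ! 0) * \<bar>sp x $ 1\<bar> + zval (u ! 1) * \<bar>sp x $ 2\<bar> + zval (u ! 2) * \<bar>sp x $ 3\<bar> + zval (u ! 3) * \<bar>sp x $ 4\<bar> \<le> m"
    if "u \<in> set U120" for u
  proof -
    have "golden * (zval (u ! 0) * \<bar>sp x $ 1\<bar> + zval (u ! 1) * \<bar>sp x $ 2\<bar> + zval (u ! 2) * \<bar>sp x $ 3\<bar> + zval (u ! 3) * \<bar>sp x $ 4\<bar>)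
      \<le> golden * m"
      using cell120.hpoly_signs[OF U120_flips x that] g by (simp add: m_def)
    then show ?thesis using g by simp
  qed
  have b: "list_all (\<lambda>u. zval (u ! 0) * \<bar>sp x $ 1\<bar> + zval (u ! 1) * \<bar>sp x $ 2\<bar> + zval (u ! 2) * \<bar>sp x $ 3\<bar> + zval (u ! 3) * \<bar>sp x $ 4\<bar> \<le> m)
    [[(0, 1), (0, 0), (-1, 1), (1, 0)],
    [(0, 1), (1, 0), (0, 0), (-1, 1)],
    [(0, 1), (-1, 1), (1, 0), (0, 0)],
    [(0, 0), (0, 1), (1, 0), (-1, 1)],
    [(-1, 1), (0, 1), (0, 0), (1, 0)],
    [(1, 0), (0, 1), (-1, 1), (0, 0)],
    [(0, 0), (-1, 1), (0, 1), (1, 0)],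
    [(1, 0), (0, 0), (0, 1), (-1, 1)],
    [(-1, 1), (1, 0), (0, 1), (0, 0)],
    [(0, 0), (1, 0), (-1, 1), (0, 1)],
    [(-1, 1), (0, 0), (1, 0), (0, 1)],
    [(1, 0), (-1, 1), (0, 0), (0, 1)],
    [(2, 0), (0, 0), (0, 0), (0, 0)],
    [(0, 0), (2, 0), (0, 0), (0, 0)],
    [(0, 0), (0, 0), (2, 0), (0, 0)],
    [(0, 0), (0, 0), (0, 0), (2, 0)],
    [(1, 0), (1, 0), (1, 0), (1, 0)]]"
    by (rule list.pred_mono_strong[OF U120_sample]) (rule u)
  have "\<bar>sp x $ 1\<bar>\<^sup>2 + \<bar>sp x $ 2\<bar>\<^sup>2 + \<bar>sp x $ 3\<bar>\<^sup>2 + \<bar>sp x $ 4\<bar>\<^sup>2 \<le> 305 / 1000 * m\<^sup>2"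
    by (rule evens_bound) (use b in \<open>simp_all add: zval_def evens_def Let_def algebra_simps\<close>)
  then show "sp x \<bullet> sp x \<le> 305 / 1000 * (2 * golden) * (x $ None)\<^sup>2"
    unfolding m2 by (simp add: inner_vec_def sum_4 power2_eq_square)
qed

lemma nice_octahedral_embeds:
  fixes X :: "'p topology" and A :: "('p, 3) hchart set"
  assumes "nice_octahedral X A"
  shows "\<exists>(Y :: mfd4_point topology) (B :: (mfd4_point, 4) hchart set).
    hyp_manifold Y B \<and> connected_space Y \<and> hyp_complete Y B \<and> hyp_finite_volume Y B \<and>
    hyp_orientable Y B \<and> (\<exists>f. geodesic_hypersurface_embedding X A Y B f)"
proof -
  obtain k \<tau> g h where t: "hyp_manifold X A" "tessellation octahedron_normals X A k \<tau> g h"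
    "\<And>i v. i < k \<Longrightarrow> v \<in> octahedron_normals \<Longrightarrow> fst (\<tau> (i, v)) \<noteq> i"
    using assms unfolding nice_octahedral_def by blast
  have "ra_polytope cell24.N3 (sqrt 2 / sqrt 2)" using cell24.ra3 by (rule ra_polytope.intro)
  then have tess: "tess cell24.N3 (sqrt 2 / sqrt 2) X A k \<tau> g h"
  proof (rule tess.intro, unfold_locales)
    show "v \<in> cell24.N3 \<Longrightarrow> (2 * (sqrt 2 / sqrt 2)) *\<^sub>R e0 - v \<in> cell24.N3" for v
      using cell24.antipode3[of v] by simp
    show "v \<in> cell24.N3 \<Longrightarrow> w \<in> cell24.N3 \<Longrightarrow>
        w = v \<or> lorentz w v = 0 \<or> (2 * (sqrt 2 / sqrt 2)) *\<^sub>R e0 - w = v \<or> lorentz ((2 * (sqrt 2 / sqrt 2)) *\<^sub>R e0 - w) v = 0" for v w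
      using cell24.antipodal_cover[of v w] by simp
    show "v \<in> cell24.N3 \<Longrightarrow> lorentz x v = 0 \<Longrightarrow> (\<And>u. u \<in> cell24.N3 \<Longrightarrow> lorentz u v = 0 \<Longrightarrow> lorentz x u = 0) \<Longrightarrow> x = 0" for v x
      unfolding N3_24 by (rule octahedron_nondegenerate)
    show "hyp_manifold X A" by (rule t)
    show "tessellation cell24.N3 X A k \<tau> g h" unfolding N3_24 by (rule t)
    show "i < k \<Longrightarrow> v \<in> cell24.N3 \<Longrightarrow> fst (\<tau> (i, v)) \<noteq> i" for i v unfolding N3_24 by (rule t)
  qed
  have Z: "cell24.ext M F \<in> cell24.Z4"
    if M: "lor M" "M e0 = e0" "\<And>v. v \<in> cell24.N3 \<Longrightarrow> M v \<in> cell24.N3" and F: "F \<in> cell24.Z4" for M F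
  proof -
    have FN: "F \<in> cell24.N4" by (rule cell24.Z_facts(1)[OF F])
    have "lorentz cell24.f0 (cell24.ext M F) = lorentz cell24.f0 F"
      by (simp add: cell24.ext_def cell24.f0_iota cell24.f0_f0)
    then show ?thesis using Z24_iff[OF cell24.ext_N4[OF M FN]] Z24_iff[OF FN] F by simp
  qed
  interpret tc: tessellated_cell 1 "sqrt 2" "sqrt 2" 1 A24 U24 Z24 "(1, 0)" "(2, 0)" "(-1, 0)"
    forms24 lows24 "[(3, 0), (1, 0), (-3, 0)]" X A k \<tau> g h
    by (rule tessellated_cell.intro[OF cell24.cell_data_axioms tessellated_cell_axioms.intro[OF tess Z]])
  interpret cc: coloured_cell 1 "sqrt 2" "sqrt 2" 1 A24 U24 Z24 "(1, 0)" "(2, 0)" "(-1, 0)"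
    forms24 lows24 "[(3, 0), (1, 0), (-3, 0)]" X A k \<tau> g h
    by unfold_locales (rule tc.colinj_single[OF rest24_single])
  show ?thesis by (rule cc.embedding_exists[OF volume24])
qed

lemma nice_dodecahedral_embeds:
  fixes X :: "'p topology" and A :: "('p, 3) hchart set"
  assumes "nice_dodecahedral X A"
  shows "\<exists>(Y :: mfd4_point topology) (B :: (mfd4_point, 4) hchart set).
    hyp_manifold Y B \<and> connected_space Y \<and> hyp_complete Y B \<and> hyp_finite_volume Y B \<and>
    hyp_orientable Y B \<and> (\<exists>f. geodesic_hypersurface_embedding X A Y B f)"
proof -
  let ?s = "sqrt (2 * golden ^ 3) / (sqrt 2 * golden)"
  obtain k \<tau> g h where t: "hyp_manifold X A" "tessellation dodecahedron_normals X A k \<tau> g h"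
    "\<And>i. i < k \<Longrightarrow> inj_on (\<lambda>x. h (i, x)) (hpoly dodecahedron_normals)"
    using assms unfolding nice_dodecahedral_def by blast
  have ra: "ra_polytope cell120.N3 ?s" using cell120.ra3 by (rule ra_polytope.intro)
  then have tess: "tess cell120.N3 ?s X A k \<tau> g h"
  proof (rule tess.intro, unfold_locales)
    have d: "2 * sqrt (2 * golden ^ 3) / (sqrt 2 * golden) = 2 * ?s" by simp
    show "v \<in> cell120.N3 \<Longrightarrow> (2 * ?s) *\<^sub>R e0 - v \<in> cell120.N3" for v
      using cell120.antipode3[of v] unfolding d .
    show "v \<in> cell120.N3 \<Longrightarrow> w \<in> cell120.N3 \<Longrightarrow>
        w = v \<or> lorentz w v = 0 \<or> (2 * ?s) *\<^sub>R e0 - w = v \<or> lorentz ((2 * ?s) *\<^sub>R e0 - w) v = 0" for v w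
      using cell120.antipodal_cover[of v w] unfolding d .
    show "v \<in> cell120.N3 \<Longrightarrow> lorentz x v = 0 \<Longrightarrow> (\<And>u. u \<in> cell120.N3 \<Longrightarrow> lorentz u v = 0 \<Longrightarrow> lorentz x u = 0) \<Longrightarrow> x = 0" for v x
      unfolding N3_120 by (rule dodecahedron_nondegenerate)
    show "hyp_manifold X A" by (rule t)
    show tt: "tessellation cell120.N3 X A k \<tau> g h" unfolding N3_120 by (rule t)
    show "i < k \<Longrightarrow> v \<in> cell120.N3 \<Longrightarrow> fst (\<tau> (i, v)) \<noteq> i" for i v
      using ra_polytope.embedded_distinct[OF ra tt] t(3) unfolding N3_120 by blast
  qed
  interpret tc: tessellated_cell golden "sqrt (2 * golden ^ 3)" "sqrt 2 * golden" "sqrt (golden ^ 3)" A120 U120 Z120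
    "(0, 1)" "(0, 2)" "(-1, 1)" forms120 lows120 "[(3, -1), (1, -1), (-3, 1)]" X A k \<tau> g h
    by (rule tessellated_cell.intro[OF cell120.cell_data_axioms tessellated_cell_axioms.intro[OF tess]])
      (use Z120_nbs in blast)
  interpret cc: coloured_cell golden "sqrt (2 * golden ^ 3)" "sqrt 2 * golden" "sqrt (golden ^ 3)" A120 U120 Z120
    "(0, 1)" "(0, 2)" "(-1, 1)" forms120 lows120 "[(3, -1), (1, -1), (-3, 1)]" X A k \<tau> g h
    by unfold_locales (rule tc.colinj_embedded[OF t(3)[folded N3_120]])
  show ?thesis by (rule cc.embedding_exists[OF volume120])
qed

theorem theorem2:
  fixes X :: "'p topology" and A :: "('p, 3) hchart set"
  assumes "nice_dodecahedral X A \<or> nice_octahedral X A"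
  shows "\<exists>(Y :: mfd4_point topology) (B :: (mfd4_point, 4) hchart set).
    hyp_manifold Y B \<and> connected_space Y \<and> hyp_complete Y B \<and> hyp_finite_volume Y B \<and>
    hyp_orientable Y B \<and>
    (\<exists>f. geodesic_hypersurface_embedding X A Y B f)"
  using assms nice_dodecahedral_embeds nice_octahedral_embeds by blast

end
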